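(* Let $\alpha,\varepsilon_0,\varepsilon_1\in(0,1)$, $C_0\ge1$, $\lambda>0$ and $v^0\in\mathcal C^{2,\alpha}(\mathbb R^d)$. Assume $|U|=1$ and that, uniformly for all $u\in U$, $$\Sigma(\cdot,u)\ge \mathbb I_d/C_0,\qquad \|r(\cdot,u)\|_{0,\alpha},\ \|b(\cdot,u)\|_{0,\alpha},\ \|\Sigma(\cdot,u)\|_{0,\alpha}\le C_0 .$$ Assume also that there is a Lipschitz continuous function $\Sigma_0$ on $\mathbb R^d$ with values in the symmetric $d\times d$ matrices such that $M(x,u):=\Sigma(x,u)-\Sigma_0(x)$ satisfies $$\sup_{u\in U}\|M(\cdot,u)\|_\infty\le\varepsilon_0,\qquad \sup_{u\in U}[M(\cdot,u)]_{0,\alpha}\le \varepsilon_1 .$$ Let $v^*$ be the bounded solution of the exploratory HJB equation $\rho v-F(x,Dv,D^2v)=0$ on $\mathbb R^d$ and let $v^n$ be produced by the policy iteration algorithm started from $v^0$. Then there exists $A_1\ge1$ such that if $$\rho\ge A_1^{2/(1-\alpha)},\qquad \varepsilon_0A_1\rho^{\alpha/2}\le 1,\qquad \varepsilon_1A_1\le1,$$ then for all $n\ge1$ and $x_0\in\mathbb R^d$, $$\rho\int_{B_1(x_0)}|v^n-v^*|^2\,dx+\int_{B_1(x_0)}|D(v^n-v^* )|^2\,dx\le C2^{-n}+C'\varepsilon_0^2/\rho .$$ Here $C>0$ depends only on $d$ and $\|v^0\|_2+\|v^*\|_2$, and $A_1,C'>0$ also depend on $\lambda$, $C_0$, and the function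 $\eta$ (described in the context). As a consequence, for all $n\ge1$, $$\|D(v^n-v^* )\|_\infty\le\left(C2^{-n}+C'\varepsilon_0^2/\rho\right)^{\frac1{d+2}}$$ and $$\|v^n-v^*\|_\infty\le\rho^{-\frac1{d+2}}\left(C2^{-n}+C'\varepsilon_0^2/\rho\right)^{\frac1{d+2}+\frac d{(d+2)^2}} .$$
   Context: Setting. $d,m,l$ are fixed positive integers, $U\subset\mathbb R^l$ is a bounded domain with Lebesgue measure $|U|=1$, $\lambda>0$, $\rho>0$, and $r:\mathbb R^d\times U\to\mathbb R$, $b:\mathbb R^d\times U\to\mathbb R^d$, $\sigma:\mathbb R^d\times U\to\mathbb R^{d\times m}$ are given (measurable in $u$); $\Sigma:=\sigma\sigma^T$. $B_1(x_0)$ is the open unit ball centered at $x_0$, and $\mathbb I_d$ is the identity matrix. $\mathcal P(U)$ is the set of probability densities on $U$. For $\pi\in\mathcal P(U)$, $x,p\in\mathbb R^d$ and $X$ a symmetric $d\times d$ matrix, $$F_\pi(x,p,X)=\int_U\left[r(x,u)+b(x,u)\cdot p+\tfrac12\mathrm{tr}(\Sigma(x,u)X)-\lambda\ln\pi(u)\right]\pi(u)\,du,\qquad F(x,p,X)=\sup_{\pi\in\mathcal P(U)}F_\pi(x,p,X).$$ Norms on $\mathbb R^d$: for $k\in\mathbb N\cup\{0\}$, $\|w\|_\infty=\sup|w|$, $[\![w]\!]_k=\sup_{|a|_1=k}\|D^aw\|_\infty$ (multi-indices $a$ of order $k$), $[w]_{k,\alpha}=\sup_{|a|_1=k,\ 0<|x-y|\le1}\frac{|D^aw(x)-D^aw(y)|}{|x-y|^\alpha}$,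 $\|w\|_k=\sum_{j\le k}[\![w]\!]_j$, $\|w\|_{k,\alpha}=\sum_{j\le k}([\![w]\!]_j+[w]_{j,\alpha})$; $\mathcal C^{k,\alpha}(\mathbb R^d)=\{w:\|w\|_{k,\alpha}<\infty\}$. For vector- or matrix-valued functions, $|\cdot|$ is the maximum of the absolute values of the entries. Policy iteration algorithm: given $v^0$, for $n\ge1$ let $$\pi^n(x,u)=\frac{\exp\left[\frac1\lambda\left(r(x,u)+b(x,u)\cdot Dv^{n-1}(x)+\frac12\mathrm{tr}(\Sigma(x,u)D^2v^{n-1}(x))\right)\right]}{\int_U\exp\left[\frac1\lambda\left(r(x,u')+b(x,u')\cdot Dv^{n-1}(x)+\frac12\mathrm{tr}(\Sigma(x,u')D^2v^{n-1}(x))\right)\right]du'},$$ and let $v^n$ be the unique bounded solution on $\mathbb R^d$ of $\rho v^n-F_{\pi^n(x,\cdot)}(x,Dv^n,D^2v^n)=0$. The function $\eta$: for the given $d,\alpha,C_0$, $\eta:[1,\infty)\to[1,\infty)$ is an increasing function, independent of $\rho$, with the following property (such a function exists). Whenever $\rho\ge1$, $A\ge1$, $\tilde r,\tilde b,\tilde\Sigma$ (real-, $\mathbb R^d$-, and symmetric-matrix-valued functions on $\mathbb R^d$) satisfy $\tilde\Sigma\ge\mathbb I_d/C_0$ and $\|\tilde r\|_{0,\alpha},\|\tilde b\|_{0,\alpha},\|\tilde\Sigma\|_{0,\alpha}\le A$, and $v$ is a bounded solution of $\rho v-\tilde r-\tilde b\cdot Dv-\frac12\mathrm{tr}(\tilde\Sigma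 D^2v)=0$ on $\mathbb R^d$, one has $$\rho\|v\|_\infty,\ \rho^{1-\frac\alpha2}[v]_{0,\alpha},\ \rho^{\frac12-\frac\alpha2}[v]_{1,\alpha},\ \rho^{-\frac\alpha2}[v]_{2,\alpha},\ \rho^{\frac12}[\![v]\!]_1,\ [\![v]\!]_2\le\eta(A).$$ *)

theory Defs
  imports "HOL-Analysis.Analysis"
begin

section \<open>Derivatives, norms and Hoelder spaces\<close>

definition partial_deriv :: "'d \<Rightarrow> (real^'d \<Rightarrow> real) \<Rightarrow> real^'d \<Rightarrow> real" where
  "partial_deriv i w x = frechet_derivative w (at x) (axis i 1)"

text \<open>
  A multi-index \<open>a\<close> of order \<open>k\<close> is represented by a list of \<open>k\<close> coordinates in which \<open>i\<close> occurs
  \<open>a i\<close> times. For functions of class \<open>C\<^sup>k\<close> the order of the list is irrelevant.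
\<close>

definition D_list :: "'d list \<Rightarrow> (real^'d \<Rightarrow> real) \<Rightarrow> real^'d \<Rightarrow> real" where
  "D_list is w = foldr partial_deriv is w"

definition grad :: "(real^'d \<Rightarrow> real) \<Rightarrow> real^'d \<Rightarrow> real^'d" where
  "grad w x = (\<chi> i. D_list [i] w x)"

definition hess :: "(real^'d \<Rightarrow> real) \<Rightarrow> real^'d \<Rightarrow> real^'d^'d" where
  "hess w x = (\<chi> i j. D_list [i, j] w x)"

primrec C_class :: "nat \<Rightarrow> (real^'d \<Rightarrow> real) \<Rightarrow> bool" where
  "C_class 0 w \<longleftrightarrow> continuous_on UNIV w"
| "C_class (Suc k) w \<longleftrightarrow> (\<forall>x. w differentiable (at x)) \<and> (\<forall>i. C_class k (partial_deriv i w))"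

text \<open>
  The size of a value is measured by \<^const>\<open>infnorm\<close>: the absolute value of a real number, and the
  largest absolute value of an entry for vectors and matrices. Distances between points of the
  domain are Euclidean. All norms are extended-valued, so that ``norm \<open>\<le>\<close> real number'' includes
  finiteness.
\<close>

definition sup_norm :: "(real^'d \<Rightarrow> 'b::euclidean_space) \<Rightarrow> ennreal" where
  "sup_norm f = (SUP x. ennreal (infnorm (f x)))"

definition hoelder_seminorm :: "real \<Rightarrow> (real^'d \<Rightarrow> 'b::euclidean_space) \<Rightarrow> ennreal" where
  "hoelder_seminorm \<alpha> f =
     (SUP (x, y) \<in> {(x, y). 0 < dist x y \<and> dist x y \<le> 1}.
        ennreal (infnorm (f x - f y) / dist x y powr \<alpha>))"

definition norm_0a :: "real \<Rightarrow> (real^'d \<Rightarrow> 'b::euclidean_space) \<Rightarrow> ennreal" where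
  "norm_0a \<alpha> f = sup_norm f + hoelder_seminorm \<alpha> f"

definition deriv_seminorm :: "nat \<Rightarrow> (real^'d \<Rightarrow> real) \<Rightarrow> ennreal" where
  "deriv_seminorm k w = (SUP is \<in> {is. length is = k}. sup_norm (D_list is w))"

definition deriv_hoelder :: "nat \<Rightarrow> real \<Rightarrow> (real^'d \<Rightarrow> real) \<Rightarrow> ennreal" where
  "deriv_hoelder k \<alpha> w = (SUP is \<in> {is. length is = k}. hoelder_seminorm \<alpha> (D_list is w))"

definition norm_k :: "nat \<Rightarrow> (real^'d \<Rightarrow> real) \<Rightarrow> ennreal" where
  "norm_k k w = (\<Sum>j\<le>k. deriv_seminorm j w)"

definition norm_ka :: "nat \<Rightarrow> real \<Rightarrow> (real^'d \<Rightarrow> real) \<Rightarrow> ennreal" where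
  "norm_ka k \<alpha> w = (\<Sum>j\<le>k. deriv_seminorm j w + deriv_hoelder j \<alpha> w)"

definition hoelder_space :: "nat \<Rightarrow> real \<Rightarrow> (real^'d \<Rightarrow> real) set" where
  "hoelder_space k \<alpha> = {w. C_class k w \<and> norm_ka k \<alpha> w < \<infinity>}"

definition loewner_le :: "real^'d^'d \<Rightarrow> real^'d^'d \<Rightarrow> bool" where
  "loewner_le A B \<longleftrightarrow> (\<forall>\<xi>. \<xi> \<bullet> (A *v \<xi>) \<le> \<xi> \<bullet> (B *v \<xi>))"


section \<open>Bounded classical solutions and the function \<open>\<eta>\<close>\<close>

definition bounded_solution ::
    "real \<Rightarrow> (real^'d \<Rightarrow> real^'d \<Rightarrow> real^'d^'d \<Rightarrow> ereal) \<Rightarrow> (real^'d \<Rightarrow> real) \<Rightarrow> bool" where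
  "bounded_solution \<rho> G v \<longleftrightarrow>
     C_class 2 v \<and> bounded (range v) \<and>
     (\<forall>x. ereal (\<rho> * v x) - G x (grad v x) (hess v x) = 0)"

definition schauder_bound :: "'d::finite itself \<Rightarrow> real \<Rightarrow> real \<Rightarrow> (real \<Rightarrow> real) \<Rightarrow> bool" where
  "schauder_bound _ \<alpha> C0 \<eta> \<longleftrightarrow>
     mono_on {1..} \<eta> \<and> \<eta> ` {1..} \<subseteq> {1..} \<and>
     (\<forall>\<rho>\<ge>1. \<forall>A\<ge>1. \<forall>(r :: real^'d \<Rightarrow> real) (b :: real^'d \<Rightarrow> real^'d) (S :: real^'d \<Rightarrow> real^'d^'d) v.
        (\<forall>x. transpose (S x) = S x \<and> loewner_le (mat (1 / C0)) (S x)) \<and>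
        norm_0a \<alpha> r \<le> ennreal A \<and> norm_0a \<alpha> b \<le> ennreal A \<and> norm_0a \<alpha> S \<le> ennreal A \<and>
        bounded_solution \<rho> (\<lambda>x p X. ereal (r x + b x \<bullet> p + 1/2 * trace (S x ** X))) v
        \<longrightarrow>
        ennreal \<rho> * sup_norm v \<le> ennreal (\<eta> A) \<and>
        ennreal (\<rho> powr (1 - \<alpha>/2)) * deriv_hoelder 0 \<alpha> v \<le> ennreal (\<eta> A) \<and>
        ennreal (\<rho> powr (1/2 - \<alpha>/2)) * deriv_hoelder 1 \<alpha> v \<le> ennreal (\<eta> A) \<and>
        ennreal (\<rho> powr (- \<alpha>/2)) * deriv_hoelder 2 \<alpha> v \<le> ennreal (\<eta> A) \<and>
        ennreal (\<rho> powr (1/2)) * deriv_seminorm 1 v \<le> ennreal (\<eta> A) \<and>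
        deriv_seminorm 2 v \<le> ennreal (\<eta> A))"


section \<open>The control problem\<close>

text \<open>
  The numbers \<open>l\<close> and \<open>m\<close> are not encoded in types, so that a statement can assert the existence of
  constants that do not depend on them. The space \<open>R\<^sup>l\<close> consists of the functions on \<open>{..<l}\<close> (extended
  by \<^term>\<open>undefined\<close>), with the product topology and Lebesgue measure. Only the entries
  \<open>\<sigma> x u i j\<close> with \<open>j < m\<close> are used.
\<close>

type_synonym control = "nat \<Rightarrow> real"

definition lebesgue_Rl :: "nat \<Rightarrow> control measure" where
  "lebesgue_Rl l = completion (Pi\<^sub>M {..<l} (\<lambda>_. lborel))"

definition bounded_domain :: "nat \<Rightarrow> control set \<Rightarrow> bool" where
  "bounded_domain l U \<longleftrightarrow>
     U \<noteq> {} \<and>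
     openin (product_topology (\<lambda>_. euclideanreal) {..<l}) U \<and>
     connectedin (product_topology (\<lambda>_. euclideanreal) {..<l}) U \<and>
     (\<exists>B. \<forall>u\<in>U. \<forall>i<l. \<bar>u i\<bar> \<le> B)"

definition lebesgue_U :: "nat \<Rightarrow> control set \<Rightarrow> control measure" where
  "lebesgue_U l U = restrict_space (lebesgue_Rl l) U"

definition diffusion ::
    "nat \<Rightarrow> (real^'d \<Rightarrow> control \<Rightarrow> 'd \<Rightarrow> nat \<Rightarrow> real) \<Rightarrow> real^'d \<Rightarrow> control \<Rightarrow> real^'d^'d" where
  "diffusion m \<sigma> x u = (\<chi> i k. \<Sum>j<m. \<sigma> x u i j * \<sigma> x u k j)"

definition measurable_coeffs ::
    "control measure \<Rightarrow> nat \<Rightarrow> (real^'d \<Rightarrow> control \<Rightarrow> real) \<Rightarrow> (real^'d \<Rightarrow> control \<Rightarrow> real^'d) \<Rightarrow>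
     (real^'d \<Rightarrow> control \<Rightarrow> 'd \<Rightarrow> nat \<Rightarrow> real) \<Rightarrow> bool" where
  "measurable_coeffs N m r b \<sigma> \<longleftrightarrow>
     (\<forall>x. r x \<in> borel_measurable N \<and> b x \<in> borel_measurable N \<and>
          (\<forall>i. \<forall>j<m. (\<lambda>u. \<sigma> x u i j) \<in> borel_measurable N))"

definition reward ::
    "(real^'d \<Rightarrow> control \<Rightarrow> real) \<Rightarrow> (real^'d \<Rightarrow> control \<Rightarrow> real^'d) \<Rightarrow>
     (real^'d \<Rightarrow> control \<Rightarrow> real^'d^'d) \<Rightarrow> real^'d \<Rightarrow> real^'d \<Rightarrow> real^'d^'d \<Rightarrow> control \<Rightarrow> real" where
  "reward r b S x p X u = r x u + b x u \<bullet> p + 1/2 * trace (S x u ** X)"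

definition densities :: "'u measure \<Rightarrow> ('u \<Rightarrow> real) set" where
  "densities N = {\<pi>. \<pi> \<in> borel_measurable N \<and> (\<forall>u \<in> space N. 0 \<le> \<pi> u) \<and>
                     (\<integral>\<^sup>+ u. ennreal (\<pi> u) \<partial>N) = 1}"

text \<open>
  Extended-valued Lebesgue integral: positive part minus negative part. A density may have infinite
  entropy, in which case \<open>F\<^sub>\<pi> = -\<infinity>\<close>; the Bochner integral would return \<open>0\<close> there and spoil the
  supremum over all densities. For bounded coefficients the positive part is always finite.
\<close>

definition ext_integral :: "'u measure \<Rightarrow> ('u \<Rightarrow> real) \<Rightarrow> ereal" where
  "ext_integral N f =
     enn2ereal (\<integral>\<^sup>+ u. ennreal (f u) \<partial>N) - enn2ereal (\<integral>\<^sup>+ u. ennreal (- f u) \<partial>N)"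

text \<open>Since \<open>ln 0 * 0 = 0\<close> in HOL, the usual convention at zeros of \<open>\<pi>\<close> is in force.\<close>

definition F_pi ::
    "control measure \<Rightarrow> real \<Rightarrow> (real^'d \<Rightarrow> control \<Rightarrow> real) \<Rightarrow> (real^'d \<Rightarrow> control \<Rightarrow> real^'d) \<Rightarrow>
     (real^'d \<Rightarrow> control \<Rightarrow> real^'d^'d) \<Rightarrow> (control \<Rightarrow> real) \<Rightarrow>
     real^'d \<Rightarrow> real^'d \<Rightarrow> real^'d^'d \<Rightarrow> ereal" where
  "F_pi N lam r b S \<pi> x p X =
     ext_integral N (\<lambda>u. (reward r b S x p X u - lam * ln (\<pi> u)) * \<pi> u)"

definition F_sup ::
    "control measure \<Rightarrow> real \<Rightarrow> (real^'d \<Rightarrow> control \<Rightarrow> real) \<Rightarrow> (real^'d \<Rightarrow> control \<Rightarrow> real^'d) \<Rightarrow>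
     (real^'d \<Rightarrow> control \<Rightarrow> real^'d^'d) \<Rightarrow> real^'d \<Rightarrow> real^'d \<Rightarrow> real^'d^'d \<Rightarrow> ereal" where
  "F_sup N lam r b S x p X = (SUP \<pi> \<in> densities N. F_pi N lam r b S \<pi> x p X)"

definition gibbs_policy ::
    "control measure \<Rightarrow> real \<Rightarrow> (real^'d \<Rightarrow> control \<Rightarrow> real) \<Rightarrow> (real^'d \<Rightarrow> control \<Rightarrow> real^'d) \<Rightarrow>
     (real^'d \<Rightarrow> control \<Rightarrow> real^'d^'d) \<Rightarrow> (real^'d \<Rightarrow> real) \<Rightarrow> real^'d \<Rightarrow> control \<Rightarrow> real" where
  "gibbs_policy N lam r b S w x u =
     exp (1/lam * reward r b S x (grad w x) (hess w x) u) /
     (LINT u'|N. exp (1/lam * reward r b S x (grad w x) (hess w x) u'))"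

definition policy_iteration ::
    "control measure \<Rightarrow> real \<Rightarrow> real \<Rightarrow> (real^'d \<Rightarrow> control \<Rightarrow> real) \<Rightarrow>
     (real^'d \<Rightarrow> control \<Rightarrow> real^'d) \<Rightarrow> (real^'d \<Rightarrow> control \<Rightarrow> real^'d^'d) \<Rightarrow>
     (real^'d \<Rightarrow> real) \<Rightarrow> (nat \<Rightarrow> real^'d \<Rightarrow> real) \<Rightarrow> bool" where
  "policy_iteration N lam \<rho> r b S v0 v \<longleftrightarrow>
     v 0 = v0 \<and>
     (\<forall>n\<ge>1. bounded_solution \<rho>
        (\<lambda>x p X. F_pi N lam r b S (gibbs_policy N lam r b S (v (n - 1)) x) x p X) (v n))"

end

theory Submission
  imports Defs
begin

text \<open>
  Let \<open>w\<^sub>n = v\<^sup>n - v\<^sup>*\<close>. The Gibbs policy maximises the functional at \<open>v\<^sup>n\<^sup>-\<^sup>1\<close>, and its suboptimality at \<open>v\<^sup>*\<close>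
  is at most twice the oscillation over \<open>u\<close> of the change in reward. Subtracting the part of the
  reward that does not depend on \<open>u\<close> replaces \<open>\<Sigma>\<close> by \<open>M\<close>, so \<open>w\<^sub>n\<close> solves a linear equation whose right-hand
  side is bounded by a multiple of \<open>\<bar>Dw\<^sub>n\<^sub>-\<^sub>1\<bar> + \<epsilon>\<^sub>0 \<bar>D\<^sup>2w\<^sub>n\<^sub>-\<^sub>1\<bar>\<close>. In the coordinates \<open>y = \<rho>\<^sup>1\<^sup>/\<^sup>2 x\<close> the first-order
  terms acquire the factor \<open>\<rho>\<^sup>-\<^sup>1\<^sup>/\<^sup>2\<close> and the oscillation of the leading coefficients becomes small. A frozen
  coefficient estimate then bounds \<open>sup \<bar>w\<^sub>n\<bar>\<close>, \<open>sup \<bar>Dw\<^sub>n\<bar>\<close> and a Morrey norm of \<open>D\<^sup>2w\<^sub>n\<close> by half of the same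
  quantity for \<open>w\<^sub>n\<^sub>-\<^sub>1\<close>. Morrey norms suit this purpose because, unlike sup norms of second derivatives, they admit
  an elliptic estimate without any modulus of continuity of the right-hand side.

  The hypothesis on \<open>\<eta>\<close> enters twice: it makes \<open>D\<^sup>2v\<^sup>n\<close> bounded, with no explicit bound being needed, and for
  \<open>d \<ge> 2\<close> it keeps \<open>\<alpha>\<close> away from \<open>0\<close>, since Schauder constants blow up as \<open>\<alpha> \<rightarrow> 0\<close>; hence \<open>A\<^sub>1\<close> can be chosen
  independently of \<open>\<alpha>\<close>.
\<close>

text \<open>The three conclusions are read off from sup bounds of order 2^-n for w_n and Dw_n. The
  exponents in the last two lie between 1/(d+2) and 1, so (K+1) 2^-n is dominated by the
  corresponding power of (K+1)^(d+2) 2^-n; this is the origin of C, with K the sum of the C^2 norms.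
  Constants depending on \<open>C0\<close> and \<eta> stay out of C because the first step, started
  from sup bounds of order K, gains a factor 1/\<rho>, half of whose power is spent on them through
  the choice of \<open>A1\<close>. The Morrey exponent comes from a balance: if mean squares over
  balls of radius h are of order 1/h, integration over scales yields affine approximation with error
  h^(3/2), and the energy estimate at scale h returns mean squares of the Hessian of order h^3/h^4 =
  1/h. The obstacle is that the averaged coefficients of step n depend on D^2 v^(n-1) through the
  Gibbs weights, so their Hoelder norms are not uniform in n. The quantitative estimates use only
  ellipticity, boundedness and small oscillation of the leading part, the last obtained by
  comparison with \<Sigma> at one fixed control.\<close>

section \<open>Elementary facts on integrals and matrices\<close>

lemma integral_translate:
  fixes f :: "'a::euclidean_space \<Rightarrow> real"
  assumes "continuous_on UNIV f"
  shows "(LINT y|lborel. f (a + y)) = (LINT y|lborel. f y)"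
proof -
  have "f \<in> borel_measurable lborel" using borel_measurable_continuous_onI[OF assms] by simp
  then have "(LINT y|distr lborel borel ((+) a). f y) = (LINT y|lborel. f (a + y))"
    by (intro integral_distr) auto
  then show ?thesis by (simp add: lborel_distr_plus)
qed

lemma integrable_compact_support:
  fixes f :: "'a::euclidean_space \<Rightarrow> real"
  assumes "continuous_on UNIV f" "\<And>x. norm x > r \<Longrightarrow> f x = 0"
  shows "integrable lborel f"
proof -
  have "integrable lborel (\<lambda>x. indicator (cball 0 r) x *\<^sub>R f x)"
    by (rule borel_integrable_compact) (auto intro: continuous_on_subset[OF assms(1)])
  also have "(\<lambda>x. indicator (cball 0 r) x *\<^sub>R f x) = f"
    using assms(2) by (auto simp: indicator_def fun_eq_iff)
  finally show ?thesis .
qed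

lemma norm_matvec_le:
  fixes A :: "real^'d^'d"
  shows "norm (A *v y) \<le> norm A * norm y"
proof -
  have "norm (A *v y)^2 = (\<Sum>i\<in>UNIV. (A$i \<bullet> y)^2)"
    unfolding power2_norm_eq_inner by (simp add: inner_vec_def matrix_vector_mult_def power2_eq_square)
  also have "\<dots> \<le> (\<Sum>i\<in>UNIV. (norm (A$i) * norm y)^2)"
    by (intro sum_mono abs_le_square_iff[THEN iffD1]) (simp add: Cauchy_Schwarz_ineq2)
  also have "\<dots> = (norm A * norm y)^2"
    by (simp add: power_mult_distrib sum_distrib_right[symmetric] power2_norm_eq_inner inner_vec_def[of A])
  finally show ?thesis by (simp add: power2_le_iff_abs_le)
qed

lemma matvec_dot_le:
  fixes A :: "real^'d^'d"
  shows "\<bar>x \<bullet> (A *v y)\<bar> \<le> norm A * norm x * norm y"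
  using order_trans[OF Cauchy_Schwarz_ineq2[of x "A *v y"] mult_left_mono[OF norm_matvec_le[of A y], of "norm x"]]
  by (simp add: mult_ac)

lemma bounded_bilinear_matvec: "bounded_bilinear (\<lambda>(A::real^'d^'d) v. A *v v)"
proof
  show "\<exists>K. \<forall>(A::real^'d^'d) v. norm (A *v v) \<le> norm A * norm v * K"
    by (intro exI[of _ 1]) (simp add: norm_matvec_le)
qed (auto simp: matrix_vector_mult_add_rdistrib matrix_vector_right_distrib scaleR_matrix_vector_assoc
     matrix_vector_mult_scaleR)

lemmas tendsto_matvec [tendsto_intros] = bounded_bilinear.tendsto[OF bounded_bilinear_matvec]
lemmas continuous_on_matvec [continuous_intros] = bounded_bilinear.continuous_on[OF bounded_bilinear_matvec]

section \<open>Twice differentiable functions\<close>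

text \<open>Gradient and Hessian are carried as explicit functions, so that products, rescalings and
  the subtraction of affine functions are computed on triples without evaluating
  \<open>frechet_derivative\<close>. Symmetry of \<open>H\<close> is derived from its continuity in
  \<open>C2_symmetric\<close>.\<close>

definition C2 :: "(real^'d \<Rightarrow> real) \<Rightarrow> (real^'d \<Rightarrow> real^'d) \<Rightarrow> (real^'d \<Rightarrow> real^'d^'d) \<Rightarrow> bool" where
  "C2 w p H \<longleftrightarrow> (\<forall>x. (w has_derivative (\<lambda>v. p x \<bullet> v)) (at x)) \<and>
     (\<forall>x. (p has_derivative (\<lambda>v. H x *v v)) (at x)) \<and> continuous_on UNIV H"

lemma C2D:
  assumes "C2 w p H"
  shows "(w has_derivative (\<lambda>v. p x \<bullet> v)) (at x)" "(p has_derivative (\<lambda>v. H x *v v)) (at x)"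
    "continuous_on UNIV H" "continuous_on UNIV p" "continuous_on UNIV w"
  using assms unfolding C2_def
  by (auto intro!: continuous_at_imp_continuous_on has_derivative_continuous)

lemma mvt_segment:
  fixes f :: "'a::real_normed_vector \<Rightarrow> real"
  assumes "\<And>x. (f has_derivative f' x) (at x)" "0 < h"
  obtains t where "0 < t" "t < h" "f (x + h *\<^sub>R v) - f x = h * f' (x + t *\<^sub>R v) v"
proof -
  have "\<exists>t\<in>{0<..<h}. f (x + h *\<^sub>R v) - f (x + 0 *\<^sub>R v) = (\<lambda>s. f' (x + t *\<^sub>R v) (s *\<^sub>R v)) (h - 0)"
  proof (rule mvt_simple)
    fix t assume "0 \<le> t" "t \<le> h"
    have "((\<lambda>t. f (x + t *\<^sub>R v)) has_derivative (\<lambda>s. f' (x + t *\<^sub>R v) (s *\<^sub>R v))) (at t within {0..h})"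
      by (rule has_derivative_compose[where g = f and g' = "f' (x + t *\<^sub>R v)"]) (auto intro!: derivative_eq_intros assms)
    then show "((\<lambda>t. f (x + t *\<^sub>R v)) has_derivative (\<lambda>s. f' (x + t *\<^sub>R v) (s *\<^sub>R v))) (at t within {0..h})" .
  qed (use assms in auto)
  moreover have "linear (f' y)" for y
    using assms(1) has_derivative_linear by blast
  ultimately show ?thesis using that by (auto simp: linear_cmul)
qed

text \<open>The second difference of \<open>w\<close> over the parallelogram spanned by h a and h b
  does not change when a and b are exchanged. Two applications of the mean value theorem write it as
  h^2 times the value of the Hessian form at a point within h (|a| + |b|) of \<open>x\<close>, and
  continuity of \<open>H\<close> lets h tend to 0.\<close>

lemma C2_symmetric:
  assumes "C2 w p H"
  shows "a \<bullet> (H x *v b) = b \<bullet> (H x *v a)"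
proof -
  have key: "\<exists>y. norm (y - x) \<le> h * (norm a + norm b) \<and>
      w (x + h *\<^sub>R a + h *\<^sub>R b) - w (x + h *\<^sub>R a) - (w (x + h *\<^sub>R b) - w x) = h^2 * (a \<bullet> (H y *v b))"
    if "0 < h" for a b :: "real^'a" and h :: real
  proof -
    have "((\<lambda>y. w (y + h *\<^sub>R b) - w y) has_derivative (\<lambda>v. p (y + h *\<^sub>R b) \<bullet> v - p y \<bullet> v)) (at y)" for y
      by (rule has_derivative_diff has_derivative_compose[where f = "\<lambda>y. y + h *\<^sub>R b" and g = w, of "\<lambda>v. v"]
            | auto intro!: derivative_eq_intros C2D[OF assms])+
    from mvt_segment[OF this that] obtain t where t: "0 < t" "t < h"
      "w (x + h *\<^sub>R a + h *\<^sub>R b) - w (x + h *\<^sub>R a) - (w (x + h *\<^sub>R b) - w x)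
        = h * (p (x + t *\<^sub>R a + h *\<^sub>R b) \<bullet> a - p (x + t *\<^sub>R a) \<bullet> a)" by blast
    have "((\<lambda>y. p y \<bullet> a) has_derivative (\<lambda>v. (H y *v v) \<bullet> a)) (at y)" for y
      by (auto intro!: derivative_eq_intros C2D[OF assms])
    from mvt_segment[OF this that] obtain s where s: "0 < s" "s < h"
      "p (x + t *\<^sub>R a + h *\<^sub>R b) \<bullet> a - p (x + t *\<^sub>R a) \<bullet> a = h * ((H (x + t *\<^sub>R a + s *\<^sub>R b) *v b) \<bullet> a)" by blast
    have "norm (t *\<^sub>R a + s *\<^sub>R b) \<le> t * norm a + s * norm b"
      using norm_triangle_ineq[of "t *\<^sub>R a" "s *\<^sub>R b"] t s by simp
    also have "\<dots> \<le> h * (norm a + norm b)"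
      using t s by (auto simp: distrib_left intro!: add_mono mult_right_mono)
    finally show ?thesis
      using t s by (intro exI[of _ "x + t *\<^sub>R a + s *\<^sub>R b"]) (simp add: power2_eq_square inner_commute algebra_simps)
  qed
  define h :: "nat \<Rightarrow> real" where "h n = inverse (Suc n)" for n
  have hpos: "0 < h n" for n by (simp add: h_def)
  have hlim: "h \<longlonglongrightarrow> 0" unfolding h_def by (rule LIMSEQ_inverse_real_of_nat)
  from key[OF hpos, of _ a b] obtain y where y: "\<And>n. norm (y n - x) \<le> h n * (norm a + norm b)"
    "\<And>n. w (x + h n *\<^sub>R a + h n *\<^sub>R b) - w (x + h n *\<^sub>R a) - (w (x + h n *\<^sub>R b) - w x) = (h n)^2 * (a \<bullet> (H (y n) *v b))"
    by metis
  from key[OF hpos, of _ b a] obtain z where z: "\<And>n. norm (z n - x) \<le> h n * (norm b + norm a)"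
    "\<And>n. w (x + h n *\<^sub>R b + h n *\<^sub>R a) - w (x + h n *\<^sub>R b) - (w (x + h n *\<^sub>R a) - w x) = (h n)^2 * (b \<bullet> (H (z n) *v a))"
    by metis
  have yl: "y \<longlonglongrightarrow> x"
    by (rule LIM_zero_cancel, rule Lim_null_comparison[OF always_eventually[OF allI[OF y(1)]]])
       (auto intro!: tendsto_eq_intros hlim)
  have zl: "z \<longlonglongrightarrow> x"
    by (rule LIM_zero_cancel, rule Lim_null_comparison[OF always_eventually[OF allI[OF z(1)]]])
       (auto intro!: tendsto_eq_intros hlim)
  have Hc: "continuous (at x) H" using C2D(3)[OF assms] by (simp add: continuous_on_eq_continuous_at)
  have eq: "a \<bullet> (H (y n) *v b) = b \<bullet> (H (z n) *v a)" for n
  proof -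
    have "w (x + h n *\<^sub>R a + h n *\<^sub>R b) = w (x + h n *\<^sub>R b + h n *\<^sub>R a)" by (simp add: add_ac)
    then have "(h n)^2 * (a \<bullet> (H (y n) *v b)) = (h n)^2 * (b \<bullet> (H (z n) *v a))"
      using y(2)[of n] z(2)[of n] by linarith
    then show ?thesis using hpos[of n] by simp
  qed
  have "(\<lambda>n. a \<bullet> (H (y n) *v b)) \<longlonglongrightarrow> a \<bullet> (H x *v b)"
    by (intro tendsto_intros isCont_tendsto_compose[OF Hc] yl)
  moreover have "(\<lambda>n. b \<bullet> (H (z n) *v a)) \<longlonglongrightarrow> b \<bullet> (H x *v a)"
    by (intro tendsto_intros isCont_tendsto_compose[OF Hc] zl)
  ultimately show ?thesis using eq LIMSEQ_unique by auto
qed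

section \<open>Integration by parts\<close>

definition C1 :: "('a::euclidean_space \<Rightarrow> real) \<Rightarrow> ('a \<Rightarrow> 'a) \<Rightarrow> bool" where
  "C1 f q \<longleftrightarrow> (\<forall>x. (f has_derivative (\<lambda>v. q x \<bullet> v)) (at x)) \<and> continuous_on UNIV q"

lemma C1D:
  assumes "C1 f q"
  shows "(f has_derivative (\<lambda>v. q x \<bullet> v)) (at x)" "continuous_on UNIV q" "continuous_on UNIV f"
  using assms unfolding C1_def
  by (auto intro!: continuous_at_imp_continuous_on has_derivative_continuous)

lemma C1_deriv_zero:
  assumes "C1 f q" "\<And>x. norm x > r \<Longrightarrow> f x = 0" "norm x > r"
  shows "q x = 0"
proof -
  have "((\<lambda>_. 0) has_derivative (\<lambda>v. q x \<bullet> v)) (at x)"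
    by (rule has_derivative_transform_within_open[OF C1D(1)[OF assms(1)], where s = "- cball 0 r"])
       (use assms in auto)
  then have "(\<lambda>v. q x \<bullet> v) = (\<lambda>_. 0)"
    by (rule has_derivative_unique) auto
  then have "q x \<bullet> q x = 0" by meson
  then show ?thesis by simp
qed

lemma C1_mult:
  assumes "C1 f p" "C1 g q"
  shows "C1 (\<lambda>x. f x * g x) (\<lambda>x. g x *\<^sub>R p x + f x *\<^sub>R q x)"
  unfolding C1_def
proof (intro conjI allI)
  show "((\<lambda>x. f x * g x) has_derivative (\<lambda>v. (g x *\<^sub>R p x + f x *\<^sub>R q x) \<bullet> v)) (at x)" for x
    by (rule has_derivative_eq_rhs, rule has_derivative_mult[OF C1D(1)[OF assms(1)] C1D(1)[OF assms(2)]])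
       (auto simp: inner_left_distrib)
  show "continuous_on UNIV (\<lambda>x. g x *\<^sub>R p x + f x *\<^sub>R q x)"
    by (intro continuous_intros C1D[OF assms(1)] C1D[OF assms(2)])
qed

lemma continuous_shift:
  assumes "continuous_on UNIV f"
  shows "continuous_on UNIV (\<lambda>x::'a::real_normed_vector. f (x + c))"
  by (rule continuous_on_compose2[OF assms]) (auto intro: continuous_intros)

lemma continuous_shift':
  assumes "continuous_on UNIV f"
  shows "continuous_on UNIV (\<lambda>x::'a::real_normed_vector. f (x - c))"
  by (rule continuous_on_compose2[OF assms]) (auto intro: continuous_intros)

lemma C1_translate:
  assumes "C1 f q"
  shows "C1 (\<lambda>x. f (x + c)) (\<lambda>x. q (x + c))"
  unfolding C1_def
proof (intro conjI allI)
  show "((\<lambda>x. f (x + c)) has_derivative (\<lambda>v. q (x + c) \<bullet> v)) (at x)" for x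
    by (rule has_derivative_compose[where f = "\<lambda>y. y + c" and f' = "\<lambda>v. v", OF _ C1D(1)[OF assms]])
       (auto intro!: derivative_eq_intros)
  show "continuous_on UNIV (\<lambda>x. q (x + c))"
    by (intro continuous_shift C1D[OF assms])
qed

lemma C1_diff:
  assumes "C1 f p" "C1 g q"
  shows "C1 (\<lambda>x. f x - g x) (\<lambda>x. p x - q x)"
  using assms unfolding C1_def
  by (auto intro!: derivative_eq_intros continuous_intros simp: inner_diff_left fun_eq_iff)

lemma continuous_bounded_ball:
  fixes g :: "'a::euclidean_space \<Rightarrow> 'b::real_normed_vector"
  assumes "continuous_on UNIV g"
  obtains M where "0 \<le> M" "\<And>x. norm x \<le> r \<Longrightarrow> norm (g x) \<le> M"
proof -
  have "compact (g ` cball 0 r)"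
    by (intro compact_continuous_image compact_cball continuous_on_subset[OF assms]) auto
  then have "bounded (g ` cball 0 r)" by (rule compact_imp_bounded)
  then obtain M where M: "\<And>y. y \<in> g ` cball 0 r \<Longrightarrow> norm y \<le> M"
    by (auto simp: bounded_iff)
  have "norm (g x) \<le> \<bar>M\<bar>" if "norm x \<le> r" for x
    using M[of "g x"] that by force
  then show ?thesis using that[of "\<bar>M\<bar>"] by auto
qed

text \<open>Integrals of derivatives are reached as limits of difference quotients because
  translation invariance of \<open>lborel\<close> applies to the quotients directly. The quotients
  vanish outside radius r + |a|, and the mean value theorem bounds them by |a| times the maximum of
  |q| over a ball larger by |a|; this gives the dominating function.\<close>

lemma difference_quotient_limit:
  fixes f :: "'a::euclidean_space \<Rightarrow> real"
  assumes f: "C1 f q" "\<And>x. norm x > r \<Longrightarrow> f x = 0" and g: "continuous_on UNIV g"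
    and h: "\<And>n. 0 < h n" "\<And>n. h n \<le> 1" "h \<longlonglongrightarrow> (0::real)"
  shows "(\<lambda>n. LINT x|lborel. (f (x + h n *\<^sub>R a) - f x) / h n * g x) \<longlonglongrightarrow> (LINT x|lborel. (q x \<bullet> a) * g x)"
proof -
  define R where "R = r + norm a"
  obtain G where G: "0 \<le> G" "\<And>x. norm x \<le> R \<Longrightarrow> norm (g x) \<le> G"
    using continuous_bounded_ball[OF g, of R] by blast
  obtain M where M: "0 \<le> M" "\<And>x. norm x \<le> R + norm a \<Longrightarrow> norm (q x) \<le> M"
    using continuous_bounded_ball[OF C1D(2)[OF f(1)], of "R + norm a"] by blast
  have fc: "continuous_on UNIV f" by (rule C1D[OF f(1)])
  have ex: "\<exists>t. 0 < t \<and> t < h n \<and> (f (x + h n *\<^sub>R a) - f x) / h n = q (x + t *\<^sub>R a) \<bullet> a" for n x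
    using mvt_segment[OF C1D(1)[OF f(1)] h(1)[of n], of x a] h(1)[of n]
    by (metis less_irrefl nonzero_mult_div_cancel_left)
  show ?thesis
  proof (rule integral_dominated_convergence[where w = "\<lambda>x. indicator (cball 0 R) x *\<^sub>R (M * norm a * G)"])
    show "(\<lambda>x. q x \<bullet> a * g x) \<in> borel_measurable lborel"
      by (simp, intro borel_measurable_continuous_onI continuous_intros g C1D[OF f(1)])
    show "(\<lambda>x. (f (x + h n *\<^sub>R a) - f x) / h n * g x) \<in> borel_measurable lborel" for n
      by (simp, intro borel_measurable_continuous_onI continuous_intros g continuous_shift[OF fc] fc)
         (use h(1)[of n] in auto)
    show "integrable lborel (\<lambda>x. indicator (cball 0 R) x *\<^sub>R (M * norm a * G))"
      by (rule borel_integrable_compact) auto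
    show "AE x in lborel. (\<lambda>n. (f (x + h n *\<^sub>R a) - f x) / h n * g x) \<longlonglongrightarrow> (q x \<bullet> a) * g x"
    proof (intro AE_I2 tendsto_mult tendsto_const)
      fix x
      have "\<forall>n. \<exists>t. 0 < t \<and> t < h n \<and> (f (x + h n *\<^sub>R a) - f x) / h n = q (x + t *\<^sub>R a) \<bullet> a"
        by (intro allI ex)
      from choice[OF this] obtain t
        where t: "\<And>n. 0 < t n \<and> t n < h n \<and> (f (x + h n *\<^sub>R a) - f x) / h n = q (x + t n *\<^sub>R a) \<bullet> a"
        by blast
      have "norm (t n) \<le> h n" for n using t[of n] by simp
      then have "t \<longlonglongrightarrow> 0"
        by (intro Lim_null_comparison[OF always_eventually h(3)]) blast
      then have "(\<lambda>n. x + t n *\<^sub>R a) \<longlonglongrightarrow> x" by (auto intro!: tendsto_eq_intros)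
      then have "(\<lambda>n. q (x + t n *\<^sub>R a) \<bullet> a) \<longlonglongrightarrow> q x \<bullet> a"
        using C1D(2)[OF f(1)]
        by (intro tendsto_intros isCont_tendsto_compose[of _ q]) (auto simp: continuous_on_eq_continuous_at)
      then show "(\<lambda>n. (f (x + h n *\<^sub>R a) - f x) / h n) \<longlonglongrightarrow> q x \<bullet> a" using t by simp
    qed
    fix n
    show "AE x in lborel. norm ((f (x + h n *\<^sub>R a) - f x) / h n * g x) \<le> indicator (cball 0 R) x *\<^sub>R (M * norm a * G)"
    proof (intro AE_I2)
      fix x
      show "norm ((f (x + h n *\<^sub>R a) - f x) / h n * g x) \<le> indicator (cball 0 R) x *\<^sub>R (M * norm a * G)"
      proof (cases "norm x \<le> R")
        case True
        obtain t where t: "0 < t" "t < h n" "(f (x + h n *\<^sub>R a) - f x) / h n = q (x + t *\<^sub>R a) \<bullet> a" using ex by blast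
        have "norm (t *\<^sub>R a) \<le> norm a" using t h(2)[of n] by (simp add: mult_left_le_one_le)
        then have "norm (x + t *\<^sub>R a) \<le> R + norm a" using True norm_triangle_ineq[of x "t *\<^sub>R a"] by linarith
        then have "\<bar>q (x + t *\<^sub>R a) \<bullet> a\<bar> \<le> M * norm a"
          by (intro order_trans[OF Cauchy_Schwarz_ineq2] mult_right_mono M(2) norm_ge_zero)
        moreover have "\<bar>g x\<bar> \<le> G" using G(2)[OF True] by simp
        ultimately show ?thesis using True t(3) M(1) by (auto simp: abs_mult intro!: mult_mono)
      next
        case False
        have "norm x \<le> norm (x + h n *\<^sub>R a) + norm (h n *\<^sub>R a)"
          using norm_triangle_ineq4[of "x + h n *\<^sub>R a" "h n *\<^sub>R a"] by simp
        moreover have "norm (h n *\<^sub>R a) \<le> norm a" using h(1)[of n] h(2)[of n] by (simp add: mult_left_le_one_le)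
        moreover have "norm a \<ge> 0" by simp
        ultimately have "f (x + h n *\<^sub>R a) = 0" "f x = 0" using False unfolding R_def
          by (intro f(2); linarith)+
        then show ?thesis using False by simp
      qed
    qed
  qed
qed

text \<open>By translation invariance every difference quotient of \<open>f\<close> has integral
  zero, and the limit inherits this. It serves as the divergence theorem in all later integrations
  by parts.\<close>

lemma integral_deriv_eq_0:
  fixes f :: "'a::euclidean_space \<Rightarrow> real"
  assumes f: "C1 f q" "\<And>x. norm x > r \<Longrightarrow> f x = 0"
  shows "(LINT x|lborel. q x \<bullet> a) = 0"
proof -
  define h :: "nat \<Rightarrow> real" where "h n = inverse (Suc n)" for n
  have h: "\<And>n. 0 < h n" "\<And>n. h n \<le> 1" "h \<longlonglongrightarrow> 0"
    unfolding h_def using LIMSEQ_inverse_real_of_nat by (auto simp: field_simps)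
  have fc: "continuous_on UNIV f" by (rule C1D[OF f(1)])
  have fs: "integrable lborel (\<lambda>x. f (x + c))" for c
  proof (rule integrable_compact_support[where r = "r + norm c"])
    show "continuous_on UNIV (\<lambda>x. f (x + c))"
      by (rule continuous_shift[OF fc])
    show "f (x + c) = 0" if "r + norm c < norm x" for x
      using that norm_triangle_ineq4[of "x + c" c] by (intro f(2)) simp
  qed
  have "(LINT x|lborel. (f (x + c) - f x) / d * 1) = 0" for c d
    using fs[of c] fs[of 0] integral_translate[OF fc, of c] by (simp add: add.commute)
  then have "(\<lambda>n. LINT x|lborel. (f (x + h n *\<^sub>R a) - f x) / h n * 1) = (\<lambda>n. 0)" by blast
  with difference_quotient_limit[OF f continuous_on_const[of _ 1] h, where a = a]
  show ?thesis by (simp add: LIMSEQ_const_iff)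
qed

text \<open>It will be applied to first derivatives of a C^2 function, for which a second
  integration by parts would need third derivatives. The derivative of \<open>g\<close> along
  \<open>b\<close> is therefore replaced by a difference quotient, which is still C^1. One
  integration by parts along \<open>a\<close> and a translation move the quotient onto
  \<open>f\<close>, and two minus signs cancel in the limit.\<close>

lemma integral_deriv_swap:
  fixes f g :: "'a::euclidean_space \<Rightarrow> real"
  assumes f: "C1 f p" "\<And>x. norm x > r \<Longrightarrow> f x = 0" and g: "C1 g q" "\<And>x. norm x > r \<Longrightarrow> g x = 0"
  shows "(LINT x|lborel. (p x \<bullet> a) * (q x \<bullet> b)) = (LINT x|lborel. (p x \<bullet> b) * (q x \<bullet> a))"
proof -
  define h :: "nat \<Rightarrow> real" where "h n = inverse (Suc n)" for n
  have h: "\<And>n. 0 < h n" "\<And>n. h n \<le> 1" "h \<longlonglongrightarrow> 0"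
    unfolding h_def using LIMSEQ_inverse_real_of_nat by (auto simp: field_simps)
  note cont = continuous_intros C1D[OF f(1)] C1D[OF g(1)] continuous_shift[OF C1D(2)[OF g(1)]]
    continuous_shift[OF C1D(3)[OF f(1)]] continuous_shift[OF C1D(3)[OF g(1)]]
    continuous_shift'[OF C1D(3)[OF f(1)]]
  have "(LINT x|lborel. (g (x + t *\<^sub>R b) - g x) / t * (p x \<bullet> a)) =
      - (LINT x|lborel. (f (x + t *\<^sub>R (-b)) - f x) / t * (q x \<bullet> a))" if t: "t > 0" for t
  proof -
    define G where "G x = g (x + t *\<^sub>R b) - g x" for x
    define Q where "Q x = q (x + t *\<^sub>R b) - q x" for x
    have G: "C1 G Q" unfolding G_def Q_def by (intro C1_diff C1_translate g)
    have i1: "integrable lborel (\<lambda>x. G x * (p x \<bullet> a))"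
      by (rule integrable_compact_support[where r = r])
         (auto simp: G_def C1_deriv_zero[OF f] intro!: cont)
    have i2: "integrable lborel (\<lambda>x. f x * (Q x \<bullet> a))"
      by (rule integrable_compact_support[where r = r])
         (auto simp: Q_def f intro!: cont)
    have i3: "integrable lborel (\<lambda>x. f x * (q x \<bullet> a))"
      by (rule integrable_compact_support[where r = r])
         (auto simp: f intro!: cont)
    have i4: "integrable lborel (\<lambda>x. f x * (q (x + t *\<^sub>R b) \<bullet> a))"
      by (rule integrable_compact_support[where r = r])
         (auto simp: f intro!: cont)
    have i5: "integrable lborel (\<lambda>x. f (x + t *\<^sub>R (-b)) * (q x \<bullet> a))"
      by (rule integrable_compact_support[where r = r])
         (auto simp: C1_deriv_zero[OF g] intro!: cont)
    have "(LINT x|lborel. (G x *\<^sub>R p x + f x *\<^sub>R Q x) \<bullet> a) = 0"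
      by (rule integral_deriv_eq_0[OF C1_mult[OF f(1) G], of r]) (simp add: f)
    then have "(LINT x|lborel. G x * (p x \<bullet> a)) = - (LINT x|lborel. f x * (Q x \<bullet> a))"
      using i1 i2 by (simp add: inner_left_distrib)
    also have "(LINT x|lborel. f x * (Q x \<bullet> a)) =
        (LINT x|lborel. f x * (q (x + t *\<^sub>R b) \<bullet> a)) - (LINT x|lborel. f x * (q x \<bullet> a))"
      using i3 i4 by (simp add: Q_def inner_diff_left right_diff_distrib)
    also have "(LINT x|lborel. f x * (q (x + t *\<^sub>R b) \<bullet> a)) = (LINT x|lborel. f (x + t *\<^sub>R (-b)) * (q x \<bullet> a))"
    proof -
      have "continuous_on UNIV (\<lambda>x. f (x + t *\<^sub>R (-b)) * (q x \<bullet> a))" by (intro cont)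
      from integral_translate[OF this, of "t *\<^sub>R b"] show ?thesis by (simp add: add.commute)
    qed
    finally have "(LINT x|lborel. G x * (p x \<bullet> a)) =
        - (LINT x|lborel. (f (x + t *\<^sub>R (-b)) - f x) * (q x \<bullet> a))"
      using i3 i5 by (simp add: left_diff_distrib)
    then show ?thesis by (simp add: G_def)
  qed
  then have eq: "(\<lambda>n. LINT x|lborel. (g (x + h n *\<^sub>R b) - g x) / h n * (p x \<bullet> a)) =
      (\<lambda>n. - (LINT x|lborel. (f (x + h n *\<^sub>R (-b)) - f x) / h n * (q x \<bullet> a)))" using h(1) by blast
  have 1: "(\<lambda>n. LINT x|lborel. (g (x + h n *\<^sub>R b) - g x) / h n * (p x \<bullet> a)) \<longlonglongrightarrow> (LINT x|lborel. (q x \<bullet> b) * (p x \<bullet> a))"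
    by (rule difference_quotient_limit[where r = r]) (use g h in \<open>auto intro!: cont\<close>)
  have 2: "(\<lambda>n. - (LINT x|lborel. (f (x + h n *\<^sub>R (-b)) - f x) / h n * (q x \<bullet> a))) \<longlonglongrightarrow> - (LINT x|lborel. (p x \<bullet> (-b)) * (q x \<bullet> a))"
    by (rule tendsto_minus, rule difference_quotient_limit[where r = r]) (use f h in \<open>auto intro!: cont\<close>)
  show ?thesis using LIMSEQ_unique[OF 1[unfolded eq] 2] by (simp add: mult.commute)
qed

section \<open>The interior energy estimate for second derivatives\<close>

text \<open>With S the sum of the matrices \<sigma>_j \<sigma>_j^T over j < m, this is the trace of
  S A, and \<open>formS\<close> is the bilinear form of S. The diffusion is given in this factored
  form, and in it the trace of S A S A becomes a sum of squares.\<close>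

definition trS :: "nat \<Rightarrow> (nat \<Rightarrow> real^'d) \<Rightarrow> real^'d^'d \<Rightarrow> real" where
  "trS m \<sigma> A = (\<Sum>j<m. \<sigma> j \<bullet> (A *v \<sigma> j))"

definition formS :: "nat \<Rightarrow> (nat \<Rightarrow> real^'d) \<Rightarrow> real^'d \<Rightarrow> real^'d \<Rightarrow> real" where
  "formS m \<sigma> x y = (\<Sum>j<m. (\<sigma> j \<bullet> x) * (\<sigma> j \<bullet> y))"

text \<open>Later constants see the matrix only through \<open>c\<close> and
  \<open>\<Lambda>\<close>, never through the number \<open>m\<close> of columns. This is what
  allows \<open>m\<close> to be quantified after the constants in the theorem.\<close>

definition gram :: "real \<Rightarrow> real \<Rightarrow> nat \<Rightarrow> (nat \<Rightarrow> real^'d) \<Rightarrow> bool" where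
  "gram c \<Lambda> m \<sigma> \<longleftrightarrow> (\<forall>v. c * norm v ^ 2 \<le> formS m \<sigma> v v \<and> formS m \<sigma> v v \<le> \<Lambda> * norm v ^ 2)"

lemma gramD:
  assumes "gram c \<Lambda> m \<sigma>"
  shows "c * norm v ^ 2 \<le> formS m \<sigma> v v" "formS m \<sigma> v v \<le> \<Lambda> * norm v ^ 2"
  using assms by (auto simp: gram_def)

lemma formS_nonneg: "0 \<le> formS m \<sigma> v v"
  by (simp add: formS_def sum_nonneg)

lemma formS_young:
  assumes "t > 0"
  shows "\<bar>formS m \<sigma> x y\<bar> \<le> (t * formS m \<sigma> x x + formS m \<sigma> y y / t) / 2"
proof -
  have **: "2 * (a * b) \<le> t * a\<^sup>2 + b\<^sup>2 / t" for a b :: real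
  proof -
    have "t * a\<^sup>2 + b\<^sup>2 / t - 2 * (a * b) = (t * a - b)^2 / t"
      using assms by (simp add: power2_eq_square field_simps)
    also have "\<dots> \<ge> 0" using assms by simp
    finally show ?thesis by simp
  qed
  have *: "2 * \<bar>a * b\<bar> \<le> t * a\<^sup>2 + b\<^sup>2 / t" for a b :: real
    using **[of "\<bar>a\<bar>" "\<bar>b\<bar>"] by (simp add: abs_mult)
  have "\<bar>formS m \<sigma> x y\<bar> \<le> (\<Sum>j<m. \<bar>(\<sigma> j \<bullet> x) * (\<sigma> j \<bullet> y)\<bar>)"
    unfolding formS_def by (rule sum_abs)
  also have "\<dots> \<le> (\<Sum>j<m. (t * (\<sigma> j \<bullet> x)\<^sup>2 + (\<sigma> j \<bullet> y)\<^sup>2 / t) / 2)"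
    by (intro sum_mono) (use * in \<open>simp add: field_simps\<close>)
  also have "\<dots> = (t * formS m \<sigma> x x + formS m \<sigma> y y / t) / 2"
    by (simp add: formS_def sum.distrib sum_distrib_left sum_divide_distrib power2_eq_square add_divide_distrib)
  finally show ?thesis .
qed

lemma formS_cauchy: "(formS m \<sigma> x y)^2 \<le> formS m \<sigma> x x * formS m \<sigma> y y"
  using Cauchy_Schwarz_ineq_sum[of "\<lambda>j. \<sigma> j \<bullet> x" "\<lambda>j. \<sigma> j \<bullet> y" "{..<m}"]
  by (simp add: formS_def power2_eq_square)

lemma sum_norm_gram_le:
  fixes \<sigma> :: "nat \<Rightarrow> real^'d"
  assumes "gram c \<Lambda> m \<sigma>"
  shows "(\<Sum>j<m. norm (\<sigma> j)^2) \<le> real CARD('d) * \<Lambda>"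
proof -
  have "(\<Sum>j<m. norm (\<sigma> j)^2) = (\<Sum>j<m. \<Sum>i\<in>UNIV. (\<sigma> j \<bullet> axis i 1)^2)"
    unfolding power2_norm_eq_inner by (simp add: inner_vec_def[of "\<sigma> _" "\<sigma> _"] inner_axis power2_eq_square)
  also have "\<dots> = (\<Sum>i\<in>UNIV. formS m \<sigma> (axis i 1) (axis i 1))"
    unfolding formS_def by (subst sum.swap) (simp add: power2_eq_square)
  also have "\<dots> \<le> (\<Sum>i\<in>(UNIV::'d set). \<Lambda> * 1)"
    using gramD(2)[OF assms] by (intro sum_mono) (metis norm_axis_1 one_power2)
  finally show ?thesis by simp
qed

lemma abs_trS_le:
  fixes \<sigma> :: "nat \<Rightarrow> real^'d"
  assumes "gram c \<Lambda> m \<sigma>"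
  shows "\<bar>trS m \<sigma> A\<bar> \<le> real CARD('d) * \<Lambda> * norm A"
proof -
  have "\<bar>trS m \<sigma> A\<bar> \<le> (\<Sum>j<m. norm A * norm (\<sigma> j)^2)"
    unfolding trS_def
    by (intro order_trans[OF sum_abs] sum_mono) (use matvec_dot_le in \<open>simp add: power2_eq_square mult.assoc\<close>)
  also have "\<dots> = norm A * (\<Sum>j<m. norm (\<sigma> j)^2)" by (simp add: sum_distrib_left)
  also have "\<dots> \<le> norm A * (real CARD('d) * \<Lambda>)" by (intro mult_left_mono sum_norm_gram_le[OF assms]) auto
  finally show ?thesis by (simp add: mult_ac)
qed

text \<open>The right-hand side is the trace of S A S A. Ellipticity is used twice: on the columns A
  e_i, whose form values regroup by symmetry of \<open>A\<close> into the sum of |A \<sigma>_k|^2,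
  and then on the vectors A \<sigma>_k.\<close>

lemma gram_frobenius_le:
  fixes A :: "real^'d^'d"
  assumes "gram c \<Lambda> m \<sigma>" "0 < c" and sym: "\<And>a b. a \<bullet> (A *v b) = b \<bullet> (A *v a)"
  shows "c^2 * norm A ^ 2 \<le> (\<Sum>j<m. \<Sum>k<m. (\<sigma> j \<bullet> (A *v \<sigma> k))^2)"
proof -
  have cols: "(\<Sum>i\<in>UNIV. norm (A *v axis i 1)^2) = norm A ^ 2"
  proof -
    have "(\<Sum>i\<in>UNIV. norm (A *v axis i 1)^2) = (\<Sum>i\<in>UNIV. \<Sum>k\<in>UNIV. (A $ k $ i)^2)"
      unfolding power2_norm_eq_inner
      by (simp add: inner_vec_def power2_eq_square matrix_vector_mult_basis column_def)
    also have "\<dots> = norm A ^ 2"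
      unfolding power2_norm_eq_inner by (subst sum.swap) (simp add: inner_vec_def power2_eq_square)
    finally show ?thesis .
  qed
  have "c^2 * norm A ^ 2 = c * (\<Sum>i\<in>UNIV. c * norm (A *v axis i 1)^2)"
    unfolding cols[symmetric] by (simp only: power2_eq_square[of c] sum_distrib_left mult.assoc)
  also have "\<dots> \<le> c * (\<Sum>i\<in>UNIV. formS m \<sigma> (A *v axis i 1) (A *v axis i 1))"
    using assms by (intro mult_left_mono sum_mono gramD) auto
  also have "\<dots> = c * (\<Sum>k<m. norm (A *v \<sigma> k)^2)"
  proof -
    have "(\<Sum>i\<in>UNIV. formS m \<sigma> (A *v axis i 1) (A *v axis i 1)) = (\<Sum>k<m. \<Sum>i\<in>UNIV. (axis i 1 \<bullet> (A *v \<sigma> k))^2)"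
      unfolding formS_def by (subst sum.swap) (simp add: power2_eq_square sym[of "\<sigma> _"])
    then show ?thesis unfolding power2_norm_eq_inner
      by (simp add: inner_vec_def[of "A *v _" "A *v _"] inner_axis' power2_eq_square)
  qed
  also have "\<dots> = (\<Sum>k<m. c * norm (A *v \<sigma> k)^2)" by (simp add: sum_distrib_left)
  also have "\<dots> \<le> (\<Sum>k<m. formS m \<sigma> (A *v \<sigma> k) (A *v \<sigma> k))"
    by (intro sum_mono gramD[OF assms(1)])
  also have "\<dots> = (\<Sum>j<m. \<Sum>k<m. (\<sigma> j \<bullet> (A *v \<sigma> k))^2)"
    unfolding formS_def by (subst sum.swap) (simp add: power2_eq_square)
  finally show ?thesis .
qed

lemma continuous_on_trS [continuous_intros]:
  assumes "continuous_on X H" shows "continuous_on X (\<lambda>x. trS m \<sigma> (H x))"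
  unfolding trS_def by (intro continuous_intros assms)

lemma C2_C1:
  assumes "C2 w p H"
  shows "C1 w p" "C1 (\<lambda>x. p x \<bullet> a) (\<lambda>x. H x *v a)"
proof -
  show "C1 w p" using C2D[OF assms] unfolding C1_def by auto
  have "((\<lambda>x. p x \<bullet> a) has_derivative (\<lambda>v. (H x *v a) \<bullet> v)) (at x)" for x
    by (rule has_derivative_eq_rhs, rule has_derivative_inner_left[OF C2D(2)[OF assms]])
       (auto simp: C2_symmetric[OF assms, of a] inner_commute)
  then show "C1 (\<lambda>x. p x \<bullet> a) (\<lambda>x. H x *v a)"
    using C2D(3)[OF assms] unfolding C1_def by (auto intro!: continuous_intros)
qed

lemma C2_vanish:
  assumes "C2 w p H" "\<And>x. norm x > r \<Longrightarrow> w x = 0" "norm x > r"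
  shows "p x = 0" "H x = 0"
proof -
  have p: "p x = 0" if "norm x > r" for x
    using C1_deriv_zero[OF C2_C1(1)[OF assms(1)] assms(2) that] .
  then show "p x = 0" using assms by auto
  have "H x *v a = 0" for a
    by (rule C1_deriv_zero[OF C2_C1(2)[OF assms(1)] _ assms(3)]) (simp add: p)
  then show "H x = 0" by (simp add: matrix_eq)
qed

text \<open>
  Integrating by parts twice turns \<open>D\<^sub>j\<^sub>j u D\<^sub>k\<^sub>k u\<close> into \<open>(D\<^sub>j\<^sub>k u)\<^sup>2\<close>.
\<close>

lemma energy_compact_support:
  assumes u: "C2 u p H" "\<And>x. norm x > r \<Longrightarrow> u x = 0" and S: "gram c \<Lambda> m \<sigma>" "0 < c"
  shows "c^2 * (LINT x|lborel. norm (H x)^2) \<le> (LINT x|lborel. (trS m \<sigma> (H x))^2)"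
proof -
  note van = C2_vanish[OF u]
  have int: "integrable lborel (\<lambda>x. (a \<bullet> (H x *v b)) * (c \<bullet> (H x *v d)))" for a b c d
    by (rule integrable_compact_support[where r = r])
       (auto simp: van intro!: continuous_intros C2D[OF u(1)])
  have swap: "(LINT x|lborel. (\<sigma> j \<bullet> (H x *v \<sigma> j)) * (\<sigma> k \<bullet> (H x *v \<sigma> k))) =
      (LINT x|lborel. (\<sigma> j \<bullet> (H x *v \<sigma> k))^2)" for j k
  proof -
    have "(LINT x|lborel. ((H x *v \<sigma> j) \<bullet> \<sigma> j) * ((H x *v \<sigma> k) \<bullet> \<sigma> k)) =
        (LINT x|lborel. ((H x *v \<sigma> j) \<bullet> \<sigma> k) * ((H x *v \<sigma> k) \<bullet> \<sigma> j))"
      by (rule integral_deriv_swap[where r = r, OF C2_C1(2)[OF u(1)] _ C2_C1(2)[OF u(1)]]) (simp_all add: van)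
    then show ?thesis
      by (simp add: inner_commute[of "_ *v _"] power2_eq_square C2_symmetric[OF u(1), of "\<sigma> k" _ "\<sigma> j"])
  qed
  have "c^2 * (LINT x|lborel. norm (H x)^2) = (LINT x|lborel. c^2 * norm (H x)^2)" by simp
  also have "\<dots> \<le> (LINT x|lborel. (\<Sum>j<m. \<Sum>k<m. (\<sigma> j \<bullet> (H x *v \<sigma> k))^2))"
  proof (rule integral_mono)
    show "integrable lborel (\<lambda>x. c\<^sup>2 * (norm (H x))\<^sup>2)"
      by (rule integrable_compact_support[where r = r]) (auto simp: van intro!: continuous_intros C2D[OF u(1)])
    show "integrable lborel (\<lambda>x. \<Sum>j<m. \<Sum>k<m. (\<sigma> j \<bullet> (H x *v \<sigma> k))\<^sup>2)"
      using int by (auto simp: power2_eq_square)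
  qed (rule gram_frobenius_le[OF S], rule C2_symmetric[OF u(1)])
  also have "\<dots> = (\<Sum>j<m. \<Sum>k<m. LINT x|lborel. (\<sigma> j \<bullet> (H x *v \<sigma> k))^2)"
    using int by (simp add: power2_eq_square)
  also have "\<dots> = (\<Sum>j<m. \<Sum>k<m. LINT x|lborel. (\<sigma> j \<bullet> (H x *v \<sigma> j)) * (\<sigma> k \<bullet> (H x *v \<sigma> k)))"
    by (simp only: swap)
  also have "\<dots> = (LINT x|lborel. (\<Sum>j<m. \<Sum>k<m. (\<sigma> j \<bullet> (H x *v \<sigma> j)) * (\<sigma> k \<bullet> (H x *v \<sigma> k))))"
    using int by simp
  also have "\<dots> = (LINT x|lborel. (trS m \<sigma> (H x))^2)"
    by (simp add: trS_def power2_eq_square sum_product)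
  finally show ?thesis .
qed

section \<open>Localisation of the energy estimate by a cutoff\<close>

lemma max_power_deriv:
  assumes "2 \<le> k"
  shows "((\<lambda>t::real. max 0 t ^ k) has_real_derivative (of_nat k * max 0 t ^ (k - 1))) (at t)"
proof -
  consider "t > 0" | "t < 0" | "t = 0" by linarith
  then show ?thesis
  proof cases
    case 1
    have "((\<lambda>t::real. t ^ k) has_real_derivative (of_nat k * max 0 t ^ (k - 1))) (at t)"
      using 1 by (auto intro!: derivative_eq_intros)
    then show ?thesis
      by (rule has_field_derivative_transform_within_open[where S = "{0<..}"]) (use 1 in auto)
  next
    case 2
    have "((\<lambda>t::real. 0) has_real_derivative (of_nat k * max 0 t ^ (k - 1))) (at t)"
      using 2 assms by (auto intro!: derivative_eq_intros)
    then show ?thesis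
      by (rule has_field_derivative_transform_within_open[where S = "{..<0}"]) (use 2 assms in auto)
  next
    case 3
    have "((\<lambda>y::real. (max 0 y ^ k - max 0 0 ^ k) / (y - 0)) \<longlongrightarrow> 0) (at 0)"
    proof (rule Lim_null_comparison)
      have "\<forall>\<^sub>F y in at (0::real). \<bar>y\<bar> < 1" by (auto simp: eventually_at intro!: exI[of _ 1])
      then show "\<forall>\<^sub>F y in at (0::real). norm ((max 0 y ^ k - max 0 0 ^ k) / (y - 0)) \<le> \<bar>y\<bar>"
      proof eventually_elim
        case (elim y)
        have "max 0 y ^ k \<le> max 0 y ^ 2"
          using elim by (intro power_decreasing assms) auto
        also have "\<dots> \<le> \<bar>y\<bar> * \<bar>y\<bar>" by (auto simp: max_def power2_eq_square)
        finally show ?case using assms by (cases "y = 0") (auto simp: divide_simps power_0_left)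
      qed
    qed (auto intro!: tendsto_eq_intros)
    then show ?thesis using 3 assms by (simp add: has_field_derivative_iff power_0_left)
  qed
qed

lemma set_integrable_cball:
  fixes F :: "'a::euclidean_space \<Rightarrow> real"
  assumes "continuous_on UNIV F"
  shows "set_integrable lborel (cball a r) F"
  unfolding set_integrable_def
  by (rule borel_integrable_compact) (auto intro: continuous_on_subset[OF assms])

definition outer :: "real^'d \<Rightarrow> real^'d \<Rightarrow> real^'d^'d" where
  "outer x y = (\<chi> i j. x $ i * y $ j)"

lemma outer_mult: "outer x y *v v = (y \<bullet> v) *\<^sub>R x"
  by (simp add: outer_def matrix_vector_mult_def vec_eq_iff inner_vec_def sum_distrib_left mult_ac)

lemma norm_outer: "norm (outer x y) = norm x * norm y"
proof -
  have "norm (outer x y)^2 = (norm x * norm y)^2"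
    unfolding power_mult_distrib power2_norm_eq_inner
    by (simp add: outer_def inner_vec_def sum_product mult_ac)
  then show ?thesis by (simp add: power2_eq_iff_nonneg)
qed

lemma continuous_on_outer [continuous_intros]:
  fixes f g :: "'a::topological_space \<Rightarrow> real^'d"
  assumes "continuous_on X f" "continuous_on X g"
  shows "continuous_on X (\<lambda>x. outer (f x) (g x))"
  unfolding outer_def
  by (intro continuous_on_vec_lambda continuous_on_mult continuous_intros assms)

lemma trS_linear:
  "trS m \<sigma> (A + B) = trS m \<sigma> A + trS m \<sigma> B"
  "trS m \<sigma> (t *\<^sub>R A) = t * trS m \<sigma> A"
  "trS m \<sigma> (outer x y) = formS m \<sigma> x y"
  by (simp_all add: trS_def formS_def matrix_vector_mult_add_rdistrib inner_right_distrib sum.distrib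
      outer_mult scaleR_matrix_vector_assoc[symmetric] sum_distrib_left inner_commute mult_ac)

lemma formS_linear:
  "formS m \<sigma> (x + y) z = formS m \<sigma> x z + formS m \<sigma> y z"
  "formS m \<sigma> (t *\<^sub>R x) z = t * formS m \<sigma> x z"
  "formS m \<sigma> x (t *\<^sub>R z) = t * formS m \<sigma> x z"
  by (simp_all add: formS_def inner_right_distrib sum.distrib algebra_simps sum_distrib_left)

lemma C2_mult:
  assumes "C2 f p A" "C2 g q B"
  shows "C2 (\<lambda>x. f x * g x) (\<lambda>x. g x *\<^sub>R p x + f x *\<^sub>R q x)
     (\<lambda>x. g x *\<^sub>R A x + f x *\<^sub>R B x + outer (p x) (q x) + outer (q x) (p x))"
  unfolding C2_def
proof (intro conjI allI)
  note f = C2D[OF assms(1)] and g = C2D[OF assms(2)]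
  show "((\<lambda>x. f x * g x) has_derivative (\<lambda>v. (g x *\<^sub>R p x + f x *\<^sub>R q x) \<bullet> v)) (at x)" for x
    using C1D(1)[OF C1_mult[OF C2_C1(1)[OF assms(1)] C2_C1(1)[OF assms(2)]]] .
  show "((\<lambda>x. g x *\<^sub>R p x + f x *\<^sub>R q x) has_derivative
      (\<lambda>v. (g x *\<^sub>R A x + f x *\<^sub>R B x + outer (p x) (q x) + outer (q x) (p x)) *v v)) (at x)" for x
    by (rule has_derivative_eq_rhs, rule has_derivative_add[OF
         has_derivative_scaleR[OF g(1) f(2)] has_derivative_scaleR[OF f(1) g(2)]])
       (auto simp: fun_eq_iff matrix_vector_mult_add_rdistrib outer_mult scaleR_matrix_vector_assoc[symmetric])
  show "continuous_on UNIV (\<lambda>x. g x *\<^sub>R A x + f x *\<^sub>R B x + outer (p x) (q x) + outer (q x) (p x))"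
    by (intro continuous_intros f g)
qed

text \<open>The fourth power z of this truncated paraboloid is C^2 and satisfies |Dz|^2 \<le> 16 z.
  Hence the cross terms between Dz and Dw carry the weight
  \<open>cutoff x ^ 4 * norm (p x)^2\<close>, which is the one controlled by
  \<open>interior_gradient_energy\<close>.\<close>

definition cutoff :: "real^'d \<Rightarrow> real" where
  "cutoff x = max 0 (1 - (x \<bullet> x) / 4)"

lemma cutoff_bounds:
  "0 \<le> cutoff x" "cutoff x \<le> 1" "norm x > 2 \<Longrightarrow> cutoff x = 0" "norm x \<le> 1 \<Longrightarrow> 3/4 \<le> cutoff x"
  "cutoff x \<noteq> 0 \<Longrightarrow> norm x \<le> 2"
proof -
  show gt: "cutoff x = 0" if "norm x > 2" for x :: "real^'a"
    using power_strict_mono[OF that, of 2] by (simp add: cutoff_def max_def power2_norm_eq_inner)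
  show "cutoff x \<noteq> 0 \<Longrightarrow> norm x \<le> 2" using gt[of x] by fastforce
  show "norm x \<le> 1 \<Longrightarrow> 3/4 \<le> cutoff x"
    using power_mono[of "norm x" 1 2] by (simp add: cutoff_def max_def power2_norm_eq_inner)
qed (auto simp: cutoff_def max_def)

lemma continuous_on_cutoff [continuous_intros]: "continuous_on X cutoff"
  unfolding cutoff_def by (intro continuous_intros) auto

lemma cutoff_power_deriv:
  assumes "2 \<le> k"
  shows "((\<lambda>x. cutoff x ^ k) has_derivative
     (\<lambda>v. (- (real k / 2 * cutoff x ^ (k - 1)) *\<^sub>R x) \<bullet> v)) (at x)"
proof -
  have "((\<lambda>x::real^'a. 1 - (x \<bullet> x) / 4) has_derivative (\<lambda>v. - (x \<bullet> v) / 2)) (at x)"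
    by (auto intro!: derivative_eq_intros simp: inner_commute)
  from has_derivative_compose[OF this max_power_deriv[OF assms, unfolded has_field_derivative_def]]
  show ?thesis unfolding cutoff_def by (rule has_derivative_eq_rhs) (auto simp: fun_eq_iff)
qed

lemma C2_cutoff:
  "C2 (\<lambda>x. cutoff x ^ 4) (\<lambda>x. (- 2 * cutoff x ^ 3) *\<^sub>R x)
     (\<lambda>x. (- 2 * cutoff x ^ 3) *\<^sub>R mat 1 + (3 * cutoff x ^ 2) *\<^sub>R outer x x)"
  unfolding C2_def
proof (intro conjI allI)
  show "((\<lambda>x. cutoff x ^ 4) has_derivative (\<lambda>v. ((- 2 * cutoff x ^ 3) *\<^sub>R x) \<bullet> v)) (at x)" for x :: "real^'a"
    by (rule has_derivative_eq_rhs[OF cutoff_power_deriv]) auto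
  show "((\<lambda>x. (- 2 * cutoff x ^ 3) *\<^sub>R x) has_derivative
      (\<lambda>v. ((- 2 * cutoff x ^ 3) *\<^sub>R mat 1 + (3 * cutoff x ^ 2) *\<^sub>R outer x x) *v v)) (at x)" for x :: "real^'a"
    by (rule has_derivative_eq_rhs, rule has_derivative_scaleR[OF has_derivative_mult_right[OF cutoff_power_deriv] has_derivative_ident])
       (auto simp: fun_eq_iff matrix_vector_mult_add_rdistrib outer_mult scaleR_matrix_vector_assoc[symmetric]
          matrix_vector_mul_lid algebra_simps)
qed (intro continuous_intros)

lemma sum3_square_le: "(a + b + c)^2 \<le> 3 * (a^2 + b^2 + (c::real)^2)"
proof -
  have "3 * (a^2 + b^2 + c^2) - (a + b + c)^2 = (a - b)^2 + (b - c)^2 + (a - c)^2"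
    by (simp add: power2_eq_square algebra_simps)
  also have "\<dots> \<ge> 0" by simp
  finally show ?thesis by simp
qed

text \<open>Caccioppoli inequality. For a constant matrix S the operator is also in divergence form,
  so it may be tested with \<open>cutoff x ^ 4 * w x\<close>; the term in which the cutoff is
  differentiated is split by Young's inequality so that half of the gradient term survives.\<close>

lemma interior_gradient_energy:
  assumes S: "gram c \<Lambda> m \<sigma>" "0 < c" and w: "C2 w p H"
  shows "(LINT x|lborel. cutoff x ^ 4 * norm (p x)^2)
    \<le> (1 + 16 * \<Lambda>) / c * (LINT x:cball 0 2|lborel. (trS m \<sigma> (H x))^2 + (w x)^2)"
proof -
  note wD = C2D[OF w]
  define J where "J x = (trS m \<sigma> (H x))^2 + (w x)^2" for x
  have J: "continuous_on UNIV J" unfolding J_def by (intro continuous_intros wD)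
  have \<Lambda>: "0 \<le> \<Lambda>"
    using gramD[OF S(1), of "axis undefined 1"] \<open>0 < c\<close> by simp
  \<comment> \<open>This is the divergence of the vector field \<open>cutoff x ^ 4 * w x\<close>
    times S Dw, so its integral is zero. The coefficient -2 comes from the gradient of the fourth
    power of the cutoff.\<close>
  define T where "T x = cutoff x ^ 4 * w x * trS m \<sigma> (H x) + cutoff x ^ 4 * formS m \<sigma> (p x) (p x)
     - 2 * w x * cutoff x ^ 3 * formS m \<sigma> x (p x)" for x
  have T: "integrable lborel T" unfolding T_def formS_def
    by (rule integrable_compact_support[where r = 2])
       (auto simp: cutoff_bounds intro!: continuous_intros wD)
  have i1: "integrable lborel (\<lambda>x. cutoff x ^ 4 * norm (p x)^2)"
    by (rule integrable_compact_support[where r = 2]) (auto simp: cutoff_bounds intro!: continuous_intros wD)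
  have i2: "integrable lborel (\<lambda>x. indicator (cball 0 2) x *\<^sub>R J x)"
    using set_integrable_cball[OF J, of 0 2] unfolding set_integrable_def .
  have "(LINT x|lborel. T x) = 0"
  proof -
    let ?G = "\<lambda>j x. (p x \<bullet> \<sigma> j) *\<^sub>R (w x *\<^sub>R (- 2 * cutoff x ^ 3) *\<^sub>R x + cutoff x ^ 4 *\<^sub>R p x)
        + (cutoff x ^ 4 * w x) *\<^sub>R (H x *v \<sigma> j)"
    have C: "C1 (\<lambda>x. (cutoff x ^ 4 * w x) * (p x \<bullet> \<sigma> j)) (?G j)" for j
      by (intro C1_mult C2_C1(2)[OF w] C2_C1(1)[OF w] C2_C1(1)[OF C2_cutoff])
    have "(LINT x|lborel. ?G j x \<bullet> \<sigma> j) = 0" for j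
      by (rule integral_deriv_eq_0[OF C, of 2]) (simp add: cutoff_bounds)
    moreover have "integrable lborel (\<lambda>x. ?G j x \<bullet> \<sigma> j)" for j
      by (rule integrable_compact_support[where r = 2])
         (auto simp: cutoff_bounds intro!: continuous_intros wD)
    ultimately have "(LINT x|lborel. (\<Sum>j<m. ?G j x \<bullet> \<sigma> j)) = 0" by simp
    also have "(\<lambda>x. \<Sum>j<m. ?G j x \<bullet> \<sigma> j) = T"
      by (simp add: T_def fun_eq_iff trS_def formS_def sum_distrib_left sum.distrib[symmetric] sum_subtractf[symmetric]
          inner_left_distrib inner_commute[of _ "\<sigma> _"] algebra_simps)
    finally show ?thesis .
  qed
  moreover have "(LINT x|lborel. c / 2 * (cutoff x ^ 4 * norm (p x)^2) - (1/2 + 8 * \<Lambda>) * (indicator (cball 0 2) x *\<^sub>R J x))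
     \<le> (LINT x|lborel. T x)"
  proof (rule integral_mono[OF _ T])
    show "integrable lborel (\<lambda>x. c / 2 * (cutoff x ^ 4 * norm (p x)^2) - (1/2 + 8 * \<Lambda>) * (indicator (cball 0 2) x *\<^sub>R J x))"
      using i1 i2 by (intro Bochner_Integration.integrable_diff integrable_mult_right)
    fix x
    show "c / 2 * (cutoff x ^ 4 * norm (p x)^2) - (1/2 + 8 * \<Lambda>) * (indicator (cball 0 2) x *\<^sub>R J x) \<le> T x"
    proof (cases "norm x \<le> 2")
      case False
      then show ?thesis by (simp add: T_def cutoff_bounds)
    next
      case True
      let ?t = "cutoff x" and ?q = "formS m \<sigma>"
      have t: "0 \<le> ?t" "?t \<le> 1" by (rule cutoff_bounds)+
      have t4: "?t ^ 4 \<le> 1" "0 \<le> ?t^4" using t by (auto intro: power_le_one)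
      have "\<bar>?q ((2 * w x * ?t) *\<^sub>R x) (?t^2 *\<^sub>R p x)\<bar> \<le>
          (1 * ?q ((2 * w x * ?t) *\<^sub>R x) ((2 * w x * ?t) *\<^sub>R x) + ?q (?t^2 *\<^sub>R p x) (?t^2 *\<^sub>R p x) / 1) / 2"
        by (rule formS_young) simp
      then have 1: "2 * w x * ?t^3 * ?q x (p x) \<le> 2 * (w x)^2 * (?t^2 * ?q x x) + ?t^4 * ?q (p x) (p x) / 2"
        by (simp add: formS_linear power2_eq_square power3_eq_cube power4_eq_xxxx algebra_simps)
      have "?t^2 * ?q x x \<le> 1 * (\<Lambda> * norm x^2)"
        by (intro mult_mono gramD[OF S(1)] power_le_one t) (auto simp: formS_nonneg)
      also have "\<dots> \<le> \<Lambda> * 2^2" using mult_left_mono[OF power_mono[OF True norm_ge_zero, of 2] \<Lambda>] by simp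
      finally have 2: "2 * (w x)^2 * (?t^2 * ?q x x) \<le> 2 * (w x)^2 * (\<Lambda> * 4)"
        by (intro mult_left_mono) auto
      have 3: "c * (?t^4 * norm (p x)^2) \<le> ?t^4 * ?q (p x) (p x)"
        using mult_left_mono[OF gramD(1)[OF S(1), of "p x"] t4(2)] by (simp add: mult_ac)
      have 4: "- (?t^4 * w x * trS m \<sigma> (H x)) \<le> J x / 2"
      proof -
        have "- (w x * trS m \<sigma> (H x)) \<le> J x / 2"
          using sum_squares_bound[of "- w x" "trS m \<sigma> (H x)"] by (simp add: J_def)
        then have "?t^4 * (- (w x * trS m \<sigma> (H x))) \<le> ?t^4 * (J x / 2)"
          using t4 by (intro mult_left_mono) auto
        also have "\<dots> \<le> 1 * (J x / 2)" using t4 by (intro mult_right_mono) (auto simp: J_def)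
        finally show ?thesis by simp
      qed
      have 5: "8 * \<Lambda> * (w x)^2 \<le> 8 * \<Lambda> * J x"
        using \<Lambda> by (intro mult_left_mono) (auto simp: J_def)
      show ?thesis using True 1 2 3 4 5 by (simp add: T_def algebra_simps)
    qed
  qed
  moreover have "(LINT x|lborel. c / 2 * (cutoff x ^ 4 * norm (p x)^2) - (1/2 + 8 * \<Lambda>) * (indicator (cball 0 2) x *\<^sub>R J x))
     = c / 2 * (LINT x|lborel. cutoff x ^ 4 * norm (p x)^2) - (1/2 + 8 * \<Lambda>) * (LINT x:cball 0 2|lborel. J x)"
    unfolding set_lebesgue_integral_def using i1 i2
    by (subst Bochner_Integration.integral_diff) auto
  ultimately show ?thesis unfolding J_def[symmetric]
    using S(2) by (simp add: field_simps)
qed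

text \<open>\<open>energy_compact_support\<close> is applied to u = cutoff^4 w. Compared with
  cutoff^4 times the Hessian of w, the Hessian of u contains terms in w and in Dw; the latter are
  paid for by the Caccioppoli inequality, both when the energy of u is bounded and when the Hessian
  of w is recovered on the unit ball.\<close>

lemma interior_hessian_energy:
  assumes "0 < c" "0 \<le> \<Lambda>"
  shows "\<exists>C>0. \<forall>m \<sigma> w p H. gram c \<Lambda> m \<sigma> \<and> C2 w p (H :: real^'d \<Rightarrow> real^'d^'d) \<longrightarrow>
    (LINT x:cball 0 1|lborel. norm (H x)^2) \<le> C * (LINT x:cball 0 2|lborel. (trS m \<sigma> (H x))^2 + (w x)^2)"
proof -
  \<comment> \<open>\<open>N\<close> bounds the Hessian of cutoff^4 on the ball of radius 2,
    \<open>K\<close> is the constant of the gradient estimate and \<open>L\<close> the one for the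
    squared trace of S D^2 u. The divisor (3/4)^8 is the square of the lower bound of cutoff^4 on
    the unit ball.\<close>
  define N where "N = 2 * norm (mat 1 :: real^'d^'d) + 12"
  define K where "K = (1 + 16 * \<Lambda>) / c"
  define L where "L = 3 * (1 + (real CARD('d) * \<Lambda> * N)^2) + 192 * \<Lambda>^2 * K"
  define C where "C = (3 / c^2 * L + 3 * N^2 + 192 * K) / (3/4)^8"
  have K0: "0 < K" using assms by (simp add: K_def)
  have "0 < C" using K0 assms unfolding C_def L_def
    by (intro divide_pos_pos add_nonneg_pos mult_nonneg_nonneg) auto
  moreover have "(LINT x:cball 0 1|lborel. norm (H x)^2) \<le> C * (LINT x:cball 0 2|lborel. (trS m \<sigma> (H x))^2 + (w x)^2)"
    if S: "gram c \<Lambda> m \<sigma>" and w: "C2 w p H" for m \<sigma> w p and H :: "real^'d \<Rightarrow> real^'d^'d"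
  proof -
    note wD = C2D[OF w]
    define J where "J x = (trS m \<sigma> (H x))^2 + (w x)^2" for x
    have J: "continuous_on UNIV J" unfolding J_def by (intro continuous_intros wD)
    define I where "I = (LINT x:cball 0 2|lborel. J x)"
    define P where "P x = cutoff x ^ 4 * norm (p x)^2" for x
    define z where "z x = cutoff x ^ 4" for x :: "real^'d"
    define zp where "zp x = (- 2 * cutoff x ^ 3) *\<^sub>R x" for x :: "real^'d"
    define zH where "zH x = (- 2 * cutoff x ^ 3) *\<^sub>R mat 1 + (3 * cutoff x ^ 2) *\<^sub>R outer x x" for x :: "real^'d"
    define uH where "uH x = w x *\<^sub>R zH x + z x *\<^sub>R H x + outer (zp x) (p x) + outer (p x) (zp x)" for x
    have u: "C2 (\<lambda>x. z x * w x) (\<lambda>x. w x *\<^sub>R zp x + z x *\<^sub>R p x) uH"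
      unfolding z_def zp_def zH_def uH_def by (rule C2_mult[OF C2_cutoff w])
    have uz: "z x * w x = 0" if "norm x > 2" for x using that by (simp add: z_def cutoff_bounds)
    have IP: "(LINT x|lborel. P x) \<le> K * I"
      unfolding P_def K_def I_def J_def by (rule interior_gradient_energy[OF S assms(1) w])
    have iP: "integrable lborel P" unfolding P_def
      by (rule integrable_compact_support[where r = 2]) (auto simp: cutoff_bounds intro!: continuous_intros wD)
    have iJ: "integrable lborel (\<lambda>x. indicator (cball 0 2) x *\<^sub>R J x)"
      using set_integrable_cball[OF J, of 0 2] unfolding set_integrable_def .
    have iU: "integrable lborel (\<lambda>x. norm (uH x)^2)" "integrable lborel (\<lambda>x. (trS m \<sigma> (uH x))^2)"
      by (rule integrable_compact_support[where r = 2];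
          auto simp: C2_vanish[OF u uz] trS_def intro!: continuous_intros C2D[OF u])+
    have iH: "integrable lborel (\<lambda>x. indicator (cball 0 1) x *\<^sub>R (norm (H x)^2))"
    proof -
      have "continuous_on UNIV (\<lambda>x. norm (H x)^2)" by (intro continuous_intros wD)
      from set_integrable_cball[OF this, of 0 1] show ?thesis unfolding set_integrable_def .
    qed
    have zp2: "norm (zp x)^2 \<le> 16 * cutoff x ^ 4" for x
    proof (cases "norm x \<le> 2")
      case True
      have "norm (zp x)^2 = 4 * (cutoff x ^ 2 * cutoff x ^ 4 * norm x ^ 2)"
        by (simp add: zp_def power_mult_distrib flip: power_mult power_add)
      also have "\<dots> \<le> 4 * (1 * cutoff x ^ 4 * 2^2)"
        using cutoff_bounds(1,2)[of x] True
        by (intro mult_left_mono mult_mono power_le_one power_mono) auto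
      finally show ?thesis by simp
    qed (simp add: zp_def cutoff_bounds)
    have zHN: "norm (zH x) \<le> N" if "norm x \<le> 2" for x
    proof -
      have "norm (zH x) \<le> 2 * cutoff x ^ 3 * norm (mat 1 :: real^'d^'d) + 3 * cutoff x ^ 2 * (norm x * norm x)"
        unfolding zH_def using cutoff_bounds(1)[of x]
        by (intro order_trans[OF norm_triangle_ineq]) (simp add: norm_outer)
      also have "\<dots> \<le> 2 * 1 * norm (mat 1 :: real^'d^'d) + 3 * 1 * (2 * 2)"
        using cutoff_bounds(1,2)[of x] that by (intro add_mono mult_mono power_le_one) auto
      finally show ?thesis by (simp add: N_def)
    qed
    have tr: "(trS m \<sigma> (uH x))^2 \<le> 3 * (1 + (real CARD('d) * \<Lambda> * N)^2) * (indicator (cball 0 2) x *\<^sub>R J x) + 192 * \<Lambda>^2 * P x" for x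
    proof (cases "norm x \<le> 2")
      case True
      have sym: "formS m \<sigma> a b = formS m \<sigma> b a" for a b by (simp add: formS_def mult.commute)
      have "trS m \<sigma> (uH x) = w x * trS m \<sigma> (zH x) + z x * trS m \<sigma> (H x) + 2 * formS m \<sigma> (zp x) (p x)"
        by (simp add: uH_def trS_linear sym[of "p x"])
      then have 0: "(trS m \<sigma> (uH x))^2 \<le> 3 * ((w x * trS m \<sigma> (zH x))^2 + (z x * trS m \<sigma> (H x))^2 + (2 * formS m \<sigma> (zp x) (p x))^2)"
        using sum3_square_le by metis
      have "\<bar>trS m \<sigma> (zH x)\<bar> \<le> real CARD('d) * \<Lambda> * N"
        using zHN[OF True] assms by (intro order_trans[OF abs_trS_le[OF S]] mult_left_mono) auto
      then have "(trS m \<sigma> (zH x))^2 \<le> (real CARD('d) * \<Lambda> * N)^2"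
        by (metis abs_ge_zero power2_abs power_mono)
      then have 1: "(w x * trS m \<sigma> (zH x))^2 \<le> (w x)^2 * (real CARD('d) * \<Lambda> * N)^2"
        unfolding power_mult_distrib by (intro mult_left_mono) auto
      have "(z x)^2 \<le> 1" using cutoff_bounds(1,2)[of x] by (auto simp: z_def intro!: power_le_one)
      then have 2: "(z x * trS m \<sigma> (H x))^2 \<le> 1 * (trS m \<sigma> (H x))^2"
        unfolding power_mult_distrib by (intro mult_right_mono) auto
      have "(formS m \<sigma> (zp x) (p x))^2 \<le> (\<Lambda> * norm (zp x)^2) * (\<Lambda> * norm (p x)^2)"
        using assms by (intro order_trans[OF formS_cauchy] mult_mono gramD[OF S]) (auto simp: formS_nonneg)
      also have "\<dots> \<le> (\<Lambda> * (16 * cutoff x ^ 4)) * (\<Lambda> * norm (p x)^2)"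
        using assms by (intro mult_right_mono mult_left_mono zp2) auto
      finally have 3: "(2 * formS m \<sigma> (zp x) (p x))^2 \<le> 64 * \<Lambda>^2 * P x"
        by (simp add: P_def power_mult_distrib power2_eq_square mult_ac)
      have "0 \<le> (trS m \<sigma> (H x))^2 * (real CARD('d) * \<Lambda> * N)^2" by simp
      moreover have "0 \<le> (w x)^2" by simp
      ultimately have "(w x)^2 * (real CARD('d) * \<Lambda> * N)^2 + 1 * (trS m \<sigma> (H x))^2 \<le> (1 + (real CARD('d) * \<Lambda> * N)^2) * J x"
        unfolding J_def by (simp add: algebra_simps)
      with 0 1 2 3 show ?thesis using True by (simp add: algebra_simps)
    next
      case False
      then have "uH x = 0" using C2_vanish[OF u uz] by simp
      then show ?thesis using False by (simp add: trS_def P_def)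
    qed
    have "(LINT x|lborel. (trS m \<sigma> (uH x))^2) \<le>
      (LINT x|lborel. 3 * (1 + (real CARD('d) * \<Lambda> * N)^2) * (indicator (cball 0 2) x *\<^sub>R J x) + 192 * \<Lambda>^2 * P x)"
      using iU iP iJ tr by (intro integral_mono) auto
    also have "\<dots> = 3 * (1 + (real CARD('d) * \<Lambda> * N)^2) * I + 192 * \<Lambda>^2 * (LINT x|lborel. P x)"
      using iP iJ by (simp add: I_def set_lebesgue_integral_def)
    also have "\<dots> \<le> 3 * (1 + (real CARD('d) * \<Lambda> * N)^2) * I + 192 * \<Lambda>^2 * (K * I)"
      by (intro add_left_mono mult_left_mono IP) auto
    finally have "(LINT x|lborel. (trS m \<sigma> (uH x))^2) \<le> L * I" by (simp add: L_def algebra_simps)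
    with energy_compact_support[where r = 2, OF u uz S assms(1)]
    have E: "(LINT x|lborel. norm (uH x)^2) \<le> L / c^2 * I"
      using assms(1) by (simp add: field_simps)
    have low: "(3/4)^8 * (indicator (cball 0 1) x *\<^sub>R (norm (H x)^2)) \<le>
        3 * norm (uH x)^2 + 3 * N^2 * (indicator (cball 0 2) x *\<^sub>R J x) + 192 * P x" for x
    proof (cases "norm x \<le> 1")
      case False
      then show ?thesis by (simp add: P_def J_def indicator_def)
    next
      case True
      have "z x *\<^sub>R H x = uH x + (- w x *\<^sub>R zH x) + (- outer (zp x) (p x) - outer (p x) (zp x))"
        by (simp add: uH_def)
      then have "norm (z x *\<^sub>R H x) \<le> norm (uH x) + \<bar>w x\<bar> * norm (zH x) + 2 * (norm (zp x) * norm (p x))"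
        by (metis (no_types) abs_minus_cancel add_mono mult_2 mult.commute norm_minus_cancel norm_outer norm_scaleR norm_triangle_ineq norm_triangle_ineq4 norm_triangle_le order_refl)
      then have "(norm (z x *\<^sub>R H x))^2 \<le> (norm (uH x) + \<bar>w x\<bar> * norm (zH x) + 2 * (norm (zp x) * norm (p x)))^2"
        by (intro power_mono) auto
      also have "\<dots> \<le> 3 * (norm (uH x)^2 + (\<bar>w x\<bar> * norm (zH x))^2 + (2 * (norm (zp x) * norm (p x)))^2)"
        by (rule sum3_square_le)
      also have "(\<bar>w x\<bar> * norm (zH x))^2 \<le> J x * N^2"
        unfolding power_mult_distrib using zHN[of x] True
        by (intro mult_mono power_mono) (auto simp: J_def)
      also have "(2 * (norm (zp x) * norm (p x)))^2 \<le> 64 * P x"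
        unfolding power_mult_distrib P_def using mult_right_mono[OF zp2[of x], of "norm (p x)^2"] by (simp add: mult_ac)
      also have "(3/4)^8 * norm (H x)^2 \<le> norm (z x *\<^sub>R H x)^2"
      proof -
        have "(3/4)^4 \<le> z x" unfolding z_def using cutoff_bounds(4)[OF True] by (intro power_mono) auto
        then have "((3/4)^4)^2 \<le> (z x)^2" by (intro power_mono) auto
        then show ?thesis by (simp add: power_mult_distrib mult_right_mono)
      qed
      finally show ?thesis using True by (simp add: algebra_simps)
    qed
    have "(3/4)^8 * (LINT x:cball 0 1|lborel. norm (H x)^2) = (LINT x|lborel. (3/4)^8 * (indicator (cball 0 1) x *\<^sub>R (norm (H x)^2)))"
      unfolding set_lebesgue_integral_def by simp
    also have "\<dots> \<le> (LINT x|lborel. 3 * norm (uH x)^2 + 3 * N^2 * (indicator (cball 0 2) x *\<^sub>R J x) + 192 * P x)"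
      using iU iP iJ iH low by (intro integral_mono) auto
    also have "\<dots> = 3 * (LINT x|lborel. norm (uH x)^2) + 3 * N^2 * I + 192 * (LINT x|lborel. P x)"
      using iU iP iJ by (simp add: I_def set_lebesgue_integral_def)
    also have "\<dots> \<le> 3 * (L / c^2 * I) + 3 * N^2 * I + 192 * (K * I)"
      by (intro add_mono mult_left_mono E IP) auto
    also have "\<dots> = (3 / c^2 * L + 3 * N^2 + 192 * K) * I" by (simp add: algebra_simps)
    also have "\<dots> = (3/4)^8 * (C * I)" unfolding C_def by simp
    finally show ?thesis by (simp add: I_def J_def)
  qed
  ultimately show ?thesis by blast
qed

section \<open>Averaging kernels adapted to a quadratic form\<close>

text \<open>The quadratic Taylor remainder stands in for second derivatives, because the square of a
  truncated function is only C^1 with Lipschitz gradient. Increments up to 2 are enough: the shifts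
  will be v/s with |v| \<le> 2 s. The lower bound \<open>I\<close> on the mass permits division by
  it, and \<open>a\<close>, \<open>L\<close>, \<open>I\<close> will be common to all matrices with
  the same ellipticity bounds.\<close>

definition kernel :: "real \<Rightarrow> real \<Rightarrow> real \<Rightarrow> (real^'d \<Rightarrow> real) \<Rightarrow> (real^'d \<Rightarrow> real^'d) \<Rightarrow> bool" where
  "kernel a L I K DK \<longleftrightarrow> C1 K DK \<and> (\<forall>y. 0 \<le> K y \<and> K y \<le> 1) \<and> (\<forall>y. norm y > a \<longrightarrow> K y = 0) \<and>
     (\<forall>y. norm (DK y) \<le> L) \<and>
     (\<forall>y v. norm v \<le> 2 \<longrightarrow> \<bar>K (y + v) - K y - DK y \<bullet> v\<bar> \<le> L * norm v ^ 2) \<and>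
     I \<le> (LINT y|lborel. K y)"

lemma kernelD:
  assumes "kernel a L I K DK"
  shows "C1 K DK" "0 \<le> K y" "K y \<le> 1" "norm y > a \<Longrightarrow> K y = 0" "norm (DK y) \<le> L"
    "norm v \<le> 2 \<Longrightarrow> \<bar>K (y + v) - K y - DK y \<bullet> v\<bar> \<le> L * norm v ^ 2"
    "I \<le> (LINT y|lborel. K y)" "norm y > a \<Longrightarrow> DK y = 0"
proof -
  show 0: "C1 K DK" "0 \<le> K y" "K y \<le> 1" "norm y > a \<Longrightarrow> K y = 0" "norm (DK y) \<le> L"
    "norm v \<le> 2 \<Longrightarrow> \<bar>K (y + v) - K y - DK y \<bullet> v\<bar> \<le> L * norm v ^ 2"
    "I \<le> (LINT y|lborel. K y)" for y v
    using assms by (auto simp: kernel_def)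
  show "norm y > a \<Longrightarrow> DK y = 0" using C1_deriv_zero[OF 0(1) 0(4)] .
qed

text \<open>\<open>T\<close> is the inverse of S. The last bound is the Cauchy-Schwarz inequality
  for the form of S, applied to |y|^2 = \<open>formS m \<sigma> (T y) y\<close>.\<close>

lemma gram_inverse:
  assumes S: "gram c \<Lambda> m \<sigma>" "0 < c"
  obtains T where "linear T" "\<And>x y. formS m \<sigma> (T x) y = x \<bullet> y" "\<And>x y. x \<bullet> T y = T x \<bullet> y"
    "\<And>y. norm (T y) \<le> norm y / c" "\<And>y. norm y ^ 2 \<le> \<Lambda> * (y \<bullet> T y)"
proof -
  define S' where "S' v = (\<Sum>j<m. (\<sigma> j \<bullet> v) *\<^sub>R \<sigma> j)" for v
  have S'dot: "S' v \<bullet> y = formS m \<sigma> v y" for v y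
    by (simp add: S'_def formS_def inner_sum_left)
  have lin: "linear S'"
    by (intro linearI) (simp_all add: S'_def inner_right_distrib scaleR_left_distrib sum.distrib scaleR_sum_right)
  have "inj S'"
  proof (rule linear_injective_0[OF lin, THEN iffD2], intro allI impI)
    fix v assume "S' v = 0"
    then have "c * norm v ^ 2 \<le> 0" using S'dot[of v v] gramD(1)[OF S(1), of v] by simp
    then show "v = 0" using S(2) by (simp add: mult_le_0_iff)
  qed
  then obtain T where T: "linear T" "\<And>x. T (S' x) = x" "\<And>x. S' (T x) = x"
    using linear_injective_isomorphism[OF lin] by blast
  have f: "formS m \<sigma> (T x) y = x \<bullet> y" for x y using S'dot[of "T x" y] T by simp
  have sym: "x \<bullet> T y = T x \<bullet> y" for x y
  proof -
    have "x \<bullet> T y = formS m \<sigma> (T x) (T y)" using f by simp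
    also have "\<dots> = formS m \<sigma> (T y) (T x)" by (simp add: formS_def mult.commute)
    also have "\<dots> = T x \<bullet> y" using f by (simp add: inner_commute)
    finally show ?thesis .
  qed
  have "norm (T y) \<le> norm y / c" for y
  proof -
    have "c * norm (T y)^2 \<le> y \<bullet> T y" using gramD(1)[OF S(1), of "T y"] f by simp
    also have "\<dots> \<le> norm y * norm (T y)" by (rule norm_cauchy_schwarz)
    finally have "norm (T y) * (c * norm (T y)) \<le> norm (T y) * norm y" by (simp add: power2_eq_square mult_ac)
    then show ?thesis using S(2) by (cases "T y = 0") (auto simp: field_simps)
  qed
  moreover have "norm y ^ 2 \<le> \<Lambda> * (y \<bullet> T y)" for y
  proof -
    have "(norm y ^ 2)^2 = (formS m \<sigma> (T y) y)^2" using f by (simp add: power2_norm_eq_inner)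
    also have "\<dots> \<le> (y \<bullet> T y) * (\<Lambda> * norm y ^ 2)"
      using f[of y "T y"] formS_nonneg[of m \<sigma> "T y"]
      by (intro order_trans[OF formS_cauchy] mult_mono gramD[OF S(1)]) (auto simp: formS_nonneg)
    finally have "norm y ^ 2 * norm y ^ 2 \<le> norm y ^ 2 * (\<Lambda> * (y \<bullet> T y))"
      by (simp add: power2_eq_square[of "norm y ^ 2"] mult_ac)
    then show ?thesis
      using mult_le_cancel_left_pos[of "norm y ^ 2" "norm y ^ 2" "\<Lambda> * (y \<bullet> T y)"] by (cases "y = 0") auto
  qed
  ultimately show ?thesis using that[OF T(1) f sym] by blast
qed

text \<open>
  With \<open>Q(y) = y \<bullet> S\<^sup>-\<^sup>1 y\<close>, where \<open>S\<close> is the matrix of the form, take \<open>\<Phi> = (1 - Q)\<^sub>+\<^sup>2\<close> and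
  \<open>\<Psi> = (1 - Q)\<^sub>+\<^sup>3\<close>.
\<close>

lemma kernels_exist:
  assumes "0 < c" "0 \<le> \<Lambda>"
  shows "\<exists>a>0. \<exists>L>0. \<exists>I>0. \<forall>m \<sigma>. gram c \<Lambda> m \<sigma> \<longrightarrow>
    (\<exists>\<Phi> D\<Phi> \<Psi> D\<Psi>. kernel a L I \<Phi> D\<Phi> \<and> kernel a L I \<Psi> (D\<Psi> :: real^'d \<Rightarrow> real^'d) \<and>
       (\<forall>y q. formS m \<sigma> (D\<Psi> y) q = - 6 * \<Phi> y * (y \<bullet> q)))"
proof -
  \<comment> \<open>The form Q dominates |y|^2/\<Lambda>, so the kernels vanish beyond radius sqrt
    \<Lambda>. Since Q \<le> |y|^2/c, one has 1 - Q \<ge> 1/2 on the ball of radius \<open>r\<close>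
    = sqrt (c/2), where both kernels are at least 1/8; this gives \<open>I\<close>. \<open>L\<close>
    adds a Lipschitz constant of the gradients on radius a + 4 to a bound for the gradients.\<close>
  define a where "a = sqrt \<Lambda> + 1"
  define L where "L = 6 * (4 * (a + 4)^2 / c^2 + 1 / c) + 6 * (a + 1) / c"
  define r where "r = sqrt (c / 2)"
  define I where "I = (1/8) * measure lborel (cball (0 :: real^'d) r)"
  have a: "0 < a" using assms by (simp add: a_def add_nonneg_pos)
  have r: "0 < r" "r^2 = c / 2" using assms by (simp_all add: r_def)
  have I: "0 < I" unfolding I_def using r content_cball_pos[of r "0::real^'d"] by simp
  have L: "0 < L" "6 * (4 * (a + 4)^2 / c^2 + 1 / c) \<le> L" "6 * (a + 1) / c \<le> L"
    using assms a by (auto simp: L_def intro!: add_pos_pos divide_pos_pos)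
  have "\<exists>\<Phi> D\<Phi> \<Psi> D\<Psi>. kernel a L I \<Phi> D\<Phi> \<and> kernel a L I \<Psi> (D\<Psi> :: real^'d \<Rightarrow> real^'d) \<and>
       (\<forall>y q. formS m \<sigma> (D\<Psi> y) q = - 6 * \<Phi> y * (y \<bullet> q))" if S: "gram c \<Lambda> m \<sigma>" for m and \<sigma> :: "nat \<Rightarrow> real^'d"
  proof -
    from gram_inverse[OF S assms(1)] obtain T where T: "linear T" "\<And>x y. formS m \<sigma> (T x) y = x \<bullet> y"
      "\<And>x y. x \<bullet> T y = T x \<bullet> y" "\<And>y. norm (T y) \<le> norm y / c" "\<And>y. norm y ^ 2 \<le> \<Lambda> * (y \<bullet> T y)" by blast
    have bT: "bounded_linear T" using T(1) by (simp add: linear_conv_bounded_linear)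
    have Tc: "continuous_on X T" for X using bT by (simp add: linear_continuous_on)
    have Tle: "norm (T y) \<le> B / c" if "norm y \<le> B" for y B
      using order_trans[OF T(4)[of y] divide_right_mono[OF that, of c]] assms(1) by simp
    have Q0: "0 \<le> y \<bullet> T y" for y using T(2)[of y "T y"] formS_nonneg[of m \<sigma> "T y"] by simp
    have Q1: "y \<bullet> T y \<le> norm y ^ 2 / c" for y
      using norm_cauchy_schwarz[of y "T y"] mult_left_mono[OF T(4)[of y], of "norm y"] by (simp add: power2_eq_square)
    define e where "e y = max 0 (1 - y \<bullet> T y)" for y
    have e: "0 \<le> e y" "e y \<le> 1" for y using Q0[of y] by (auto simp: e_def)
    have ez: "e y = 0" if "norm y > sqrt \<Lambda>" for y
    proof (rule ccontr)
      assume "e y \<noteq> 0"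
      then have "y \<bullet> T y \<le> 1" by (auto simp: e_def max_def split: if_splits)
      then have "norm y ^ 2 \<le> \<Lambda>" using order_trans[OF T(5)[of y] mult_left_mono[of "y \<bullet> T y" 1 \<Lambda>]] assms(2) by simp
      then have "norm y \<le> sqrt \<Lambda>" by (rule real_le_rsqrt)
      with that show False by simp
    qed
    have ec: "continuous_on X e" for X unfolding e_def by (intro continuous_intros Tc)
    define K where "K k y = e y ^ k" for k y
    define DK where "DK k y = (- 2 * real k * e y ^ (k - 1)) *\<^sub>R T y" for k y
    have C1: "C1 (K k) (DK k)" if "2 \<le> k" for k
      unfolding C1_def
    proof (intro conjI allI)
      fix x
      have "((\<lambda>y. 1 - y \<bullet> T y) has_derivative (\<lambda>v. - 2 * (T x \<bullet> v))) (at x)"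
        by (rule has_derivative_eq_rhs, rule has_derivative_diff[OF has_derivative_const
              has_derivative_inner[OF has_derivative_ident bounded_linear.has_derivative[OF bT has_derivative_ident]]])
           (simp add: fun_eq_iff T(3)[of x] inner_commute[of _ "T x"])
      from has_derivative_compose[OF this max_power_deriv[OF that, unfolded has_field_derivative_def]]
      show "(K k has_derivative (\<lambda>v. DK k x \<bullet> v)) (at x)"
        unfolding K_def[abs_def] DK_def e_def by (rule has_derivative_eq_rhs) (auto simp: fun_eq_iff)
    qed (unfold DK_def, intro continuous_intros ec Tc)
    have Kz: "K k y = 0" "DK k y = 0" if "norm y > sqrt \<Lambda>" "2 \<le> k" for k y
      using ez[OF that(1)] that(2) by (auto simp: K_def DK_def)
    have Lip: "norm (DK k x - DK k y) \<le> 6 * (4 * (a + 4)^2 / c^2 + 1 / c) * norm (x - y)"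
      if k: "k \<in> {2, 3}" and xy: "norm x \<le> a + 4" "norm y \<le> a + 4" for k x y
    proof -
      define b where "b = a + 4"
      have b: "0 < b" using a by (simp add: b_def)
      have "\<bar>e x - e y\<bar> \<le> \<bar>x \<bullet> T x - y \<bullet> T y\<bar>" unfolding e_def max_def by (auto simp: abs_if)
      also have "x \<bullet> T x - y \<bullet> T y = (x - y) \<bullet> T (x + y)"
        using T(3)[of y x] inner_commute[of "T y" x]
          by (simp add: linear_add[OF T(1)] inner_diff_left inner_add_right)
      also have "\<bar>\<dots>\<bar> \<le> norm (x - y) * (2 * b / c)"
      proof (intro order_trans[OF Cauchy_Schwarz_ineq2] mult_left_mono)
        have "norm (x + y) \<le> 2 * b" using xy norm_triangle_ineq[of x y] by (simp add: b_def)
        then show "norm (T (x + y)) \<le> 2 * b / c"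
          by (rule Tle)
      qed auto
      finally have e1: "\<bar>e x - e y\<bar> \<le> norm (x - y) * (2 * b / c)" .
      have e2: "\<bar>e x ^ (k - 1) - e y ^ (k - 1)\<bar> \<le> 2 * (norm (x - y) * (2 * b / c))"
      proof -
        have "\<bar>e x ^ (k - 1) - e y ^ (k - 1)\<bar> \<le> 2 * \<bar>e x - e y\<bar>"
        proof (cases "k = 2")
          case False
          then have "k = 3" using k by simp
          then have "\<bar>e x ^ (k - 1) - e y ^ (k - 1)\<bar> = \<bar>e x + e y\<bar> * \<bar>e x - e y\<bar>"
            by (simp add: abs_mult[symmetric] power2_eq_square algebra_simps)
          also have "\<dots> \<le> 2 * \<bar>e x - e y\<bar>" using e[of x] e[of y] by (intro mult_right_mono) auto
          finally show ?thesis .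
        qed simp
        from order_trans[OF this mult_left_mono[OF e1, of 2]] show ?thesis by simp
      qed
      have "DK k x - DK k y = (- 2 * real k) *\<^sub>R ((e x ^ (k-1) - e y ^ (k-1)) *\<^sub>R T x + e y ^ (k-1) *\<^sub>R T (x - y))"
        by (simp add: DK_def linear_diff[OF T(1)] algebra_simps)
      then have "norm (DK k x - DK k y) = 2 * real k * norm ((e x ^ (k-1) - e y ^ (k-1)) *\<^sub>R T x + e y ^ (k-1) *\<^sub>R T (x - y))"
        by simp
      also have "\<dots> \<le> 2 * 3 * (2 * (norm (x - y) * (2 * b / c)) * (b / c) + 1 * (norm (x - y) / c))"
      proof (intro mult_mono)
        have "norm (T x) \<le> b / c" using xy by (intro Tle) (simp add: b_def)
        moreover have "e y ^ (k-1) \<le> 1" by (intro power_le_one e)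
        ultimately show "norm ((e x ^ (k-1) - e y ^ (k-1)) *\<^sub>R T x + e y ^ (k-1) *\<^sub>R T (x - y))
            \<le> 2 * (norm (x - y) * (2 * b / c)) * (b / c) + 1 * (norm (x - y) / c)"
          using b assms(1) e by (intro order_trans[OF norm_triangle_ineq] add_mono; simp only: norm_scaleR)
            (intro mult_mono e2 T(4); simp)+
      qed (use k b assms(1) in auto)
      also have "\<dots> = 6 * (4 * b^2 / c^2 + 1 / c) * norm (x - y)"
        using assms(1) by (simp add: power2_eq_square field_simps)
      finally show ?thesis by (simp add: b_def)
    qed
    have Tay: "\<bar>K k (y + v) - K k y - DK k y \<bullet> v\<bar> \<le> L * norm v ^ 2" if k: "k \<in> {2, 3}" and v: "norm v \<le> 2" for k y v
    proof (cases "norm y \<le> a + 2")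
      case True
      have k2: "2 \<le> k" using k by auto
      from mvt_segment[OF C1D(1)[OF C1[OF k2]], of 1 y v]
      obtain t where t: "0 < t" "t < 1" "K k (y + v) - K k y = DK k (y + t *\<^sub>R v) \<bullet> v" by auto
      have tv: "norm (t *\<^sub>R v) \<le> norm v" using t by (simp add: mult_left_le_one_le)
      have "K k (y + v) - K k y - DK k y \<bullet> v = (DK k (y + t *\<^sub>R v) - DK k y) \<bullet> v"
        using t by (simp add: inner_diff_left)
      also have "\<bar>\<dots>\<bar> \<le> norm (DK k (y + t *\<^sub>R v) - DK k y) * norm v" by (rule Cauchy_Schwarz_ineq2)
      also have "norm (DK k (y + t *\<^sub>R v) - DK k y) \<le> 6 * (4 * (a + 4)^2 / c^2 + 1 / c) * norm (y + t *\<^sub>R v - y)"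
        using True v tv norm_triangle_ineq[of y "t *\<^sub>R v"] by (intro Lip k) auto
      also have "\<dots> \<le> L * norm v"
        using tv L by (intro mult_mono) auto
      finally show ?thesis by (simp add: power2_eq_square mult_right_mono mult.assoc)
    next
      case False
      have k2: "2 \<le> k" using k by auto
      have "sqrt \<Lambda> < norm y" "sqrt \<Lambda> < norm (y + v)"
        using False v norm_triangle_ineq4[of "y + v" v] by (auto simp: a_def)
      then show ?thesis using Kz[OF _ k2] L(1) by simp
    qed
    have "kernel a L I (K k) (DK k)" if k: "k \<in> {2, 3}" for k
      unfolding kernel_def
    proof (intro conjI allI impI)
      have k2: "2 \<le> k" using k by auto
      show "C1 (K k) (DK k)" by (rule C1[OF k2])
      fix y v :: "real^'d"
      show "0 \<le> K k y" "K k y \<le> 1" using e by (auto simp: K_def intro: power_le_one)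
      show "K k y = 0" if "a < norm y" using that Kz(1)[OF _ k2] by (simp add: a_def)
      show "norm (DK k y) \<le> L"
      proof (cases "norm y \<le> sqrt \<Lambda>")
        case True
        have "norm (DK k y) = 2 * real k * e y ^ (k - 1) * norm (T y)" using e by (simp add: DK_def)
        also have "\<dots> \<le> 2 * 3 * 1 * ((a + 1) / c)"
        proof (intro mult_mono power_le_one e)
          have "norm y \<le> a + 1" using True by (simp add: a_def)
          then show "norm (T y) \<le> (a + 1) / c" by (rule Tle)
        qed (use k e in auto)
        finally show ?thesis using L(3) by simp
      next
        case False
        then show ?thesis using Kz(2)[OF _ k2] L(1) by simp
      qed
      show "norm v \<le> 2 \<Longrightarrow> \<bar>K k (y + v) - K k y - DK k y \<bullet> v\<bar> \<le> L * norm v ^ 2" by (rule Tay[OF k])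
      have "(LINT y|lborel. indicator (cball (0::real^'d) r) y *\<^sub>R (1/8)) \<le> (LINT y|lborel. K k y)"
      proof (rule integral_mono)
        show "integrable lborel (\<lambda>y. indicator (cball (0::real^'d) r) y *\<^sub>R (1/8::real))"
          by (rule borel_integrable_compact) auto
        show "integrable lborel (K k)"
          by (rule integrable_compact_support[where r = "sqrt \<Lambda>"]) (use Kz k2 C1D(3)[OF C1[OF k2]] in auto)
        fix y :: "real^'d"
        show "indicator (cball 0 r) y *\<^sub>R (1/8) \<le> K k y"
        proof (cases "norm y \<le> r")
          case True
          have "norm y ^ 2 \<le> r ^ 2" using True by (intro power_mono) auto
          then have "norm y ^ 2 / c \<le> 1/2" using r assms(1) by (simp add: field_simps)
          then have "1/2 \<le> e y" using Q1[of y] unfolding e_def by linarith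
          then have "(1/2)^k \<le> K k y" unfolding K_def by (intro power_mono) auto
          then show ?thesis using k True by (auto simp: power2_eq_square power3_eq_cube)
        qed (use e in \<open>simp add: K_def\<close>)
      qed
      then show "I \<le> (LINT y|lborel. K k y)" by (simp add: I_def mult.commute)
    qed
    \<comment> \<open>The gradient of (1 - Q)^3 is -6 (1 - Q)^2 S^-1 y, and applying S leaves the
      radial field y weighted by the square kernel. This identity is the reason for pairing the
      exponents 2 and 3.\<close>
    moreover have "formS m \<sigma> (DK 3 y) q = - 6 * K 2 y * (y \<bullet> q)" for y q
      unfolding DK_def K_def formS_linear T(2) by simp
    ultimately show ?thesis
      by (intro exI[of _ "K 2"] exI[of _ "DK 2"] exI[of _ "K 3"] exI[of _ "DK 3"]) simp
  qed
  with a L(1) I show ?thesis by blast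
qed

text \<open>Passage to the gauge integral over a box, to which the theorems on continuity in a
  parameter and on differentiation under the integral sign are applied below.\<close>

lemma lborel_integral_eq_cbox:
  fixes f :: "'a::euclidean_space \<Rightarrow> real"
  assumes "continuous_on UNIV f" "\<And>x. norm x > r \<Longrightarrow> f x = 0" "cball 0 r \<subseteq> cbox l u"
  shows "(LINT y|lborel. f y) = integral (cbox l u) f"
proof -
  have "(LINT y|lborel. f y) = integral UNIV f"
    using integral_lborel[OF integrable_compact_support[where r = r, OF assms(1) assms(2)]] by simp
  also have "\<dots> = integral (cbox l u) f"
  proof -
    have "f x = 0" if "x \<notin> cbox l u" for x
      using assms(2)[of x] assms(3) that by (force simp: not_le)
    then have "(\<lambda>x. if x \<in> cbox l u then f x else 0) = f" by auto
    then show ?thesis using integral_restrict_UNIV[of "cbox l u" f] by simp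
  qed
  finally show ?thesis .
qed

lemma cball_subset_cbox:
  obtains l u :: "'a::euclidean_space" where "cball 0 r \<subseteq> cbox l u"
  using bounded_subset_cbox_symmetric[OF bounded_cball] by metis

text \<open>Not normalised: at s = 0 the value is the mass of \<open>K\<close> times
  \<open>f x\<close>.\<close>

definition avg :: "(real^'d \<Rightarrow> real) \<Rightarrow> (real^'d \<Rightarrow> real) \<Rightarrow> real \<Rightarrow> real^'d \<Rightarrow> real" where
  "avg K f s x = (LINT y|lborel. K y * f (x + s *\<^sub>R y))"

lemma continuous_rescale:
  assumes "continuous_on UNIV f"
  shows "continuous_on X (\<lambda>y::'a::real_normed_vector. f (x + s *\<^sub>R y))"
  by (rule continuous_on_compose2[OF assms]) (rule continuous_intros | simp)+

lemma C2_rescale: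
  assumes "C2 w p H"
  shows "C2 (\<lambda>y. w (x + s *\<^sub>R y)) (\<lambda>y. s *\<^sub>R p (x + s *\<^sub>R y)) (\<lambda>y. s^2 *\<^sub>R H (x + s *\<^sub>R y))"
  unfolding C2_def
proof (intro conjI allI)
  have d: "((\<lambda>y. x + s *\<^sub>R y) has_derivative (\<lambda>v. s *\<^sub>R v)) (at y)" for y
    by (auto intro!: derivative_eq_intros)
  show "((\<lambda>y. w (x + s *\<^sub>R y)) has_derivative (\<lambda>v. (s *\<^sub>R p (x + s *\<^sub>R y)) \<bullet> v)) (at y)" for y
    by (rule has_derivative_eq_rhs[OF has_derivative_compose[OF d C2D(1)[OF assms]]]) auto
  show "((\<lambda>y. s *\<^sub>R p (x + s *\<^sub>R y)) has_derivative (\<lambda>v. (s^2 *\<^sub>R H (x + s *\<^sub>R y)) *v v)) (at y)" for y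
    by (rule has_derivative_eq_rhs[OF has_derivative_scaleR_right[OF has_derivative_compose[OF d C2D(2)[OF assms]]]])
       (auto simp: fun_eq_iff power2_eq_square matrix_vector_mult_scaleR scaleR_matrix_vector_assoc[symmetric])
  show "continuous_on UNIV (\<lambda>y. s^2 *\<^sub>R H (x + s *\<^sub>R y))"
    by (intro continuous_intros continuous_rescale C2D[OF assms])
qed

text \<open>The inner product with \<open>b\<close> lets one statement cover a scalar kernel, with b
  = 1, and the components of the gradient of a kernel.\<close>

lemma continuous_on_avg:
  fixes K :: "real^'d \<Rightarrow> 'b::euclidean_space"
  assumes "continuous_on UNIV K" "\<And>y. norm y > a \<Longrightarrow> K y = 0" "continuous_on UNIV f"
  shows "continuous_on X (\<lambda>s. LINT y|lborel. (K y \<bullet> b) * f (x + s *\<^sub>R y))"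
proof -
  obtain l u :: "real^'d" where lu: "cball 0 a \<subseteq> cbox l u" by (rule cball_subset_cbox)
  have "(LINT y|lborel. (K y \<bullet> b) * f (x + s *\<^sub>R y)) = integral (cbox l u) (\<lambda>y. (K y \<bullet> b) * f (x + s *\<^sub>R y))" for s
    by (rule lborel_integral_eq_cbox[OF _ _ lu])
       (use assms in \<open>auto intro!: continuous_intros continuous_rescale\<close>)
  moreover have "continuous_on X (\<lambda>s. integral (cbox l u) (\<lambda>y. (K y \<bullet> b) * f (x + s *\<^sub>R y)))"
  proof (rule integral_continuous_on_param)
    have "continuous_on (X \<times> cbox l u) (\<lambda>z. (K (snd z) \<bullet> b) * f (x + fst z *\<^sub>R snd z))"
      by (intro continuous_intros continuous_on_compose2[OF assms(1)] continuous_on_compose2[OF assms(3)]) auto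
    then show "continuous_on (X \<times> cbox l u) (\<lambda>(s, y). (K y \<bullet> b) * f (x + s *\<^sub>R y))"
      by (simp add: case_prod_unfold)
  qed
  ultimately show ?thesis by simp
qed

text \<open>Differentiation in s produces the integral of \<Phi>(y) y against Dw(x + s y). The field
  \<Phi>(y) y equals -1/6 of S applied to the gradient of \<Psi>, so one integration by parts moves
  that gradient onto Dw and leaves the Hessian contracted with S; the factor s comes from the chain
  rule.\<close>

lemma avg_deriv:
  assumes w: "C2 w p H" and \<Phi>: "kernel a L I \<Phi> D\<Phi>" and \<Psi>: "kernel a L I \<Psi> D\<Psi>"
    and S: "\<And>y q. formS m \<sigma> (D\<Psi> y) q = - 6 * \<Phi> y * (y \<bullet> q)"
  shows "((\<lambda>s. avg \<Phi> w s x) has_real_derivative s / 6 * avg \<Psi> (\<lambda>x. trS m \<sigma> (H x)) s x) (at s)"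
proof -
  note wD = C2D[OF w]
  note k = kernelD[OF \<Phi>] kernelD[OF \<Psi>]
  note kc = C1D(2,3)[OF k(1)] C1D(2,3)[OF k(9)]
  obtain l u :: "real^'a" where lu: "cball 0 a \<subseteq> cbox l u" by (rule cball_subset_cbox)
  let ?F = "\<lambda>s y. \<Phi> y * w (x + s *\<^sub>R y)"
  let ?D = "\<lambda>s y. \<Phi> y * (p (x + s *\<^sub>R y) \<bullet> y)"
  have c1: "continuous_on UNIV (?F s)" "continuous_on UNIV (?D s)" for s
    by (intro continuous_intros continuous_rescale wD kc)+
  have "((\<lambda>s. integral (cbox l u) (?F s)) has_field_derivative integral (cbox l u) (?D s)) (at s within UNIV)"
  proof (rule leibniz_rule_field_derivative)
    fix s y
    have "((\<lambda>s. x + s *\<^sub>R y) has_derivative (\<lambda>t. t *\<^sub>R y)) (at s)" by (auto intro!: derivative_eq_intros)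
    from has_derivative_compose[OF this wD(1)]
    have "((\<lambda>s. w (x + s *\<^sub>R y)) has_derivative (\<lambda>t. p (x + s *\<^sub>R y) \<bullet> (t *\<^sub>R y))) (at s)" .
    then have "((\<lambda>s. w (x + s *\<^sub>R y)) has_real_derivative p (x + s *\<^sub>R y) \<bullet> y) (at s)"
      unfolding has_field_derivative_def by (rule has_derivative_eq_rhs) (auto simp: fun_eq_iff)
    then show "((\<lambda>s. ?F s y) has_real_derivative ?D s y) (at s within UNIV)"
      by (rule DERIV_cmult)
    show "?F s integrable_on cbox l u"
      by (intro integrable_continuous continuous_on_subset[OF c1(1)]) auto
    have "continuous_on (UNIV \<times> cbox l u) (\<lambda>z. \<Phi> (snd z) * (p (x + fst z *\<^sub>R snd z) \<bullet> snd z))"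
      by (intro continuous_intros continuous_on_compose2[OF kc(2)] continuous_on_compose2[OF wD(4)]) auto
    then show "continuous_on (UNIV \<times> cbox l u) (\<lambda>(s, y). ?D s y)"
      by (simp add: case_prod_unfold)
  qed auto
  moreover have "integral (cbox l u) (?F s) = avg \<Phi> w s x" for s unfolding avg_def
    by (rule lborel_integral_eq_cbox[symmetric, OF c1(1) _ lu]) (use k in auto)
  moreover have "integral (cbox l u) (?D s) = (LINT y|lborel. ?D s y)"
    by (rule lborel_integral_eq_cbox[symmetric, OF c1(2) _ lu]) (use k in auto)
  moreover have "(LINT y|lborel. ?D s y) = s / 6 * avg \<Psi> (\<lambda>x. trS m \<sigma> (H x)) s x"
  proof -
    let ?q = "\<lambda>y. p (x + s *\<^sub>R y)"
    let ?G = "\<lambda>j y. (?q y \<bullet> \<sigma> j) *\<^sub>R D\<Psi> y + \<Psi> y *\<^sub>R (s *\<^sub>R (H (x + s *\<^sub>R y) *v \<sigma> j))"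
    have q: "C1 (\<lambda>y. ?q y \<bullet> \<sigma> j) (\<lambda>y. s *\<^sub>R (H (x + s *\<^sub>R y) *v \<sigma> j))" for j
      unfolding C1_def
    proof (intro conjI allI)
      fix y
      have "((\<lambda>y. x + s *\<^sub>R y) has_derivative (\<lambda>v. s *\<^sub>R v)) (at y)" by (auto intro!: derivative_eq_intros)
      from has_derivative_compose[OF this C1D(1)[OF C2_C1(2)[OF w]]]
      show "((\<lambda>y. ?q y \<bullet> \<sigma> j) has_derivative (\<lambda>v. (s *\<^sub>R (H (x + s *\<^sub>R y) *v \<sigma> j)) \<bullet> v)) (at y)"
        by (rule has_derivative_eq_rhs) (auto simp: fun_eq_iff)
    qed (intro continuous_intros continuous_rescale wD)
    have C: "C1 (\<lambda>y. \<Psi> y * (?q y \<bullet> \<sigma> j)) (?G j)" for j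
      by (rule C1_mult[OF k(9) q])
    have "(LINT y|lborel. ?G j y \<bullet> \<sigma> j) = 0" for j
      by (rule integral_deriv_eq_0[OF C, of a]) (use k in auto)
    moreover have "integrable lborel (\<lambda>y. ?G j y \<bullet> \<sigma> j)" for j
      by (rule integrable_compact_support[where r = a])
         (use k in \<open>auto intro!: continuous_intros continuous_rescale wD kc\<close>)
    ultimately have 0: "(LINT y|lborel. (\<Sum>j<m. ?G j y \<bullet> \<sigma> j)) = 0" by simp
    have "(\<Sum>j<m. ?G j y \<bullet> \<sigma> j) = formS m \<sigma> (D\<Psi> y) (?q y) + s * (\<Psi> y * trS m \<sigma> (H (x + s *\<^sub>R y)))" for y
      by (simp add: trS_def formS_def sum_distrib_left sum.distrib[symmetric]
          inner_left_distrib inner_commute[of _ "\<sigma> _"] algebra_simps)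
    then have 1: "(\<Sum>j<m. ?G j y \<bullet> \<sigma> j) = - 6 * ?D s y + s * (\<Psi> y * trS m \<sigma> (H (x + s *\<^sub>R y)))" for y
      by (simp add: S inner_commute)
    have i1: "integrable lborel (?D s)"
      by (rule integrable_compact_support[where r = a]) (use k c1 in auto)
    have i2: "integrable lborel (\<lambda>y. \<Psi> y * trS m \<sigma> (H (x + s *\<^sub>R y)))"
      by (rule integrable_compact_support[where r = a])
         (use k in \<open>auto intro!: continuous_intros continuous_rescale wD kc\<close>)
    have "(LINT y|lborel. - 6 * ?D s y + s * (\<Psi> y * trS m \<sigma> (H (x + s *\<^sub>R y)))) = 0"
      using 0 unfolding 1 .
    then have "- 6 * (LINT y|lborel. ?D s y) + s * avg \<Psi> (\<lambda>x. trS m \<sigma> (H x)) s x = 0"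
      using i1 i2 unfolding avg_def by (subst (asm) Bochner_Integration.integral_add) auto
    then show ?thesis by simp
  qed
  ultimately show ?thesis by simp
qed

text \<open>It plays the role of a Green representation: the value at \<open>x\<close> is recovered
  from one average of \<open>w\<close> and from averages of the leading part over all smaller
  scales. A change of \<open>x\<close> can afterwards be moved onto the smooth kernels, so no
  modulus of continuity of the leading part enters.\<close>

lemma avg_representation:
  assumes w: "C2 w p H" and \<Phi>: "kernel a L I \<Phi> D\<Phi>" and \<Psi>: "kernel a L I \<Psi> D\<Psi>"
    and S: "\<And>y q. formS m \<sigma> (D\<Psi> y) q = - 6 * \<Phi> y * (y \<bullet> q)" and R: "0 \<le> R"
  shows "((\<lambda>s. s / 6 * avg \<Psi> (\<lambda>x. trS m \<sigma> (H x)) s x) has_integral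
     (avg \<Phi> w R x - (LINT y|lborel. \<Phi> y) * w x)) {0..R}"
proof -
  have "((\<lambda>s. avg \<Phi> w s x) has_vector_derivative s / 6 * avg \<Psi> (\<lambda>x. trS m \<sigma> (H x)) s x) (at s within {0..R})" for s
    unfolding has_real_derivative_iff_has_vector_derivative[symmetric]
    by (rule has_field_derivative_at_within[OF avg_deriv[OF w \<Phi> \<Psi> S]])
  then have "((\<lambda>s. s / 6 * avg \<Psi> (\<lambda>x. trS m \<sigma> (H x)) s x) has_integral (avg \<Phi> w R x - avg \<Phi> w 0 x)) {0..R}"
    by (intro fundamental_theorem_of_calculus R)
  then show ?thesis by (simp add: avg_def)
qed

lemma avg_shift:
  assumes "continuous_on UNIV K" "continuous_on UNIV f" "s \<noteq> 0"
  shows "avg K f s (x + v) = (LINT y|lborel. K (y - (1 / s) *\<^sub>R v) * f (x + s *\<^sub>R y))"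
proof -
  have "continuous_on UNIV (\<lambda>y. K (y - (1 / s) *\<^sub>R v) * f (x + s *\<^sub>R y))"
    by (intro continuous_intros continuous_rescale continuous_shift' assms)
  from integral_translate[OF this, of "(1 / s) *\<^sub>R v"] show ?thesis
    using assms(3) by (simp add: avg_def algebra_simps)
qed

section \<open>Affine approximation in terms of averages of the leading part\<close>

lemma kernel_integral_bound:
  fixes k f :: "'a::euclidean_space \<Rightarrow> real"
  assumes "continuous_on UNIV k" "\<And>y. \<bar>k y\<bar> \<le> M" "\<And>y. norm y > r \<Longrightarrow> k y = 0" "continuous_on UNIV f"
    and B: "(LINT y:cball 0 r|lborel. (f (x + s *\<^sub>R y))\<^sup>2) \<le> B\<^sup>2" "0 < B"
  shows "\<bar>LINT y|lborel. k y * f (x + s *\<^sub>R y)\<bar> \<le> M * ((measure lborel (cball (0::'a) r) + 1) * B)"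
proof -
  let ?V = "measure lborel (cball (0::'a) r)"
  have M: "0 \<le> M" using assms(2)[of 0] by linarith
  have fc: "continuous_on UNIV (\<lambda>y. f (x + s *\<^sub>R y))" by (rule continuous_rescale[OF assms(4)])
  have i1: "integrable lborel (\<lambda>y. indicator (cball 0 r) y *\<^sub>R (f (x + s *\<^sub>R y))\<^sup>2)"
    using set_integrable_cball[OF continuous_on_power[OF fc], of 0 r 2] unfolding set_integrable_def .
  have i2: "integrable lborel (\<lambda>y. indicator (cball (0::'a) r) y *\<^sub>R (1::real))"
    by (rule borel_integrable_compact) auto
  have i3: "integrable lborel (\<lambda>y. k y * f (x + s *\<^sub>R y))"
    by (rule integrable_compact_support[where r = r]) (use assms fc in \<open>auto intro!: continuous_intros\<close>)
  have "\<bar>LINT y|lborel. k y * f (x + s *\<^sub>R y)\<bar> \<le> (LINT y|lborel. \<bar>k y * f (x + s *\<^sub>R y)\<bar>)"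
    by (rule integral_abs_bound)
  also have "\<dots> \<le> (LINT y|lborel. M * (B * (indicator (cball 0 r) y *\<^sub>R (1::real))
      + (indicator (cball 0 r) y *\<^sub>R (f (x + s *\<^sub>R y))\<^sup>2) / B))"
  proof (rule integral_mono)
    show "integrable lborel (\<lambda>y. M * (B * (indicator (cball 0 r) y *\<^sub>R (1::real))
      + (indicator (cball 0 r) y *\<^sub>R (f (x + s *\<^sub>R y))\<^sup>2) / B))"
      using i1 i2 by (intro integrable_mult_right Bochner_Integration.integrable_add integrable_divide)
    fix y
    show "\<bar>k y * f (x + s *\<^sub>R y)\<bar> \<le> M * (B * (indicator (cball 0 r) y *\<^sub>R (1::real))
      + (indicator (cball 0 r) y *\<^sub>R (f (x + s *\<^sub>R y))\<^sup>2) / B)"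
    proof (cases "norm y \<le> r")
      case True
      \<comment> \<open>Takes the place of the Cauchy-Schwarz inequality. Integrated over the ball
        it gives B times the volume plus one, from the bound on the mean square alone.\<close>
      have "\<bar>t\<bar> \<le> B + t\<^sup>2 / B" for t
      proof (cases "\<bar>t\<bar> \<le> B")
        case True then show ?thesis using B(2) by (simp add: add_increasing2)
      next
        case False
        then have "B * \<bar>t\<bar> \<le> \<bar>t\<bar> * \<bar>t\<bar>" by (intro mult_right_mono) auto
        then have "\<bar>t\<bar> \<le> t\<^sup>2 / B" using B(2) by (simp add: field_simps power2_eq_square)
        then show ?thesis using B(2) by linarith
      qed
      then show ?thesis using True assms(2)[of y] M by (auto simp: abs_mult intro!: mult_mono)
    next
      case False
      then show ?thesis using assms(3)[of y] by simp
    qed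
  qed (use i3 in auto)
  also have "\<dots> = M * (B * ?V + (LINT y:cball 0 r|lborel. (f (x + s *\<^sub>R y))\<^sup>2) / B)"
    using i1 i2 unfolding set_lebesgue_integral_def by simp
  also have "\<dots> \<le> M * (B * ?V + B\<^sup>2 / B)"
    using B M by (intro mult_left_mono add_left_mono divide_right_mono) auto
  also have "\<dots> = M * ((?V + 1) * B)" using B(2) by (simp add: power2_eq_square algebra_simps)
  finally show ?thesis .
qed

lemma linear_functional_repr:
  assumes "linear (Q :: real^'d \<Rightarrow> real)"
  obtains q where "\<And>e. Q e = q \<bullet> e"
proof
  fix e
  have "Q e = Q (\<Sum>i\<in>UNIV. (e $ i) *\<^sub>R axis i 1)"
    by (simp add: basis_expansion scalar_mult_eq_scaleR[symmetric])
  also have "\<dots> = (\<Sum>i\<in>UNIV. e $ i * Q (axis i 1))"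
    by (simp add: linear_sum[OF assms] linear_cmul[OF assms])
  also have "\<dots> = (\<chi> i. Q (axis i 1)) \<bullet> e" by (simp add: inner_vec_def mult.commute)
  finally show "Q e = (\<chi> i. Q (axis i 1)) \<bullet> e" .
qed

lemma integral_inverse_sqrt:
  assumes "0 < h" "h \<le> (1::real)"
  shows "((\<lambda>s. 1 / sqrt s) has_integral (2 - 2 * sqrt h)) {h..1}"
    "((\<lambda>s. 1 / (s * sqrt s)) has_integral (2 / sqrt h - 2)) {h..1}"
proof -
  have "((\<lambda>s. 1 / sqrt s) has_integral (2 * sqrt 1 - 2 * sqrt h)) {h..1}"
  proof (rule fundamental_theorem_of_calculus[OF assms(2)])
    fix s assume "s \<in> {h..1}"
    then have "0 < s" using assms by auto
    then have "((\<lambda>s. 2 * sqrt s) has_real_derivative 1 / sqrt s) (at s)"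
      by (auto intro!: derivative_eq_intros simp: field_simps)
    then show "((\<lambda>s. 2 * sqrt s) has_vector_derivative 1 / sqrt s) (at s within {h..1})"
      unfolding has_real_derivative_iff_has_vector_derivative[symmetric] by (rule has_field_derivative_at_within)
  qed
  then show "((\<lambda>s. 1 / sqrt s) has_integral (2 - 2 * sqrt h)) {h..1}" by simp
  have "((\<lambda>s. 1 / (s * sqrt s)) has_integral (- 2 / sqrt 1 - (- 2 / sqrt h))) {h..1}"
  proof (rule fundamental_theorem_of_calculus[OF assms(2)])
    fix s assume "s \<in> {h..1}"
    then have "0 < s" using assms by auto
    then have "((\<lambda>s. - 2 / sqrt s) has_real_derivative 1 / (s * sqrt s)) (at s)"
      by (auto intro!: derivative_eq_intros simp: field_simps power2_eq_square)
    then show "((\<lambda>s. - 2 / sqrt s) has_vector_derivative 1 / (s * sqrt s)) (at s within {h..1})"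
      unfolding has_real_derivative_iff_has_vector_derivative[symmetric] by (rule has_field_derivative_at_within)
  qed
  then show "((\<lambda>s. 1 / (s * sqrt s)) has_integral (2 / sqrt h - 2)) {h..1}" by simp
qed

lemma kernel_linear:
  fixes D :: "real^'d \<Rightarrow> real^'d"
  assumes "continuous_on UNIV D" "\<And>y. norm y > a \<Longrightarrow> D y = 0" "continuous_on UNIV f"
  shows "linear (\<lambda>e. LINT y|lborel. (D y \<bullet> e) * f (x + s *\<^sub>R y))"
proof -
  have i: "integrable lborel (\<lambda>y. (D y \<bullet> e) * f (x + s *\<^sub>R y))" for e
    by (rule integrable_compact_support[where r = a])
       (use assms in \<open>auto intro!: continuous_intros continuous_rescale\<close>)
  show ?thesis
    by (rule linearI) (use i in \<open>simp_all add: inner_add_right distrib_right mult.assoc\<close>)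
qed

text \<open>A shift of the centre by \<open>v\<close> equals a shift of the kernel by v/s, which has
  norm at most 2. The Taylor expansion thus falls on the kernel, and \<open>f\<close> is seen only
  through its mean square on radius a + 2, the support enlarged by the shift.\<close>

lemma kernel_taylor_integral:
  fixes K :: "real^'d \<Rightarrow> real"
  assumes K: "kernel a L I K DK" and f: "continuous_on UNIV f" and s: "0 < s" "norm v \<le> 2 * s"
    and B: "(LINT y:cball 0 (a + 2)|lborel. (f (x + s *\<^sub>R y))\<^sup>2) \<le> B\<^sup>2" "0 < B"
  shows "\<bar>avg K f s (x + v) - avg K f s x + (1 / s) * (LINT y|lborel. (DK y \<bullet> v) * f (x + s *\<^sub>R y))\<bar>
     \<le> L * norm v ^ 2 / s\<^sup>2 * ((measure lborel (cball (0::real^'d) (a + 2)) + 1) * B)"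
proof -
  note k = kernelD[OF K]
  note kc = C1D(2,3)[OF k(1)]
  define u where "u = (1 / s) *\<^sub>R v"
  have u: "norm u \<le> 2" using s by (simp add: u_def field_simps)
  define d where "d y = K (y - u) - K y + DK y \<bullet> u" for y
  have dc: "continuous_on UNIV d" unfolding d_def
    by (intro continuous_intros continuous_shift' kc)
  have d1: "\<bar>d y\<bar> \<le> L * norm u ^ 2" for y using k(6)[of "- u" y] u by (simp add: d_def)
  have d2: "d y = 0" if "norm y > a + 2" for y
  proof -
    have "norm (y - u) > a" using norm_triangle_ineq2[of y u] u that by linarith
    then show ?thesis using that by (simp add: d_def k)
  qed
  have sup: "norm y > a + 2 \<Longrightarrow> K (y - u) = 0" for y
    using norm_triangle_ineq2[of y u] u by (intro k(4)) linarith
  have i1: "integrable lborel (\<lambda>y. K (y - u) * f (x + s *\<^sub>R y))"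
    by (rule integrable_compact_support[where r = "a + 2"])
       (use sup f in \<open>auto intro!: continuous_intros continuous_rescale continuous_shift' kc\<close>)
  have i2: "integrable lborel (\<lambda>y. K y * f (x + s *\<^sub>R y))"
    by (rule integrable_compact_support[where r = "a"])
       (use k f in \<open>auto intro!: continuous_intros continuous_rescale kc\<close>)
  have i3: "integrable lborel (\<lambda>y. (DK y \<bullet> u) * f (x + s *\<^sub>R y))"
    by (rule integrable_compact_support[where r = "a"])
       (use k f in \<open>auto intro!: continuous_intros continuous_rescale kc\<close>)
  have "avg K f s (x + v) - avg K f s x + (LINT y|lborel. (DK y \<bullet> u) * f (x + s *\<^sub>R y)) = (LINT y|lborel. d y * f (x + s *\<^sub>R y))"
    using i1 i2 i3 s by (subst avg_shift[OF kc(2) f]) (simp_all add: avg_def d_def u_def[symmetric] left_diff_distrib distrib_right)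
  moreover have "(LINT y|lborel. (DK y \<bullet> u) * f (x + s *\<^sub>R y)) = (1 / s) * (LINT y|lborel. (DK y \<bullet> v) * f (x + s *\<^sub>R y))"
    by (simp add: u_def)
  moreover have "\<bar>LINT y|lborel. d y * f (x + s *\<^sub>R y)\<bar>
     \<le> L * norm u ^ 2 * ((measure lborel (cball (0::real^'d) (a + 2)) + 1) * B)"
    by (rule kernel_integral_bound[where r = "a + 2", OF dc d1 d2 f B])
  moreover have "L * norm u ^ 2 = L * norm v ^ 2 / s\<^sup>2" using s by (simp add: u_def power_divide)
  ultimately show ?thesis by simp
qed

text \<open>The representation is split at scale h. Scales below h contribute the integral of s
  s^(-1/2), of order h^(3/2). On scales above h the kernels are expanded to first order in v with
  remainder s (h/s)^2 s^(-1/2), whose integral is again of order h^(3/2). The zeroth and first order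
  parts of these larger scales form the affine function, which therefore depends on h.\<close>

lemma affine_approx_kernel:
  fixes w :: "real^'d \<Rightarrow> real"
  assumes \<Phi>: "kernel a L I \<Phi> D\<Phi>" and \<Psi>: "kernel a L I \<Psi> D\<Psi>" and S: "\<And>y q. formS m \<sigma> (D\<Psi> y) q = - 6 * \<Phi> y * (y \<bullet> q)"
    and pos: "0 < a" "0 < L" "0 < I" and w: "C2 w p H" and W: "\<And>x. \<bar>w x\<bar> \<le> W" and G: "0 < G"
    and Mor: "\<And>x s. norm (x - x0) \<le> 2 \<Longrightarrow> 0 < s \<Longrightarrow> s \<le> 1 \<Longrightarrow>
      (LINT y:cball 0 (a + 2)|lborel. (trS m \<sigma> (H (x + s *\<^sub>R y)))\<^sup>2) \<le> G\<^sup>2 / s"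
    and h: "0 < h" "h \<le> 1"
    and V: "V = measure lborel (cball (0::real^'d) (a + 2)) + 1"
    and C: "C = (4 * L * V\<^sup>2 + V + 4 * L * V) / I"
  shows "\<exists>\<beta> q. norm q \<le> C * (W + G) \<and> (\<forall>v. norm v \<le> 2 * h \<longrightarrow> \<bar>w (x0 + v) - \<beta> - q \<bullet> v\<bar> \<le> C * (h * sqrt h) * (W + G))"
proof -
  note wD = C2D[OF w]
  note k = kernelD[OF \<Phi>] kernelD[OF \<Psi>]
  note kc = C1D(2,3)[OF k(1)] C1D(2,3)[OF k(9)]
  define g where "g x = trS m \<sigma> (H x)" for x
  have gc: "continuous_on UNIV g" unfolding g_def by (intro continuous_intros wD)
  have V1: "1 \<le> V" using V by simp
  have W0: "0 \<le> W" using W[of 0] by linarith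
  define I\<Phi> where "I\<Phi> = (LINT y|lborel. \<Phi> y)"
  have I\<Phi>: "I \<le> I\<Phi>" using k(7) by (simp add: I\<Phi>_def)
  have MG: "(LINT y:cball 0 (a + 2)|lborel. (g (x + s *\<^sub>R y))\<^sup>2) \<le> (G / sqrt s)\<^sup>2" "0 < G / sqrt s"
    if "norm (x - x0) \<le> 2" "0 < s" "s \<le> 1" for x s
    using Mor[OF that] that G by (auto simp: g_def power_divide)
  have MW: "(LINT y:cball 0 (a + 2)|lborel. (w (x0 + 1 *\<^sub>R y))\<^sup>2) \<le> ((W + G) * V)\<^sup>2" "0 < (W + G) * V"
  proof -
    have "(LINT y:cball 0 (a + 2)|lborel. (w (x0 + 1 *\<^sub>R y))\<^sup>2) \<le> (LINT y:cball (0::real^'d) (a + 2)|lborel. W\<^sup>2)"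
    proof (rule set_integral_mono)
      show "set_integrable lborel (cball 0 (a + 2)) (\<lambda>y. (w (x0 + 1 *\<^sub>R y))\<^sup>2)"
        by (intro set_integrable_cball continuous_intros continuous_rescale wD)
      show "set_integrable lborel (cball (0::real^'d) (a + 2)) (\<lambda>y. W\<^sup>2)"
        by (intro set_integrable_cball continuous_intros)
      show "(w (x0 + 1 *\<^sub>R y))\<^sup>2 \<le> W\<^sup>2" for y
        using power_mono[OF W[of "x0 + 1 *\<^sub>R y"], of 2] by simp
    qed
    also have "\<dots> = (V - 1) * W\<^sup>2" using V by (simp add: set_lebesgue_integral_def)
    also have "\<dots> \<le> V\<^sup>2 * (W + G)\<^sup>2"
    proof (intro mult_mono power_mono)
      show "V - 1 \<le> V\<^sup>2" using self_le_power[of V 2] V1 by linarith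
    qed (use W0 G V1 in auto)
    finally show "(LINT y:cball 0 (a + 2)|lborel. (w (x0 + 1 *\<^sub>R y))\<^sup>2) \<le> ((W + G) * V)\<^sup>2"
      by (simp add: power_mult_distrib mult.commute)
    show "0 < (W + G) * V" using W0 G V1 by simp
  qed
  define D1 where "D1 e = (LINT y|lborel. (D\<Phi> y \<bullet> e) * w (x0 + 1 *\<^sub>R y))" for e
  define D2 where "D2 s e = (LINT y|lborel. (D\<Psi> y \<bullet> e) * g (x0 + s *\<^sub>R y))" for s e
  have lin1: "linear D1" unfolding D1_def by (rule kernel_linear[where a = a, OF kc(1) k(8) wD(5)])
  have lin2: "linear (D2 s)" for s unfolding D2_def by (rule kernel_linear[where a = a, OF kc(3) k(16) gc])
  have cD2: "continuous_on X (\<lambda>s. D2 s e)" for X e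
    unfolding D2_def by (rule continuous_on_avg[where a = a, OF kc(3) k(16) gc])
  have iD2: "(\<lambda>s. D2 s e) integrable_on {h..1}" for e
    by (intro integrable_continuous_real cD2)
  \<comment> \<open>First-order coefficient in v of the part above scale h: \<open>D1\<close> comes
    from the average of \<open>w\<close> at scale 1, \<open>D2\<close> from the averages of the
    leading part at scale s, where the weight s/6 cancels the 1/s of the rescaled shift.\<close>
  define Q where "Q e = (- D1 e + (1/6) * integral {h..1} (\<lambda>s. D2 s e)) / I\<Phi>" for e
  have "linear Q"
    by (rule linearI)
      (use iD2 in \<open>simp_all add: Q_def linear_add[OF lin1] linear_add[OF lin2] linear_cmul[OF lin1] linear_cmul[OF lin2]
        Henstock_Kurzweil_Integration.integral_add algebra_simps add_divide_distrib diff_divide_distrib\<close>)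
  then obtain q where q: "\<And>e. Q e = q \<bullet> e" by (rule linear_functional_repr) blast
  have bD1: "\<bar>D1 e\<bar> \<le> L * norm e * (V * ((W + G) * V))" for e
    unfolding D1_def V
  proof (rule kernel_integral_bound[OF _ _ _ wD(5)])
    show "continuous_on UNIV (\<lambda>y. D\<Phi> y \<bullet> e)" by (intro continuous_intros kc)
    show "\<bar>D\<Phi> y \<bullet> e\<bar> \<le> L * norm e" for y
      using order_trans[OF Cauchy_Schwarz_ineq2[of "D\<Phi> y" e] mult_right_mono[OF k(5)[of y], of "norm e"]] by simp
    show "D\<Phi> y \<bullet> e = 0" if "norm y > a + 2" for y using k(8)[of y] that by simp
  qed (use MW V in auto)
  have bD2: "\<bar>D2 s e\<bar> \<le> L * norm e * (V * (G / sqrt s))" if "0 < s" "s \<le> 1" for s e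
    unfolding D2_def V
  proof (rule kernel_integral_bound[OF _ _ _ gc])
    show "continuous_on UNIV (\<lambda>y. D\<Psi> y \<bullet> e)" by (intro continuous_intros kc)
    show "\<bar>D\<Psi> y \<bullet> e\<bar> \<le> L * norm e" for y
      using order_trans[OF Cauchy_Schwarz_ineq2[of "D\<Psi> y" e] mult_right_mono[OF k(13)[of y], of "norm e"]] by simp
    show "D\<Psi> y \<bullet> e = 0" if "norm y > a + 2" for y using k(16)[of y] that by simp
  qed (use MG[of x0 s] that in auto)
  define B where "B s v = avg \<Psi> g s (x0 + v)" for s v
  have cB: "continuous_on X (\<lambda>s. B s v)" for X v
  proof -
    have "continuous_on X (\<lambda>s. LINT y|lborel. (\<Psi> y \<bullet> 1) * g ((x0 + v) + s *\<^sub>R y))"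
      by (rule continuous_on_avg[where a = a, OF kc(4) k(12) gc])
    then show ?thesis by (simp add: B_def avg_def)
  qed
  define \<beta> where "\<beta> = (avg \<Phi> w 1 x0 - integral {h..1} (\<lambda>s. s / 6 * B s 0)) / I\<Phi>"
  have I\<Phi>0: "0 < I\<Phi>" using I\<Phi> pos by linarith
  have sh: "0 < sqrt h" "sqrt h \<le> 1" "h * h \<le> h * sqrt h" "sqrt h * sqrt h = h"
  proof -
    show "0 < sqrt h" "sqrt h \<le> 1" "sqrt h * sqrt h = h" using h by auto
    have "h \<le> sqrt h" using h by (simp add: real_le_rsqrt power2_eq_square mult_left_le_one_le)
    then show "h * h \<le> h * sqrt h" using h by (intro mult_left_mono) auto
  qed
  have main: "\<bar>w (x0 + v) - \<beta> - q \<bullet> v\<bar> \<le> C * (h * sqrt h) * (W + G)" if v: "norm v \<le> 2 * h" for v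
  proof -
    have rep: "((\<lambda>s. s / 6 * B s v) has_integral (avg \<Phi> w 1 (x0 + v) - I\<Phi> * w (x0 + v))) {0..1}"
      using avg_representation[OF w \<Phi> \<Psi> S, of 1 "x0 + v"] by (simp add: B_def g_def[abs_def] I\<Phi>_def)
    have io: "(\<lambda>s. s / 6 * B s v) integrable_on {x..y}" for x y v
      by (intro integrable_continuous_real continuous_intros cB) auto
    have split: "I\<Phi> * w (x0 + v) = avg \<Phi> w 1 (x0 + v) - integral {0..h} (\<lambda>s. s / 6 * B s v) - integral {h..1} (\<lambda>s. s / 6 * B s v)"
      using Henstock_Kurzweil_Integration.integral_combine[of 0 h 1 "\<lambda>s. s / 6 * B s v"] h io integral_unique[OF rep] by simp
    have e1: "I\<Phi> * \<beta> = avg \<Phi> w 1 x0 - integral {h..1} (\<lambda>s. s / 6 * B s 0)"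
      using I\<Phi>0 by (simp add: \<beta>_def)
    have e2: "I\<Phi> * (q \<bullet> v) = - D1 v + (1/6) * integral {h..1} (\<lambda>s. D2 s v)"
      using I\<Phi>0 by (simp add: q[symmetric] Q_def)
    have "I\<Phi> * (w (x0 + v) - \<beta> - q \<bullet> v) = (avg \<Phi> w 1 (x0 + v) - avg \<Phi> w 1 x0 + 1 / 1 * D1 v)
       - integral {0..h} (\<lambda>s. s / 6 * B s v)
       - (integral {h..1} (\<lambda>s. s / 6 * B s v) - integral {h..1} (\<lambda>s. s / 6 * B s 0) + (1/6) * integral {h..1} (\<lambda>s. D2 s v))"
      unfolding right_diff_distrib split e1 e2 by simp
    also have "integral {h..1} (\<lambda>s. s / 6 * B s v) - integral {h..1} (\<lambda>s. s / 6 * B s 0) + (1/6) * integral {h..1} (\<lambda>s. D2 s v)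
       = integral {h..1} (\<lambda>s. s / 6 * B s v - s / 6 * B s 0 + (1/6) * D2 s v)"
      using io iD2 by (simp add: Henstock_Kurzweil_Integration.integral_add Henstock_Kurzweil_Integration.integral_diff
          integrable_diff integrable_on_cmult_left)
    finally have eq: "I\<Phi> * (w (x0 + v) - \<beta> - q \<bullet> v) = (avg \<Phi> w 1 (x0 + v) - avg \<Phi> w 1 x0 + 1 / 1 * D1 v)
       - integral {0..h} (\<lambda>s. s / 6 * B s v) - integral {h..1} (\<lambda>s. s / 6 * B s v - s / 6 * B s 0 + (1/6) * D2 s v)" .
    have vh: "norm v ^ 2 \<le> 4 * (h * h)" using power_mono[OF v norm_ge_zero, of 2] by (simp add: power2_eq_square)
    have vh': "norm v ^ 2 \<le> 4 * (h * sqrt h)" using vh sh by linarith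
    have t1: "\<bar>avg \<Phi> w 1 (x0 + v) - avg \<Phi> w 1 x0 + 1 / 1 * D1 v\<bar> \<le> 4 * (h * sqrt h) * (L * (V * ((W + G) * V)))"
    proof -
      have "\<bar>avg \<Phi> w 1 (x0 + v) - avg \<Phi> w 1 x0 + 1 / 1 * D1 v\<bar> \<le> L * norm v ^ 2 / 1\<^sup>2 * (V * ((W + G) * V))"
        unfolding D1_def V using v h MW V by (intro kernel_taylor_integral[OF \<Phi> wD(5)]) auto
      also have "\<dots> \<le> L * (4 * (h * sqrt h)) * (V * ((W + G) * V))"
        using vh' pos V1 W0 G h sh by (intro mult_mono) auto
      finally show ?thesis by (simp add: mult_ac)
    qed
    have t2: "\<bar>integral {0..h} (\<lambda>s. s / 6 * B s v)\<bar> \<le> h * sqrt h * (V * G)"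
    proof -
      have "norm (integral {0..h} (\<lambda>s. s / 6 * B s v)) \<le> integral {0..h} (\<lambda>s. sqrt h * (V * G))"
      proof (rule integral_norm_bound_integral[OF io])
        fix s assume s: "s \<in> {0..h}"
        show "norm (s / 6 * B s v) \<le> sqrt h * (V * G)"
        proof (cases "s = 0")
          case False
          then have s: "0 < s" "s \<le> h" "s \<le> 1" using s h by auto
          have "\<bar>B s v\<bar> \<le> 1 * (V * (G / sqrt s))"
            unfolding B_def avg_def V
            by (rule kernel_integral_bound[OF kc(4) _ _ gc])
               (use k(10,11) k(12) MG[of "x0 + v" s] s v h in \<open>auto simp: abs_le_iff intro: order_trans[of _ 0]\<close>)
          then have "s / 6 * \<bar>B s v\<bar> \<le> s / 6 * (V * (G / sqrt s))" using s by (intro mult_left_mono) auto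
          also have "\<dots> = (s / sqrt s) / 6 * (V * G)" by simp
          also have "s / sqrt s = sqrt s" using s by (simp add: real_div_sqrt)
          also have "sqrt s / 6 * (V * G) \<le> sqrt h * (V * G)"
          proof (rule mult_right_mono)
            have "0 \<le> sqrt s" "sqrt s \<le> sqrt h" using s by auto
            then show "sqrt s / 6 \<le> sqrt h" by linarith
          qed (use V1 G in auto)
          finally show ?thesis using s by (simp add: abs_mult)
        qed (use h V1 G in auto)
      qed auto
      then show ?thesis using h by (simp add: mult_ac)
    qed
    have t3: "\<bar>integral {h..1} (\<lambda>s. s / 6 * B s v - s / 6 * B s 0 + (1/6) * D2 s v)\<bar> \<le> 4 * (h * sqrt h) * (L * (V * G))"
    proof -
      let ?c = "4 * (h * h) * (L * (V * G)) / 6"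
      have "norm (integral {h..1} (\<lambda>s. s / 6 * B s v - s / 6 * B s 0 + (1/6) * D2 s v)) \<le> integral {h..1} (\<lambda>s. ?c * (1 / (s * sqrt s)))"
      proof (rule integral_norm_bound_integral)
        show "(\<lambda>s. s / 6 * B s v - s / 6 * B s 0 + (1/6) * D2 s v) integrable_on {h..1}"
          by (intro integrable_continuous_real continuous_intros cB cD2) auto
        show "(\<lambda>s. ?c * (1 / (s * sqrt s))) integrable_on {h..1}"
          by (rule has_integral_integrable[OF has_integral_mult_right[OF integral_inverse_sqrt(2)[OF h]]])
        fix s assume "s \<in> {h..1}"
        then have s: "h \<le> s" "s \<le> 1" "0 < s" using h by auto
        have "\<bar>avg \<Psi> g s (x0 + v) - avg \<Psi> g s x0 + (1 / s) * D2 s v\<bar> \<le> L * norm v ^ 2 / s\<^sup>2 * (V * (G / sqrt s))"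
          unfolding D2_def V by (rule kernel_taylor_integral[OF \<Psi> gc s(3)]) (use v s MG[of x0 s] in auto)
        also have "\<dots> \<le> L * (4 * (h * h)) / s\<^sup>2 * (V * (G / sqrt s))"
          using vh pos V1 G s by (intro mult_right_mono divide_right_mono mult_left_mono) auto
        finally have "s / 6 * \<bar>B s v - B s 0 + (1 / s) * D2 s v\<bar> \<le> s / 6 * (L * (4 * (h * h)) / s\<^sup>2 * (V * (G / sqrt s)))"
          using s by (intro mult_left_mono) (auto simp: B_def)
        also have "\<dots> = ?c * (1 / (s * sqrt s))" using s by (simp add: power2_eq_square)
        also have "s / 6 * \<bar>B s v - B s 0 + (1 / s) * D2 s v\<bar> = \<bar>s / 6 * (B s v - B s 0 + (1 / s) * D2 s v)\<bar>"
          using s by (simp add: abs_mult)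
        also have "s / 6 * (B s v - B s 0 + (1 / s) * D2 s v) = s / 6 * B s v - s / 6 * B s 0 + (1/6) * D2 s v"
          using s by (simp add: algebra_simps)
        finally show "norm (s / 6 * B s v - s / 6 * B s 0 + (1/6) * D2 s v) \<le> ?c * (1 / (s * sqrt s))" by simp
      qed
      also have "\<dots> = ?c * (2 / sqrt h - 2)"
        by (rule integral_unique[OF has_integral_mult_right[OF integral_inverse_sqrt(2)[OF h]]])
      also have "\<dots> \<le> ?c * (2 / sqrt h)" using h pos V1 G by (intro mult_left_mono) auto
      also have "\<dots> = (h * (h / sqrt h)) * (L * (V * G)) * (8 / 6)" by (simp add: mult_ac)
      also have "h / sqrt h = sqrt h" using h by (simp add: real_div_sqrt)
      also have "(h * sqrt h) * (L * (V * G)) * (8 / 6) \<le> (h * sqrt h) * (L * (V * G)) * 4"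
        using h pos V1 G by (intro mult_left_mono) auto
      finally show ?thesis by (simp add: mult_ac)
    qed
    have "I * \<bar>w (x0 + v) - \<beta> - q \<bullet> v\<bar> \<le> \<bar>I\<Phi> * (w (x0 + v) - \<beta> - q \<bullet> v)\<bar>"
      using I\<Phi> I\<Phi>0 by (simp add: abs_mult mult_right_mono)
    also have "\<dots> \<le> 4 * (h * sqrt h) * (L * (V * ((W + G) * V))) + h * sqrt h * (V * G) + 4 * (h * sqrt h) * (L * (V * G))"
      unfolding eq using t1 t2 t3 by linarith
    also have "\<dots> \<le> 4 * (h * sqrt h) * (L * (V * ((W + G) * V))) + h * sqrt h * (V * (W + G)) + 4 * (h * sqrt h) * (L * (V * (W + G)))"
      using h pos V1 W0 G by (intro add_mono mult_left_mono) auto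
    also have "\<dots> = I * (C * (h * sqrt h) * (W + G))"
      using pos unfolding C by (simp add: power2_eq_square field_simps)
    finally show ?thesis using pos by simp
  qed
  \<comment> \<open>The slope stays bounded as h tends to 0 because s^(-1/2) is integrable at
    zero.\<close>
  have qb: "norm q \<le> C * (W + G)"
  proof -
    have b: "\<bar>Q e\<bar> \<le> C * (W + G) * norm e" for e
    proof -
      have "norm (integral {h..1} (\<lambda>s. D2 s e)) \<le> integral {h..1} (\<lambda>s. L * norm e * (V * G) * (1 / sqrt s))"
      proof (rule integral_norm_bound_integral[OF iD2])
        show "(\<lambda>s. L * norm e * (V * G) * (1 / sqrt s)) integrable_on {h..1}"
          by (rule has_integral_integrable[OF has_integral_mult_right[OF integral_inverse_sqrt(1)[OF h]]])
      qed (use bD2 h in auto)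
      also have "\<dots> = L * norm e * (V * G) * (2 - 2 * sqrt h)"
        by (rule integral_unique[OF has_integral_mult_right[OF integral_inverse_sqrt(1)[OF h]]])
      also have "\<dots> \<le> L * norm e * (V * (W + G)) * 2"
        using h pos V1 G W0 by (intro mult_mono) auto
      finally have 2: "\<bar>integral {h..1} (\<lambda>s. D2 s e)\<bar> \<le> L * norm e * (V * (W + G)) * 2" by simp
      have "I * \<bar>Q e\<bar> \<le> \<bar>I\<Phi> * Q e\<bar>"
        using I\<Phi> I\<Phi>0 by (simp add: abs_mult mult_right_mono)
      also have "I\<Phi> * Q e = - D1 e + (1/6) * integral {h..1} (\<lambda>s. D2 s e)" using I\<Phi>0 by (simp add: Q_def)
      also have "\<bar>\<dots>\<bar> \<le> L * norm e * (V * ((W + G) * V)) + L * norm e * (V * (W + G))"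
        using bD1[of e] 2 by linarith
      also have "\<dots> \<le> I * (C * (W + G) * norm e)"
      proof -
        have "0 \<le> L * norm e * (V * ((W + G) * V))" "0 \<le> L * norm e * (V * (W + G))" "0 \<le> norm e * (V * (W + G))"
          using pos V1 G W0 by auto
        moreover have "I * (C * (W + G) * norm e) = 4 * (L * norm e * (V * ((W + G) * V))) + norm e * (V * (W + G)) + 4 * (L * norm e * (V * (W + G)))"
          using pos unfolding C by (simp add: power2_eq_square field_simps)
        ultimately show ?thesis by linarith
      qed
      finally show ?thesis using pos by simp
    qed
    show ?thesis
    proof (cases "q = 0")
      case False
      have "norm q * norm q \<le> C * (W + G) * norm q" using b[of q] q[of q] by (simp add: dot_square_norm power2_eq_square)
      then show ?thesis using False by simp
    next
      case True
      have "0 < C" unfolding C using pos V1 by (intro divide_pos_pos add_pos_pos mult_pos_pos) auto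
      then show ?thesis using True W0 G by simp
    qed
  qed
  show ?thesis using main qb by blast
qed

lemma affine_approx:
  assumes "0 < c" "0 \<le> \<Lambda>"
  shows "\<exists>a>0. \<exists>C>0. \<forall>m \<sigma> w p (H :: real^'d \<Rightarrow> real^'d^'d) x0 W G h.
    gram c \<Lambda> m \<sigma> \<and> C2 w p H \<and> (\<forall>x. \<bar>w x\<bar> \<le> W) \<and> 0 < G \<and> 0 < h \<and> h \<le> 1 \<and>
    (\<forall>x s. norm (x - x0) \<le> 2 \<longrightarrow> 0 < s \<longrightarrow> s \<le> 1 \<longrightarrow>
      (LINT y:cball 0 (a + 2)|lborel. (trS m \<sigma> (H (x + s *\<^sub>R y)))\<^sup>2) \<le> G\<^sup>2 / s) \<longrightarrow>
    (\<exists>\<beta> q. norm q \<le> C * (W + G) \<and> (\<forall>v. norm v \<le> 2 * h \<longrightarrow> \<bar>w (x0 + v) - \<beta> - q \<bullet> v\<bar> \<le> C * (h * sqrt h) * (W + G)))"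
proof -
  from kernels_exist[OF assms, where 'd = 'd] obtain a L I where pos: "0 < a" "0 < L" "0 < I" and
    ker: "\<forall>m \<sigma>. gram c \<Lambda> m \<sigma> \<longrightarrow> (\<exists>\<Phi> D\<Phi> \<Psi> D\<Psi>. kernel a L I \<Phi> D\<Phi> \<and> kernel a L I \<Psi> (D\<Psi> :: real^'d \<Rightarrow> real^'d) \<and>
       (\<forall>y q. formS m \<sigma> (D\<Psi> y) q = - 6 * \<Phi> y * (y \<bullet> q)))"
    by (elim exE conjE) (rule that)
  define V where "V = measure lborel (cball (0::real^'d) (a + 2)) + 1"
  define C where "C = (4 * L * V\<^sup>2 + V + 4 * L * V) / I"
  have "1 \<le> V" by (simp add: V_def)
  then have Cp: "0 < C" unfolding C_def using pos by (intro divide_pos_pos add_pos_pos mult_pos_pos) auto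
  have main: "\<exists>\<beta> q. norm q \<le> C * (W + G) \<and> (\<forall>v. norm v \<le> 2 * h \<longrightarrow> \<bar>w (x0 + v) - \<beta> - q \<bullet> v\<bar> \<le> C * (h * sqrt h) * (W + G))"
    if *: "gram c \<Lambda> m \<sigma> \<and> C2 w p H \<and> (\<forall>x. \<bar>w x\<bar> \<le> W) \<and> 0 < G \<and> 0 < h \<and> h \<le> 1 \<and>
    (\<forall>x s. norm (x - x0) \<le> 2 \<longrightarrow> 0 < s \<longrightarrow> s \<le> 1 \<longrightarrow>
      (LINT y:cball 0 (a + 2)|lborel. (trS m \<sigma> (H (x + s *\<^sub>R y)))\<^sup>2) \<le> G\<^sup>2 / s)"
    for m \<sigma> w p W G h and H :: "real^'d \<Rightarrow> real^'d^'d" and x0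
  proof -
    have g: "gram c \<Lambda> m \<sigma>" and rest: "C2 w p H" "\<And>x. \<bar>w x\<bar> \<le> W" "0 < G" "0 < h" "h \<le> 1"
      "\<And>x s. norm (x - x0) \<le> 2 \<Longrightarrow> 0 < s \<Longrightarrow> s \<le> 1 \<Longrightarrow>
      (LINT y:cball 0 (a + 2)|lborel. (trS m \<sigma> (H (x + s *\<^sub>R y)))\<^sup>2) \<le> G\<^sup>2 / s"
      using * by simp_all
    from ker[rule_format, OF g] obtain \<Phi> D\<Phi> \<Psi> and D\<Psi> :: "real^'d \<Rightarrow> real^'d" where
      K: "kernel a L I \<Phi> D\<Phi>" "kernel a L I \<Psi> D\<Psi>" "\<forall>y q. formS m \<sigma> (D\<Psi> y) q = - 6 * \<Phi> y * (y \<bullet> q)" by blast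
    show ?thesis
    proof (rule affine_approx_kernel[where w = w and p = p and H = H and W = W and G = G and h = h and ?x0.0 = x0
          and m = m and \<sigma> = \<sigma>, OF K(1) K(2) _ pos _ _ _ _ _ _ V_def C_def])
      show "formS m \<sigma> (D\<Psi> y) q = - 6 * \<Phi> y * (y \<bullet> q)" for y q using K(3) by blast
      show "C2 w p H" by (rule rest)
      show "\<bar>w x\<bar> \<le> W" for x by (rule rest)
      show "0 < G" by (rule rest)
      show "(LINT y:cball 0 (a + 2)|lborel. (trS m \<sigma> (H (x + s *\<^sub>R y)))\<^sup>2) \<le> G\<^sup>2 / s"
        if "norm (x - x0) \<le> 2" "0 < s" "s \<le> 1" for x s by (rule rest(6)[OF that])
      show "0 < h" "h \<le> 1" by (rule rest)+
    qed
  qed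
  show ?thesis
    by (rule exI[of _ a], rule conjI[OF pos(1)], rule exI[of _ C], rule conjI[OF Cp], intro allI impI, rule main)
qed

section \<open>Morrey bounds for second derivatives\<close>

lemma integrable_cball_rescale:
  fixes F :: "'a::euclidean_space \<Rightarrow> real"
  assumes "continuous_on UNIV F"
  shows "set_integrable lborel (cball a r) (\<lambda>y. F (x + h *\<^sub>R y))"
  by (intro set_integrable_cball continuous_rescale assms)

lemma set_integral_cball_mono:
  fixes F G :: "'a::euclidean_space \<Rightarrow> real"
  assumes "continuous_on UNIV F" "continuous_on UNIV G" "\<And>y. y \<in> cball a r \<Longrightarrow> F y \<le> G y"
  shows "(LINT y:cball a r|lborel. F y) \<le> (LINT y:cball a r|lborel. G y)"
  by (intro set_integral_mono set_integrable_cball assms)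

lemma set_integral_cball_shift:
  fixes F :: "'a::euclidean_space \<Rightarrow> real"
  assumes "continuous_on UNIV F"
  shows "(LINT y:cball z r|lborel. F y) = (LINT y:cball 0 r|lborel. F (z + y))"
proof -
  have "F \<in> borel_measurable borel" using assms by (rule borel_measurable_continuous_onI)
  then have m: "(\<lambda>y. indicator (cball z r) y *\<^sub>R F y) \<in> borel_measurable borel"
    by (intro borel_measurable_scaleR borel_measurable_indicator) auto
  have "(LINT y|lborel. indicator (cball z r) y *\<^sub>R F y) =
      (LINT y|distr lborel borel ((+) z). indicator (cball z r) y *\<^sub>R F y)" by (simp only: lborel_distr_plus)
  also have "\<dots> = (LINT y|lborel. indicator (cball z r) (z + y) *\<^sub>R F (z + y))"
    using m by (intro integral_distr) auto
  also have "\<dots> = (LINT y|lborel. indicator (cball 0 r) y *\<^sub>R F (z + y))"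
    by (intro Bochner_Integration.integral_cong) (auto simp: indicator_def dist_norm)
  finally show ?thesis by (simp add: set_lebesgue_integral_def)
qed

text \<open>The ball of radius r is covered by finitely many unit balls, and each of them is
  translated to the origin. The covering is made in the rescaled variable, so \<open>N\<close> does
  not depend on the scale h.\<close>

lemma cball_doubling:
  "\<exists>N\<ge>1. \<forall>(F :: 'a::euclidean_space \<Rightarrow> real) B h. continuous_on UNIV F \<and> (\<forall>x. 0 \<le> F x) \<and>
     (\<forall>x. (LINT y:cball 0 1|lborel. F (x + h *\<^sub>R y)) \<le> B) \<longrightarrow>
     (\<forall>x. (LINT y:cball 0 r|lborel. F (x + h *\<^sub>R y)) \<le> N * B)"
proof -
  have "\<forall>e>0. \<exists>k. finite k \<and> cball (0::'a) r \<subseteq> (\<Union>x\<in>k. ball x e)"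
    using compact_cball[of "0::'a" r] unfolding compact_eq_totally_bounded by blast
  from this[rule_format, of 1] obtain Z where Z: "finite Z" "cball (0::'a) r \<subseteq> (\<Union>z\<in>Z. ball z 1)" by auto
  have main: "(LINT y:cball 0 r|lborel. F (x + h *\<^sub>R y)) \<le> (1 + real (card Z)) * B"
    if F: "continuous_on UNIV F" "\<And>x. 0 \<le> F x" and B: "\<And>x. (LINT y:cball 0 1|lborel. F (x + h *\<^sub>R y)) \<le> B"
    for F :: "'a \<Rightarrow> real" and B h x
  proof -
    have i: "integrable lborel (\<lambda>y. indicator (cball z s) y *\<^sub>R F (x + h *\<^sub>R y))" for z s
      using integrable_cball_rescale[OF F(1), of z s x h] unfolding set_integrable_def .
    have Fc: "continuous_on UNIV (\<lambda>y. F (x + h *\<^sub>R y))" by (rule continuous_rescale[OF F(1)])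
    have "(LINT y|lborel. indicator (cball 0 r) y *\<^sub>R F (x + h *\<^sub>R y)) \<le>
        (LINT y|lborel. (\<Sum>z\<in>Z. indicator (cball z 1) y *\<^sub>R F (x + h *\<^sub>R y)))"
    proof (rule integral_mono[OF i])
      show "integrable lborel (\<lambda>y. \<Sum>z\<in>Z. indicator (cball z 1) y *\<^sub>R F (x + h *\<^sub>R y))" using i by simp
      fix y
      show "indicator (cball 0 r) y *\<^sub>R F (x + h *\<^sub>R y) \<le> (\<Sum>z\<in>Z. indicator (cball z 1) y *\<^sub>R F (x + h *\<^sub>R y))"
      proof (cases "y \<in> cball 0 r")
        case True
        then obtain z where z: "z \<in> Z" "y \<in> ball z 1" using Z(2) by blast
        then have "indicator (cball 0 r) y *\<^sub>R F (x + h *\<^sub>R y) = indicator (cball z 1) y *\<^sub>R F (x + h *\<^sub>R y)"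
          using True by simp
        also have "\<dots> \<le> (\<Sum>z\<in>Z. indicator (cball z 1) y *\<^sub>R F (x + h *\<^sub>R y))"
          by (rule member_le_sum[OF z(1)]) (use F(2) Z(1) in auto)
        finally show ?thesis .
      qed (use F(2) in \<open>auto intro!: sum_nonneg\<close>)
    qed
    also have "\<dots> = (\<Sum>z\<in>Z. LINT y:cball z 1|lborel. F (x + h *\<^sub>R y))"
      using i by (simp add: set_lebesgue_integral_def)
    also have "\<dots> = (\<Sum>z\<in>Z. LINT y:cball 0 1|lborel. F ((x + h *\<^sub>R z) + h *\<^sub>R y))"
      by (intro sum.cong refl) (simp add: set_integral_cball_shift[OF Fc] scaleR_add_right add.assoc)
    also have "\<dots> \<le> (\<Sum>z\<in>Z. B)" by (intro sum_mono B)
    also have "\<dots> \<le> (1 + real (card Z)) * B"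
    proof -
      have "0 \<le> (LINT y:cball 0 1|lborel. F (x + h *\<^sub>R y))"
        unfolding set_lebesgue_integral_def using F(2) by (intro integral_nonneg_AE) auto
      with B[of x] show ?thesis by (simp add: distrib_right)
    qed
    finally show ?thesis by (simp add: set_lebesgue_integral_def)
  qed
  show ?thesis
    by (rule exI[of _ "1 + real (card Z)"]) (use main in auto)
qed

text \<open>Without the rescaling this reads: the integral of f^2 over the ball of radius h is at
  most B^2 h^(d-1) for all h \<le> 1. It is the local Morrey space L^(2,d-1), in the form of a bound
  that can be weakened, scaled and added.\<close>

definition morrey :: "(real^'d \<Rightarrow> real) \<Rightarrow> real \<Rightarrow> bool" where
  "morrey f B \<longleftrightarrow> (\<forall>x h. 0 < h \<longrightarrow> h \<le> 1 \<longrightarrow> (LINT y:cball 0 1|lborel. (f (x + h *\<^sub>R y))\<^sup>2) \<le> B\<^sup>2 / h)"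

lemma morreyD:
  assumes "morrey f B" "0 < h" "h \<le> 1"
  shows "(LINT y:cball 0 1|lborel. (f (x + h *\<^sub>R y))\<^sup>2) \<le> B\<^sup>2 / h"
  using assms by (simp add: morrey_def)

lemma morrey_weaken:
  assumes "morrey f B" "0 \<le> B" "B \<le> B'"
  shows "morrey f B'"
  unfolding morrey_def
proof (intro allI impI)
  fix x :: "real^'a" and h :: real assume h: "0 < h" "h \<le> 1"
  show "(LINT y:cball 0 1|lborel. (f (x + h *\<^sub>R y))\<^sup>2) \<le> B'\<^sup>2 / h"
    using h by (intro order_trans[OF morreyD[OF assms(1) h]] divide_right_mono power_mono assms) auto
qed

lemma morrey_scale:
  assumes "morrey f B" shows "morrey (\<lambda>x. t * f x) (t * B)"
  unfolding morrey_def
proof (intro allI impI)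
  fix x :: "real^'a" and h :: real assume h: "0 < h" "h \<le> 1"
  have "(LINT y:cball 0 1|lborel. (t * f (x + h *\<^sub>R y))\<^sup>2) = t\<^sup>2 * (LINT y:cball 0 1|lborel. (f (x + h *\<^sub>R y))\<^sup>2)"
    by (simp add: power_mult_distrib)
  also have "\<dots> \<le> t\<^sup>2 * (B\<^sup>2 / h)" by (intro mult_left_mono morreyD[OF assms h]) auto
  finally show "(LINT y:cball 0 1|lborel. (t * f (x + h *\<^sub>R y))\<^sup>2) \<le> (t * B)\<^sup>2 / h" by (simp add: power_mult_distrib)
qed

lemma morrey_bounded:
  fixes f :: "real^'d \<Rightarrow> real"
  assumes f: "continuous_on UNIV f" and B: "\<And>x. \<bar>f x\<bar> \<le> B"
  shows "morrey f ((measure lborel (cball (0::real^'d) 1) + 1) * B)" (is "morrey f ((?V + 1) * B)")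
  unfolding morrey_def
proof (intro allI impI)
  fix x :: "real^'d" and h :: real assume h: "0 < h" "h \<le> 1"
  have "(LINT y:cball 0 1|lborel. (f (x + h *\<^sub>R y))\<^sup>2) \<le> (LINT y:cball (0::real^'d) 1|lborel. B\<^sup>2)"
  proof (rule set_integral_cball_mono)
    show "(f (x + h *\<^sub>R y))\<^sup>2 \<le> B\<^sup>2" for y
      using power_mono[OF B[of "x + h *\<^sub>R y"] abs_ge_zero, of 2] by simp
  qed (intro continuous_intros continuous_rescale f)+
  also have "\<dots> = ?V * B\<^sup>2" by (simp add: set_lebesgue_integral_def)
  also have "\<dots> \<le> (?V + 1)\<^sup>2 * B\<^sup>2"
    by (intro mult_right_mono) (auto simp: power2_eq_square algebra_simps)
  also have "\<dots> \<le> (?V + 1)\<^sup>2 * B\<^sup>2 / h" using h by (simp add: field_simps mult_left_le_one_le)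
  finally show "(LINT y:cball 0 1|lborel. (f (x + h *\<^sub>R y))\<^sup>2) \<le> ((?V + 1) * B)\<^sup>2 / h"
    by (simp add: power_mult_distrib)
qed

lemma morrey_add3:
  assumes f: "morrey f A" "continuous_on UNIV f" and g: "morrey g B" "continuous_on UNIV g"
    and k: "morrey k C" "continuous_on UNIV k" and pos: "0 \<le> A" "0 \<le> B" "0 \<le> C"
  shows "morrey (\<lambda>x. f x + g x + k x) (2 * (A + B + C))"
  unfolding morrey_def
proof (intro allI impI)
  fix x :: "real^'a" and h :: real assume h: "0 < h" "h \<le> 1"
  have sq: "set_integrable lborel (cball 0 1) (\<lambda>y. (u (x + h *\<^sub>R y))\<^sup>2)" if "continuous_on UNIV u" for u :: "real^'a \<Rightarrow> real"
    by (intro set_integrable_cball continuous_intros continuous_rescale that)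
  have "(LINT y:cball 0 1|lborel. (f (x + h *\<^sub>R y) + g (x + h *\<^sub>R y) + k (x + h *\<^sub>R y))\<^sup>2) \<le>
      (LINT y:cball 0 1|lborel. 3 * ((f (x + h *\<^sub>R y))\<^sup>2 + (g (x + h *\<^sub>R y))\<^sup>2 + (k (x + h *\<^sub>R y))\<^sup>2))"
    by (rule set_integral_cball_mono) (intro sum3_square_le continuous_intros continuous_rescale f g k)+
  also have "\<dots> = 3 * ((LINT y:cball 0 1|lborel. (f (x + h *\<^sub>R y))\<^sup>2) + (LINT y:cball 0 1|lborel. (g (x + h *\<^sub>R y))\<^sup>2)
      + (LINT y:cball 0 1|lborel. (k (x + h *\<^sub>R y))\<^sup>2))"
    using sq[OF f(2)] sq[OF g(2)] sq[OF k(2)] by (simp add: set_integral_add)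
  also have "\<dots> \<le> 3 * (A\<^sup>2 / h + B\<^sup>2 / h + C\<^sup>2 / h)"
    by (intro mult_left_mono add_mono morreyD h f g k) auto
  also have "\<dots> = 3 * (A\<^sup>2 + B\<^sup>2 + C\<^sup>2) / h" using h by (simp add: field_simps)
  also have "\<dots> \<le> (2 * (A + B + C))\<^sup>2 / h"
  proof (intro divide_right_mono)
    have "0 \<le> A * B" "0 \<le> A * C" "0 \<le> B * C" "0 \<le> A\<^sup>2" "0 \<le> B\<^sup>2" "0 \<le> C\<^sup>2" using pos by auto
    then show "3 * (A\<^sup>2 + B\<^sup>2 + C\<^sup>2) \<le> (2 * (A + B + C))\<^sup>2"
      by (simp add: power2_eq_square algebra_simps)
  qed (use h in auto)
  finally show "(LINT y:cball 0 1|lborel. (f (x + h *\<^sub>R y) + g (x + h *\<^sub>R y) + k (x + h *\<^sub>R y))\<^sup>2) \<le> (2 * (A + B + C))\<^sup>2 / h" .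
qed

lemma C2_diff_affine:
  assumes "C2 w p H"
  shows "C2 (\<lambda>y. w y - \<beta> - q \<bullet> y) (\<lambda>y. p y - q) H"
  unfolding C2_def
proof (intro conjI allI)
  show "((\<lambda>y. w y - \<beta> - q \<bullet> y) has_derivative (\<lambda>v. (p x - q) \<bullet> v)) (at x)" for x
    by (rule has_derivative_eq_rhs, rule has_derivative_diff[OF has_derivative_diff[OF C2D(1)[OF assms] has_derivative_const]
          has_derivative_inner_right[OF has_derivative_ident]])
       (simp add: fun_eq_iff inner_diff_left)
  show "((\<lambda>y. p y - q) has_derivative (\<lambda>v. H x *v v)) (at x)" for x
    by (rule has_derivative_eq_rhs, rule has_derivative_diff[OF C2D(2)[OF assms] has_derivative_const]) simp
qed (rule C2D[OF assms])

lemma gradient_bound_from_increments: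
  assumes "(w has_derivative (\<lambda>v. p \<bullet> v)) (at x)"
    and "\<And>v. norm v \<le> 1 \<Longrightarrow> \<bar>w (x + v) - w x\<bar> \<le> K * norm v" and "0 \<le> K"
  shows "norm p \<le> K"
proof (cases "p = 0")
  case False
  define u where "u = p /\<^sub>R norm p"
  have u: "norm u = 1" "p \<bullet> u = norm p" using False by (auto simp: u_def dot_square_norm power2_eq_square)
  have "((\<lambda>t. x + t *\<^sub>R u) has_derivative (\<lambda>t. t *\<^sub>R u)) (at 0)" by (auto intro!: derivative_eq_intros)
  from has_derivative_compose[OF this, of w "\<lambda>v. p \<bullet> v"] assms(1)
  have "((\<lambda>t. w (x + t *\<^sub>R u)) has_derivative (\<lambda>t. p \<bullet> (t *\<^sub>R u))) (at 0)" by simp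
  then have "((\<lambda>t. w (x + t *\<^sub>R u)) has_real_derivative norm p) (at 0)"
    unfolding has_field_derivative_def by (rule has_derivative_eq_rhs) (simp add: fun_eq_iff u mult.commute)
  then have "((\<lambda>t. (w (x + (0 + t) *\<^sub>R u) - w (x + 0 *\<^sub>R u)) / t) \<longlongrightarrow> norm p) (at 0)"
    by (simp add: DERIV_def)
  then have "((\<lambda>t. (w (x + t *\<^sub>R u) - w x) / t) \<longlongrightarrow> norm p) (at_right 0)"
    by (auto intro: filterlim_mono at_le)
  moreover have "\<forall>\<^sub>F t in at_right 0. (w (x + t *\<^sub>R u) - w x) / t \<le> K"
  proof -
    have "\<forall>\<^sub>F t in at_right (0::real). t \<in> {0<..<1}" by (rule eventually_at_right_real) simp
    then show ?thesis
    proof eventually_elim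
      case (elim t)
      then have "\<bar>w (x + t *\<^sub>R u) - w x\<bar> \<le> K * t" using assms(2)[of "t *\<^sub>R u"] u by simp
      then show ?case using elim by (simp add: field_simps)
    qed
  qed
  ultimately show ?thesis by (rule tendsto_upperbound) simp
qed (use assms(3) in simp)

text \<open>Absorption for a predicate that is only upward closed. The iterates approach 2 B from
  above, and 3 B is passed after finitely many steps, so no closedness of \<open>P\<close> enters
  and the starting value \<open>Z0\<close> leaves no trace in the bound.\<close>

lemma le_half_geometric:
  assumes "\<And>Z::real. 0 < Z \<Longrightarrow> P Z \<Longrightarrow> P (Z / 2 + B)" "0 < B" "0 < Z0" "P Z0"
    and mono: "\<And>Z Z'. 0 < Z \<Longrightarrow> P Z \<Longrightarrow> Z \<le> Z' \<Longrightarrow> P Z'"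
  shows "P (3 * B)"
proof -
  have P: "P (Z0 / 2 ^ n + 2 * B)" for n
  proof (induction n)
    case 0
    show ?case by (rule mono[OF assms(3,4)]) (use assms(2) in auto)
  next
    case (Suc n)
    have "0 < Z0 / 2 ^ n + 2 * B" using assms(2,3) by (simp add: add_pos_pos)
    from assms(1)[OF this Suc] show ?case by (simp add: add_divide_distrib add_ac mult_ac)
  qed
  have "(\<lambda>n. Z0 * (1/2) ^ n) \<longlonglongrightarrow> Z0 * 0"
    by (intro tendsto_mult tendsto_const LIMSEQ_realpow_zero) auto
  then have "\<forall>\<^sub>F n in sequentially. Z0 * (1/2) ^ n < B"
    using assms(2) by (intro order_tendstoD(2)) auto
  then obtain n where "Z0 * (1/2) ^ n < B" by (meson eventually_happens sequentially_bot)
  then have n: "Z0 / 2 ^ n + 2 * B \<le> 3 * B" by (simp add: power_one_over field_simps)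
  have "0 < Z0 / 2 ^ n + 2 * B" using assms(2,3) by (simp add: add_pos_pos)
  then show ?thesis by (rule mono[OF _ P n])
qed

lemma hessian_morrey_bound:
  assumes "0 < c" "0 \<le> \<Lambda>"
  shows "\<exists>R>0. \<exists>C\<ge>1. \<forall>w p (H :: real^'d \<Rightarrow> real^'d^'d) e W G.
    C2 w p H \<and> (\<forall>x. \<bar>w x\<bar> \<le> W) \<and> 0 < G \<and> continuous_on UNIV e \<and> morrey e G \<and>
    (\<forall>x0. \<exists>m \<sigma>. gram c \<Lambda> m \<sigma> \<and> (\<forall>x. norm (x - x0) \<le> R \<longrightarrow> \<bar>trS m \<sigma> (H x)\<bar> \<le> e x)) \<longrightarrow>
    (\<forall>x. norm (p x) \<le> C * (W + G)) \<and> morrey (\<lambda>x. norm (H x)) (C * (W + G))"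
proof -
  from affine_approx[OF assms, where 'd = 'd] obtain a CA where a: "0 < a" "0 < CA" and
    aff: "\<forall>m \<sigma> w p (H :: real^'d \<Rightarrow> real^'d^'d) x0 W G h.
    gram c \<Lambda> m \<sigma> \<and> C2 w p H \<and> (\<forall>x. \<bar>w x\<bar> \<le> W) \<and> 0 < G \<and> 0 < h \<and> h \<le> 1 \<and>
    (\<forall>x s. norm (x - x0) \<le> 2 \<longrightarrow> 0 < s \<longrightarrow> s \<le> 1 \<longrightarrow>
      (LINT y:cball 0 (a + 2)|lborel. (trS m \<sigma> (H (x + s *\<^sub>R y)))\<^sup>2) \<le> G\<^sup>2 / s) \<longrightarrow>
    (\<exists>\<beta> q. norm q \<le> CA * (W + G) \<and> (\<forall>v. norm v \<le> 2 * h \<longrightarrow> \<bar>w (x0 + v) - \<beta> - q \<bullet> v\<bar> \<le> CA * (h * sqrt h) * (W + G)))"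
    by (elim exE conjE) (rule that)
  from interior_hessian_energy[OF assms, where 'd = 'd] obtain CE where CE: "0 < CE" and
    ener: "\<forall>m \<sigma> w p (H :: real^'d \<Rightarrow> real^'d^'d). gram c \<Lambda> m \<sigma> \<and> C2 w p H \<longrightarrow>
    (LINT x:cball 0 1|lborel. norm (H x)^2) \<le> CE * (LINT x:cball 0 2|lborel. (trS m \<sigma> (H x))^2 + (w x)^2)"
    by (elim exE conjE) (rule that)
  from cball_doubling[where 'a = "real^'d", of "a + 2"] obtain N :: real where N: "1 \<le> N" and
    doub: "\<forall>(F :: real^'d \<Rightarrow> real) B h. continuous_on UNIV F \<and> (\<forall>x. 0 \<le> F x) \<and>
     (\<forall>x. (LINT y:cball 0 1|lborel. F (x + h *\<^sub>R y)) \<le> B) \<longrightarrow>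
     (\<forall>x. (LINT y:cball 0 (a + 2)|lborel. F (x + h *\<^sub>R y)) \<le> N * B)"
    by (elim exE conjE) (rule that)
  define V2 where "V2 = measure lborel (cball (0::real^'d) 2)"
  define C where "C = 1 + 3 * CA * N + CE * (N + V2 * (CA * N)\<^sup>2)"
  have V2: "0 \<le> V2" by (simp add: V2_def)
  have C1: "1 \<le> C" "3 * CA * N \<le> C" "CE * (N + V2 * (CA * N)\<^sup>2) \<le> C"
    using a CE N V2 by (simp_all add: C_def)
  have main: "(\<forall>x. norm (p x) \<le> C * (W + G)) \<and> morrey (\<lambda>x. norm (H x)) (C * (W + G))"
    if *: "C2 w p H \<and> (\<forall>x. \<bar>w x\<bar> \<le> W) \<and> 0 < G \<and> continuous_on UNIV e \<and> morrey e G \<and>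
    (\<forall>x0. \<exists>m \<sigma>. gram c \<Lambda> m \<sigma> \<and> (\<forall>x. norm (x - x0) \<le> a + 4 \<longrightarrow> \<bar>trS m \<sigma> (H x)\<bar> \<le> e x))"
    for w p e W G and H :: "real^'d \<Rightarrow> real^'d^'d"
  proof -
    have w: "C2 w p H" and W: "\<And>x. \<bar>w x\<bar> \<le> W" and G: "0 < G" and e: "continuous_on UNIV e" "morrey e G"
      and tr: "\<forall>x0. \<exists>m \<sigma>. gram c \<Lambda> m \<sigma> \<and> (\<forall>x. norm (x - x0) \<le> a + 4 \<longrightarrow> \<bar>trS m \<sigma> (H x)\<bar> \<le> e x)"
      using * by simp_all
    note wD = C2D[OF w]
    have W0: "0 \<le> W" using W[of 0] by linarith
    define D where "D = CA * (W + N * G)"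
    have D0: "0 \<le> D" using a W0 N G by (simp add: D_def)
    have DN: "D \<le> CA * N * (W + G)"
    proof -
      have "W + N * G \<le> N * (W + G)" using N W0 by (simp add: distrib_left mult_right_mono[of 1 N W, simplified])
      then show ?thesis using a by (simp add: D_def mult.assoc mult_left_mono)
    qed
    have e2: "(LINT y:cball 0 (a + 2)|lborel. (e (x + h *\<^sub>R y))\<^sup>2) \<le> N * (G\<^sup>2 / h)" if "0 < h" "h \<le> 1" for x h
    proof -
      have "continuous_on UNIV (\<lambda>x. (e x)\<^sup>2)" by (intro continuous_intros e)
      moreover have "\<forall>x. (LINT y:cball 0 1|lborel. (e (x + h *\<^sub>R y))\<^sup>2) \<le> G\<^sup>2 / h"
        using morreyD[OF e(2) that] by blast
      ultimately show ?thesis using doub[rule_format, of "\<lambda>x. (e x)\<^sup>2" h "G\<^sup>2 / h" x] by simp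
    qed
    have ap: "\<exists>m \<sigma>. gram c \<Lambda> m \<sigma> \<and> (\<forall>x. norm (x - x0) \<le> a + 4 \<longrightarrow> \<bar>trS m \<sigma> (H x)\<bar> \<le> e x) \<and>
      (\<forall>h. 0 < h \<and> h \<le> 1 \<longrightarrow> (\<exists>\<beta> q. norm q \<le> D \<and> (\<forall>v. norm v \<le> 2 * h \<longrightarrow> \<bar>w (x0 + v) - \<beta> - q \<bullet> v\<bar> \<le> D * (h * sqrt h))))" for x0
    proof -
      obtain m \<sigma> where S: "gram c \<Lambda> m \<sigma>" and t: "\<And>x. norm (x - x0) \<le> a + 4 \<Longrightarrow> \<bar>trS m \<sigma> (H x)\<bar> \<le> e x"
        using tr by blast
      have mor: "(LINT y:cball 0 (a + 2)|lborel. (trS m \<sigma> (H (x + s *\<^sub>R y)))\<^sup>2) \<le> (N * G)\<^sup>2 / s"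
        if "norm (x - x0) \<le> 2" "0 < s" "s \<le> 1" for x s
      proof -
        have "(LINT y:cball 0 (a + 2)|lborel. (trS m \<sigma> (H (x + s *\<^sub>R y)))\<^sup>2) \<le> (LINT y:cball 0 (a + 2)|lborel. (e (x + s *\<^sub>R y))\<^sup>2)"
        proof (rule set_integral_cball_mono)
          show "continuous_on UNIV (\<lambda>y. (trS m \<sigma> (H (x + s *\<^sub>R y)))\<^sup>2)" "continuous_on UNIV (\<lambda>y. (e (x + s *\<^sub>R y))\<^sup>2)"
            by (intro continuous_intros continuous_rescale wD e)+
          fix y :: "real^'d" assume "y \<in> cball 0 (a + 2)"
          then have "norm (s *\<^sub>R y) \<le> a + 2" using that mult_left_le_one_le[of "norm y" s] by simp
          then have "norm (x + s *\<^sub>R y - x0) \<le> a + 4"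
            using norm_triangle_ineq[of "x - x0" "s *\<^sub>R y"] that by (simp add: algebra_simps)
          from power_mono[OF t[OF this] abs_ge_zero, of 2]
          show "(trS m \<sigma> (H (x + s *\<^sub>R y)))\<^sup>2 \<le> (e (x + s *\<^sub>R y))\<^sup>2" by simp
        qed
        also have "\<dots> \<le> N * (G\<^sup>2 / s)" by (rule e2[OF that(2,3)])
        also have "\<dots> \<le> N\<^sup>2 * (G\<^sup>2 / s)" using N that self_le_power[of N 2] by (intro mult_right_mono) auto
        finally show ?thesis by (simp add: power_mult_distrib)
      qed
      have "\<exists>\<beta> q. norm q \<le> D \<and> (\<forall>v. norm v \<le> 2 * h \<longrightarrow> \<bar>w (x0 + v) - \<beta> - q \<bullet> v\<bar> \<le> D * (h * sqrt h))"
        if h: "0 < h" "h \<le> 1" for h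
      proof -
        have NG: "0 < N * G" using N G by simp
        have "\<exists>\<beta> q. norm q \<le> CA * (W + N * G) \<and> (\<forall>v. norm v \<le> 2 * h \<longrightarrow> \<bar>w (x0 + v) - \<beta> - q \<bullet> v\<bar> \<le> CA * (h * sqrt h) * (W + N * G))"
          by (rule aff[rule_format, of m \<sigma> w p H W "N * G" h x0]) (intro conjI allI impI S w W NG h mor)
        moreover have "CA * (h * sqrt h) * (W + N * G) = D * (h * sqrt h)" by (simp add: D_def)
        ultimately show ?thesis by (simp add: D_def)
      qed
      then show ?thesis using S t by blast
    qed
    have pb: "norm (p x0) \<le> C * (W + G)" for x0
    proof -
      obtain m \<sigma> where apx: "\<And>h. 0 < h \<Longrightarrow> h \<le> 1 \<Longrightarrow> \<exists>\<beta> q. norm q \<le> D \<and> (\<forall>v. norm v \<le> 2 * h \<longrightarrow> \<bar>w (x0 + v) - \<beta> - q \<bullet> v\<bar> \<le> D * (h * sqrt h))"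
        using ap[of x0] by blast
      \<comment> \<open>The approximation is used at the scale h = |v| of the increment. Its errors
        at v and at 0 are at most D h^(3/2) \<le> D h each, and the slope contributes the third D
        h.\<close>
      have "norm (p x0) \<le> 3 * D"
      proof (rule gradient_bound_from_increments[OF wD(1)])
        fix v :: "real^'d" assume v: "norm v \<le> 1"
        show "\<bar>w (x0 + v) - w x0\<bar> \<le> 3 * D * norm v"
        proof (cases "v = 0")
          case False
          define h where "h = norm v"
          have h: "0 < h" "h \<le> 1" using False v by (auto simp: h_def)
          obtain \<beta> q where q: "norm q \<le> D" "\<And>v. norm v \<le> 2 * h \<Longrightarrow> \<bar>w (x0 + v) - \<beta> - q \<bullet> v\<bar> \<le> D * (h * sqrt h)"
            using apx[OF h] by blast
          have "\<bar>q \<bullet> v\<bar> \<le> D * h"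
            unfolding h_def by (intro order_trans[OF Cauchy_Schwarz_ineq2] mult_right_mono q(1)) auto
          moreover have "\<bar>w (x0 + v) - \<beta> - q \<bullet> v\<bar> \<le> D * (h * sqrt h)" using q(2)[of v] h by (simp add: h_def)
          moreover have "\<bar>w x0 - \<beta>\<bar> \<le> D * (h * sqrt h)" using q(2)[of 0] h by simp
          moreover have "D * (h * sqrt h) \<le> D * h" using h D0 by (intro mult_left_mono) (auto simp: mult_left_le)
          ultimately have "\<bar>w (x0 + v) - w x0\<bar> \<le> 3 * (D * h)" by linarith
          then show ?thesis by (simp add: h_def)
        qed simp
      qed (use D0 in simp)
      also have "\<dots> \<le> 3 * CA * N * (W + G)" using DN by simp
      also have "\<dots> \<le> C * (W + G)" using C1(2) W0 G by (intro mult_right_mono) auto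
      finally show ?thesis .
    qed
    have "morrey (\<lambda>x. norm (H x)) (C * (W + G))"
      unfolding morrey_def
    proof (intro allI impI)
      fix x0 :: "real^'d" and h :: real assume h: "0 < h" "h \<le> 1"
      obtain m \<sigma> where S: "gram c \<Lambda> m \<sigma>" and t: "\<And>x. norm (x - x0) \<le> a + 4 \<Longrightarrow> \<bar>trS m \<sigma> (H x)\<bar> \<le> e x"
        and apx: "\<And>h. 0 < h \<Longrightarrow> h \<le> 1 \<Longrightarrow> \<exists>\<beta> q. norm q \<le> D \<and> (\<forall>v. norm v \<le> 2 * h \<longrightarrow> \<bar>w (x0 + v) - \<beta> - q \<bullet> v\<bar> \<le> D * (h * sqrt h))"
        using ap[of x0] by blast
      obtain \<beta> q where q: "norm q \<le> D" "\<And>v. norm v \<le> 2 * h \<Longrightarrow> \<bar>w (x0 + v) - \<beta> - q \<bullet> v\<bar> \<le> D * (h * sqrt h)"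
        using apx[OF h] by blast
      define \<omega> where "\<omega> y = w (x0 + h *\<^sub>R y) - \<beta> - (h *\<^sub>R q) \<bullet> y" for y
      have o: "C2 \<omega> (\<lambda>y. h *\<^sub>R p (x0 + h *\<^sub>R y) - h *\<^sub>R q) (\<lambda>y. h^2 *\<^sub>R H (x0 + h *\<^sub>R y))"
        unfolding \<omega>_def by (rule C2_diff_affine[OF C2_rescale[OF w]])
      have Hc: "continuous_on UNIV (\<lambda>y. (e (x0 + h *\<^sub>R y))\<^sup>2)"
        by (intro continuous_intros continuous_rescale e)
      have "h^4 * (LINT y:cball 0 1|lborel. (norm (H (x0 + h *\<^sub>R y)))\<^sup>2) = (LINT y:cball 0 1|lborel. norm (h^2 *\<^sub>R H (x0 + h *\<^sub>R y))^2)"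
        by (simp add: power_mult_distrib flip: power_mult)
      also have "\<dots> \<le> CE * (LINT y:cball 0 2|lborel. (trS m \<sigma> (h^2 *\<^sub>R H (x0 + h *\<^sub>R y)))^2 + (\<omega> y)^2)"
        by (rule ener[rule_format, OF conjI[OF S o]])
      also have "(LINT y:cball 0 2|lborel. (trS m \<sigma> (h^2 *\<^sub>R H (x0 + h *\<^sub>R y)))^2 + (\<omega> y)^2)
        \<le> (LINT y:cball 0 2|lborel. h^4 * (e (x0 + h *\<^sub>R y))\<^sup>2 + D\<^sup>2 * h^3)"
      proof (rule set_integral_cball_mono)
        show "continuous_on UNIV (\<lambda>y. (trS m \<sigma> (h^2 *\<^sub>R H (x0 + h *\<^sub>R y)))^2 + (\<omega> y)^2)"
          by (intro continuous_intros continuous_rescale wD C2D(5)[OF o])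
        show "continuous_on UNIV (\<lambda>y. h^4 * (e (x0 + h *\<^sub>R y))\<^sup>2 + D\<^sup>2 * h^3)" by (intro continuous_intros Hc)
        fix y :: "real^'d" assume y: "y \<in> cball 0 2"
        have hy: "norm (h *\<^sub>R y) \<le> 2 * h" using h y by (simp add: mult.commute)
        moreover have "norm (x0 + h *\<^sub>R y - x0) = norm (h *\<^sub>R y)" by simp
        ultimately have "norm (x0 + h *\<^sub>R y - x0) \<le> a + 4" using h a by linarith
        from power_mono[OF t[OF this] abs_ge_zero, of 2]
        have 1: "(trS m \<sigma> (h^2 *\<^sub>R H (x0 + h *\<^sub>R y)))^2 \<le> h^4 * (e (x0 + h *\<^sub>R y))\<^sup>2"
          by (simp add: trS_linear power_mult_distrib mult_left_mono flip: power_mult)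
        have "\<bar>\<omega> y\<bar> \<le> D * (h * sqrt h)" using q(2)[OF hy] by (simp add: \<omega>_def)
        from power_mono[OF this abs_ge_zero, of 2]
        have "(\<omega> y)^2 \<le> D\<^sup>2 * (h^2 * (sqrt h)^2)" by (simp add: power_mult_distrib)
        also have "h^2 * (sqrt h)^2 = h^3" using h by (simp add: power2_eq_square power3_eq_cube)
        finally show "(trS m \<sigma> (h^2 *\<^sub>R H (x0 + h *\<^sub>R y)))^2 + (\<omega> y)^2 \<le> h^4 * (e (x0 + h *\<^sub>R y))\<^sup>2 + D\<^sup>2 * h^3"
          using 1 by linarith
      qed
      also have "\<dots> = h^4 * (LINT y:cball 0 2|lborel. (e (x0 + h *\<^sub>R y))\<^sup>2) + D\<^sup>2 * h^3 * V2"
        using set_integrable_cball[OF Hc, of 0 2] set_integrable_cball[where F = "\<lambda>_. D\<^sup>2 * h^3" and a = "0::real^'d" and r = 2, OF continuous_on_const]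
        by (simp add: set_integral_add V2_def) (simp add: set_lebesgue_integral_def)
      also have "(LINT y:cball 0 2|lborel. (e (x0 + h *\<^sub>R y))\<^sup>2) \<le> N * (G\<^sup>2 / h)"
      proof -
        have "(LINT y:cball 0 2|lborel. (e (x0 + h *\<^sub>R y))\<^sup>2) \<le> (LINT y:cball 0 (a+2)|lborel. (e (x0 + h *\<^sub>R y))\<^sup>2)"
          unfolding set_lebesgue_integral_def
          using set_integrable_cball[OF Hc, of 0 2] set_integrable_cball[OF Hc, of 0 "a + 2"] a
          unfolding set_integrable_def
          by (intro integral_mono) (auto simp: indicator_def)
        then show ?thesis using e2[OF h, of x0] by linarith
      qed
      finally have 1: "h^4 * (LINT y:cball 0 1|lborel. (norm (H (x0 + h *\<^sub>R y)))\<^sup>2) \<le> CE * (h^4 * (N * (G\<^sup>2 / h)) + D\<^sup>2 * h^3 * V2)"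
        using CE h by (simp add: mult_left_mono)
      have 3: "CE * (h^4 * (N * (G\<^sup>2 / h)) + D\<^sup>2 * h^3 * V2) = h^4 * (CE * (N * G\<^sup>2 + V2 * D\<^sup>2) / h)"
        using h by (simp add: field_simps eval_nat_numeral)
      have 2: "(LINT y:cball 0 1|lborel. (norm (H (x0 + h *\<^sub>R y)))\<^sup>2) \<le> CE * (N * G\<^sup>2 + V2 * D\<^sup>2) / h"
        by (rule mult_left_le_imp_le[OF 1[unfolded 3]]) (use h in simp)
      have "N * G\<^sup>2 + V2 * D\<^sup>2 \<le> N * (W + G)\<^sup>2 + V2 * (CA * N * (W + G))\<^sup>2"
        using N G W0 V2 D0 DN by (intro add_mono mult_left_mono power_mono) auto
      also have "\<dots> = (N + V2 * (CA * N)\<^sup>2) * (W + G)\<^sup>2"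
        by (simp only: power_mult_distrib distrib_right[of N _ "(W + G)\<^sup>2"] mult.assoc)
      finally have "CE * (N * G\<^sup>2 + V2 * D\<^sup>2) \<le> CE * (N + V2 * (CA * N)\<^sup>2) * (W + G)\<^sup>2"
        using CE by (simp add: mult.assoc mult_left_mono)
      also have "\<dots> \<le> C\<^sup>2 * (W + G)\<^sup>2"
        using C1(1,3) self_le_power[of C 2] by (intro mult_right_mono) auto
      finally have "CE * (N * G\<^sup>2 + V2 * D\<^sup>2) / h \<le> (C * (W + G))\<^sup>2 / h"
        using h by (intro divide_right_mono) (auto simp: power_mult_distrib)
      with 2 show "(LINT y:cball 0 1|lborel. (norm (H (x0 + h *\<^sub>R y)))\<^sup>2) \<le> (C * (W + G))\<^sup>2 / h" by linarith
    qed
    with pb show ?thesis by blast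
  qed
  have a4: "0 < a + 4" using a by simp
  show ?thesis
    by (rule exI[of _ "a + 4"], rule conjI[OF a4], rule exI[of _ C], rule conjI[OF C1(1)], intro allI impI, rule main)
qed

section \<open>Quantitative maximum principle and absorption of small perturbations\<close>

lemma trS_uminus: "trS m \<sigma> (- A) = - trS m \<sigma> A"
  using trS_linear(2)[of m \<sigma> "-1" A] by simp

lemma C2_uminus:
  assumes "C2 w p H" shows "C2 (\<lambda>x. - w x) (\<lambda>x. - p x) (\<lambda>x. - H x)"
  unfolding C2_def
proof (intro conjI allI)
  show "((\<lambda>x. - w x) has_derivative (\<lambda>v. (- p x) \<bullet> v)) (at x)" for x
    by (rule has_derivative_eq_rhs[OF has_derivative_minus[OF C2D(1)[OF assms]]]) simp
  show "((\<lambda>x. - p x) has_derivative (\<lambda>v. (- H x) *v v)) (at x)" for x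
    by (rule has_derivative_eq_rhs[OF has_derivative_minus[OF C2D(2)[OF assms]]])
       (use scaleR_matrix_vector_assoc[of "-1" "H x"] in \<open>simp add: fun_eq_iff\<close>)
  show "continuous_on UNIV (\<lambda>x. - H x)" by (intro continuous_intros C2D[OF assms])
qed

text \<open>Averaging at scale r can raise \<open>w\<close> above \<open>w x0\<close> by no more
  than a multiple of \<open>W - w x0\<close>, while the representation writes this rise as an
  integral over scales of averages of the leading part, to which \<open>b\<close> contributes at
  least r^2 I b/12. The result is a maximum principle in which the error \<open>e\<close> is
  controlled in mean square only: at scale s it enters as s s^(-1/2) \<le> 1, hence in total with
  order r E.\<close>

lemma near_max_estimate:
  fixes w :: "real^'d \<Rightarrow> real"
  assumes \<Phi>: "kernel a L I \<Phi> D\<Phi>" and \<Psi>: "kernel a L I \<Psi> D\<Psi>" and S: "\<And>y q. formS m \<sigma> (D\<Psi> y) q = - 6 * \<Phi> y * (y \<bullet> q)"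
    and pos: "0 < a" "0 < I" and w: "C2 w p H" and r: "0 < r" "r \<le> 1" and W: "\<And>x. w x \<le> W" "0 < W"
    and near: "\<And>x. norm (x - x0) \<le> r * a \<Longrightarrow> b - e x \<le> trS m \<sigma> (H x)" "0 \<le> b"
    and e: "continuous_on UNIV e" "\<And>s. 0 < s \<Longrightarrow> s \<le> 1 \<Longrightarrow> (LINT y:cball 0 a|lborel. (e (x0 + s *\<^sub>R y))\<^sup>2) \<le> E\<^sup>2 / s" "0 < E"
    and V: "V = measure lborel (cball (0::real^'d) a) + 1"
  shows "r\<^sup>2 * I * b \<le> 12 * V * (W - w x0) + 2 * r * V * E"
proof -
  note wD = C2D[OF w]
  note k = kernelD[OF \<Phi>] kernelD[OF \<Psi>]
  note kc = C1D(2,3)[OF k(1)] C1D(2,3)[OF k(9)]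
  define g where "g x = trS m \<sigma> (H x)" for x
  have gc: "continuous_on UNIV g" unfolding g_def by (intro continuous_intros wD)
  have V1: "1 \<le> V" using V by simp
  have i\<Phi>: "integrable lborel \<Phi>" by (rule integrable_compact_support[where r = a]) (use k kc in auto)
  have i\<Psi>: "integrable lborel \<Psi>" by (rule integrable_compact_support[where r = a]) (use k kc in auto)
  have low: "I * b - V * E / sqrt s \<le> avg \<Psi> g s x0" if s: "0 < s" "s \<le> r" for s
  proof -
    have s1: "s \<le> 1" using s r by simp
    have i1: "integrable lborel (\<lambda>y. \<Psi> y * e (x0 + s *\<^sub>R y))"
      by (rule integrable_compact_support[where r = a])
         (use k e in \<open>auto intro!: continuous_intros continuous_rescale kc\<close>)
    have i2: "integrable lborel (\<lambda>y. \<Psi> y * g (x0 + s *\<^sub>R y))"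
      by (rule integrable_compact_support[where r = a])
         (use k gc in \<open>auto intro!: continuous_intros continuous_rescale kc\<close>)
    have "\<bar>LINT y|lborel. \<Psi> y * e (x0 + s *\<^sub>R y)\<bar> \<le> 1 * ((measure lborel (cball (0::real^'d) a) + 1) * (E / sqrt s))"
    proof (rule kernel_integral_bound[OF kc(4) _ _ e(1)])
      show "\<bar>\<Psi> y\<bar> \<le> 1" for y using k(10,11)[of y] by simp
      show "\<Psi> y = 0" if "norm y > a" for y using k(12) that .
      show "(LINT y:cball 0 a|lborel. (e (x0 + s *\<^sub>R y))\<^sup>2) \<le> (E / sqrt s)\<^sup>2"
        using e(2)[OF s(1) s1] s by (simp add: power_divide)
    qed (use e s in auto)
    then have 1: "(LINT y|lborel. \<Psi> y * e (x0 + s *\<^sub>R y)) \<le> V * E / sqrt s" by (simp add: V)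
    have "I * b \<le> (LINT y|lborel. \<Psi> y) * b" using k(15) near(2) by (intro mult_right_mono) auto
    then have "I * b - V * E / sqrt s \<le> (LINT y|lborel. \<Psi> y * b - \<Psi> y * e (x0 + s *\<^sub>R y))"
      using i1 i\<Psi> 1 by simp
    also have "\<dots> \<le> (LINT y|lborel. \<Psi> y * g (x0 + s *\<^sub>R y))"
    proof (rule integral_mono)
      show "integrable lborel (\<lambda>y. \<Psi> y * b - \<Psi> y * e (x0 + s *\<^sub>R y))" using i1 i\<Psi> by simp
      fix y
      show "\<Psi> y * b - \<Psi> y * e (x0 + s *\<^sub>R y) \<le> \<Psi> y * g (x0 + s *\<^sub>R y)"
      proof (cases "norm y \<le> a")
        case True
        have "norm (x0 + s *\<^sub>R y - x0) \<le> r * a" using s True by (auto intro: mult_mono)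
        from mult_left_mono[OF near(1)[OF this] k(10)[of y]] show ?thesis by (simp add: g_def right_diff_distrib)
      next
        case False
        then show ?thesis using k(12)[of y] by simp
      qed
    qed (use i2 in auto)
    finally show ?thesis by (simp add: avg_def)
  qed
  have rep: "((\<lambda>s. s / 6 * avg \<Psi> g s x0) has_integral (avg \<Phi> w r x0 - (LINT y|lborel. \<Phi> y) * w x0)) {0..r}"
    using avg_representation[OF w \<Phi> \<Psi> S, of r x0] r by (simp add: g_def[abs_def])
  have lin: "((\<lambda>s. s / 6 * (I * b) - V * E / 6) has_integral (r\<^sup>2 / 12 * (I * b) - r * (V * E / 6))) {0..r}"
  proof -
    have "((\<lambda>s. s / 6 * (I * b) - V * E / 6) has_integral ((r\<^sup>2 / 12 * (I * b) - r * (V * E / 6)) - (0\<^sup>2 / 12 * (I * b) - 0 * (V * E / 6)))) {0..r}"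
    proof (rule fundamental_theorem_of_calculus)
      fix s :: real
      have "((\<lambda>s. s\<^sup>2 / 12 * (I * b) - s * (V * E / 6)) has_real_derivative s / 6 * (I * b) - V * E / 6) (at s)"
        by (auto intro!: derivative_eq_intros simp: algebra_simps)
      then show "((\<lambda>s. s\<^sup>2 / 12 * (I * b) - s * (V * E / 6)) has_vector_derivative s / 6 * (I * b) - V * E / 6) (at s within {0..r})"
        unfolding has_real_derivative_iff_has_vector_derivative[symmetric] by (rule has_field_derivative_at_within)
    qed (use r in auto)
    then show ?thesis by simp
  qed
  have "r\<^sup>2 / 12 * (I * b) - r * (V * E / 6) \<le> avg \<Phi> w r x0 - (LINT y|lborel. \<Phi> y) * w x0"
  proof (rule has_integral_le[OF lin rep])
    fix s assume "s \<in> {0..r}"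
    then have s: "0 \<le> s" "s \<le> r" by auto
    show "s / 6 * (I * b) - V * E / 6 \<le> s / 6 * avg \<Psi> g s x0"
    proof (cases "s = 0")
      case True
      then show ?thesis using V1 e(3) by simp
    next
      case False
      then have s0: "0 < s" using s by simp
      have "s / 6 * (I * b - V * E / sqrt s) \<le> s / 6 * avg \<Psi> g s x0"
        using low[OF s0 s(2)] s0 by (intro mult_left_mono) auto
      moreover have "s / 6 * (V * E / sqrt s) = sqrt s * (V * E / 6)"
        using s0 real_div_sqrt[of s] by (metis (no_types, opaque_lifting) less_imp_le mult.commute times_divide_eq_left times_divide_eq_right)
      moreover have "sqrt s * (V * E / 6) \<le> 1 * (V * E / 6)"
        using s r V1 e(3) by (intro mult_right_mono) auto
      ultimately show ?thesis by (simp add: right_diff_distrib)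
    qed
  qed
  also have "avg \<Phi> w r x0 \<le> (LINT y|lborel. \<Phi> y) * W"
  proof -
    have "avg \<Phi> w r x0 \<le> (LINT y|lborel. \<Phi> y * W)" unfolding avg_def
    proof (rule integral_mono)
      show "integrable lborel (\<lambda>y. \<Phi> y * w (x0 + r *\<^sub>R y))"
        by (rule integrable_compact_support[where r = a])
           (use k wD(5) in \<open>auto intro!: continuous_intros continuous_rescale kc\<close>)
    qed (use i\<Phi> W k in \<open>auto intro!: mult_left_mono\<close>)
    then show ?thesis by simp
  qed
  also have "(LINT y|lborel. \<Phi> y) * W - (LINT y|lborel. \<Phi> y) * w x0 = (LINT y|lborel. \<Phi> y) * (W - w x0)"
    by (simp add: right_diff_distrib)
  also have "\<dots> \<le> V * (W - w x0)"
  proof (rule mult_right_mono)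
    have "(LINT y|lborel. \<Phi> y) \<le> (LINT y|lborel. indicator (cball (0::real^'d) a) y *\<^sub>R (1::real))"
    proof (rule integral_mono[OF i\<Phi>])
      show "integrable lborel (\<lambda>y. indicator (cball (0::real^'d) a) y *\<^sub>R (1::real))"
        by (rule borel_integrable_compact) auto
      show "\<Phi> y \<le> indicator (cball 0 a) y *\<^sub>R 1" for y
        using k(3)[of y] k(4)[of y] by (auto simp: indicator_def)
    qed
    then show "(LINT y|lborel. \<Phi> y) \<le> V" by (simp add: V)
  qed (use W in auto)
  finally show ?thesis by (simp add: field_simps)
qed

lemma gradient_lipschitz:
  assumes w: "C2 w p H" and K: "\<And>x. norm (p x) \<le> K"
  shows "\<bar>w x - w y\<bar> \<le> K * norm (x - y)"
proof -
  obtain t where "w (y + 1 *\<^sub>R (x - y)) - w y = 1 * (p (y + t *\<^sub>R (x - y)) \<bullet> (x - y))"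
    using mvt_segment[OF C2D(1)[OF w], of 1 y "x - y"] by auto
  then have "w x - w y = p (y + t *\<^sub>R (x - y)) \<bullet> (x - y)" by simp
  also have "\<bar>\<dots>\<bar> \<le> K * norm (x - y)"
    by (intro order_trans[OF Cauchy_Schwarz_ineq2] mult_right_mono K) auto
  finally show ?thesis .
qed

text \<open>\<open>hessian_morrey_bound\<close>, with the zeroth-order term on the right, bounds
  |Dw| by a multiple of W + E, where W is the supremum of |w|. If W > E, this gradient bound keeps
  \<open>w\<close> above W/2 on a small ball around an almost maximal point; there the zeroth-order
  term is at least c1 W/2, and \<open>near_max_estimate\<close> bounds W by a multiple of E. Almost
  minimal points are treated through -w.\<close>

lemma sup_morrey_bound:
  assumes "0 < c" "0 \<le> \<Lambda>" "0 < c1" "0 < Cu"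
  shows "\<exists>R>0. \<exists>C\<ge>1. \<forall>w p (H :: real^'d \<Rightarrow> real^'d^'d) e E B.
    C2 w p H \<and> (\<forall>x. \<bar>w x\<bar> \<le> B) \<and> 0 < E \<and> continuous_on UNIV e \<and> morrey e E \<and>
    (\<forall>x0. \<exists>m \<sigma> \<alpha>. gram c \<Lambda> m \<sigma> \<and> (\<forall>x. norm (x - x0) \<le> R \<longrightarrow>
        c1 \<le> \<alpha> x \<and> \<alpha> x \<le> Cu \<and> \<bar>trS m \<sigma> (H x) - \<alpha> x * w x\<bar> \<le> e x)) \<longrightarrow>
    (\<forall>x. \<bar>w x\<bar> \<le> C * E) \<and> (\<forall>x. norm (p x) \<le> C * E) \<and> morrey (\<lambda>x. norm (H x)) (C * E)"
proof -
  from hessian_morrey_bound[OF assms(1,2), where 'd = 'd] obtain R1 CH where R1: "0 < R1" and CH: "1 \<le> CH" and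
    hess: "\<forall>w p (H :: real^'d \<Rightarrow> real^'d^'d) e W G.
    C2 w p H \<and> (\<forall>x. \<bar>w x\<bar> \<le> W) \<and> 0 < G \<and> continuous_on UNIV e \<and> morrey e G \<and>
    (\<forall>x0. \<exists>m \<sigma>. gram c \<Lambda> m \<sigma> \<and> (\<forall>x. norm (x - x0) \<le> R1 \<longrightarrow> \<bar>trS m \<sigma> (H x)\<bar> \<le> e x)) \<longrightarrow>
    (\<forall>x. norm (p x) \<le> CH * (W + G)) \<and> morrey (\<lambda>x. norm (H x)) (CH * (W + G))"
    by (elim exE conjE) (rule that)
  from kernels_exist[OF assms(1,2), where 'd = 'd] obtain a L I where a: "0 < a" "0 < L" "0 < I" and
    ker: "\<forall>m \<sigma>. gram c \<Lambda> m \<sigma> \<longrightarrow> (\<exists>\<Phi> D\<Phi> \<Psi> D\<Psi>. kernel a L I \<Phi> D\<Phi> \<and> kernel a L I \<Psi> (D\<Psi> :: real^'d \<Rightarrow> real^'d) \<and>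
       (\<forall>y q. formS m \<sigma> (D\<Psi> y) q = - 6 * \<Phi> y * (y \<bullet> q)))"
    by (elim exE conjE) (rule that)
  from cball_doubling[where 'a = "real^'d", of a] obtain N :: real where N: "1 \<le> N" and
    doub: "\<forall>(F :: real^'d \<Rightarrow> real) B h. continuous_on UNIV F \<and> (\<forall>x. 0 \<le> F x) \<and>
     (\<forall>x. (LINT y:cball 0 1|lborel. F (x + h *\<^sub>R y)) \<le> B) \<longrightarrow>
     (\<forall>x. (LINT y:cball 0 a|lborel. F (x + h *\<^sub>R y)) \<le> N * B)"
    by (elim exE conjE) (rule that)
  define V1 where "V1 = measure lborel (cball (0::real^'d) 1) + 1"
  define V where "V = measure lborel (cball (0::real^'d) a) + 1"
  have V: "1 \<le> V1" "1 \<le> V" by (simp_all add: V1_def V_def)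
  define K where "K = CH * (3 + 2 * V1 * Cu)"
  have K: "1 \<le> K"
  proof -
    have "1 * 1 \<le> CH * (3 + 2 * V1 * Cu)" using CH V assms by (intro mult_mono) auto
    then show ?thesis by (simp add: K_def)
  qed
  \<comment> \<open>Gives r a \<le> 1/(8 K), so that a gradient of size at most 2 K W changes
    \<open>w\<close> by at most W/4 on the ball of radius r a.\<close>
  define r where "r = 1 / (8 * K * (a + 1))"
  have r: "0 < r" "r \<le> 1" "r * a \<le> 1 / (8 * K)"
  proof -
    show "0 < r" using K a by (simp add: r_def)
    have "1 * 1 \<le> 8 * K * (a + 1)" using K a by (intro mult_mono) auto
    then show "r \<le> 1" by (simp add: r_def)
    have "r * a = 1 / (8 * K) * (a / (a + 1))" by (simp add: r_def)
    also have "\<dots> \<le> 1 / (8 * K) * 1" using K a by (intro mult_left_mono) auto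
    finally show "r * a \<le> 1 / (8 * K)" by simp
  qed
  define CW where "CW = 1 + 8 * V * N / (r * I * c1)"
  have CW: "1 \<le> CW" "8 * V * N / (r * I * c1) \<le> CW" using V N r a assms by (simp_all add: CW_def)
  define C where "C = K * (CW + 1)"
  have C: "CW \<le> C"
  proof -
    have "1 * CW \<le> K * (CW + 1)" using K CW by (intro mult_mono) auto
    then show ?thesis by (simp add: C_def)
  qed
  define R where "R = max R1 1"
  have main: "(\<forall>x. \<bar>w x\<bar> \<le> C * E) \<and> (\<forall>x. norm (p x) \<le> C * E) \<and> morrey (\<lambda>x. norm (H x)) (C * E)"
    if *: "C2 w p H \<and> (\<forall>x. \<bar>w x\<bar> \<le> B) \<and> 0 < E \<and> continuous_on UNIV e \<and> morrey e E \<and>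
    (\<forall>x0. \<exists>m \<sigma> \<alpha>. gram c \<Lambda> m \<sigma> \<and> (\<forall>x. norm (x - x0) \<le> R \<longrightarrow>
        c1 \<le> \<alpha> x \<and> \<alpha> x \<le> Cu \<and> \<bar>trS m \<sigma> (H x) - \<alpha> x * w x\<bar> \<le> e x))"
    for w p e E B and H :: "real^'d \<Rightarrow> real^'d^'d"
  proof -
    have w: "C2 w p H" and B: "\<And>x. \<bar>w x\<bar> \<le> B" and E: "0 < E" and e: "continuous_on UNIV e" "morrey e E"
      and eq: "\<forall>x0. \<exists>m \<sigma> \<alpha>. gram c \<Lambda> m \<sigma> \<and> (\<forall>x. norm (x - x0) \<le> R \<longrightarrow>
        c1 \<le> \<alpha> x \<and> \<alpha> x \<le> Cu \<and> \<bar>trS m \<sigma> (H x) - \<alpha> x * w x\<bar> \<le> e x)"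
      using * by simp_all
    define W where "W = (SUP x. \<bar>w x\<bar>)"
    have bdd: "bdd_above (range (\<lambda>x. \<bar>w x\<bar>))" by (rule bdd_aboveI2[of _ _ B]) (rule B)
    have W: "\<bar>w x\<bar> \<le> W" for x unfolding W_def by (rule cSUP_upper[OF _ bdd]) simp
    have W0: "0 \<le> W" using W[of 0] by linarith
    define G where "G = 2 * (V1 * (Cu * W) + E + 0)"
    have G0: "0 < G" using E W0 V assms by (simp add: G_def add_nonneg_pos)
    have WG: "CH * (W + G) \<le> K * (W + E)"
    proof -
      have "0 \<le> V1 * Cu * E" using V assms E by simp
      then have "W + G \<le> (3 + 2 * V1 * Cu) * (W + E)" using E W0 by (simp add: G_def algebra_simps)
      then show ?thesis using CH by (simp add: K_def mult.assoc mult_left_mono)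
    qed
    have mo: "morrey (\<lambda>x. Cu * W + e x + 0) G" unfolding G_def V1_def
    proof (rule morrey_add3[OF _ _ e(2,1)])
      show "morrey (\<lambda>x::real^'d. Cu * W) ((measure lborel (cball (0::real^'d) 1) + 1) * (Cu * W))"
        by (rule morrey_bounded) (use assms W0 in auto)
      show "morrey (\<lambda>x::real^'d. 0) 0" by (simp add: morrey_def)
    qed (use assms W0 E in auto)
    have "(\<forall>x. norm (p x) \<le> CH * (W + G)) \<and> morrey (\<lambda>x. norm (H x)) (CH * (W + G))"
    proof (rule hess[rule_format, of w p H W G "\<lambda>x. Cu * W + e x + 0"], intro conjI allI)
      show "C2 w p H" by (rule w)
      show "\<bar>w x\<bar> \<le> W" for x by (rule W)
      show "0 < G" by (rule G0)
      show "continuous_on UNIV (\<lambda>x. Cu * W + e x + 0)" by (intro continuous_intros e)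
      show "morrey (\<lambda>x. Cu * W + e x + 0) G" by (rule mo)
      fix x0
      obtain m \<sigma> \<alpha> where S: "gram c \<Lambda> m \<sigma>" and t: "\<And>x. norm (x - x0) \<le> R \<Longrightarrow>
        c1 \<le> \<alpha> x \<and> \<alpha> x \<le> Cu \<and> \<bar>trS m \<sigma> (H x) - \<alpha> x * w x\<bar> \<le> e x" using eq by blast
      have "\<bar>trS m \<sigma> (H x)\<bar> \<le> Cu * W + e x + 0" if "norm (x - x0) \<le> R1" for x
      proof -
        have x: "c1 \<le> \<alpha> x" "\<alpha> x \<le> Cu" "\<bar>trS m \<sigma> (H x) - \<alpha> x * w x\<bar> \<le> e x"
          using t[of x] that by (auto simp: R_def)
        have "\<bar>\<alpha> x * w x\<bar> \<le> Cu * W" unfolding abs_mult using x assms W by (intro mult_mono) auto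
        then show ?thesis using x(3) by linarith
      qed
      with S show "\<exists>m \<sigma>. gram c \<Lambda> m \<sigma> \<and> (\<forall>x. norm (x - x0) \<le> R1 \<longrightarrow> \<bar>trS m \<sigma> (H x)\<bar> \<le> Cu * W + e x + 0)" by blast
    qed
    then have p: "\<And>x. norm (p x) \<le> K * (W + E)" and HM: "morrey (\<lambda>x. norm (H x)) (K * (W + E))"
      using WG W0 G0 CH by (auto intro: order_trans morrey_weaken)
    have WE: "W \<le> CW * E"
    proof (cases "W \<le> E")
      case True
      have "1 * E \<le> CW * E" using CW E by (intro mult_right_mono) auto
      then show ?thesis using True by simp
    next
      case False
      then have W1: "0 < W" "E < W" using E by auto
      have pW: "norm (p x) \<le> 2 * K * W" for x
      proof -
        have "K * (W + E) \<le> K * (2 * W)" using K W1 by (intro mult_left_mono) auto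
        then show ?thesis using p[of x] by simp
      qed
      \<comment> \<open>The supremum may not be attained, so \<open>x0\<close> is only almost
        maximal. The bound W/4 leaves w \<ge> W/2 after the oscillation is subtracted, and r E/6
        turns 12 V (W - w x0) into at most 2 r V E.\<close>
      define \<theta> where "\<theta> = min (W / 4) (r * E / 6)"
      have \<theta>: "0 < \<theta>" "\<theta> \<le> W / 4" "\<theta> \<le> r * E / 6" using W1 r E by (auto simp: \<theta>_def)
      have "W - \<theta> < (SUP x. \<bar>w x\<bar>)" using \<theta> by (simp add: W_def)
      then obtain x0 where x0: "W - \<theta> < \<bar>w x0\<bar>" using less_cSUP_iff[OF _ bdd] by auto
      obtain m \<sigma> \<alpha> where S: "gram c \<Lambda> m \<sigma>" and t: "\<And>x. norm (x - x0) \<le> R \<Longrightarrow>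
        c1 \<le> \<alpha> x \<and> \<alpha> x \<le> Cu \<and> \<bar>trS m \<sigma> (H x) - \<alpha> x * w x\<bar> \<le> e x" using eq by blast
      obtain \<Phi> D\<Phi> \<Psi> and D\<Psi> :: "real^'d \<Rightarrow> real^'d" where
        K3: "kernel a L I \<Phi> D\<Phi>" "kernel a L I \<Psi> D\<Psi>" "\<forall>y q. formS m \<sigma> (D\<Psi> y) q = - 6 * \<Phi> y * (y \<bullet> q)"
        using ker[rule_format, OF S] by blast
      have main: "W \<le> 8 * V * N / (r * I * c1) * E"
        if w: "C2 w p H" and W: "\<And>x. \<bar>w x\<bar> \<le> W" and pW: "\<And>x. norm (p x) \<le> 2 * K * W" and x0: "W - \<theta> < w x0" and
          t: "\<And>x. norm (x - x0) \<le> R \<Longrightarrow> c1 \<le> \<alpha> x \<and> \<bar>trS m \<sigma> (H x) - \<alpha> x * w x\<bar> \<le> e x"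
        for w p and H :: "real^'d \<Rightarrow> real^'d^'d"
      proof -
        have "r\<^sup>2 * I * (c1 * W / 2) \<le> 12 * V * (W - w x0) + 2 * r * V * (N * E)"
        proof (rule near_max_estimate[OF K3(1,2) K3(3)[rule_format] a(1,3) w r(1,2) _ W1(1) _ _ e(1) _ _ V_def])
          show "w x \<le> W" for x using W[of x] by linarith
          show "0 \<le> c1 * W / 2" using assms W1 by simp
          show "0 < N * E" using N E by simp
          show "c1 * W / 2 - e x \<le> trS m \<sigma> (H x)" if "norm (x - x0) \<le> r * a" for x
          proof -
            have "r * a \<le> 1" using r(3) K by (auto intro: order_trans)
            then have tx: "c1 \<le> \<alpha> x" "\<bar>trS m \<sigma> (H x) - \<alpha> x * w x\<bar> \<le> e x" using t[of x] that by (auto simp: R_def)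
            have "\<bar>w x - w x0\<bar> \<le> 2 * K * W * norm (x - x0)" by (rule gradient_lipschitz[OF w pW])
            also have "\<dots> \<le> 2 * K * W * (1 / (8 * K))" using that r(3) K W1 by (intro mult_left_mono) auto
            also have "\<dots> = W / 4" using K by simp
            finally have "W / 2 \<le> w x" using x0 \<theta>(2) by linarith
            then have "c1 * (W / 2) \<le> \<alpha> x * w x" using tx(1) assms W1 by (intro mult_mono) auto
            then show ?thesis using tx(2) by linarith
          qed
          show "(LINT y:cball 0 a|lborel. (e (x0 + s *\<^sub>R y))\<^sup>2) \<le> (N * E)\<^sup>2 / s" if s: "0 < s" "s \<le> 1" for s
          proof -
            have "continuous_on UNIV (\<lambda>x. (e x)\<^sup>2)" by (intro continuous_intros e)
            moreover have "\<forall>x. (LINT y:cball 0 1|lborel. (e (x + s *\<^sub>R y))\<^sup>2) \<le> E\<^sup>2 / s"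
              using morreyD[OF e(2) s] by blast
            ultimately have "(LINT y:cball 0 a|lborel. (e (x0 + s *\<^sub>R y))\<^sup>2) \<le> N * (E\<^sup>2 / s)"
              using doub[rule_format, of "\<lambda>x. (e x)\<^sup>2" s "E\<^sup>2 / s" x0] by simp
            also have "\<dots> \<le> N\<^sup>2 * (E\<^sup>2 / s)" using N s self_le_power[of N 2] by (intro mult_right_mono) auto
            finally show ?thesis by (simp add: power_mult_distrib)
          qed
        qed
        also have "12 * V * (W - w x0) \<le> 12 * V * (r * E / 6)" using x0 \<theta>(3) V by (intro mult_left_mono) auto
        also have "\<dots> = 2 * r * V * (1 * E)" by simp
        also have "\<dots> \<le> 2 * r * V * (N * E)" using N E r V by (intro mult_left_mono mult_right_mono) auto
        finally have "r * (r * (I * c1) * W) \<le> r * (8 * V * N * E)" by (simp add: power2_eq_square field_simps)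
        then have "r * (I * c1) * W \<le> 8 * V * N * E" using r by simp
        then show ?thesis using r a assms by (simp add: field_simps)
      qed
      have "W \<le> 8 * V * N / (r * I * c1) * E"
      proof (cases "0 \<le> w x0")
        case True
        show ?thesis by (rule main[OF w W pW]) (use x0 True t in auto)
      next
        case False
        show ?thesis
          by (rule main[OF C2_uminus[OF w]]) (use W pW x0 False t in \<open>auto simp: trS_uminus abs_minus_commute\<close>)
      qed
      also have "\<dots> \<le> CW * E" using CW(2) E by (intro mult_right_mono) auto
      finally show ?thesis .
    qed
    have KE: "K * (W + E) \<le> C * E"
    proof -
      have "W + E \<le> (CW + 1) * E" using WE by (simp add: distrib_right)
      then show ?thesis using K by (simp add: C_def mult.assoc mult_left_mono)
    qed
    have "\<bar>w x\<bar> \<le> C * E" for x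
    proof -
      have "CW * E \<le> C * E" using C E by (intro mult_right_mono) auto
      then show ?thesis using W[of x] WE by linarith
    qed
    moreover have "norm (p x) \<le> C * E" for x using p[of x] KE by linarith
    moreover have "morrey (\<lambda>x. norm (H x)) (C * E)"
      by (rule morrey_weaken[OF HM _ KE]) (use K W0 E in auto)
    ultimately show ?thesis by blast
  qed
  have "0 < R" "1 \<le> C" using CW C by (auto simp: R_def)
  then show ?thesis
    by - (rule exI[of _ R], rule conjI, assumption, rule exI[of _ C], rule conjI, assumption, intro allI impI, rule main)
qed

text \<open>The small multiples of |Dw| and |D^2 w| are moved into the error of
  \<open>sup_morrey_bound\<close>, so a bound Z for the solution improves to Z/2 + 2 C F. The
  qualitative bound \<open>B\<close> serves only to start this iteration and is absent from the
  result; the constant 6 C is the factor 3 of \<open>le_half_geometric\<close> times 2 C.\<close>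

lemma perturbed_morrey_bound:
  assumes "0 < c" "0 \<le> \<Lambda>" "0 < c1" "0 < Cu"
  shows "\<exists>R>0. \<exists>C\<ge>1. \<exists>\<kappa>0>0. \<forall>w p (H :: real^'d \<Rightarrow> real^'d^'d) f F \<beta> \<kappa> B.
    C2 w p H \<and> (\<forall>x. \<bar>w x\<bar> \<le> B \<and> norm (p x) \<le> B \<and> norm (H x) \<le> B) \<and> 0 < F \<and> continuous_on UNIV f \<and> morrey f F \<and>
    0 \<le> \<beta> \<and> \<beta> \<le> \<kappa>0 \<and> 0 \<le> \<kappa> \<and> \<kappa> \<le> \<kappa>0 \<and>
    (\<forall>x0. \<exists>m \<sigma> \<alpha>. gram c \<Lambda> m \<sigma> \<and> (\<forall>x. norm (x - x0) \<le> R \<longrightarrow>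
        c1 \<le> \<alpha> x \<and> \<alpha> x \<le> Cu \<and> \<bar>trS m \<sigma> (H x) - \<alpha> x * w x\<bar> \<le> \<beta> * norm (p x) + \<kappa> * norm (H x) + f x)) \<longrightarrow>
    (\<forall>x. \<bar>w x\<bar> \<le> C * F) \<and> (\<forall>x. norm (p x) \<le> C * F) \<and> morrey (\<lambda>x. norm (H x)) (C * F)"
proof -
  from sup_morrey_bound[OF assms, where 'd = 'd] obtain R C where R: "0 < R" and C: "1 \<le> C" and
    sup: "\<forall>w p (H :: real^'d \<Rightarrow> real^'d^'d) e E B.
    C2 w p H \<and> (\<forall>x. \<bar>w x\<bar> \<le> B) \<and> 0 < E \<and> continuous_on UNIV e \<and> morrey e E \<and>
    (\<forall>x0. \<exists>m \<sigma> \<alpha>. gram c \<Lambda> m \<sigma> \<and> (\<forall>x. norm (x - x0) \<le> R \<longrightarrow>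
        c1 \<le> \<alpha> x \<and> \<alpha> x \<le> Cu \<and> \<bar>trS m \<sigma> (H x) - \<alpha> x * w x\<bar> \<le> e x)) \<longrightarrow>
    (\<forall>x. \<bar>w x\<bar> \<le> C * E) \<and> (\<forall>x. norm (p x) \<le> C * E) \<and> morrey (\<lambda>x. norm (H x)) (C * E)"
    by (elim exE conjE) (rule that)
  define V where "V = measure lborel (cball (0::real^'d) 1) + 1"
  have V: "1 \<le> V" by (simp add: V_def)
  \<comment> \<open>The two perturbations enter the Morrey bound of the error as 2 (V + 1) k Z, and
    this value of \<open>k\<close> makes C times that equal to Z/2.\<close>
  define k where "k = 1 / (4 * C * (V + 1))"
  have k: "0 < k" using C V by (simp add: k_def)
  have main: "(\<forall>x. \<bar>w x\<bar> \<le> (6 * C) * F) \<and> (\<forall>x. norm (p x) \<le> (6 * C) * F) \<and> morrey (\<lambda>x. norm (H x)) ((6 * C) * F)"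
    if *: "C2 w p H \<and> (\<forall>x. \<bar>w x\<bar> \<le> B \<and> norm (p x) \<le> B \<and> norm (H x) \<le> B) \<and> 0 < F \<and> continuous_on UNIV f \<and> morrey f F \<and>
    0 \<le> \<beta> \<and> \<beta> \<le> k \<and> 0 \<le> \<kappa> \<and> \<kappa> \<le> k \<and>
    (\<forall>x0. \<exists>m \<sigma> \<alpha>. gram c \<Lambda> m \<sigma> \<and> (\<forall>x. norm (x - x0) \<le> R \<longrightarrow>
        c1 \<le> \<alpha> x \<and> \<alpha> x \<le> Cu \<and> \<bar>trS m \<sigma> (H x) - \<alpha> x * w x\<bar> \<le> \<beta> * norm (p x) + \<kappa> * norm (H x) + f x))"
    for w p f F \<beta> \<kappa> B and H :: "real^'d \<Rightarrow> real^'d^'d"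
  proof -
    have w: "C2 w p H" and B: "\<And>x. \<bar>w x\<bar> \<le> B" "\<And>x. norm (p x) \<le> B" "\<And>x. norm (H x) \<le> B"
      and F: "0 < F" and f: "continuous_on UNIV f" "morrey f F" and b: "0 \<le> \<beta>" "\<beta> \<le> k" "0 \<le> \<kappa>" "\<kappa> \<le> k"
      and eq: "\<forall>x0. \<exists>m \<sigma> \<alpha>. gram c \<Lambda> m \<sigma> \<and> (\<forall>x. norm (x - x0) \<le> R \<longrightarrow>
        c1 \<le> \<alpha> x \<and> \<alpha> x \<le> Cu \<and> \<bar>trS m \<sigma> (H x) - \<alpha> x * w x\<bar> \<le> \<beta> * norm (p x) + \<kappa> * norm (H x) + f x)"
      using * by simp_all
    note wD = C2D[OF w]
    define P where "P Z \<longleftrightarrow> (\<forall>x. \<bar>w x\<bar> \<le> Z) \<and> (\<forall>x. norm (p x) \<le> Z) \<and> morrey (\<lambda>x. norm (H x)) Z" for Z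
    have mono: "P Z'" if "0 < Z" "P Z" "Z \<le> Z'" for Z Z'
      using that unfolding P_def by (auto intro: order_trans morrey_weaken)
    have "P (3 * (2 * C * F))"
    proof (rule le_half_geometric[of P])
      show "0 < 2 * C * F" using C F by simp
      have B0: "0 \<le> B" using B(1)[of 0] by linarith
      show "0 < V * B + 1" using V B0 by (simp add: add_nonneg_pos)
      have VB: "B \<le> V * B" using V B0 mult_right_mono[of 1 V B] by simp
      have "morrey (\<lambda>x. norm (H x)) (V * B)" unfolding V_def
        by (rule morrey_bounded) (use B(3) in \<open>auto intro!: continuous_intros wD\<close>)
      then have "morrey (\<lambda>x. norm (H x)) (V * B + 1)" by (rule morrey_weaken) (use V B0 in auto)
      moreover have "\<bar>w x\<bar> \<le> V * B + 1" "norm (p x) \<le> V * B + 1" for x using B(1,2)[of x] VB by linarith+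
      ultimately show "P (V * B + 1)" unfolding P_def by blast
      show "P Z'" if "0 < Z" "P Z" "Z \<le> Z'" for Z Z' by (rule mono[OF that])
      fix Z :: real assume Z: "0 < Z" "P Z"
      then have Zp: "\<And>x. norm (p x) \<le> Z" and ZH: "morrey (\<lambda>x. norm (H x)) Z" by (auto simp: P_def)
      define E where "E = 2 * (V * (k * Z) + k * Z + F)"
      have E0: "0 < E" using V k Z F by (simp add: E_def add_pos_pos)
      have me: "morrey (\<lambda>x. \<beta> * norm (p x) + \<kappa> * norm (H x) + f x) E"
        unfolding E_def V_def
      proof (rule morrey_add3[OF _ _ _ _ f(2,1)])
        show "morrey (\<lambda>x. \<beta> * norm (p x)) ((measure lborel (cball (0::real^'d) 1) + 1) * (k * Z))"
          by (rule morrey_bounded) (use Zp b k Z in \<open>auto intro!: continuous_intros wD mult_mono simp: abs_mult\<close>)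
        have "morrey (\<lambda>x. \<kappa> * norm (H x)) (\<kappa> * Z)" by (rule morrey_scale[OF ZH])
        then show "morrey (\<lambda>x. \<kappa> * norm (H x)) (k * Z)" by (rule morrey_weaken) (use b Z in auto)
      qed (use k Z F in \<open>auto intro!: continuous_intros wD\<close>)
      have "(\<forall>x. \<bar>w x\<bar> \<le> C * E) \<and> (\<forall>x. norm (p x) \<le> C * E) \<and> morrey (\<lambda>x. norm (H x)) (C * E)"
      proof (rule sup[rule_format, of w p H B E "\<lambda>x. \<beta> * norm (p x) + \<kappa> * norm (H x) + f x"], intro conjI)
        show "\<forall>x. \<bar>w x\<bar> \<le> B" using B by blast
        show "continuous_on UNIV (\<lambda>x. \<beta> * norm (p x) + \<kappa> * norm (H x) + f x)" by (intro continuous_intros wD f)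
      qed (rule w E0 me eq)+
      then have "P (C * E)" unfolding P_def .
      also have "C * E = 2 * C * (V + 1) * k * Z + 2 * C * F" by (simp add: E_def algebra_simps)
      also have "2 * C * (V + 1) * k = 1 / 2" using C V by (simp add: k_def)
      finally show "P (Z / 2 + 2 * C * F)" by simp
    qed
    then show ?thesis unfolding P_def by (simp add: mult.assoc)
  qed
  have "1 \<le> 6 * C" using C by simp
  then show ?thesis
    by - (rule exI[of _ R], rule conjI[OF R], rule exI[of _ "6 * C"], rule conjI, assumption,
        rule exI[of _ k], rule conjI[OF k], intro allI impI, rule main)
qed

section \<open>Extended norms\<close>

lemma sup_norm_le_iff:
  assumes "0 \<le> A"
  shows "sup_norm f \<le> ennreal A \<longleftrightarrow> (\<forall>x. infnorm (f x) \<le> A)"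
  using assms by (auto simp: sup_norm_def SUP_le_iff ennreal_le_iff)

lemma hoelder_seminorm_le_iff:
  assumes "0 \<le> A"
  shows "hoelder_seminorm \<alpha> f \<le> ennreal A \<longleftrightarrow>
    (\<forall>x y. 0 < dist x y \<longrightarrow> dist x y \<le> 1 \<longrightarrow> infnorm (f x - f y) \<le> A * dist x y powr \<alpha>)"
proof -
  have "hoelder_seminorm \<alpha> f \<le> ennreal A \<longleftrightarrow>
    (\<forall>x y. 0 < dist x y \<longrightarrow> dist x y \<le> 1 \<longrightarrow> infnorm (f x - f y) / dist x y powr \<alpha> \<le> A)"
    using assms by (auto simp: hoelder_seminorm_def SUP_le_iff ennreal_le_iff)
  also have "\<dots> \<longleftrightarrow> (\<forall>x y. 0 < dist x y \<longrightarrow> dist x y \<le> 1 \<longrightarrow> infnorm (f x - f y) \<le> A * dist x y powr \<alpha>)"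
    by (auto simp: divide_le_eq)
  finally show ?thesis .
qed

lemma norm_0a_leD:
  assumes "norm_0a \<alpha> f \<le> ennreal A" "0 \<le> A"
  shows "infnorm (f x) \<le> A" "0 < dist x y \<Longrightarrow> dist x y \<le> 1 \<Longrightarrow> infnorm (f x - f y) \<le> A * dist x y powr \<alpha>"
proof -
  have "sup_norm f \<le> ennreal A" "hoelder_seminorm \<alpha> f \<le> ennreal A"
    using assms(1) unfolding norm_0a_def by (auto intro: order_trans[rotated] simp: add_increasing2)
  then show "infnorm (f x) \<le> A" "0 < dist x y \<Longrightarrow> dist x y \<le> 1 \<Longrightarrow> infnorm (f x - f y) \<le> A * dist x y powr \<alpha>"
    using sup_norm_le_iff[OF assms(2)] hoelder_seminorm_le_iff[OF assms(2)] by blast+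
qed

lemma norm_0a_leI:
  assumes "\<And>x. infnorm (f x) \<le> A" "\<And>x y. 0 < dist x y \<Longrightarrow> dist x y \<le> 1 \<Longrightarrow> infnorm (f x - f y) \<le> B * dist x y powr \<alpha>"
    "0 \<le> A" "0 \<le> B" "A + B \<le> C"
  shows "norm_0a \<alpha> f \<le> ennreal C"
proof -
  have "sup_norm f \<le> ennreal A" "hoelder_seminorm \<alpha> f \<le> ennreal B"
    using sup_norm_le_iff[OF assms(3)] hoelder_seminorm_le_iff[OF assms(4)] assms(1,2) by blast+
  then have "norm_0a \<alpha> f \<le> ennreal A + ennreal B" unfolding norm_0a_def by (rule add_mono)
  also have "\<dots> \<le> ennreal C" using assms by (simp flip: ennreal_plus)
  finally show ?thesis .
qed

lemma norm_le_card_infnorm: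
  "norm (v :: real^'d) \<le> real CARD('d) * infnorm v"
  "norm (A :: real^'d^'d) \<le> real CARD('d) * infnorm A"
proof -
  have "1 \<le> real CARD('d)" by simp
  then have "1 * real CARD('d) \<le> real CARD('d) * real CARD('d)" by (intro mult_right_mono) auto
  then have "sqrt (real CARD('d)) \<le> real CARD('d)" by (intro real_le_lsqrt) (auto simp: power2_eq_square)
  moreover have "norm v \<le> sqrt (real CARD('d)) * infnorm v" using norm_le_infnorm[of v] by simp
  ultimately show "norm v \<le> real CARD('d) * infnorm v"
    by (meson infnorm_pos_le mult_right_mono order_trans)
  show "norm A \<le> real CARD('d) * infnorm A" using norm_le_infnorm[of A] by (simp add: real_sqrt_mult_self)
qed

lemma infnorm_real [simp]: "infnorm (x::real) = \<bar>x\<bar>"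
  by (simp add: infnorm_def Basis_real_def)

lemma abs_trace_mult_le:
  fixes A B :: "real^'d^'d"
  shows "\<bar>trace (A ** B)\<bar> \<le> norm A * norm B"
proof -
  have "trace (A ** B) = A \<bullet> transpose B"
    by (simp add: trace_def matrix_matrix_mult_def inner_vec_def transpose_def)
  moreover have "norm (transpose B) = norm B"
  proof -
    have "transpose B \<bullet> transpose B = B \<bullet> B"
      unfolding inner_vec_def by (subst sum.swap) (simp add: transpose_def inner_vec_def)
    then show ?thesis by (simp add: norm_eq_sqrt_inner)
  qed
  ultimately show ?thesis using Cauchy_Schwarz_ineq2[of A "transpose B"] by simp
qed

section \<open>Gibbs measures\<close>

lemma ext_integral_eq:
  assumes "integrable N f"
  shows "ext_integral N f = ereal (LINT u|N. f u)"
proof -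
  have fin: "(\<integral>\<^sup>+ u. ennreal (f u) \<partial>N) \<noteq> \<infinity>" "(\<integral>\<^sup>+ u. ennreal (- f u) \<partial>N) \<noteq> \<infinity>"
    using assms by (auto simp: real_integrable_def)
  have e: "enn2ereal x = ereal (enn2real x)" if "x \<noteq> \<infinity>" for x
    using that by (cases x) auto
  show ?thesis unfolding ext_integral_def real_lebesgue_integral_def[OF assms] e[OF fin(1)] e[OF fin(2)] by simp
qed

text \<open>The majorant makes the positive part of \<open>f\<close> finite. Hence an infinite
  negative part gives the value -\<infinity>, and otherwise \<open>f\<close> is integrable. In this
  way densities of infinite entropy are covered.\<close>

lemma ext_integral_le:
  assumes h: "integrable N h" and f: "f \<in> borel_measurable N" and le: "\<And>u. u \<in> space N \<Longrightarrow> f u \<le> h u"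
  shows "ext_integral N f \<le> ereal (LINT u|N. h u)"
proof (cases "(\<integral>\<^sup>+ u. ennreal (- f u) \<partial>N) = \<infinity>")
  case True
  have "(\<integral>\<^sup>+ u. ennreal (f u) \<partial>N) \<le> (\<integral>\<^sup>+ u. ennreal (h u) \<partial>N)"
    by (intro nn_integral_mono ennreal_leI le)
  also have "\<dots> < \<infinity>" using h by (auto simp: real_integrable_def top.not_eq_extremum)
  finally have "enn2ereal (\<integral>\<^sup>+ u. ennreal (f u) \<partial>N) \<noteq> \<infinity>" by (auto simp: enn2ereal_eq_top_iff)
  then show ?thesis unfolding ext_integral_def True by (cases "enn2ereal (\<integral>\<^sup>+ u. ennreal (f u) \<partial>N)") auto
next
  case False
  have "(\<integral>\<^sup>+ u. ennreal (f u) \<partial>N) \<le> (\<integral>\<^sup>+ u. ennreal (h u) \<partial>N)"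
    by (intro nn_integral_mono ennreal_leI le)
  also have "\<dots> < \<infinity>" using h by (auto simp: real_integrable_def top.not_eq_extremum)
  finally have i: "integrable N f" using False f by (auto simp: real_integrable_def)
  show ?thesis unfolding ext_integral_eq[OF i] using integral_mono[OF i h le] by simp
qed

lemma gibbs_density:
  fixes N :: "'u measure"
  assumes N: "finite_measure N" "measure N (space N) = 1" and z: "z \<in> borel_measurable N" "\<forall>u\<in>space N. \<bar>z u\<bar> \<le> B"
    and lam: "0 < lam" and Z: "Z = (LINT u|N. exp (1 / lam * z u))" and \<pi>: "\<And>u. \<pi> u = exp (1 / lam * z u) / Z"
  shows "exp (- B / lam) \<le> Z" "Z \<le> exp (B / lam)" "integrable N (\<lambda>u. exp (1 / lam * z u))"
    "\<pi> \<in> borel_measurable N" "\<pi> \<in> densities N"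
    "\<And>u. u \<in> space N \<Longrightarrow> exp (- 2 * B / lam) \<le> \<pi> u" "\<And>u. u \<in> space N \<Longrightarrow> \<pi> u \<le> exp (2 * B / lam)"
    "(LINT u|N. \<pi> u) = 1" "integrable N \<pi>" "0 < Z"
    "\<And>u. lam * ln (\<pi> u) = z u - lam * ln Z"
proof -
  interpret finite_measure N by fact
  have E: "exp (- B / lam) \<le> exp (1 / lam * z u)" "exp (1 / lam * z u) \<le> exp (B / lam)" if "u \<in> space N" for u
    using z(2)[rule_format, OF that] lam by (auto simp: divide_right_mono abs_le_iff field_simps)
  have Em: "(\<lambda>u. exp (1 / lam * z u)) \<in> borel_measurable N" using z(1) by measurable
  show Ei: "integrable N (\<lambda>u. exp (1 / lam * z u))"
    by (rule integrable_const_bound[where B = "exp (B / lam)", OF _ Em]) (use E in \<open>auto intro!: AE_I2\<close>)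
  have "(LINT u|N. exp (- B / lam)) \<le> Z" unfolding Z by (intro integral_mono Ei E) auto
  then show Zl: "exp (- B / lam) \<le> Z" by (simp add: N(2))
  have "Z \<le> (LINT u|N. exp (B / lam))" unfolding Z by (intro integral_mono Ei E) auto
  then show Zu: "Z \<le> exp (B / lam)" by (simp add: N(2))
  show Z0: "0 < Z" using Zl exp_gt_zero[of "- B / lam"] by linarith
  have pe: "\<pi> = (\<lambda>u. exp (1 / lam * z u) / Z)" using \<pi> by auto
  show pm: "\<pi> \<in> borel_measurable N" unfolding pe using Em by measurable
  show pi: "integrable N \<pi>" unfolding pe using Ei by simp
  show p1: "(LINT u|N. \<pi> u) = 1" unfolding pe integral_divide_zero Z[symmetric] using Z0 by simp
  have p0: "0 \<le> \<pi> u" for u unfolding pe using Z0 by simp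
  have "(\<integral>\<^sup>+ u. ennreal (\<pi> u) \<partial>N) = ennreal (LINT u|N. \<pi> u)"
    by (rule nn_integral_eq_integral[OF pi]) (use p0 in auto)
  then show "\<pi> \<in> densities N" using pm p0 p1 by (simp add: densities_def)
  fix u
  show "lam * ln (\<pi> u) = z u - lam * ln Z"
    unfolding pe using Z0 lam by (simp add: ln_div right_diff_distrib)
  assume u: "u \<in> space N"
  have "exp (- 2 * B / lam) = exp (- B / lam) / exp (B / lam)"
    by (simp add: exp_diff[symmetric] field_simps)
  also have "\<dots> \<le> \<pi> u" unfolding pe by (intro frac_le E[OF u] Zu Z0) auto
  finally show "exp (- 2 * B / lam) \<le> \<pi> u" .
  have "\<pi> u \<le> exp (B / lam) / exp (- B / lam)" unfolding pe by (intro frac_le E[OF u] Zl) auto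
  also have "\<dots> = exp (2 * B / lam)" by (simp add: exp_diff[symmetric] field_simps)
  finally show "\<pi> u \<le> exp (2 * B / lam)" .
qed

text \<open>\<open>\<pi>\<close> is optimal for the reward \<open>z\<close> with optimal value lam
  ln Z. Replacing \<open>z\<close> by \<open>z'\<close> changes every value by k up to an error h:
  the supremum becomes at most lam ln Z + k + h, and the value of \<open>\<pi>\<close> at least lam
  ln Z + k - h. The constant k cancels in the difference and 2 h remains.\<close>

lemma gibbs_gap:
  fixes N :: "'u measure"
  assumes N: "finite_measure N" "measure N (space N) = 1" and z: "z \<in> borel_measurable N" "\<forall>u\<in>space N. \<bar>z u\<bar> \<le> B"
    and z': "z' \<in> borel_measurable N" "\<forall>u\<in>space N. \<bar>z' u\<bar> \<le> B"
    and lam: "0 < lam" and Z: "Z = (LINT u|N. exp (1 / lam * z u))" and \<pi>: "\<And>u. \<pi> u = exp (1 / lam * z u) / Z"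
    and osc: "\<forall>u\<in>space N. \<bar>z' u - z u - k\<bar> \<le> h"
  shows "integrable N (\<lambda>u. (z' u - lam * ln (\<pi> u)) * \<pi> u)"
    "(SUP \<rho>\<in>densities N. ext_integral N (\<lambda>u. (z' u - lam * ln (\<rho> u)) * \<rho> u)) \<le> ereal ((LINT u|N. (z' u - lam * ln (\<pi> u)) * \<pi> u) + 2 * h)"
    "ereal (LINT u|N. (z' u - lam * ln (\<pi> u)) * \<pi> u) \<le> (SUP \<rho>\<in>densities N. ext_integral N (\<lambda>u. (z' u - lam * ln (\<rho> u)) * \<rho> u))"
proof -
  interpret finite_measure N by fact
  note g = gibbs_density[OF N z lam Z \<pi>]
  have eq: "(z' u - lam * ln (\<pi> u)) * \<pi> u = (z' u - z u) * \<pi> u + lam * ln Z * \<pi> u" for u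
    by (simp add: g(11) algebra_simps)
  have zi: "integrable N (\<lambda>u. (z' u - z u) * \<pi> u)"
  proof (rule Bochner_Integration.integrable_bound[OF integrable_mult_right[OF g(9), of "2 * B"]])
    show "(\<lambda>u. (z' u - z u) * \<pi> u) \<in> borel_measurable N" using z(1) z'(1) g(4) by measurable
    show "AE u in N. norm ((z' u - z u) * \<pi> u) \<le> norm (2 * B * \<pi> u)"
    proof (intro AE_I2)
      fix u assume u: "u \<in> space N"
      have "\<bar>z' u - z u\<bar> \<le> \<bar>2 * B\<bar>" using z(2)[rule_format, OF u] z'(2)[rule_format, OF u] by linarith
      then show "norm ((z' u - z u) * \<pi> u) \<le> norm (2 * B * \<pi> u)"
        by (simp add: abs_mult mult_right_mono)
    qed
  qed
  show i: "integrable N (\<lambda>u. (z' u - lam * ln (\<pi> u)) * \<pi> u)"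
    unfolding eq using zi g(9) by simp
  have low: "lam * ln Z + k - h \<le> (LINT u|N. (z' u - lam * ln (\<pi> u)) * \<pi> u)"
  proof -
    have "(LINT u|N. (k - h) * \<pi> u + lam * ln Z * \<pi> u) \<le> (LINT u|N. (z' u - z u) * \<pi> u + lam * ln Z * \<pi> u)"
    proof (rule integral_mono)
      fix u assume u: "u \<in> space N"
      have "(k - h) * \<pi> u \<le> (z' u - z u) * \<pi> u"
        using osc[rule_format, OF u] g(6)[OF u] exp_gt_zero[of "- 2 * B / lam"] by (intro mult_right_mono) linarith+
      then show "(k - h) * \<pi> u + lam * ln Z * \<pi> u \<le> (z' u - z u) * \<pi> u + lam * ln Z * \<pi> u" by simp
    qed (use zi g(9) in auto)
    then show ?thesis unfolding eq using g(8,9) by simp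
  qed
  show "(SUP \<rho>\<in>densities N. ext_integral N (\<lambda>u. (z' u - lam * ln (\<rho> u)) * \<rho> u)) \<le> ereal ((LINT u|N. (z' u - lam * ln (\<pi> u)) * \<pi> u) + 2 * h)"
  proof (rule SUP_least)
    fix \<rho> assume "\<rho> \<in> densities N"
    then have \<rho>: "\<rho> \<in> borel_measurable N" "\<And>u. u \<in> space N \<Longrightarrow> 0 \<le> \<rho> u" "(\<integral>\<^sup>+ u. ennreal (\<rho> u) \<partial>N) = ennreal 1"
      by (auto simp: densities_def)
    have \<rho>i: "integrable N \<rho>" by (rule integrableI_nonneg) (use \<rho> in \<open>auto intro!: AE_I2\<close>)
    have \<rho>1: "(LINT u|N. \<rho> u) = 1"
      by (rule integral_eq_nn_integral[of \<rho> N, unfolded \<rho>(3), simplified]) (use \<rho> in \<open>auto intro!: AE_I2\<close>)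
    let ?h = "\<lambda>u. lam * (\<rho> u * ln Z + exp (1 / lam * z u) / Z - \<rho> u) + (k + h) * \<rho> u"
    have hi: "integrable N ?h" using \<rho>i g(3) by simp
    have "ext_integral N (\<lambda>u. (z' u - lam * ln (\<rho> u)) * \<rho> u) \<le> ereal (LINT u|N. ?h u)"
    proof (rule ext_integral_le[OF hi])
      show "(\<lambda>u. (z' u - lam * ln (\<rho> u)) * \<rho> u) \<in> borel_measurable N" using z'(1) \<rho>(1) by measurable
      fix u assume u: "u \<in> space N"
      have 1: "(z' u - z u) * \<rho> u \<le> (k + h) * \<rho> u"
        using osc[rule_format, OF u] \<rho>(2)[OF u] by (intro mult_right_mono) linarith+
      \<comment> \<open>The Gibbs variational inequality in pointwise form, from ln t \<le> t - 1
        with t the ratio of the Gibbs density to \<open>\<rho>\<close>. The right-hand side is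
        integrable for every density, whatever its entropy, and integrates to lam ln Z.\<close>
      have 2: "(z u - lam * ln (\<rho> u)) * \<rho> u \<le> lam * (\<rho> u * ln Z + exp (1 / lam * z u) / Z - \<rho> u)"
      proof (cases "\<rho> u = 0")
        case True
        then show ?thesis using g(10) lam by simp
      next
        case False
        then have r0: "0 < \<rho> u" using \<rho>(2)[OF u] by simp
        define t where "t = exp (1 / lam * z u) / (Z * \<rho> u)"
        have t0: "0 < t" using r0 g(10) by (simp add: t_def)
        have "ln t \<le> t - 1" by (rule ln_le_minus_one[OF t0])
        moreover have "ln t = z u / lam - ln Z - ln (\<rho> u)" using r0 g(10) by (simp add: t_def ln_div ln_mult)
        ultimately have "z u / lam - ln (\<rho> u) \<le> ln Z + t - 1" by linarith
        then have "lam * \<rho> u * (z u / lam - ln (\<rho> u)) \<le> lam * \<rho> u * (ln Z + t - 1)"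
          using lam r0 by (intro mult_left_mono) auto
        moreover have "lam * \<rho> u * (z u / lam - ln (\<rho> u)) = (z u - lam * ln (\<rho> u)) * \<rho> u" using lam by (simp add: field_simps)
        moreover have "\<rho> u * t = exp (1 / lam * z u) / Z" using r0 by (simp add: t_def)
        ultimately show ?thesis by (simp add: algebra_simps)
      qed
      show "(z' u - lam * ln (\<rho> u)) * \<rho> u \<le> ?h u" using 1 2 by (simp add: algebra_simps)
    qed
    also have "(LINT u|N. ?h u) = lam * ln Z + (k + h)"
    proof -
      have "(LINT u|N. ?h u) = (LINT u|N. lam * ln Z * \<rho> u + lam / Z * exp (1 / lam * z u) + (k + h - lam) * \<rho> u)"
        by (rule arg_cong[where f = "integral\<^sup>L N"]) (simp add: fun_eq_iff algebra_simps)
      also have "\<dots> = lam * ln Z * (LINT u|N. \<rho> u) + lam / Z * (LINT u|N. exp (1 / lam * z u)) + (k + h - lam) * (LINT u|N. \<rho> u)"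
        using \<rho>i g(3) by simp
      also have "\<dots> = lam * ln Z + (k + h)"
        unfolding \<rho>1 Z[symmetric] using g(10) by simp
      finally show ?thesis .
    qed
    also have "\<dots> \<le> (LINT u|N. (z' u - lam * ln (\<pi> u)) * \<pi> u) + 2 * h" using low by linarith
    finally show "ext_integral N (\<lambda>u. (z' u - lam * ln (\<rho> u)) * \<rho> u) \<le> ereal ((LINT u|N. (z' u - lam * ln (\<pi> u)) * \<pi> u) + 2 * h)" by simp
  qed
  show "ereal (LINT u|N. (z' u - lam * ln (\<pi> u)) * \<pi> u) \<le> (SUP \<rho>\<in>densities N. ext_integral N (\<lambda>u. (z' u - lam * ln (\<rho> u)) * \<rho> u))"
    unfolding ext_integral_eq[OF i, symmetric] by (rule SUP_upper[OF g(5)])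
qed

section \<open>Classical derivatives\<close>

lemma has_derivative_grad:
  assumes "w differentiable (at x)"
  shows "(w has_derivative (\<lambda>v. grad w x \<bullet> v)) (at x)"
proof -
  have d: "(w has_derivative frechet_derivative w (at x)) (at x)"
    using assms by (simp add: frechet_derivative_works)
  from linear_functional_repr[OF has_derivative_linear[OF d]]
  obtain q where q: "\<And>e. frechet_derivative w (at x) e = q \<bullet> e" by blast
  have "grad w x = q"
    by (simp add: grad_def D_list_def partial_deriv_def q vec_eq_iff inner_axis)
  then show ?thesis by (intro has_derivative_eq_rhs[OF d]) (simp add: q fun_eq_iff)
qed

text \<open>Row j of the Jacobian of \<open>grad w\<close> is the gradient of the j-th partial
  derivative, so the Jacobian first appears as the transpose of \<open>hess w\<close>.
  \<open>C2_symmetric\<close>, applied to that matrix, removes the transpose.\<close>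

lemma C_class_2_C2:
  assumes "C_class 2 w"
  shows "C2 w (grad w) (hess w)"
proof -
  have w: "\<And>x. w differentiable (at x)" "\<And>i x. partial_deriv i w differentiable (at x)"
    "\<And>i j. continuous_on UNIV (partial_deriv j (partial_deriv i w))"
    using assms by (auto simp: numeral_2_eq_2)
  have C: "C2 w (grad w) (\<lambda>x. transpose (hess w x))"
    unfolding C2_def
  proof (intro conjI allI)
    fix x
    show "(w has_derivative (\<lambda>v. grad w x \<bullet> v)) (at x)" by (rule has_derivative_grad[OF w(1)])
    show "(grad w has_derivative (\<lambda>v. transpose (hess w x) *v v)) (at x)"
    proof (rule has_derivative_componentwise_within[THEN iffD2, rule_format])
      fix e :: "real^'a" assume "e \<in> Basis"
      then obtain j where e: "e = axis j 1" by (auto simp: Basis_vec_def)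
      have "((partial_deriv j w) has_derivative (\<lambda>v. grad (partial_deriv j w) x \<bullet> v)) (at x)"
        by (rule has_derivative_grad[OF w(2)])
      moreover have "(\<lambda>x. grad w x \<bullet> e) = partial_deriv j w"
        by (simp add: e inner_axis grad_def D_list_def fun_eq_iff)
      moreover have "(\<lambda>v. (transpose (hess w x) *v v) \<bullet> e) = (\<lambda>v. grad (partial_deriv j w) x \<bullet> v)"
        unfolding e inner_axis by (simp add: fun_eq_iff matrix_vector_mult_def transpose_def hess_def grad_def D_list_def inner_vec_def)
      ultimately show "((\<lambda>x. grad w x \<bullet> e) has_derivative (\<lambda>v. (transpose (hess w x) *v v) \<bullet> e)) (at x)" by simp
    qed
    show "continuous_on UNIV (\<lambda>x. transpose (hess w x))"
      unfolding transpose_def hess_def D_list_def using w(3)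
      by (auto intro!: continuous_on_vec_lambda)
  qed
  have "transpose (hess w x) = hess w x" for x
  proof -
    have "transpose (hess w x) $ i $ j = transpose (hess w x) $ j $ i" for i j
      using C2_symmetric[OF C, of "axis i 1" x "axis j 1"]
      by (simp add: inner_axis' matrix_vector_mult_basis column_def)
    then show ?thesis by (simp add: transpose_def vec_eq_iff)
  qed
  then show ?thesis using C by simp
qed

lemma grad_eq:
  assumes "C2 w p H" shows "grad w = p"
proof
  fix x
  have "w differentiable (at x)" using C2D(1)[OF assms] by (auto simp: differentiable_def)
  then have "(\<lambda>v. grad w x \<bullet> v) = (\<lambda>v. p x \<bullet> v)"
    using has_derivative_unique[OF has_derivative_grad C2D(1)[OF assms]] by blast
  then have "grad w x \<bullet> (grad w x - p x) = p x \<bullet> (grad w x - p x)" by meson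
  then have "(grad w x - p x) \<bullet> (grad w x - p x) = 0" by (simp add: inner_diff_left)
  then show "grad w x = p x" by simp
qed

lemma C2_minus:
  assumes "C2 v p A" "C2 w q B" shows "C2 (\<lambda>x. v x - w x) (\<lambda>x. p x - q x) (\<lambda>x. A x - B x)"
  unfolding C2_def
proof (intro conjI allI)
  show "((\<lambda>x. v x - w x) has_derivative (\<lambda>h. (p x - q x) \<bullet> h)) (at x)" for x
    by (rule has_derivative_eq_rhs[OF has_derivative_diff[OF C2D(1)[OF assms(1)] C2D(1)[OF assms(2)]]])
       (simp add: inner_diff_left)
  show "((\<lambda>x. p x - q x) has_derivative (\<lambda>h. (A x - B x) *v h)) (at x)" for x
    by (rule has_derivative_eq_rhs[OF has_derivative_diff[OF C2D(2)[OF assms(1)] C2D(2)[OF assms(2)]]])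
       (simp add: matrix_vector_mult_diff_rdistrib)
qed (intro continuous_intros C2D[OF assms(1)] C2D[OF assms(2)])

section \<open>The control problem\<close>

text \<open>The control set is represented by the probability measure \<open>N\<close> alone, so
  nothing proved in the locale refers to the dimension \<open>l\<close> of the control
  space.\<close>

locale control_problem =
  fixes N :: "control measure" and m :: nat and r :: "real^'d \<Rightarrow> control \<Rightarrow> real"
    and b :: "real^'d \<Rightarrow> control \<Rightarrow> real^'d" and \<sigma> :: "real^'d \<Rightarrow> control \<Rightarrow> 'd \<Rightarrow> nat \<Rightarrow> real"
    and S :: "real^'d \<Rightarrow> control \<Rightarrow> real^'d^'d" and lam C0 \<alpha> :: real
  assumes N: "finite_measure N" "measure N (space N) = 1"
    and coeffs: "measurable_coeffs N m r b \<sigma>" and S: "S = diffusion m \<sigma>"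
    and pars: "0 < lam" "1 \<le> C0" "0 < \<alpha>" "\<alpha> < 1"
    and elliptic: "\<And>u x. u \<in> space N \<Longrightarrow> loewner_le (mat (1 / C0)) (S x u)"
    and bounds: "\<And>u. u \<in> space N \<Longrightarrow> norm_0a \<alpha> (\<lambda>x. r x u) \<le> ennreal C0"
      "\<And>u. u \<in> space N \<Longrightarrow> norm_0a \<alpha> (\<lambda>x. b x u) \<le> ennreal C0"
      "\<And>u. u \<in> space N \<Longrightarrow> norm_0a \<alpha> (\<lambda>x. S x u) \<le> ennreal C0"
begin

sublocale finite_measure N by (rule N)

lemma C0_nonneg: "0 \<le> C0" using pars by simp

lemma coeff_bounds:
  assumes "u \<in> space N"
  shows "\<bar>r x u\<bar> \<le> C0" "norm (b x u) \<le> real CARD('d) * C0" "norm (S x u) \<le> real CARD('d) * C0"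
    "dist x y \<le> 1 \<Longrightarrow> \<bar>r x u - r y u\<bar> \<le> C0 * dist x y powr \<alpha>"
    "dist x y \<le> 1 \<Longrightarrow> norm (b x u - b y u) \<le> real CARD('d) * C0 * dist x y powr \<alpha>"
    "dist x y \<le> 1 \<Longrightarrow> norm (S x u - S y u) \<le> real CARD('d) * C0 * dist x y powr \<alpha>"
proof -
  note nb = norm_0a_leD[OF bounds(1)[OF assms] C0_nonneg] norm_0a_leD[OF bounds(2)[OF assms] C0_nonneg]
    norm_0a_leD[OF bounds(3)[OF assms] C0_nonneg]
  show "\<bar>r x u\<bar> \<le> C0" using nb(1)[of x] by simp
  show "norm (b x u) \<le> real CARD('d) * C0" using order_trans[OF norm_le_card_infnorm(1) mult_left_mono[OF nb(3)[of x]]] by simp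
  show "norm (S x u) \<le> real CARD('d) * C0" using order_trans[OF norm_le_card_infnorm(2) mult_left_mono[OF nb(5)[of x]]] by simp
  have z: "x = y" if "\<not> 0 < dist x y" using that by simp
  show "\<bar>r x u - r y u\<bar> \<le> C0 * dist x y powr \<alpha>" if "dist x y \<le> 1"
    using nb(2)[of x y] that z by (cases "0 < dist x y") auto
  show "norm (b x u - b y u) \<le> real CARD('d) * C0 * dist x y powr \<alpha>" if "dist x y \<le> 1"
  proof (cases "0 < dist x y")
    case True
    from order_trans[OF norm_le_card_infnorm(1) mult_left_mono[OF nb(4)[OF True that]]] show ?thesis by (simp add: mult.assoc)
  qed (use z in auto)
  show "norm (S x u - S y u) \<le> real CARD('d) * C0 * dist x y powr \<alpha>" if "dist x y \<le> 1"
  proof (cases "0 < dist x y")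
    case True
    from order_trans[OF norm_le_card_infnorm(2) mult_left_mono[OF nb(6)[OF True that]]] show ?thesis by (simp add: mult.assoc)
  qed (use z in auto)
qed

lemma coeff_measurable:
  "r x \<in> borel_measurable N" "(\<lambda>u. b x u $ i) \<in> borel_measurable N" "(\<lambda>u. S x u $ i $ k) \<in> borel_measurable N"
proof -
  have m: "r x \<in> borel_measurable N" "b x \<in> borel_measurable N" "\<And>i j. j < m \<Longrightarrow> (\<lambda>u. \<sigma> x u i j) \<in> borel_measurable N"
    using coeffs by (auto simp: measurable_coeffs_def)
  show "r x \<in> borel_measurable N" by (rule m)
  have "(\<lambda>u. b x u \<bullet> axis i 1) \<in> borel_measurable N" using m(2) by measurable
  then show "(\<lambda>u. b x u $ i) \<in> borel_measurable N" by (simp add: inner_axis)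
  show "(\<lambda>u. S x u $ i $ k) \<in> borel_measurable N"
    unfolding S diffusion_def using m(3) by (auto intro!: borel_measurable_sum)
qed

lemma reward_eq: "reward r b S x p X u = r x u + (\<Sum>i\<in>UNIV. b x u $ i * p $ i) + 1/2 * (\<Sum>i\<in>UNIV. \<Sum>k\<in>UNIV. S x u $ i $ k * X $ k $ i)"
  by (simp add: reward_def inner_vec_def trace_def matrix_matrix_mult_def)

lemma reward_measurable: "(\<lambda>u. reward r b S x p X u) \<in> borel_measurable N"
  unfolding reward_eq
  by (intro borel_measurable_add borel_measurable_times borel_measurable_sum borel_measurable_const coeff_measurable)

definition reward_bound :: "real^'d \<Rightarrow> real^'d^'d \<Rightarrow> real" where
  "reward_bound p X = C0 + real CARD('d) * C0 * norm p + real CARD('d) * C0 * norm X"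

lemma reward_bounded:
  assumes "u \<in> space N"
  shows "\<bar>reward r b S x p X u\<bar> \<le> reward_bound p X"
proof -
  have "\<bar>b x u \<bullet> p\<bar> \<le> real CARD('d) * C0 * norm p"
    by (intro order_trans[OF Cauchy_Schwarz_ineq2] mult_right_mono coeff_bounds assms) auto
  moreover have "\<bar>trace (S x u ** X)\<bar> \<le> real CARD('d) * C0 * norm X"
    by (intro order_trans[OF abs_trace_mult_le] mult_right_mono coeff_bounds assms) auto
  moreover have "0 \<le> real CARD('d) * C0 * norm X" using C0_nonneg by simp
  ultimately show ?thesis using coeff_bounds(1)[OF assms, of x] unfolding reward_def reward_bound_def by linarith
qed

lemma reward_diff:
  "reward r b S x p X u - reward r b S x p' X' u = b x u \<bullet> (p - p') + 1/2 * trace (S x u ** (X - X'))"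
  by (simp add: reward_eq inner_vec_def trace_def matrix_matrix_mult_def right_diff_distrib sum_subtractf algebra_simps)

definition gibbs :: "(real^'d \<Rightarrow> real) \<Rightarrow> real^'d \<Rightarrow> control \<Rightarrow> real" where
  "gibbs w = gibbs_policy N lam r b S w"

definition gibbs_norm :: "(real^'d \<Rightarrow> real) \<Rightarrow> real^'d \<Rightarrow> real" where
  "gibbs_norm w x = (LINT u|N. exp (1/lam * reward r b S x (grad w x) (hess w x) u))"

lemma gibbs_eq: "gibbs w x u = exp (1/lam * reward r b S x (grad w x) (hess w x) u) / gibbs_norm w x"
  by (simp only: gibbs_def gibbs_policy_def gibbs_norm_def)

lemma gibbs_facts:
  defines "Bz w x \<equiv> reward_bound (grad w x) (hess w x)"
  shows "exp (- Bz w x / lam) \<le> gibbs_norm w x" "gibbs_norm w x \<le> exp (Bz w x / lam)"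
    "gibbs w x \<in> borel_measurable N" "gibbs w x \<in> densities N"
    "u \<in> space N \<Longrightarrow> 0 \<le> gibbs w x u" "u \<in> space N \<Longrightarrow> gibbs w x u \<le> exp (2 * Bz w x / lam)"
    "(LINT u|N. gibbs w x u) = 1" "integrable N (gibbs w x)"
    "lam * ln (gibbs w x u) = reward r b S x (grad w x) (hess w x) u - lam * ln (gibbs_norm w x)"
proof -
  have zb: "\<forall>u\<in>space N. \<bar>reward r b S x (grad w x) (hess w x) u\<bar> \<le> Bz w x"
    using reward_bounded unfolding Bz_def by blast
  note g = gibbs_density[OF N reward_measurable zb pars(1) gibbs_norm_def gibbs_eq]
  show "exp (- Bz w x / lam) \<le> gibbs_norm w x" "gibbs_norm w x \<le> exp (Bz w x / lam)"
    "gibbs w x \<in> borel_measurable N" "gibbs w x \<in> densities N"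
    "(LINT u|N. gibbs w x u) = 1" "integrable N (gibbs w x)"
    "lam * ln (gibbs w x u) = reward r b S x (grad w x) (hess w x) u - lam * ln (gibbs_norm w x)"
    using g by blast+
  show "u \<in> space N \<Longrightarrow> gibbs w x u \<le> exp (2 * Bz w x / lam)" by (rule g(7))
  show "u \<in> space N \<Longrightarrow> 0 \<le> gibbs w x u" using g(6)[of u] exp_gt_zero[of "- 2 * Bz w x / lam"] by linarith
qed

lemma integrable_gibbs_mult:
  assumes "f \<in> borel_measurable N" "\<And>u. u \<in> space N \<Longrightarrow> \<bar>f u\<bar> \<le> B"
  shows "integrable N (\<lambda>u. f u * gibbs w x u)"
proof (rule Bochner_Integration.integrable_bound[OF integrable_mult_right[OF gibbs_facts(8), of B]])
  show "(\<lambda>u. f u * gibbs w x u) \<in> borel_measurable N" using assms(1) gibbs_facts(3) by measurable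
  show "AE u in N. norm (f u * gibbs w x u) \<le> norm (B * gibbs w x u)"
  proof (intro AE_I2)
    fix u assume u: "u \<in> space N"
    have "\<bar>f u\<bar> \<le> \<bar>B\<bar>" using assms(2)[OF u] by linarith
    then show "norm (f u * gibbs w x u) \<le> norm (B * gibbs w x u)" by (simp add: abs_mult mult_right_mono)
  qed
qed

lemma gibbs_average_bound:
  assumes "f \<in> borel_measurable N" "\<And>u. u \<in> space N \<Longrightarrow> \<bar>f u\<bar> \<le> B"
  shows "\<bar>LINT u|N. f u * gibbs w x u\<bar> \<le> B"
proof -
  have i: "integrable N (\<lambda>u. f u * gibbs w x u)" by (rule integrable_gibbs_mult[OF assms])
  have "\<bar>LINT u|N. f u * gibbs w x u\<bar> \<le> (LINT u|N. \<bar>f u * gibbs w x u\<bar>)" by (rule integral_abs_bound)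
  also have "\<dots> \<le> (LINT u|N. B * gibbs w x u)"
  proof (rule integral_mono)
    fix u assume u: "u \<in> space N"
    show "\<bar>f u * gibbs w x u\<bar> \<le> B * gibbs w x u"
      unfolding abs_mult using gibbs_facts(5)[OF u] assms(2)[OF u] by (simp add: mult_right_mono)
  qed (use i gibbs_facts(8) in auto)
  also have "\<dots> = B" using gibbs_facts(7) by simp
  finally show ?thesis .
qed

definition avg_r :: "(real^'d \<Rightarrow> real) \<Rightarrow> real^'d \<Rightarrow> real" where
  "avg_r w x = (LINT u|N. (r x u - lam * ln (gibbs w x u)) * gibbs w x u)"

definition avg_b :: "(real^'d \<Rightarrow> real) \<Rightarrow> real^'d \<Rightarrow> real^'d" where
  "avg_b w x = (\<chi> i. LINT u|N. b x u $ i * gibbs w x u)"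

definition avg_S :: "(real^'d \<Rightarrow> real) \<Rightarrow> real^'d \<Rightarrow> real^'d^'d" where
  "avg_S w x = (\<chi> i k. LINT u|N. S x u $ i $ k * gibbs w x u)"

lemma comp_bounds:
  assumes "u \<in> space N" shows "\<bar>b x u $ i\<bar> \<le> real CARD('d) * C0" "\<bar>S x u $ i $ k\<bar> \<le> real CARD('d) * C0"
  using order_trans[OF component_le_norm_cart coeff_bounds(2)[OF assms]]
    order_trans[OF component_le_norm_cart order_trans[OF Finite_Cartesian_Product.norm_nth_le coeff_bounds(3)[OF assms]]] by auto

lemma gibbs_integrable:
  "integrable N (\<lambda>u. b x u $ i * gibbs w x u)" "integrable N (\<lambda>u. S x u $ i $ k * gibbs w x u)"
  "integrable N (\<lambda>u. (r x u - lam * ln (gibbs w x u)) * gibbs w x u)"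
proof -
  show "integrable N (\<lambda>u. b x u $ i * gibbs w x u)" by (rule integrable_gibbs_mult[OF coeff_measurable(2) comp_bounds(1)])
  show "integrable N (\<lambda>u. S x u $ i $ k * gibbs w x u)" by (rule integrable_gibbs_mult[OF coeff_measurable(3) comp_bounds(2)])
  show "integrable N (\<lambda>u. (r x u - lam * ln (gibbs w x u)) * gibbs w x u)"
  proof (rule integrable_gibbs_mult)
    show "(\<lambda>u. r x u - lam * ln (gibbs w x u)) \<in> borel_measurable N"
      using coeff_measurable(1) gibbs_facts(3) by measurable
    show "\<bar>r x u - lam * ln (gibbs w x u)\<bar> \<le> C0 + reward_bound (grad w x) (hess w x) + \<bar>lam * ln (gibbs_norm w x)\<bar>" if "u \<in> space N" for u
      using coeff_bounds(1)[OF that, of x] reward_bounded[OF that, of x "grad w x" "hess w x"] unfolding gibbs_facts(9) by linarith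
  qed
qed

lemma F_pi_gibbs_integral:
  "integrable N (\<lambda>u. (reward r b S x p X u - lam * ln (gibbs w x u)) * gibbs w x u)"
  "(LINT u|N. (reward r b S x p X u - lam * ln (gibbs w x u)) * gibbs w x u) =
     avg_r w x + avg_b w x \<bullet> p + 1/2 * trace (avg_S w x ** X)"
proof -
  have e: "(reward r b S x p X u - lam * ln (gibbs w x u)) * gibbs w x u =
    (r x u - lam * ln (gibbs w x u)) * gibbs w x u + (\<Sum>i\<in>UNIV. p $ i * (b x u $ i * gibbs w x u))
     + 1/2 * (\<Sum>i\<in>UNIV. \<Sum>k\<in>UNIV. X $ k $ i * (S x u $ i $ k * gibbs w x u))" for u
    by (simp add: reward_eq algebra_simps sum_distrib_left)
  note i = gibbs_integrable
  show "integrable N (\<lambda>u. (reward r b S x p X u - lam * ln (gibbs w x u)) * gibbs w x u)"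
    unfolding e using i by simp
  show "(LINT u|N. (reward r b S x p X u - lam * ln (gibbs w x u)) * gibbs w x u) =
     avg_r w x + avg_b w x \<bullet> p + 1/2 * trace (avg_S w x ** X)"
    unfolding e using i
    by (simp add: avg_r_def avg_b_def avg_S_def inner_vec_def trace_def matrix_matrix_mult_def mult.commute)
qed

lemma F_pi_gibbs:
  "F_pi N lam r b S (gibbs w x) x p X = ereal (avg_r w x + avg_b w x \<bullet> p + 1/2 * trace (avg_S w x ** X))"
  unfolding F_pi_def ext_integral_eq[OF F_pi_gibbs_integral(1)] F_pi_gibbs_integral(2) ..

lemma F_sup_gibbs_gap:
  assumes "\<And>u. u \<in> space N \<Longrightarrow> \<bar>b x u \<bullet> (p - grad w x) + 1/2 * trace (S x u ** (X - hess w x)) - k\<bar> \<le> h"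
    and "F_sup N lam r b S x p X = ereal y"
  shows "\<bar>y - (avg_r w x + avg_b w x \<bullet> p + 1/2 * trace (avg_S w x ** X))\<bar> \<le> 2 * h"
proof -
  define B where "B = max (reward_bound (grad w x) (hess w x)) (reward_bound p X)"
  have B: "\<forall>u\<in>space N. \<bar>reward r b S x (grad w x) (hess w x) u\<bar> \<le> B" "\<forall>u\<in>space N. \<bar>reward r b S x p X u\<bar> \<le> B"
    using reward_bounded unfolding B_def by (auto intro: max.coboundedI1 max.coboundedI2)
  have osc: "\<forall>u\<in>space N. \<bar>reward r b S x p X u - reward r b S x (grad w x) (hess w x) u - k\<bar> \<le> h"
    unfolding reward_diff using assms(1) by blast
  note g = gibbs_gap[OF N reward_measurable B(1) reward_measurable B(2) pars(1) gibbs_norm_def gibbs_eq osc]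
  have "ereal y \<le> ereal ((avg_r w x + avg_b w x \<bullet> p + 1/2 * trace (avg_S w x ** X)) + 2 * h)"
    using g(2) assms(2) unfolding F_sup_def F_pi_def F_pi_gibbs_integral(2) by simp
  moreover have "ereal (avg_r w x + avg_b w x \<bullet> p + 1/2 * trace (avg_S w x ** X)) \<le> ereal y"
    using g(3) assms(2) unfolding F_sup_def F_pi_def F_pi_gibbs_integral(2) by simp
  ultimately show ?thesis by simp
qed

end

section \<open>Qualitative regularity of the policy iterates\<close>

lemma deriv_seminorm_finite:
  assumes "deriv_seminorm k w < \<infinity>"
  obtains B where "0 \<le> B" "\<And>is x. length is = k \<Longrightarrow> \<bar>D_list is w x\<bar> \<le> B"
proof -
  obtain B where B: "deriv_seminorm k w = ennreal B" "0 \<le> B" using assms by (cases "deriv_seminorm k w") auto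
  have "\<bar>D_list is w x\<bar> \<le> B" if "length is = k" for "is" x
  proof -
    have "sup_norm (D_list is w) \<le> deriv_seminorm k w"
      unfolding deriv_seminorm_def by (rule SUP_upper) (use that in simp)
    then show ?thesis unfolding B(1) sup_norm_le_iff[OF B(2)] by simp
  qed
  with B(2) show ?thesis using that by blast
qed

lemma deriv_hoelder_finite:
  assumes "deriv_hoelder k \<alpha> w < \<infinity>"
  obtains B where "0 \<le> B" "\<And>is x y. length is = k \<Longrightarrow> dist x y \<le> 1 \<Longrightarrow> \<bar>D_list is w x - D_list is w y\<bar> \<le> B * dist x y powr \<alpha>"
proof -
  obtain B where B: "deriv_hoelder k \<alpha> w = ennreal B" "0 \<le> B" using assms by (cases "deriv_hoelder k \<alpha> w") auto
  have "\<bar>D_list is w x - D_list is w y\<bar> \<le> B * dist x y powr \<alpha>" if "length is = k" "dist x y \<le> 1" for "is" x y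
  proof (cases "x = y")
    case False
    have "hoelder_seminorm \<alpha> (D_list is w) \<le> deriv_hoelder k \<alpha> w"
      unfolding deriv_hoelder_def by (rule SUP_upper) (use that in simp)
    then show ?thesis unfolding B(1) hoelder_seminorm_le_iff[OF B(2)] using that False by simp
  qed simp
  with B(2) show ?thesis using that by blast
qed

text \<open>The qualitative information that a policy step consumes and reproduces: the Gibbs
  weights depend on x through the first and second derivatives of the previous iterate. Sizes are
  not recorded, since they are not uniform in n.\<close>

definition regular :: "real \<Rightarrow> (real^'d \<Rightarrow> real) \<Rightarrow> bool" where
  "regular \<alpha> w \<longleftrightarrow> C_class 2 w \<and> deriv_seminorm 1 w < \<infinity> \<and> deriv_seminorm 2 w < \<infinity> \<and>
     deriv_hoelder 1 \<alpha> w < \<infinity> \<and> deriv_hoelder 2 \<alpha> w < \<infinity>"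

lemma hoelder_space_regular:
  assumes "w \<in> hoelder_space 2 \<alpha>" shows "regular \<alpha> w"
proof -
  have "norm_ka 2 \<alpha> w < \<infinity>" "C_class 2 w" using assms by (auto simp: hoelder_space_def)
  then show ?thesis
    unfolding regular_def norm_ka_def by (auto simp: numeral_2_eq_2 atMost_Suc)
qed

lemma norm_2_finite:
  assumes "norm_k 2 w < \<infinity>" shows "deriv_seminorm 1 w < \<infinity>" "deriv_seminorm 2 w < \<infinity>"
  using assms unfolding norm_k_def by (auto simp: numeral_2_eq_2 atMost_Suc)

section \<open>Hoelder calculus for families depending on the control\<close>

text \<open>Families indexed by \<open>u\<close> let one set of closure rules serve the
  coefficients, the Gibbs weights and, as families constant in \<open>u\<close>, their averages.
  Uniformity of the constant in \<open>u\<close> is what survives integration over the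
  controls.\<close>

definition unif_hoelder :: "'u set \<Rightarrow> real \<Rightarrow> (real^'d \<Rightarrow> 'u \<Rightarrow> real) \<Rightarrow> bool" where
  "unif_hoelder U \<alpha> g \<longleftrightarrow> (\<exists>B\<ge>0. \<forall>u\<in>U. \<forall>x. \<bar>g x u\<bar> \<le> B \<and>
     (\<forall>y. dist x y \<le> 1 \<longrightarrow> \<bar>g x u - g y u\<bar> \<le> B * dist x y powr \<alpha>))"

lemma unif_hoelderI:
  assumes "\<And>u x. u \<in> U \<Longrightarrow> \<bar>g x u\<bar> \<le> A" "0 \<le> A" "0 \<le> B"
    "\<And>u x y. u \<in> U \<Longrightarrow> dist x y \<le> 1 \<Longrightarrow> \<bar>g x u - g y u\<bar> \<le> B * dist x y powr \<alpha>"
  shows "unif_hoelder U \<alpha> g"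
  unfolding unif_hoelder_def
proof (intro exI[of _ "max A B"] conjI ballI allI impI)
  fix u x y assume u: "u \<in> U"
  show "\<bar>g x u\<bar> \<le> max A B" using assms(1)[OF u, of x] by simp
  show "\<bar>g x u - g y u\<bar> \<le> max A B * dist x y powr \<alpha>" if "dist x y \<le> 1"
    by (rule order_trans[OF assms(4)[OF u that]]) (intro mult_right_mono, auto)
qed (use assms(2) in simp)

lemma unif_hoelderE:
  assumes "unif_hoelder U \<alpha> g"
  obtains B where "0 \<le> B" "\<And>u x. u \<in> U \<Longrightarrow> \<bar>g x u\<bar> \<le> B"
    "\<And>u x y. u \<in> U \<Longrightarrow> dist x y \<le> 1 \<Longrightarrow> \<bar>g x u - g y u\<bar> \<le> B * dist x y powr \<alpha>"
  using assms unfolding unif_hoelder_def by blast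

lemma unif_hoelder_const: "unif_hoelder U \<alpha> (\<lambda>x u. c)"
  by (rule unif_hoelderI[of _ _ "\<bar>c\<bar>" 0]) auto

lemma unif_hoelder_add:
  assumes "unif_hoelder U \<alpha> f" "unif_hoelder U \<alpha> g" shows "unif_hoelder U \<alpha> (\<lambda>x u. f x u + g x u)"
proof -
  obtain A where A: "0 \<le> A" "\<And>u x. u \<in> U \<Longrightarrow> \<bar>f x u\<bar> \<le> A"
    "\<And>u x y. u \<in> U \<Longrightarrow> dist x y \<le> 1 \<Longrightarrow> \<bar>f x u - f y u\<bar> \<le> A * dist x y powr \<alpha>"
    using unif_hoelderE[OF assms(1)] by blast
  obtain B where B: "0 \<le> B" "\<And>u x. u \<in> U \<Longrightarrow> \<bar>g x u\<bar> \<le> B"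
    "\<And>u x y. u \<in> U \<Longrightarrow> dist x y \<le> 1 \<Longrightarrow> \<bar>g x u - g y u\<bar> \<le> B * dist x y powr \<alpha>"
    using unif_hoelderE[OF assms(2)] by blast
  show ?thesis
  proof (rule unif_hoelderI[of _ _ "A + B" "A + B"])
    fix u x y assume u: "u \<in> U"
    show "\<bar>f x u + g x u\<bar> \<le> A + B" using A(2)[OF u, of x] B(2)[OF u, of x] by linarith
    show "\<bar>f x u + g x u - (f y u + g y u)\<bar> \<le> (A + B) * dist x y powr \<alpha>" if "dist x y \<le> 1"
      using A(3)[OF u that] B(3)[OF u that] unfolding distrib_right by linarith
  qed (use A B in auto)
qed

lemma unif_hoelder_mult:
  assumes "unif_hoelder U \<alpha> f" "unif_hoelder U \<alpha> g" shows "unif_hoelder U \<alpha> (\<lambda>x u. f x u * g x u)"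
proof -
  obtain A where A: "0 \<le> A" "\<And>u x. u \<in> U \<Longrightarrow> \<bar>f x u\<bar> \<le> A"
    "\<And>u x y. u \<in> U \<Longrightarrow> dist x y \<le> 1 \<Longrightarrow> \<bar>f x u - f y u\<bar> \<le> A * dist x y powr \<alpha>"
    using unif_hoelderE[OF assms(1)] by blast
  obtain B where B: "0 \<le> B" "\<And>u x. u \<in> U \<Longrightarrow> \<bar>g x u\<bar> \<le> B"
    "\<And>u x y. u \<in> U \<Longrightarrow> dist x y \<le> 1 \<Longrightarrow> \<bar>g x u - g y u\<bar> \<le> B * dist x y powr \<alpha>"
    using unif_hoelderE[OF assms(2)] by blast
  show ?thesis
  proof (rule unif_hoelderI[of _ _ "A * B" "2 * A * B"])
    fix u x y assume u: "u \<in> U"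
    show "\<bar>f x u * g x u\<bar> \<le> A * B"
      unfolding abs_mult using A(1) A(2)[OF u] B(2)[OF u] by (intro mult_mono) auto
    assume d: "dist x y \<le> 1"
    have "f x u * g x u - f y u * g y u = f x u * (g x u - g y u) + (f x u - f y u) * g y u" by (simp add: algebra_simps)
    moreover have "\<bar>f x u * (g x u - g y u)\<bar> \<le> A * (B * dist x y powr \<alpha>)"
      unfolding abs_mult using A(1) A(2)[OF u] B(3)[OF u d] by (intro mult_mono) auto
    moreover have "\<bar>(f x u - f y u) * g y u\<bar> \<le> (A * dist x y powr \<alpha>) * B"
      unfolding abs_mult using A(1) A(3)[OF u d] B(2)[OF u] by (intro mult_mono) auto
    ultimately show "\<bar>f x u * g x u - f y u * g y u\<bar> \<le> 2 * A * B * dist x y powr \<alpha>"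
      by (simp add: algebra_simps)
  qed (use A B in auto)
qed

lemma unif_hoelder_sum:
  assumes "finite I" "\<And>i. i \<in> I \<Longrightarrow> unif_hoelder U \<alpha> (f i)"
  shows "unif_hoelder U \<alpha> (\<lambda>x u. \<Sum>i\<in>I. f i x u)"
  using assms by (induction I rule: finite_induct) (auto intro: unif_hoelder_const unif_hoelder_add)

lemma unif_hoelder_comp:
  assumes "unif_hoelder U \<alpha> g" and I: "\<And>u x. u \<in> U \<Longrightarrow> g x u \<in> I"
    and f: "\<And>s t. s \<in> I \<Longrightarrow> t \<in> I \<Longrightarrow> s \<le> t \<Longrightarrow> \<bar>f s - f t\<bar> \<le> L * (t - s)" "\<And>s. s \<in> I \<Longrightarrow> \<bar>f s\<bar> \<le> M" "0 \<le> L" "0 \<le> M"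
  shows "unif_hoelder U \<alpha> (\<lambda>x u. f (g x u))"
proof -
  obtain B where B: "0 \<le> B" "\<And>u x. u \<in> U \<Longrightarrow> \<bar>g x u\<bar> \<le> B"
    "\<And>u x y. u \<in> U \<Longrightarrow> dist x y \<le> 1 \<Longrightarrow> \<bar>g x u - g y u\<bar> \<le> B * dist x y powr \<alpha>"
    using unif_hoelderE[OF assms(1)] by blast
  have L: "\<bar>f s - f t\<bar> \<le> L * \<bar>s - t\<bar>" if "s \<in> I" "t \<in> I" for s t
  proof (cases "s \<le> t")
    case True
    then have "\<bar>s - t\<bar> = t - s" by simp
    then show ?thesis using f(1)[OF that True] by simp
  next
    case False
    then have "\<bar>s - t\<bar> = s - t" by simp
    then show ?thesis using f(1)[OF that(2,1)] False by (simp add: abs_minus_commute)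
  qed
  show ?thesis
  proof (rule unif_hoelderI[of _ _ M "L * B"])
    fix u x y assume u: "u \<in> U"
    show "\<bar>f (g x u)\<bar> \<le> M" by (rule f(2)[OF I[OF u]])
    assume d: "dist x y \<le> 1"
    have "\<bar>f (g x u) - f (g y u)\<bar> \<le> L * \<bar>g x u - g y u\<bar>" by (rule L[OF I[OF u] I[OF u]])
    also have "\<dots> \<le> L * (B * dist x y powr \<alpha>)" by (intro mult_left_mono B(3)[OF u d] f(3))
    finally show "\<bar>f (g x u) - f (g y u)\<bar> \<le> L * B * dist x y powr \<alpha>" by simp
  qed (use B f in auto)
qed

context control_problem
begin

lemma unif_hoelder_integral:
  assumes g: "unif_hoelder (space N) \<alpha> g" and m: "\<And>x. (\<lambda>u. g x u) \<in> borel_measurable N"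
  shows "unif_hoelder (space N) \<alpha> (\<lambda>x u. LINT v|N. g x v)"
proof -
  obtain B where B: "0 \<le> B" "\<And>u x. u \<in> space N \<Longrightarrow> \<bar>g x u\<bar> \<le> B"
    "\<And>u x y. u \<in> space N \<Longrightarrow> dist x y \<le> 1 \<Longrightarrow> \<bar>g x u - g y u\<bar> \<le> B * dist x y powr \<alpha>"
    using unif_hoelderE[OF assms(1)] by blast
  have bd: "\<bar>LINT v|N. h v\<bar> \<le> K" if "h \<in> borel_measurable N" "\<And>v. v \<in> space N \<Longrightarrow> \<bar>h v\<bar> \<le> K" for h :: "control \<Rightarrow> real" and K :: real
  proof -
    have i: "integrable N h" by (rule integrable_const_bound[where B = K, OF _ that(1)]) (use that(2) in \<open>auto intro!: AE_I2\<close>)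
    have "\<bar>LINT v|N. h v\<bar> \<le> (LINT v|N. \<bar>h v\<bar>)" by (rule integral_abs_bound)
    also have "\<dots> \<le> (LINT v|N. K)" by (intro integral_mono) (use i that(2) in auto)
    also have "\<dots> = K" using N(2) by simp
    finally show ?thesis .
  qed
  have i: "integrable N (g x)" for x
    by (rule integrable_const_bound[where B = B, OF _ m]) (use B(2) in \<open>auto intro!: AE_I2\<close>)
  show ?thesis
  proof (rule unif_hoelderI[of _ _ B B])
    fix u x y
    show "\<bar>LINT v|N. g x v\<bar> \<le> B" by (rule bd[OF m B(2)])
    assume d: "dist x y \<le> 1"
    have "(LINT v|N. g x v) - (LINT v|N. g y v) = (LINT v|N. g x v - g y v)" using i by simp
    also have "\<bar>\<dots>\<bar> \<le> B * dist x y powr \<alpha>" by (rule bd) (use m B(3) d in auto)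
    finally show "\<bar>(LINT v|N. g x v) - (LINT v|N. g y v)\<bar> \<le> B * dist x y powr \<alpha>" .
  qed (use B in auto)
qed

lemma unif_hoelder_coeffs:
  "unif_hoelder (space N) \<alpha> r" "unif_hoelder (space N) \<alpha> (\<lambda>x u. b x u $ i)" "unif_hoelder (space N) \<alpha> (\<lambda>x u. S x u $ i $ k)"
proof -
  show "unif_hoelder (space N) \<alpha> r"
    by (rule unif_hoelderI[of _ _ C0 C0]) (use coeff_bounds C0_nonneg in auto)
  show "unif_hoelder (space N) \<alpha> (\<lambda>x u. b x u $ i)"
    using order_trans[OF component_le_norm_cart coeff_bounds(5)]
    by (intro unif_hoelderI[of _ _ "real CARD('d) * C0" "real CARD('d) * C0"]) (use comp_bounds C0_nonneg in auto)
  show "unif_hoelder (space N) \<alpha> (\<lambda>x u. S x u $ i $ k)"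
    using order_trans[OF component_le_norm_cart order_trans[OF Finite_Cartesian_Product.norm_nth_le coeff_bounds(6)]]
    by (intro unif_hoelderI[of _ _ "real CARD('d) * C0" "real CARD('d) * C0"]) (use comp_bounds C0_nonneg in auto)
qed

lemma unif_hoelder_derivs:
  assumes "regular \<alpha> w"
  shows "unif_hoelder (space N) \<alpha> (\<lambda>x u. grad w x $ i)" "unif_hoelder (space N) \<alpha> (\<lambda>x u. hess w x $ i $ k)"
proof -
  have w: "deriv_seminorm 1 w < \<infinity>" "deriv_seminorm 2 w < \<infinity>" "deriv_hoelder 1 \<alpha> w < \<infinity>" "deriv_hoelder 2 \<alpha> w < \<infinity>"
    using assms by (auto simp: regular_def)
  obtain A1 where A1: "0 \<le> A1" "\<And>is x. length is = 1 \<Longrightarrow> \<bar>D_list is w x\<bar> \<le> A1" using deriv_seminorm_finite[OF w(1)] by blast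
  obtain A2 where A2: "0 \<le> A2" "\<And>is x. length is = 2 \<Longrightarrow> \<bar>D_list is w x\<bar> \<le> A2" using deriv_seminorm_finite[OF w(2)] by blast
  obtain B1 where B1: "0 \<le> B1" "\<And>is x y. length is = 1 \<Longrightarrow> dist x y \<le> 1 \<Longrightarrow> \<bar>D_list is w x - D_list is w y\<bar> \<le> B1 * dist x y powr \<alpha>"
    using deriv_hoelder_finite[OF w(3)] by blast
  obtain B2 where B2: "0 \<le> B2" "\<And>is x y. length is = 2 \<Longrightarrow> dist x y \<le> 1 \<Longrightarrow> \<bar>D_list is w x - D_list is w y\<bar> \<le> B2 * dist x y powr \<alpha>"
    using deriv_hoelder_finite[OF w(4)] by blast
  show "unif_hoelder (space N) \<alpha> (\<lambda>x u. grad w x $ i)"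
    by (rule unif_hoelderI[of _ _ A1 B1]) (use A1 B1 in \<open>auto simp: grad_def\<close>)
  show "unif_hoelder (space N) \<alpha> (\<lambda>x u. hess w x $ i $ k)"
    by (rule unif_hoelderI[of _ _ A2 B2]) (use A2 B2 in \<open>auto simp: hess_def\<close>)
qed

text \<open>The exponent takes values in a fixed interval of half-length B/lam, and the
  normalisation lies between the exponentials of the end points. On these ranges exp, the reciprocal
  and ln are bounded and Lipschitz, so composition preserves the Hoelder property.\<close>

lemma unif_hoelder_gibbs:
  assumes "regular \<alpha> w"
  shows "unif_hoelder (space N) \<alpha> (\<lambda>x u. gibbs w x u)" "unif_hoelder (space N) \<alpha> (\<lambda>x u. lam * ln (gibbs w x u))"
proof -
  define z where "z x u = reward r b S x (grad w x) (hess w x) u" for x u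
  have z: "unif_hoelder (space N) \<alpha> z"
    unfolding z_def reward_eq
    by (intro unif_hoelder_add unif_hoelder_mult unif_hoelder_sum unif_hoelder_const unif_hoelder_coeffs
        unif_hoelder_derivs[OF assms] finite)
  then obtain B where B: "0 \<le> B" "\<And>u x. u \<in> space N \<Longrightarrow> \<bar>z x u\<bar> \<le> B"
    by (elim unif_hoelderE) blast
  define E where "E x u = exp (1 / lam * z x u)" for x u
  have zl: "unif_hoelder (space N) \<alpha> (\<lambda>x u. 1 / lam * z x u)" by (intro unif_hoelder_mult unif_hoelder_const z)
  have lz: "1 / lam * z x u \<in> {-(B / lam)..B / lam}" if "u \<in> space N" for u x
    using B(2)[OF that, of x] pars(1) by (auto simp: abs_le_iff divide_right_mono field_simps)
  have E: "unif_hoelder (space N) \<alpha> E"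
    unfolding E_def
  proof (rule unif_hoelder_comp[OF zl lz, where f = exp and L = "exp (B / lam)" and M = "exp (B / lam)"])
    fix s t :: real assume st: "s \<in> {-(B / lam)..B / lam}" "t \<in> {-(B / lam)..B / lam}" "s \<le> t"
    have "exp t * (1 + (s - t)) \<le> exp t * exp (s - t)" by (intro mult_left_mono exp_ge_add_one_self) auto
    also have "\<dots> = exp s" by (simp flip: exp_add)
    finally have "exp t - exp s \<le> exp t * (t - s)" by (simp add: algebra_simps)
    also have "\<dots> \<le> exp (B / lam) * (t - s)" using st by (intro mult_right_mono) auto
    finally show "\<bar>exp s - exp t\<bar> \<le> exp (B / lam) * (t - s)" using st by simp
  qed auto
  have Em: "(\<lambda>u. E x u) \<in> borel_measurable N" for x
    using reward_measurable[of x "grad w x" "hess w x"] unfolding E_def z_def by measurable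
  have Zi: "gibbs_norm w x = (LINT v|N. E x v)" for x by (simp add: gibbs_norm_def E_def z_def)
  have Zh: "unif_hoelder (space N) \<alpha> (\<lambda>x u. gibbs_norm w x)"
    unfolding Zi by (rule unif_hoelder_integral[OF E Em])
  define c where "c = exp (- B / lam)"
  have c: "0 < c" by (simp add: c_def)
  have Zb: "c \<le> gibbs_norm w x" "gibbs_norm w x \<le> exp (B / lam)" for x
    using gibbs_density(1,2)[OF N reward_measurable _ pars(1) gibbs_norm_def gibbs_eq, of x w B] B(2)
    by (auto simp: z_def c_def)
  have Zin: "gibbs_norm w x \<in> {c..exp (B / lam)}" for x using Zb by auto
  have inv: "unif_hoelder (space N) \<alpha> (\<lambda>x u. 1 / gibbs_norm w x)"
  proof (rule unif_hoelder_comp[OF Zh, where f = "\<lambda>s. 1 / s" and L = "1 / c^2" and M = "1 / c" and I = "{c..exp (B / lam)}"])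
    fix s t :: real assume st: "s \<in> {c..exp (B / lam)}" "t \<in> {c..exp (B / lam)}" "s \<le> t"
    have s0: "0 < s" "0 < t" using st c by auto
    have "\<bar>1 / s - 1 / t\<bar> = (t - s) / (s * t)" using s0 st by (simp add: field_simps abs_if)
    also have "\<dots> \<le> (t - s) / (c * c)" using st c by (intro divide_left_mono mult_mono) auto
    finally show "\<bar>1 / s - 1 / t\<bar> \<le> 1 / c^2 * (t - s)" by (simp add: power2_eq_square)
  qed (use c Zb in \<open>auto intro: frac_le\<close>)
  have "gibbs w x u = E x u * (1 / gibbs_norm w x)" for x u by (simp add: gibbs_eq E_def z_def)
  then show "unif_hoelder (space N) \<alpha> (\<lambda>x u. gibbs w x u)" by (simp only:) (intro unif_hoelder_mult E inv)
  have lnZ: "unif_hoelder (space N) \<alpha> (\<lambda>x u. ln (gibbs_norm w x))"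
  proof (rule unif_hoelder_comp[OF Zh, where f = ln and L = "1 / c" and M = "B / lam" and I = "{c..exp (B / lam)}"])
    fix s t :: real assume st: "s \<in> {c..exp (B / lam)}" "t \<in> {c..exp (B / lam)}" "s \<le> t"
    have s0: "0 < s" "0 < t" using st c by auto
    have "ln t - ln s \<le> (t - s) / s" by (rule ln_diff_le[OF s0(2,1)])
    also have "\<dots> \<le> (t - s) / c" using st c by (intro divide_left_mono) auto
    finally show "\<bar>ln s - ln t\<bar> \<le> 1 / c * (t - s)" using st s0 by simp
  next
    fix s assume s: "s \<in> {c..exp (B / lam)}"
    then have s0: "0 < s" using c by auto
    have "ln c \<le> ln s" by (rule iffD2[OF ln_le_cancel_iff[OF c s0]]) (use s in simp)
    moreover have "ln s \<le> ln (exp (B / lam))" by (rule iffD2[OF ln_le_cancel_iff[OF s0 exp_gt_zero]]) (use s in simp)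
    ultimately show "\<bar>ln s\<bar> \<le> B / lam" by (simp add: c_def abs_le_iff)
  qed (use c Zb B pars in auto)
  have "lam * ln (gibbs w x u) = z x u + (- lam) * ln (gibbs_norm w x)" for x u
    by (simp add: gibbs_facts(9) z_def)
  then show "unif_hoelder (space N) \<alpha> (\<lambda>x u. lam * ln (gibbs w x u))"
    by (simp only:) (intro unif_hoelder_add unif_hoelder_mult unif_hoelder_const z lnZ)
qed

lemma averaged_coeffs_hoelder:
  assumes "regular \<alpha> w"
  shows "unif_hoelder (space N) \<alpha> (\<lambda>x u. avg_r w x)" "unif_hoelder (space N) \<alpha> (\<lambda>x u. avg_b w x $ i)" "unif_hoelder (space N) \<alpha> (\<lambda>x u. avg_S w x $ i $ k)"
proof -
  note g = unif_hoelder_gibbs[OF assms]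
  have "unif_hoelder (space N) \<alpha> (\<lambda>x u. (r x u + (-1) * (lam * ln (gibbs w x u))) * gibbs w x u)"
    by (intro unif_hoelder_add unif_hoelder_mult unif_hoelder_const unif_hoelder_coeffs g)
  then have "unif_hoelder (space N) \<alpha> (\<lambda>x u. (r x u - lam * ln (gibbs w x u)) * gibbs w x u)" by simp
  then show "unif_hoelder (space N) \<alpha> (\<lambda>x u. avg_r w x)" unfolding avg_r_def
    by (rule unif_hoelder_integral) (use gibbs_integrable(3) in \<open>rule borel_measurable_integrable\<close>)
  have "unif_hoelder (space N) \<alpha> (\<lambda>x u. b x u $ i * gibbs w x u)" by (intro unif_hoelder_mult unif_hoelder_coeffs g)
  then have "unif_hoelder (space N) \<alpha> (\<lambda>x u. LINT u|N. b x u $ i * gibbs w x u)"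
    by (rule unif_hoelder_integral) (use gibbs_integrable(1) in \<open>rule borel_measurable_integrable\<close>)
  then show "unif_hoelder (space N) \<alpha> (\<lambda>x u. avg_b w x $ i)" by (simp add: avg_b_def)
  have "unif_hoelder (space N) \<alpha> (\<lambda>x u. S x u $ i $ k * gibbs w x u)" by (intro unif_hoelder_mult unif_hoelder_coeffs g)
  then have "unif_hoelder (space N) \<alpha> (\<lambda>x u. LINT u|N. S x u $ i $ k * gibbs w x u)"
    by (rule unif_hoelder_integral) (use gibbs_integrable(2) in \<open>rule borel_measurable_integrable\<close>)
  then show "unif_hoelder (space N) \<alpha> (\<lambda>x u. avg_S w x $ i $ k)" by (simp add: avg_S_def)
qed

lemma space_nonempty: "space N \<noteq> {}"
  using N(2) by auto

lemma norm_0a_from_components: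
  fixes f :: "real^'d \<Rightarrow> 'b::euclidean_space"
  assumes h: "\<And>e. e \<in> Basis \<Longrightarrow> unif_hoelder (space N) \<alpha> (\<lambda>x u. f x \<bullet> e)"
  shows "\<exists>A\<ge>0. norm_0a \<alpha> f \<le> ennreal A"
proof -
  obtain u where u: "u \<in> space N" using space_nonempty by blast
  have "\<exists>B\<ge>0. \<forall>x. \<bar>f x \<bullet> e\<bar> \<le> B \<and> (\<forall>y. dist x y \<le> 1 \<longrightarrow> \<bar>f x \<bullet> e - f y \<bullet> e\<bar> \<le> B * dist x y powr \<alpha>)" if "e \<in> Basis" for e
    using h[OF that] u unfolding unif_hoelder_def by blast
  then obtain B where B: "\<And>e. e \<in> Basis \<Longrightarrow> 0 \<le> B e" "\<And>e x. e \<in> Basis \<Longrightarrow> \<bar>f x \<bullet> e\<bar> \<le> B e"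
     "\<And>e x y. e \<in> Basis \<Longrightarrow> dist x y \<le> 1 \<Longrightarrow> \<bar>f x \<bullet> e - f y \<bullet> e\<bar> \<le> B e * dist x y powr \<alpha>" by metis
  define A where "A = sum B Basis"
  have A: "0 \<le> A" "\<And>e. e \<in> Basis \<Longrightarrow> B e \<le> A" unfolding A_def using B(1) by (auto intro!: sum_nonneg member_le_sum)
  have inf: "infnorm v \<le> K" if "\<And>e. e \<in> Basis \<Longrightarrow> \<bar>v \<bullet> e\<bar> \<le> K" for v :: 'b and K
    unfolding infnorm_Max using that by (intro Max.boundedI) auto
  have "norm_0a \<alpha> f \<le> ennreal (A + A)"
  proof (rule norm_0a_leI[of f A A])
    show "infnorm (f x) \<le> A" for x using B(2) A(2) by (intro inf) (meson order_trans)
    show "infnorm (f x - f y) \<le> A * dist x y powr \<alpha>" if "0 < dist x y" "dist x y \<le> 1" for x y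
    proof (rule inf)
      fix e :: 'b assume e: "e \<in> Basis"
      have "\<bar>(f x - f y) \<bullet> e\<bar> \<le> B e * dist x y powr \<alpha>" using B(3)[OF e that(2)] by (simp add: inner_diff_left)
      also have "\<dots> \<le> A * dist x y powr \<alpha>" using A(2)[OF e] by (intro mult_right_mono) auto
      finally show "\<bar>(f x - f y) \<bullet> e\<bar> \<le> A * dist x y powr \<alpha>" .
    qed
  qed (use A in auto)
  then show ?thesis using A by (intro exI[of _ "A + A"]) auto
qed

lemma S_symmetric: "S x u $ i $ k = S x u $ k $ i"
  by (simp add: S diffusion_def mult.commute)

lemma S_elliptic:
  assumes "u \<in> space N" shows "norm v ^ 2 / C0 \<le> v \<bullet> (S x u *v v)"
proof -
  have "mat (1 / C0) *v v = (1 / C0) *\<^sub>R v"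
    by (simp add: matrix_vector_mult_def mat_def vec_eq_iff if_distrib[of "\<lambda>x. x * _"] cong: if_cong)
  moreover have "v \<bullet> (mat (1 / C0) *v v) \<le> v \<bullet> (S x u *v v)" using elliptic[OF assms, of x] unfolding loewner_le_def by blast
  ultimately show ?thesis by (simp add: power2_norm_eq_inner)
qed

lemma quadratic_avg_S: "v \<bullet> (avg_S w x *v v) = (LINT u|N. (v \<bullet> (S x u *v v)) * gibbs w x u)"
  "integrable N (\<lambda>u. (v \<bullet> (S x u *v v)) * gibbs w x u)"
proof -
  have e: "(v \<bullet> (S x u *v v)) * gibbs w x u = (\<Sum>i\<in>UNIV. \<Sum>k\<in>UNIV. v $ i * v $ k * (S x u $ i $ k * gibbs w x u))" for u
    by (simp add: inner_vec_def matrix_vector_mult_def sum_distrib_left sum_distrib_right mult_ac)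
  show "integrable N (\<lambda>u. (v \<bullet> (S x u *v v)) * gibbs w x u)" unfolding e using gibbs_integrable(2) by simp
  have "(LINT u|N. (v \<bullet> (S x u *v v)) * gibbs w x u) = (\<Sum>i\<in>UNIV. \<Sum>k\<in>UNIV. v $ i * v $ k * avg_S w x $ i $ k)"
    unfolding e using gibbs_integrable(2) by (simp add: avg_S_def)
  also have "\<dots> = v \<bullet> (avg_S w x *v v)"
    by (simp add: inner_vec_def matrix_vector_mult_def sum_distrib_left mult_ac)
  finally show "v \<bullet> (avg_S w x *v v) = (LINT u|N. (v \<bullet> (S x u *v v)) * gibbs w x u)" by simp
qed

lemma avg_S_bounds:
  "norm v ^ 2 / C0 \<le> v \<bullet> (avg_S w x *v v)" "v \<bullet> (avg_S w x *v v) \<le> real CARD('d) * C0 * norm v ^ 2"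
proof -
  have "norm v ^ 2 / C0 = (LINT u|N. (norm v ^ 2 / C0) * gibbs w x u)" using gibbs_facts(7) by simp
  also have "\<dots> \<le> (LINT u|N. (v \<bullet> (S x u *v v)) * gibbs w x u)"
  proof (rule integral_mono[OF _ quadratic_avg_S(2)])
    fix u assume u: "u \<in> space N"
    show "(norm v ^ 2 / C0) * gibbs w x u \<le> (v \<bullet> (S x u *v v)) * gibbs w x u"
      by (intro mult_right_mono S_elliptic gibbs_facts(5) u)
  qed (use gibbs_facts(8) in simp)
  finally show "norm v ^ 2 / C0 \<le> v \<bullet> (avg_S w x *v v)" unfolding quadratic_avg_S(1) .
  have "(LINT u|N. (v \<bullet> (S x u *v v)) * gibbs w x u) \<le> (LINT u|N. (real CARD('d) * C0 * norm v ^ 2) * gibbs w x u)"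
  proof (rule integral_mono[OF quadratic_avg_S(2)])
    fix u assume u: "u \<in> space N"
    have "v \<bullet> (S x u *v v) \<le> norm (S x u) * norm v * norm v" using matvec_dot_le[of v "S x u" v] by linarith
    also have "\<dots> \<le> (real CARD('d) * C0) * norm v * norm v" by (intro mult_right_mono coeff_bounds u) auto
    finally show "(v \<bullet> (S x u *v v)) * gibbs w x u \<le> (real CARD('d) * C0 * norm v ^ 2) * gibbs w x u"
      by (intro mult_right_mono gibbs_facts(5) u) (simp add: power2_eq_square mult.assoc)
  qed (use gibbs_facts(8) in simp)
  also have "\<dots> = real CARD('d) * C0 * norm v ^ 2" using gibbs_facts(7) by simp
  finally show "v \<bullet> (avg_S w x *v v) \<le> real CARD('d) * C0 * norm v ^ 2" unfolding quadratic_avg_S(1) .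
qed

text \<open>With the policy frozen, \<open>v\<close> solves a linear equation whose coefficients are
  averages against the Gibbs weights of \<open>w\<close>, and these are bounded and Hoelder because
  \<open>w\<close> is regular. The number \<open>A\<close> fed to \<open>\<eta>\<close> depends on
  \<open>w\<close> and hence on the step, so only finiteness is kept.\<close>

lemma regular_policy_step:
  assumes w: "regular \<alpha> w" and v: "bounded_solution \<rho> (\<lambda>x p X. F_pi N lam r b S (gibbs_policy N lam r b S w x) x p X) v"
    and sch: "schauder_bound TYPE('d) \<alpha> C0 \<eta>" and \<rho>: "1 \<le> \<rho>"
  shows "regular \<alpha> v"
proof -
  note h = averaged_coeffs_hoelder[OF w]
  obtain A1 where A1: "0 \<le> A1" "norm_0a \<alpha> (avg_r w) \<le> ennreal A1"
    using norm_0a_from_components[of "avg_r w"] h(1) by auto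
  obtain A2 where A2: "0 \<le> A2" "norm_0a \<alpha> (avg_b w) \<le> ennreal A2"
  proof -
    have "unif_hoelder (space N) \<alpha> (\<lambda>x u. avg_b w x \<bullet> e)" if e: "e \<in> Basis" for e
    proof -
      obtain i where "e = axis i 1" using e by (auto simp: Basis_vec_def)
      then show ?thesis using h(2)[of i] by (simp add: inner_axis)
    qed
    from norm_0a_from_components[OF this] that show thesis by blast
  qed
  obtain A3 where A3: "0 \<le> A3" "norm_0a \<alpha> (avg_S w) \<le> ennreal A3"
  proof -
    have "unif_hoelder (space N) \<alpha> (\<lambda>x u. avg_S w x \<bullet> e)" if e: "e \<in> Basis" for e
    proof -
      obtain i k where "e = axis i (axis k 1)" using e by (auto simp: Basis_vec_def)
      then show ?thesis using h(3)[of i k] by (simp add: inner_axis)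
    qed
    from norm_0a_from_components[OF this] that show thesis by blast
  qed
  define A where "A = 1 + A1 + A2 + A3"
  have le: "norm_0a \<alpha> (avg_r w) \<le> ennreal A" "norm_0a \<alpha> (avg_b w) \<le> ennreal A" "norm_0a \<alpha> (avg_S w) \<le> ennreal A" "1 \<le> A"
    using A1 A2 A3 by (auto simp: A_def intro: order_trans ennreal_leI)
  have sol: "bounded_solution \<rho> (\<lambda>x p X. ereal (avg_r w x + avg_b w x \<bullet> p + 1/2 * trace (avg_S w x ** X))) v"
    using v unfolding gibbs_def[symmetric] F_pi_gibbs .
  have el: "\<forall>x. transpose (avg_S w x) = avg_S w x \<and> loewner_le (mat (1 / C0)) (avg_S w x)"
  proof (intro allI conjI)
    fix x
    show "transpose (avg_S w x) = avg_S w x"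
      unfolding avg_S_def transpose_def by (subst S_symmetric) simp
    have "mat (1 / C0) *v v = (1 / C0) *\<^sub>R v" for v :: "real^'d"
      by (simp add: matrix_vector_mult_def mat_def vec_eq_iff if_distrib[of "\<lambda>x. x * _"] cong: if_cong)
    then show "loewner_le (mat (1 / C0)) (avg_S w x)"
      using avg_S_bounds(1)[of _ w x] by (simp add: loewner_le_def power2_norm_eq_inner)
  qed
  have sb: "ennreal (\<rho> powr (1/2 - \<alpha>/2)) * deriv_hoelder 1 \<alpha> v \<le> ennreal (\<eta> A) \<and>
        ennreal (\<rho> powr (- \<alpha>/2)) * deriv_hoelder 2 \<alpha> v \<le> ennreal (\<eta> A) \<and>
        ennreal (\<rho> powr (1/2)) * deriv_seminorm 1 v \<le> ennreal (\<eta> A) \<and> deriv_seminorm 2 v \<le> ennreal (\<eta> A)"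
    using sch \<rho> le el sol unfolding schauder_bound_def by blast
  have fin: "x < \<infinity>" if "ennreal (\<rho> powr t) * x \<le> ennreal y" for x t y
  proof (rule ccontr)
    assume "\<not> x < \<infinity>"
    then have "x = \<infinity>" using less_top[of x] by auto
    moreover have "ennreal (\<rho> powr t) \<noteq> 0" using \<rho> by simp
    ultimately have "ennreal (\<rho> powr t) * x = \<infinity>" by (simp add: ennreal_mult_top)
    with that show False by (simp add: top_unique)
  qed
  have "deriv_seminorm 2 v < \<infinity>" using sb by (auto intro: le_less_trans)
  then show ?thesis using sb fin v unfolding regular_def bounded_solution_def by blast
qed

end

section \<open>The Schauder constants exclude small exponents in dimension at least two\<close>

lemma C2_imp_C_class:
  assumes "C2 w p H"
  shows "C_class 2 w" "grad w = p" "hess w = H"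
proof -
  show g: "grad w = p" by (rule grad_eq[OF assms])
  have wd: "w differentiable (at x)" for x using C2D(1)[OF assms] by (auto simp: differentiable_def)
  have pd: "partial_deriv i w = (\<lambda>x. p x \<bullet> axis i 1)" for i
    using fun_cong[OF g] by (auto simp: grad_def D_list_def fun_eq_iff vec_eq_iff inner_axis)
  have d1: "((\<lambda>x. p x \<bullet> axis i 1) has_derivative (\<lambda>v. (H x *v axis i 1) \<bullet> v)) (at x)" for i x
    using C1D(1)[OF C2_C1(2)[OF assms]] .
  have pdd: "partial_deriv j (partial_deriv i w) x = H x $ j $ i" for i j x
  proof -
    have "frechet_derivative (partial_deriv i w) (at x) = (\<lambda>v. (H x *v axis i 1) \<bullet> v)"
      unfolding pd by (rule frechet_derivative_at[OF d1, symmetric])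
    then show ?thesis by (simp add: partial_deriv_def inner_axis matrix_vector_mult_basis column_def)
  qed
  have "continuous_on UNIV (\<lambda>x. H x $ j $ i)" for i j
    by (intro continuous_intros C2D[OF assms])
  then have "continuous_on UNIV (partial_deriv j (partial_deriv i w))" for i j by (simp add: pdd[abs_def])
  moreover have "partial_deriv i w differentiable (at x)" for i x
    unfolding pd using d1 by (auto simp: differentiable_def)
  ultimately show "C_class 2 w" using wd by (simp add: numeral_2_eq_2)
  show "hess w = H" by (simp add: hess_def D_list_def pdd fun_eq_iff vec_eq_iff)
qed

lemma C2_compose:
  assumes w: "C2 w p H" and f: "\<And>x. (f has_real_derivative f' (w x)) (at (w x))"
    "\<And>x. (f' has_real_derivative f'' (w x)) (at (w x))" and c: "continuous_on UNIV (\<lambda>x. f'' (w x))"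
  shows "C2 (\<lambda>x. f (w x)) (\<lambda>x. f' (w x) *\<^sub>R p x) (\<lambda>x. f' (w x) *\<^sub>R H x + f'' (w x) *\<^sub>R outer (p x) (p x))"
proof -
  note wD = C2D[OF w]
  have f'd: "((\<lambda>x. f' (w x)) has_derivative (\<lambda>v. f'' (w x) * (p x \<bullet> v))) (at x)" for x
    using has_derivative_compose[OF wD(1) f(2)[unfolded has_field_derivative_def]] by (simp add: mult.commute)
  have f'c: "continuous_on UNIV (\<lambda>x. f' (w x))"
    using f'd by (auto intro!: continuous_at_imp_continuous_on has_derivative_continuous)
  show ?thesis unfolding C2_def
  proof (intro conjI allI)
    show "((\<lambda>x. f (w x)) has_derivative (\<lambda>v. (f' (w x) *\<^sub>R p x) \<bullet> v)) (at x)" for x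
      using has_derivative_compose[OF wD(1) f(1)[unfolded has_field_derivative_def]] by simp
    show "((\<lambda>x. f' (w x) *\<^sub>R p x) has_derivative (\<lambda>v. (f' (w x) *\<^sub>R H x + f'' (w x) *\<^sub>R outer (p x) (p x)) *v v)) (at x)" for x
      by (rule has_derivative_eq_rhs[OF has_derivative_scaleR[OF f'd wD(2)]])
         (auto simp: fun_eq_iff matrix_vector_mult_add_rdistrib outer_mult scaleR_matrix_vector_assoc[symmetric])
    show "continuous_on UNIV (\<lambda>x. f' (w x) *\<^sub>R H x + f'' (w x) *\<^sub>R outer (p x) (p x))"
      by (intro continuous_intros f'c c wD)
  qed
qed

lemma C2_linear: "C2 (\<lambda>x. x \<bullet> e) (\<lambda>x. e) (\<lambda>x. 0)"
  unfolding C2_def by (auto intro!: derivative_eq_intros simp: inner_commute)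

lemma C2_add:
  assumes "C2 v p A" "C2 w q B" shows "C2 (\<lambda>x. v x + w x) (\<lambda>x. p x + q x) (\<lambda>x. A x + B x)"
  using C2_minus[OF assms(1) C2_uminus[OF assms(2)]] by simp

lemma C2_const: "C2 (\<lambda>x. c) (\<lambda>x. 0) (\<lambda>x. 0)"
  unfolding C2_def by (auto intro!: derivative_eq_intros)

lemma abs_mult_ln_le:
  fixes t :: real
  assumes "0 < t" "t \<le> 5" shows "t * \<bar>ln t\<bar> \<le> 20"
proof (cases "t \<le> 1")
  case True
  have "ln (1 / t) \<le> 1 / t - 1" using assms by (intro ln_le_minus_one) auto
  then have "- ln t \<le> 1 / t - 1" using assms by (simp add: ln_div)
  then have "t * (- ln t) \<le> t * (1 / t - 1)" using assms by (intro mult_left_mono) auto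
  also have "\<dots> \<le> 20" using assms by (simp add: field_simps)
  finally show ?thesis using True assms by (simp add: abs_if)
next
  case False
  have "\<bar>ln t\<bar> \<le> 4" using False assms ln_le_minus_one[of t] by simp
  then have "t * \<bar>ln t\<bar> \<le> 5 * 4" using assms by (intro mult_mono) auto
  then show ?thesis by simp
qed

text \<open>
  The function is \<open>sin x\<^sub>i sin x\<^sub>j ln (\<delta> + 2 - cos x\<^sub>i - cos x\<^sub>j)\<close>, a periodic regularisation of
  \<open>x\<^sub>i x\<^sub>j ln \<bar>x\<bar>\<close>: its Laplacian stays bounded as \<open>\<delta> \<rightarrow> 0\<close> while a second derivative does not.
  The Lipschitz constant may depend on \<open>\<delta>\<close>, because the Hoelder seminorms tend to the oscillation
  as the exponent tends to \<open>0\<close>.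
\<close>

lemma log_example:
  fixes i j :: "'d::finite"
  assumes ij: "i \<noteq> j" and \<delta>: "0 < \<delta>" "\<delta> \<le> 1"
  shows "\<exists>v p (H :: real^'d \<Rightarrow> real^'d^'d) L. C2 v p H \<and> (\<forall>x. \<bar>v x\<bar> \<le> 20) \<and> (\<forall>x. \<bar>v x - 1/2 * trace (H x)\<bar> \<le> 44) \<and>
    0 \<le> L \<and> (\<forall>x y. dist x y \<le> 1 \<longrightarrow> \<bar>(v x - 1/2 * trace (H x)) - (v y - 1/2 * trace (H y))\<bar> \<le> L * dist x y) \<and>
    H 0 $ i $ j = ln \<delta>"
proof -
  define ei where "ei = (axis i 1 :: real^'d)"
  define ej where "ej = (axis j 1 :: real^'d)"
  have ee: "ei \<bullet> ei = 1" "ej \<bullet> ej = 1" "ei \<bullet> ej = 0" "ej \<bullet> ei = 0"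
    using ij by (auto simp: ei_def ej_def inner_axis_axis)
  define A where "A x = sin (x \<bullet> ei)" for x
  define B where "B x = sin (x \<bullet> ej)" for x
  define a where "a x = cos (x \<bullet> ei)" for x
  define b where "b x = cos (x \<bullet> ej)" for x
  define T where "T x = (\<delta> + 2) + ((- 1) * a x + (- 1) * b x)" for x
  have ab: "\<bar>a x\<bar> \<le> 1" "\<bar>b x\<bar> \<le> 1" "\<bar>A x\<bar> \<le> 1" "\<bar>B x\<bar> \<le> 1" for x
    by (simp_all add: a_def b_def A_def B_def)
  have T: "\<delta> \<le> T x" "T x \<le> 5" "0 < T x" for x
    using ab(1,2)[of x] \<delta> by (auto simp: T_def abs_le_iff)
  have sq: "(A x)\<^sup>2 = 1 - (a x)\<^sup>2" "(B x)\<^sup>2 = 1 - (b x)\<^sup>2" for x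
    by (simp_all add: A_def B_def a_def b_def sin_squared_eq)
  \<comment> \<open>From sin^2 = 1 - cos^2 \<le> 2 (1 - cos), where \<open>T\<close> dominates the
    sum of the two terms 1 - cos. The product of the sines is then at most \<open>T\<close>, which
    compensates each singular factor 1/T below.\<close>
  have AB2: "(A x)\<^sup>2 + (B x)\<^sup>2 \<le> 2 * T x" for x
  proof -
    have "0 \<le> (1 - a x)\<^sup>2" "0 \<le> (1 - b x)\<^sup>2" by simp_all
    then show ?thesis using \<delta> unfolding sq T_def by (simp add: power2_eq_square algebra_simps)
  qed
  have ABT: "\<bar>A x * B x\<bar> \<le> T x" for x
    using AB2[of x] sum_squares_bound[of "\<bar>A x\<bar>" "\<bar>B x\<bar>"] by (simp add: abs_mult)
  have sinC: "C2 (\<lambda>x. sin (x \<bullet> e)) (\<lambda>x. cos (x \<bullet> e) *\<^sub>R e) (\<lambda>x. - sin (x \<bullet> e) *\<^sub>R outer e e)" for e :: "real^'d"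
  proof -
    have "C2 (\<lambda>x. sin (x \<bullet> e)) (\<lambda>x. cos (x \<bullet> e) *\<^sub>R e) (\<lambda>x. cos (x \<bullet> e) *\<^sub>R 0 + (- sin (x \<bullet> e)) *\<^sub>R outer e e)"
      by (rule C2_compose[OF C2_linear, where f'' = "\<lambda>x. - sin x"]) (auto intro!: derivative_eq_intros continuous_intros)
    then show ?thesis by simp
  qed
  have cosC: "C2 (\<lambda>x. cos (x \<bullet> e)) (\<lambda>x. - sin (x \<bullet> e) *\<^sub>R e) (\<lambda>x. - cos (x \<bullet> e) *\<^sub>R outer e e)" for e :: "real^'d"
  proof -
    have "C2 (\<lambda>x. cos (x \<bullet> e)) (\<lambda>x. (- sin (x \<bullet> e)) *\<^sub>R e) (\<lambda>x. (- sin (x \<bullet> e)) *\<^sub>R 0 + (- cos (x \<bullet> e)) *\<^sub>R outer e e)"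
      by (rule C2_compose[OF C2_linear, where f'' = "\<lambda>x. - cos x"]) (auto intro!: derivative_eq_intros continuous_intros)
    then show ?thesis by simp
  qed
  define Tp where "Tp x = A x *\<^sub>R ei + B x *\<^sub>R ej" for x
  define TH where "TH x = a x *\<^sub>R outer ei ei + b x *\<^sub>R outer ej ej" for x
  have TC: "C2 T Tp TH"
  proof -
    have "C2 T (\<lambda>x. 0 + (((- 1) *\<^sub>R (- A x *\<^sub>R ei)) + ((- 1) *\<^sub>R (- B x *\<^sub>R ej)))) (\<lambda>x. 0 + (((- 1) *\<^sub>R (- a x *\<^sub>R outer ei ei)) + ((- 1) *\<^sub>R (- b x *\<^sub>R outer ej ej))))"
      using C2_add[OF C2_const C2_add[OF C2_uminus[OF cosC] C2_uminus[OF cosC]], of "\<delta> + 2" ei ej]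
      by (simp add: T_def[abs_def] A_def B_def a_def b_def)
    then show ?thesis by (simp add: Tp_def[abs_def] TH_def[abs_def])
  qed
  have cM: "continuous_on UNIV (\<lambda>x. - 1 / (T x)\<^sup>2)"
    using T(3) by (intro continuous_intros C2D[OF TC]) (auto simp: less_imp_neq[symmetric])
  define lp where "lp x = (1 / T x) *\<^sub>R Tp x" for x
  define lH where "lH x = (1 / T x) *\<^sub>R TH x + (- 1 / (T x)\<^sup>2) *\<^sub>R outer (Tp x) (Tp x)" for x
  have lC: "C2 (\<lambda>x. ln (T x)) lp lH"
    unfolding lp_def lH_def
    by (rule C2_compose[OF TC, where f' = "\<lambda>t. 1 / t" and f'' = "\<lambda>t. - 1 / t\<^sup>2", OF _ _ cM])
       (use T(3) in \<open>auto intro!: derivative_eq_intros simp: power2_eq_square less_imp_neq[symmetric]\<close>)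
  define up where "up x = B x *\<^sub>R (a x *\<^sub>R ei) + A x *\<^sub>R (b x *\<^sub>R ej)" for x
  define uH where "uH x = B x *\<^sub>R (- A x *\<^sub>R outer ei ei) + A x *\<^sub>R (- B x *\<^sub>R outer ej ej)
      + outer (a x *\<^sub>R ei) (b x *\<^sub>R ej) + outer (b x *\<^sub>R ej) (a x *\<^sub>R ei)" for x
  have uC: "C2 (\<lambda>x. A x * B x) up uH"
    using C2_mult[OF sinC sinC, of ei ej] by (simp add: A_def[abs_def] B_def[abs_def] a_def b_def up_def[abs_def] uH_def[abs_def])
  define v where "v x = (A x * B x) * ln (T x)" for x
  define vp where "vp x = ln (T x) *\<^sub>R up x + (A x * B x) *\<^sub>R lp x" for x
  define H where "H x = ln (T x) *\<^sub>R uH x + (A x * B x) *\<^sub>R lH x + outer (up x) (lp x) + outer (lp x) (up x)" for x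
  have vC: "C2 v vp H" unfolding v_def[abs_def] vp_def[abs_def] H_def[abs_def] by (rule C2_mult[OF uC lC])
  have tr: "trace (X + Y) = trace X + trace Y" "trace (t *\<^sub>R X) = t * trace X" "trace (outer x y) = x \<bullet> y"
    for X Y :: "real^'d^'d" and t and x y :: "real^'d"
    by (simp_all add: trace_def outer_def inner_vec_def sum.distrib sum_distrib_left)
  \<comment> \<open>Each sine is an eigenfunction of its second derivative, so the logarithm
    survives in the trace only through -2 v. All other terms are built from A B/T, bounded by 1, and
    (A^2 + B^2)/T, bounded by 2, uniformly in \<open>\<delta>\<close>.\<close>
  have trH: "trace (H x) = - 2 * v x + 3 * (A x * B x * (1 / T x)) * (a x + b x)
     - (A x * B x * (1 / T x)) * ((1 / T x) * ((A x)\<^sup>2 + (B x)\<^sup>2))" for x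
    unfolding H_def lH_def uH_def TH_def tr up_def lp_def Tp_def v_def
    by (simp add: inner_add_left inner_add_right ee power2_eq_square algebra_simps add_divide_distrib)
  have vb: "\<bar>v x\<bar> \<le> 20" for x
  proof -
    have "\<bar>v x\<bar> \<le> T x * \<bar>ln (T x)\<bar>" unfolding v_def abs_mult[of "A x * B x"] using ABT by (intro mult_right_mono) auto
    also have "\<dots> \<le> 20" by (rule abs_mult_ln_le[OF T(3,2)])
    finally show ?thesis .
  qed
  have ABM: "\<bar>A x * B x * (1 / T x)\<bar> \<le> 1" for x using ABT[of x] T(3)[of x] by (simp add: abs_mult)
  have tb: "\<bar>trace (H x)\<bar> \<le> 48" for x
  proof -
    have "\<bar>3 * (A x * B x * (1 / T x)) * (a x + b x)\<bar> \<le> 3 * 1 * 2"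
      unfolding abs_mult[of _ "a x + b x"] abs_mult[of 3] using ABM ab(1,2)[of x] by (intro mult_mono) auto
    moreover have "\<bar>(A x * B x * (1 / T x)) * ((1 / T x) * ((A x)\<^sup>2 + (B x)\<^sup>2))\<bar> \<le> 1 * 2"
      unfolding abs_mult[of "A x * B x * (1 / T x)"]
    proof (intro mult_mono ABM)
      show "\<bar>1 / T x * ((A x)\<^sup>2 + (B x)\<^sup>2)\<bar> \<le> 2" using AB2[of x] T(3)[of x] by (simp add: field_simps)
    qed auto
    ultimately show ?thesis using vb[of x] unfolding trH by linarith
  qed
  \<comment> \<open>Lipschitz continuity at distances up to 1 is the case of exponent 1; the
    parameter set is a single point, so the closure rules for families can be reused.\<close>
  let ?h = "unif_hoelder (UNIV :: unit set) 1"
  have lip: "?h (\<lambda>x u. A x)" "?h (\<lambda>x u. B x)" "?h (\<lambda>x u. a x)" "?h (\<lambda>x u. b x)"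
  proof -
    have ne: "norm ei = 1" "norm ej = 1" by (simp_all add: ei_def ej_def)
    have d: "\<bar>x \<bullet> e - y \<bullet> e\<bar> \<le> 1 * dist x y powr 1" if "norm e = 1" for x y e :: "real^'d"
      using Cauchy_Schwarz_ineq2[of "x - y" e] that by (simp add: dist_norm inner_diff_left)
    have s: "\<bar>sin s - sin t\<bar> \<le> \<bar>s - t\<bar>" "\<bar>cos s - cos t\<bar> \<le> \<bar>s - t\<bar>" for s t :: real
    proof -
      show "\<bar>sin s - sin t\<bar> \<le> \<bar>s - t\<bar>"
        using field_differentiable_bound[of UNIV sin cos 1 s t] by (auto intro: DERIV_sin has_field_derivative_at_within)
      show "\<bar>cos s - cos t\<bar> \<le> \<bar>s - t\<bar>"
        using field_differentiable_bound[of UNIV cos "\<lambda>x. - sin x" 1 s t] by (auto intro: DERIV_cos has_field_derivative_at_within)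
    qed
    have h: "?h (\<lambda>x u. sin (x \<bullet> e))" "?h (\<lambda>x u. cos (x \<bullet> e))" if "norm e = 1" for e :: "real^'d"
      by (rule unif_hoelderI[of _ _ 1 1]; (rule order_trans[OF s(1) d[OF that]] order_trans[OF s(2) d[OF that]] | simp))+
    show "?h (\<lambda>x u. A x)" "?h (\<lambda>x u. B x)" "?h (\<lambda>x u. a x)" "?h (\<lambda>x u. b x)"
      unfolding A_def B_def a_def b_def by (rule h ne)+
  qed
  have TU: "?h (\<lambda>x u. T x)" unfolding T_def by (intro unif_hoelder_add unif_hoelder_mult unif_hoelder_const lip)
  have Tin: "T x \<in> {\<delta>..5}" for x using T by auto
  have MU: "?h (\<lambda>x u. 1 / T x)"
  proof (rule unif_hoelder_comp[OF TU, where f = "\<lambda>s. 1 / s" and L = "1 / \<delta>^2" and M = "1 / \<delta>" and I = "{\<delta>..5}"])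
    fix s t :: real assume st: "s \<in> {\<delta>..5}" "t \<in> {\<delta>..5}" "s \<le> t"
    have s0: "0 < s" "0 < t" using st \<delta> by auto
    have "\<bar>1 / s - 1 / t\<bar> = (t - s) / (s * t)" using s0 st by (simp add: field_simps abs_if)
    also have "\<dots> \<le> (t - s) / (\<delta> * \<delta>)" using st \<delta> by (intro divide_left_mono mult_mono) auto
    finally show "\<bar>1 / s - 1 / t\<bar> \<le> 1 / \<delta>^2 * (t - s)" by (simp add: power2_eq_square)
  qed (use \<delta> Tin in \<open>auto intro: frac_le\<close>)
  have LU: "?h (\<lambda>x u. ln (T x))"
  proof (rule unif_hoelder_comp[OF TU, where f = ln and L = "1 / \<delta>" and M = "\<bar>ln \<delta>\<bar> + 4" and I = "{\<delta>..5}"])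
    fix s t :: real assume st: "s \<in> {\<delta>..5}" "t \<in> {\<delta>..5}" "s \<le> t"
    have s0: "0 < s" "0 < t" using st \<delta> by auto
    have "ln t - ln s \<le> (t - s) / s" by (rule ln_diff_le[OF s0(2,1)])
    also have "\<dots> \<le> (t - s) / \<delta>" using st \<delta> by (intro divide_left_mono) auto
    finally show "\<bar>ln s - ln t\<bar> \<le> 1 / \<delta> * (t - s)" using st s0 by simp
  next
    fix s assume s: "s \<in> {\<delta>..5}"
    then have s0: "0 < s" using \<delta> by auto
    have "ln \<delta> \<le> ln s" by (rule iffD2[OF ln_le_cancel_iff[OF \<delta>(1) s0]]) (use s in simp)
    moreover have "ln s \<le> 4" using ln_le_minus_one[OF s0] s by simp
    ultimately show "\<bar>ln s\<bar> \<le> \<bar>ln \<delta>\<bar> + 4" by linarith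
  next
    show "0 \<le> \<bar>ln \<delta>\<bar> + 4" by (rule add_nonneg_nonneg[OF abs_ge_zero]) simp
  qed (use \<delta> Tin in auto)
  have vU: "?h (\<lambda>x u. v x)" unfolding v_def by (intro unif_hoelder_mult lip LU)
  have "v x - 1/2 * trace (H x) = v x + (- 1/2) * (- 2 * v x + 3 * (A x * B x * (1 / T x)) * (a x + b x)
     + (- 1) * ((A x * B x * (1 / T x)) * ((1 / T x) * (A x * A x + B x * B x))))" for x
    unfolding trH by (simp add: power2_eq_square)
  then have rU: "?h (\<lambda>x u. v x - 1/2 * trace (H x))"
    by (simp only:) (intro unif_hoelder_add unif_hoelder_mult unif_hoelder_const lip MU vU)
  obtain L where L: "0 \<le> L" "\<And>x y. dist x y \<le> 1 \<Longrightarrow>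
      \<bar>(v x - 1/2 * trace (H x)) - (v y - 1/2 * trace (H y))\<bar> \<le> L * dist x y powr 1"
  proof (rule unif_hoelderE[OF rU])
    fix K :: real
    assume K: "0 \<le> K" "\<And>u x y. u \<in> (UNIV :: unit set) \<Longrightarrow> dist x y \<le> 1 \<Longrightarrow>
      \<bar>(v x - 1/2 * trace (H x)) - (v y - 1/2 * trace (H y))\<bar> \<le> K * dist x y powr 1"
    show thesis using K(1) K(2)[OF UNIV_I] by (rule that)
  qed
  \<comment> \<open>At the origin both sines vanish, both cosines are 1 and \<open>T\<close> equals
    \<open>\<delta>\<close>, so only ln T times the product of the two first derivatives is
    left.\<close>
  have H0: "H 0 $ i $ j = ln \<delta>"
    using ij by (simp add: H_def uH_def lH_def up_def lp_def Tp_def TH_def A_def B_def a_def b_def T_def outer_def ei_def ej_def axis_def)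
  have rb: "\<bar>v x - 1/2 * trace (H x)\<bar> \<le> 44" for x using vb[of x] tb[of x] by (simp add: abs_le_iff)
  have hL: "\<bar>(v x - 1/2 * trace (H x)) - (v y - 1/2 * trace (H y))\<bar> \<le> L * dist x y" if "dist x y \<le> 1" for x y
    using L(2)[OF that] by simp
  show ?thesis
    by (rule exI[of _ v], rule exI[of _ vp], rule exI[of _ H], rule exI[of _ L], intro conjI allI impI)
       (rule vC vb rb L(1) H0 hL | assumption)+
qed

text \<open>The hypothesis on \<open>\<eta>\<close> is tested at \<rho> = 1 with identity diffusion,
  zero drift and the right-hand side r of \<open>log_example\<close>. For a small exponent the
  Hoelder seminorm of r is controlled by its oscillation, whatever its Lipschitz constant. So
  \<open>A\<close> can be fixed first, then \<open>\<delta>\<close> in terms of \<eta> A, then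
  \<open>L\<close>, and finally \<open>\<alpha>0\<close>; an exponent below \<open>\<alpha>0\<close>
  would force |ln \<delta>| \<le> |\<eta> A|, against the choice of \<open>\<delta>\<close>.\<close>

lemma schauder_exponent_bound:
  assumes d: "2 \<le> CARD('d::finite)" and C0: "1 \<le> C0"
  shows "\<exists>\<alpha>0>0. \<forall>\<alpha>. 0 < \<alpha> \<and> schauder_bound TYPE('d) \<alpha> C0 \<eta> \<longrightarrow> \<alpha>0 \<le> \<alpha>"
proof -
  obtain i j :: 'd where ij: "i \<noteq> j"
    using d by (metis card_2_iff' ex_card subset_UNIV)
  \<comment> \<open>220 = 44 + 176, the sup bound of r plus its Hoelder constant, where 176 is twice
    the oscillation bound 88. The norm of the identity matrix accounts for the diffusion.\<close>
  define A where "A = 220 + norm (mat 1 :: real^'d^'d)"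
  define \<delta> where "\<delta> = exp (- (\<bar>\<eta> A\<bar> + 1))"
  have \<delta>: "0 < \<delta>" "\<delta> \<le> 1" by (simp_all add: \<delta>_def)
  obtain v p and H :: "real^'d \<Rightarrow> real^'d^'d" and L where v: "C2 v p H" "\<And>x. \<bar>v x\<bar> \<le> 20" "\<And>x. \<bar>v x - 1/2 * trace (H x)\<bar> \<le> 44"
    "0 \<le> L" "\<And>x y. dist x y \<le> 1 \<Longrightarrow> \<bar>(v x - 1/2 * trace (H x)) - (v y - 1/2 * trace (H y))\<bar> \<le> L * dist x y"
    "H 0 $ i $ j = ln \<delta>"
    using log_example[OF ij \<delta>] by blast
  define r where "r x = v x - 1/2 * trace (H x)" for x
  define L' where "L' = L + 2"
  have L': "2 \<le> L'" "L \<le> L'" using v(4) by (simp_all add: L'_def)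
  define \<alpha>0 where "\<alpha>0 = ln 2 / ln L'"
  have "0 < \<alpha>0" using L' by (simp add: \<alpha>0_def)
  moreover have "\<alpha>0 \<le> \<alpha>" if \<alpha>: "0 < \<alpha>" and sch: "schauder_bound TYPE('d) \<alpha> C0 \<eta>" for \<alpha>
  proof (rule ccontr)
    assume "\<not> \<alpha>0 \<le> \<alpha>"
    then have "\<alpha> * ln L' < ln 2" using L' by (simp add: \<alpha>0_def field_simps)
    then have "L' powr \<alpha> \<le> 2" using L' by (simp add: powr_def) (metis exp_le_cancel_iff exp_ln less_imp_le zero_less_numeral)
    have hol: "\<bar>r x - r y\<bar> \<le> 176 * dist x y powr \<alpha>" if xy: "0 < dist x y" "dist x y \<le> 1" for x y
    proof -
      \<comment> \<open>The difference of r is at most both 88 and t, hence at most 88 t^\<alpha>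
        when \<alpha> \<le> 1, and t^\<alpha> \<le> 2 |x - y|^\<alpha> because L'^\<alpha> \<le> 2.
        An exponent above 1 is incompatible with this since L' \<ge> 2.\<close>
      define t where "t = L' * dist x y"
      have t0: "0 < t" using L' xy by (simp add: t_def)
      have tp: "t powr \<alpha> \<le> 2 * dist x y powr \<alpha>"
        unfolding t_def using L' xy \<open>L' powr \<alpha> \<le> 2\<close> by (simp add: powr_mult mult_right_mono)
      have a1: "\<bar>r x - r y\<bar> \<le> 88" using v(3)[of x] v(3)[of y] by (simp add: r_def)
      have "L * dist x y \<le> t" unfolding t_def using L' by (intro mult_right_mono) auto
      then have a2: "\<bar>r x - r y\<bar> \<le> t" using v(5)[OF xy(2)] by (simp add: r_def)
      have "\<bar>r x - r y\<bar> \<le> 88 * t powr \<alpha>"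
      proof (cases "1 \<le> t")
        case True
        then have "1 \<le> t powr \<alpha>" using \<alpha> by (simp add: ge_one_powr_ge_zero)
        then show ?thesis using a1 by simp
      next
        case False
        show ?thesis
        proof (cases "\<alpha> \<le> 1")
          case True
          then have "t powr 1 \<le> t powr \<alpha>" using False t0 by (intro powr_mono') auto
          then show ?thesis using a2 t0 by simp
        next
          case False
          have "2 powr \<alpha> \<le> L' powr \<alpha>" using L' \<alpha> by (intro powr_mono2) auto
          moreover have "2 powr 1 < (2::real) powr \<alpha>" using False by (intro powr_less_mono) auto
          ultimately show ?thesis using \<open>L' powr \<alpha> \<le> 2\<close> by simp
        qed
      qed
      then show ?thesis using tp by linarith
    qed
    have nr: "norm_0a \<alpha> r \<le> ennreal A"
      by (rule norm_0a_leI[of r 44 176]) (use v(3) hol in \<open>auto simp: r_def A_def\<close>)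
    have nb: "norm_0a \<alpha> (\<lambda>x::real^'d. 0 :: real^'d) \<le> ennreal A"
      by (rule norm_0a_leI[of _ 0 0]) (auto simp: A_def infnorm_0)
    have nS: "norm_0a \<alpha> (\<lambda>x::real^'d. mat 1 :: real^'d^'d) \<le> ennreal A"
      by (rule norm_0a_leI[of _ "norm (mat 1 :: real^'d^'d)" 0]) (auto simp: A_def infnorm_le_norm infnorm_0)
    note C = C2_imp_C_class[OF v(1)]
    have el: "\<forall>x::real^'d. transpose (mat 1 :: real^'d^'d) = mat 1 \<and> loewner_le (mat (1 / C0)) (mat 1 :: real^'d^'d)"
    proof -
      have "mat (1 / C0) *v v = (1 / C0) *\<^sub>R v" for v :: "real^'d"
        by (simp add: matrix_vector_mult_def mat_def vec_eq_iff if_distrib[of "\<lambda>x. x * _"] cong: if_cong)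
      moreover have "(v \<bullet> v) / C0 \<le> v \<bullet> v" for v :: "real^'d"
        using divide_left_mono[of 1 C0 "v \<bullet> v"] C0 by simp
      ultimately show ?thesis by (simp add: loewner_le_def transpose_mat matrix_vector_mul_lid)
    qed
    have sol: "bounded_solution 1 (\<lambda>x p X. ereal (r x + 0 \<bullet> p + 1/2 * trace (mat 1 ** X))) v"
      unfolding bounded_solution_def C(2,3)
      using C(1) v(2) by (auto simp: r_def bounded_iff matrix_mul_lid intro!: exI[of _ 20])
    have "1 \<le> A" by (simp add: A_def add_increasing2)
    then have "deriv_seminorm 2 v \<le> ennreal (\<eta> A)"
      using sch[unfolded schauder_bound_def, THEN conjunct2, THEN conjunct2, rule_format, of 1 A "\<lambda>_. mat 1" r "\<lambda>_. 0" v]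
        el nr nb nS sol by simp
    also have "\<dots> \<le> ennreal \<bar>\<eta> A\<bar>" by (intro ennreal_leI) simp
    finally have "sup_norm (D_list [i, j] v) \<le> ennreal \<bar>\<eta> A\<bar>"
      unfolding deriv_seminorm_def SUP_le_iff by simp
    then have "\<bar>D_list [i, j] v 0\<bar> \<le> \<bar>\<eta> A\<bar>" by (simp add: sup_norm_le_iff)
    moreover have "D_list [i, j] v 0 = ln \<delta>"
      using fun_cong[OF C(3), of 0] v(6) by (simp add: hess_def vec_eq_iff)
    ultimately show False by (simp add: \<delta>_def)
  qed
  ultimately show ?thesis by blast
qed

section \<open>Contraction of the policy iteration\<close>

text \<open>As \<theta> D \<ge> 1 and k \<ge> 1, k is at most k^(D \<theta>); as \<theta> \<le> 1
  and h \<le> 1, h is at most h^\<theta>. With k = K + 1, h = 2^-n and D = d + 2 this converts a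
  bound linear in 2^-n into the fractional powers of the theorem.\<close>

lemma powr_le_aux:
  fixes k h \<theta> t :: real
  assumes "1 \<le> k" "0 < h" "h \<le> 1" "1 / real D \<le> \<theta>" "\<theta> \<le> 1" "0 < D" "k ^ D * h \<le> t"
  shows "k * h \<le> t powr \<theta>"
proof -
  have \<theta>: "0 < \<theta>" using assms(4,6) by (simp add: less_le_trans[of 0 "1 / real D"])
  have "1 = real D * (1 / real D)" using assms(6) by simp
  also have "\<dots> \<le> real D * \<theta>" using assms by (intro mult_left_mono) auto
  finally have "k powr 1 \<le> k powr (real D * \<theta>)" using assms(1) by (intro powr_mono) auto
  also have "\<dots> = (k ^ D) powr \<theta>" using assms(1) by (simp add: powr_powr[symmetric] powr_realpow)
  finally have 1: "k \<le> (k ^ D) powr \<theta>" using assms(1) by simp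
  have "h powr 1 \<le> h powr \<theta>" using assms by (intro powr_mono') auto
  then have 2: "h \<le> h powr \<theta>" using assms by simp
  have "k * h \<le> (k ^ D) powr \<theta> * h powr \<theta>" using 1 2 assms by (intro mult_mono) auto
  also have "\<dots> = (k ^ D * h) powr \<theta>" using assms by (simp add: powr_mult)
  also have "\<dots> \<le> t powr \<theta>" using assms \<theta> by (intro powr_mono2) auto
  finally show ?thesis .
qed

lemma infnorm_matrix_le:
  fixes A :: "real^'d^'d"
  assumes "\<And>i k. \<bar>A $ i $ k\<bar> \<le> K" shows "infnorm A \<le> K"
proof -
  have "\<bar>A \<bullet> e\<bar> \<le> K" if e: "e \<in> Basis" for e
  proof -
    obtain i k where "e = axis i (axis k 1)" using e by (auto simp: Basis_vec_def)
    then show ?thesis using assms[of i k] by (simp add: inner_axis)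
  qed
  then show ?thesis unfolding infnorm_Max by (intro Max.boundedI) auto
qed

lemma matrix_entry_le_infnorm:
  fixes A :: "real^'d^'d" shows "\<bar>A $ i $ k\<bar> \<le> infnorm A"
proof -
  have "\<bar>A \<bullet> axis i (axis k 1)\<bar> \<le> infnorm A" by (rule Basis_le_infnorm) (simp add: axis_in_Basis_iff)
  then show ?thesis by (simp add: inner_axis)
qed

context control_problem
begin

lemma gram_columns:
  assumes "u \<in> space N"
  shows "gram (1 / C0) (real CARD('d) * C0) m (\<lambda>j. \<chi> i. \<sigma> x u i j)" "trS m (\<lambda>j. \<chi> i. \<sigma> x u i j) A = trace (S x u ** A)"
proof -
  have "formS m (\<lambda>j. \<chi> i. \<sigma> x u i j) v v = v \<bullet> (S x u *v v)" for v
  proof -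
    have "formS m (\<lambda>j. \<chi> i. \<sigma> x u i j) v v = (\<Sum>j<m. \<Sum>i\<in>UNIV. \<Sum>k\<in>UNIV. v $ i * (\<sigma> x u i j * \<sigma> x u k j) * v $ k)"
      by (simp add: formS_def inner_vec_def sum_product mult_ac)
    also have "\<dots> = (\<Sum>i\<in>UNIV. \<Sum>j<m. \<Sum>k\<in>UNIV. v $ i * (\<sigma> x u i j * \<sigma> x u k j) * v $ k)"
      by (rule sum.swap)
    also have "\<dots> = (\<Sum>i\<in>UNIV. \<Sum>k\<in>UNIV. \<Sum>j<m. v $ i * (\<sigma> x u i j * \<sigma> x u k j) * v $ k)"
      by (intro sum.cong refl sum.swap)
    also have "\<dots> = v \<bullet> (S x u *v v)"
      by (simp add: inner_vec_def matrix_vector_mult_def S diffusion_def sum_distrib_left sum_distrib_right mult_ac)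
    finally show ?thesis .
  qed
  moreover have "v \<bullet> (S x u *v v) \<le> real CARD('d) * C0 * norm v ^ 2" for v
  proof -
    have "v \<bullet> (S x u *v v) \<le> norm (S x u) * norm v * norm v" using matvec_dot_le[of v "S x u" v] by linarith
    also have "\<dots> \<le> (real CARD('d) * C0) * norm v * norm v" by (intro mult_right_mono coeff_bounds assms) auto
    finally show ?thesis by (simp add: power2_eq_square mult.assoc)
  qed
  ultimately show "gram (1 / C0) (real CARD('d) * C0) m (\<lambda>j. \<chi> i. \<sigma> x u i j)"
    using S_elliptic[OF assms, of _ x] by (simp add: gram_def)
  have "trS m (\<lambda>j. \<chi> i. \<sigma> x u i j) A = (\<Sum>j<m. \<Sum>i\<in>UNIV. \<Sum>k\<in>UNIV. (\<sigma> x u k j * \<sigma> x u i j) * A $ i $ k)"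
    by (simp add: trS_def inner_vec_def matrix_vector_mult_def sum_distrib_left mult_ac)
  also have "\<dots> = (\<Sum>i\<in>UNIV. \<Sum>j<m. \<Sum>k\<in>UNIV. (\<sigma> x u k j * \<sigma> x u i j) * A $ i $ k)" by (rule sum.swap)
  also have "\<dots> = (\<Sum>i\<in>UNIV. \<Sum>k\<in>UNIV. \<Sum>j<m. (\<sigma> x u k j * \<sigma> x u i j) * A $ i $ k)"
    by (intro sum.cong refl sum.swap)
  also have "\<dots> = (\<Sum>k\<in>UNIV. \<Sum>i\<in>UNIV. \<Sum>j<m. (\<sigma> x u k j * \<sigma> x u i j) * A $ i $ k)" by (rule sum.swap)
  also have "\<dots> = trace (S x u ** A)"
    by (simp add: trace_def matrix_matrix_mult_def S diffusion_def sum_distrib_right)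
  finally show "trS m (\<lambda>j. \<chi> i. \<sigma> x u i j) A = trace (S x u ** A)" .
qed

text \<open>Both functions are inserted into the linear equation averaged over the policy of
  \<open>w\<close>: \<open>v\<close> solves it exactly, and \<open>vs\<close> up to the
  suboptimality gap of that policy. The constant subtracted in the gap is half the trace of S0
  against the difference of the Hessians.\<close>

lemma difference_equation:
  assumes v: "bounded_solution \<rho> (\<lambda>x p X. F_pi N lam r b S (gibbs_policy N lam r b S w x) x p X) v"
    and vs: "bounded_solution \<rho> (F_sup N lam r b S) vs"
    and S0: "\<And>u. u \<in> space N \<Longrightarrow> norm (S x u - S0 x) \<le> e"
  shows "\<bar>\<rho> * (v x - vs x) - avg_b w x \<bullet> (grad v x - grad vs x) - 1/2 * trace (avg_S w x ** (hess v x - hess vs x))\<bar>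
    \<le> 2 * (real CARD('d) * C0 * norm (grad w x - grad vs x) + 1/2 * e * norm (hess w x - hess vs x))"
proof -
  have 1: "\<rho> * v x = avg_r w x + avg_b w x \<bullet> grad v x + 1/2 * trace (avg_S w x ** hess v x)"
    using v unfolding bounded_solution_def gibbs_def[symmetric] F_pi_gibbs by simp
  have 2: "F_sup N lam r b S x (grad vs x) (hess vs x) = ereal (\<rho> * vs x)"
  proof -
    have "ereal (\<rho> * vs x) - F_sup N lam r b S x (grad vs x) (hess vs x) = 0"
      using vs unfolding bounded_solution_def by blast
    then show ?thesis by (cases "F_sup N lam r b S x (grad vs x) (hess vs x)") auto
  qed
  have td: "trace (A ** (B - C)) = trace (A ** B) - trace (A ** C)" "trace ((A - B) ** C) = trace (A ** C) - trace (B ** C)" for A B C :: "real^'d^'d"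
    by (simp_all add: trace_def matrix_matrix_mult_def right_diff_distrib left_diff_distrib sum_subtractf)
  have "\<bar>\<rho> * vs x - (avg_r w x + avg_b w x \<bullet> grad vs x + 1/2 * trace (avg_S w x ** hess vs x))\<bar>
    \<le> 2 * (real CARD('d) * C0 * norm (grad w x - grad vs x) + 1/2 * e * norm (hess w x - hess vs x))"
  proof (rule F_sup_gibbs_gap[OF _ 2, where k = "1/2 * trace (S0 x ** (hess vs x - hess w x))"])
    fix u assume u: "u \<in> space N"
    have "\<bar>b x u \<bullet> (grad vs x - grad w x)\<bar> \<le> real CARD('d) * C0 * norm (grad w x - grad vs x)"
      unfolding norm_minus_commute[of "grad w x"]
      by (intro order_trans[OF Cauchy_Schwarz_ineq2] mult_right_mono coeff_bounds u) auto
    moreover have "\<bar>trace ((S x u - S0 x) ** (hess vs x - hess w x))\<bar> \<le> e * norm (hess w x - hess vs x)"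
      unfolding norm_minus_commute[of "hess w x"]
      by (intro order_trans[OF abs_trace_mult_le] mult_right_mono S0 u) auto
    ultimately show "\<bar>b x u \<bullet> (grad vs x - grad w x) + 1/2 * trace (S x u ** (hess vs x - hess w x)) - 1/2 * trace (S0 x ** (hess vs x - hess w x))\<bar>
      \<le> real CARD('d) * C0 * norm (grad w x - grad vs x) + 1/2 * e * norm (hess w x - hess vs x)"
      unfolding td(2) by linarith
  qed
  then show ?thesis unfolding right_diff_distrib 1 inner_diff_right td(1) by linarith
qed

lemma avg_b_bound: "norm (avg_b w x) \<le> real CARD('d) * (real CARD('d) * C0)"
proof -
  have "\<bar>avg_b w x $ i\<bar> \<le> real CARD('d) * C0" for i
    unfolding avg_b_def using gibbs_average_bound[OF coeff_measurable(2) comp_bounds(1)] by simp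
  then have "(\<Sum>i\<in>UNIV. \<bar>avg_b w x $ i\<bar>) \<le> (\<Sum>i\<in>(UNIV::'d set). real CARD('d) * C0)" by (intro sum_mono)
  then show ?thesis using norm_le_l1_cart[of "avg_b w x"] by simp
qed

text \<open>The averaged matrix has no Hoelder bound uniform in the step, because its weights depend
  on the Hessian of \<open>w\<close>. It is therefore compared, at the same point x and through
  \<open>S0 x\<close>, with \<open>S x u0\<close>, at the cost 2 e; only then is x moved to x0, for
  the fixed control \<open>u0\<close> whose Hoelder constant is \<open>C0\<close>.\<close>

lemma avg_S_oscillation:
  assumes u0: "u0 \<in> space N" and e: "\<And>u x. u \<in> space N \<Longrightarrow> infnorm (S x u - S0 x) \<le> e" and xy: "dist x x0 \<le> 1"
  shows "norm (avg_S w x - S x0 u0) \<le> real CARD('d) * (2 * e + C0 * dist x x0 powr \<alpha>)"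
proof -
  have ent: "\<bar>S x u $ i $ k - S x0 u0 $ i $ k\<bar> \<le> 2 * e + C0 * dist x x0 powr \<alpha>" if u: "u \<in> space N" for u i k
  proof -
    have "\<bar>(S x u - S0 x) $ i $ k\<bar> \<le> e" "\<bar>(S x u0 - S0 x) $ i $ k\<bar> \<le> e"
      using order_trans[OF matrix_entry_le_infnorm e] u u0 by blast+
    moreover have "\<bar>(S x u0 - S x0 u0) $ i $ k\<bar> \<le> C0 * dist x x0 powr \<alpha>"
    proof (cases "x = x0")
      case False
      then show ?thesis
        using order_trans[OF matrix_entry_le_infnorm norm_0a_leD(2)[OF bounds(3)[OF u0] C0_nonneg, of x x0]] xy by simp
    qed simp
    ultimately show ?thesis by simp
  qed
  have "infnorm (avg_S w x - S x0 u0) \<le> 2 * e + C0 * dist x x0 powr \<alpha>"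
  proof (rule infnorm_matrix_le)
    fix i k
    have "avg_S w x $ i $ k - S x0 u0 $ i $ k = (LINT u|N. (S x u $ i $ k - S x0 u0 $ i $ k) * gibbs w x u)"
      using gibbs_integrable(2) gibbs_facts(7,8) by (simp add: avg_S_def left_diff_distrib)
    also have "\<bar>\<dots>\<bar> \<le> 2 * e + C0 * dist x x0 powr \<alpha>"
      by (rule gibbs_average_bound) (use coeff_measurable(3) ent in auto)
    finally show "\<bar>(avg_S w x - S x0 u0) $ i $ k\<bar> \<le> 2 * e + C0 * dist x x0 powr \<alpha>" by simp
  qed
  then show ?thesis using order_trans[OF norm_le_card_infnorm(2) mult_left_mono] by fastforce
qed

text \<open>
  In dimension one the coefficient \<open>\<Sigma>\<close> may be divided out, so that no smallness of its oscillation is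
  required; in higher dimensions it is frozen at the centre of the ball.
\<close>

lemma frozen_equation:
  fixes p p' :: "real^'d" and H H' :: "real^'d^'d"
  assumes eq: "\<bar>\<rho> * w - avg_b wp x \<bullet> p - 1/2 * trace (avg_S wp x ** H)\<bar> \<le> 2 * D"
    and \<tau>: "0 < \<tau>" "\<tau>\<^sup>2 * \<rho> = 1"
    and u0: "u0 \<in> space N" and e: "\<And>u x. u \<in> space N \<Longrightarrow> infnorm (S x u - S0 x) \<le> e"
    and xx: "dist x x0 \<le> 1" "CARD('d) = 1 \<or> real CARD('d) * (2 * e + C0 * dist x x0 powr \<alpha>) \<le> \<kappa>" and \<kappa>: "0 \<le> \<kappa>"
  defines "\<sigma>' \<equiv> (if CARD('d) = 1 then (\<lambda>j. axis undefined 1) else (\<lambda>j. \<chi> i. \<sigma> x0 u0 i j))"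
    and "m' \<equiv> (if CARD('d) = 1 then 1 else m)"
    and "al \<equiv> (if CARD('d) = 1 then 2 / (avg_S wp x $ undefined $ undefined) else 2)"
    and "\<beta> \<equiv> 2 * real CARD('d)^2 * C0^2 * \<tau>"
  shows "2 / (real CARD('d) * C0) \<le> al" "al \<le> 2 * C0"
    "\<bar>trS m' \<sigma>' (\<tau>\<^sup>2 *\<^sub>R H) - al * w\<bar> \<le> \<beta> * norm (\<tau> *\<^sub>R p) + \<kappa> * norm (\<tau>\<^sup>2 *\<^sub>R H) + 4 * C0 * \<tau>\<^sup>2 * D"
proof -
  let ?d = "real CARD('d)"
  have d1: "1 \<le> ?d" by simp
  have C01: "1 \<le> C0" by (rule pars)
  have bp: "\<bar>avg_b wp x \<bullet> p\<bar> \<le> ?d * (?d * C0) * norm p"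
    by (intro order_trans[OF Cauchy_Schwarz_ineq2] mult_right_mono avg_b_bound) auto
  have D0: "0 \<le> D" using eq by linarith
  have pre: "\<bar>trace (avg_S wp x ** H) - 2 * \<rho> * w\<bar> \<le> 2 * (?d * (?d * C0) * norm p) + 4 * D"
    using eq bp by linarith
  have tau: "\<tau>\<^sup>2 * (2 * (?d * (?d * C0) * norm p) + 4 * D) = 2 * ?d^2 * C0 * \<tau> * norm (\<tau> *\<^sub>R p) + 4 * \<tau>\<^sup>2 * D"
    using \<tau> by (simp add: power2_eq_square algebra_simps)
  have scal: "\<bar>\<tau>\<^sup>2 * trace (avg_S wp x ** H) - 2 * w\<bar> \<le> 2 * ?d^2 * C0 * \<tau> * norm (\<tau> *\<^sub>R p) + 4 * \<tau>\<^sup>2 * D"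
  proof -
    have "\<tau>\<^sup>2 * (trace (avg_S wp x ** H) - 2 * \<rho> * w) = \<tau>\<^sup>2 * trace (avg_S wp x ** H) - 2 * (\<tau>\<^sup>2 * \<rho>) * w"
      by (simp add: algebra_simps)
    then have "\<tau>\<^sup>2 * trace (avg_S wp x ** H) - 2 * w = \<tau>\<^sup>2 * (trace (avg_S wp x ** H) - 2 * \<rho> * w)" unfolding \<tau>(2) by simp
    then have "\<bar>\<tau>\<^sup>2 * trace (avg_S wp x ** H) - 2 * w\<bar> = \<tau>\<^sup>2 * \<bar>trace (avg_S wp x ** H) - 2 * \<rho> * w\<bar>" by (simp add: abs_mult)
    also have "\<dots> \<le> \<tau>\<^sup>2 * (2 * (?d * (?d * C0) * norm p) + 4 * D)" by (intro mult_left_mono pre) auto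
    finally show ?thesis unfolding tau .
  qed
  have CC: "C0 * (2 * ?d^2 * C0 * \<tau> * norm (\<tau> *\<^sub>R p) + 4 * \<tau>\<^sup>2 * D) = \<beta> * norm (\<tau> *\<^sub>R p) + 4 * C0 * \<tau>\<^sup>2 * D"
    by (simp add: \<beta>_def power2_eq_square algebra_simps)
  have nn: "0 \<le> 2 * ?d^2 * C0 * \<tau> * norm (\<tau> *\<^sub>R p) + 4 * \<tau>\<^sup>2 * D" using C01 \<tau> D0 by simp
  have kH: "0 \<le> \<kappa> * norm (\<tau>\<^sup>2 *\<^sub>R H)" using \<kappa> by simp
  show "2 / (?d * C0) \<le> al" "al \<le> 2 * C0"
    "\<bar>trS m' \<sigma>' (\<tau>\<^sup>2 *\<^sub>R H) - al * w\<bar> \<le> \<beta> * norm (\<tau> *\<^sub>R p) + \<kappa> * norm (\<tau>\<^sup>2 *\<^sub>R H) + 4 * C0 * \<tau>\<^sup>2 * D"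
  proof -
    consider "CARD('d) = 1" | "CARD('d) \<noteq> 1" by blast
    then have "2 / (?d * C0) \<le> al \<and> al \<le> 2 * C0 \<and>
      \<bar>trS m' \<sigma>' (\<tau>\<^sup>2 *\<^sub>R H) - al * w\<bar> \<le> \<beta> * norm (\<tau> *\<^sub>R p) + \<kappa> * norm (\<tau>\<^sup>2 *\<^sub>R H) + 4 * C0 * \<tau>\<^sup>2 * D"
    proof cases
      case 1
      define a where "a = avg_S wp x $ undefined $ undefined"
      have uni: "UNIV = {undefined :: 'd}"
      proof -
        obtain z :: 'd where "UNIV = {z}" using 1 by (auto simp: card_1_singleton_iff)
        then show ?thesis by (metis UNIV_I singletonD)
      qed
      have ta: "trace (avg_S wp x ** H) = a * H $ undefined $ undefined"
        unfolding trace_def matrix_matrix_mult_def by (simp add: uni a_def)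
      have qa: "axis undefined 1 \<bullet> (avg_S wp x *v axis undefined 1) = a"
        by (simp add: inner_axis' matrix_vector_mult_basis column_def a_def)
      have a: "1 / C0 \<le> a" "a \<le> C0"
        using avg_S_bounds[of "axis undefined 1" wp x] unfolding qa by (simp_all add: 1)
      have a0: "0 < a" using a(1) C01 by (simp add: less_le_trans[of 0 "1 / C0"])
      have "2 / C0 \<le> 2 / a" using a a0 C01 by (intro divide_left_mono) auto
      moreover have "2 / a \<le> 2 / (1 / C0)" using a a0 C01 by (intro divide_left_mono) auto
      moreover have "\<bar>trS m' \<sigma>' (\<tau>\<^sup>2 *\<^sub>R H) - al * w\<bar> \<le> \<beta> * norm (\<tau> *\<^sub>R p) + \<kappa> * norm (\<tau>\<^sup>2 *\<^sub>R H) + 4 * C0 * \<tau>\<^sup>2 * D"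
      proof -
        have "trS m' \<sigma>' (\<tau>\<^sup>2 *\<^sub>R H) = \<tau>\<^sup>2 * H $ undefined $ undefined"
          unfolding trS_linear(2) by (simp add: trS_def m'_def \<sigma>'_def 1 inner_axis' matrix_vector_mult_basis column_def)
        then have "trS m' \<sigma>' (\<tau>\<^sup>2 *\<^sub>R H) - al * w = (1 / a) * (\<tau>\<^sup>2 * trace (avg_S wp x ** H) - 2 * w)"
          using a0 by (simp add: ta al_def 1 a_def[symmetric] field_simps)
        then have "\<bar>trS m' \<sigma>' (\<tau>\<^sup>2 *\<^sub>R H) - al * w\<bar> = (1 / a) * \<bar>\<tau>\<^sup>2 * trace (avg_S wp x ** H) - 2 * w\<bar>"
          using a0 by (simp add: abs_mult)
        also have "\<dots> \<le> C0 * (2 * ?d^2 * C0 * \<tau> * norm (\<tau> *\<^sub>R p) + 4 * \<tau>\<^sup>2 * D)"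
        proof (intro mult_mono scal)
          have "1 / a \<le> 1 / (1 / C0)" using a a0 C01 by (intro divide_left_mono) auto
          then show "1 / a \<le> C0" by simp
        qed (use C01 in auto)
        finally show ?thesis unfolding CC using kH by linarith
      qed
      ultimately show ?thesis by (simp add: al_def 1 a_def[symmetric])
    next
      case 2
      have "norm (avg_S wp x - S x0 u0) \<le> \<kappa>"
        using avg_S_oscillation[OF u0 e xx(1), of wp] xx(2) 2 by linarith
      then have "\<bar>trace ((avg_S wp x - S x0 u0) ** (\<tau>\<^sup>2 *\<^sub>R H))\<bar> \<le> \<kappa> * norm (\<tau>\<^sup>2 *\<^sub>R H)"
        by (intro order_trans[OF abs_trace_mult_le] mult_right_mono) auto
      moreover have "trace ((avg_S wp x - S x0 u0) ** (\<tau>\<^sup>2 *\<^sub>R H)) = \<tau>\<^sup>2 * trace (avg_S wp x ** H) - trace (S x0 u0 ** (\<tau>\<^sup>2 *\<^sub>R H))"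
        by (simp add: trace_def matrix_matrix_mult_def left_diff_distrib right_diff_distrib sum_subtractf sum_distrib_left mult_ac)
      moreover have "trS m' \<sigma>' (\<tau>\<^sup>2 *\<^sub>R H) = trace (S x0 u0 ** (\<tau>\<^sup>2 *\<^sub>R H))"
        using gram_columns(2)[OF u0] 2 by (simp add: m'_def \<sigma>'_def)
      moreover have "2 * ?d^2 * C0 * \<tau> * norm (\<tau> *\<^sub>R p) + 4 * \<tau>\<^sup>2 * D \<le> \<beta> * norm (\<tau> *\<^sub>R p) + 4 * C0 * \<tau>\<^sup>2 * D"
        unfolding CC[symmetric] using mult_right_mono[OF C01 nn] by simp
      ultimately have "\<bar>trS m' \<sigma>' (\<tau>\<^sup>2 *\<^sub>R H) - 2 * w\<bar> \<le> \<beta> * norm (\<tau> *\<^sub>R p) + \<kappa> * norm (\<tau>\<^sup>2 *\<^sub>R H) + 4 * C0 * \<tau>\<^sup>2 * D"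
        using scal by linarith
      moreover have "2 / (?d * C0) \<le> 2 / 1"
      proof (intro divide_left_mono)
        show "1 \<le> ?d * C0" using mult_mono[OF d1 C01] by simp
      qed (use C01 in auto)
      ultimately show ?thesis using 2 C01 by (simp add: al_def)
    qed
    then show "2 / (?d * C0) \<le> al" "al \<le> 2 * C0"
      "\<bar>trS m' \<sigma>' (\<tau>\<^sup>2 *\<^sub>R H) - al * w\<bar> \<le> \<beta> * norm (\<tau> *\<^sub>R p) + \<kappa> * norm (\<tau>\<^sup>2 *\<^sub>R H) + 4 * C0 * \<tau>\<^sup>2 * D" by blast+
  qed
qed

lemma gram_frozen:
  assumes "u0 \<in> space N"
  shows "gram (1 / C0) (real CARD('d) * C0) (if CARD('d) = 1 then 1 else m)
    (if CARD('d) = 1 then (\<lambda>j. axis undefined 1) else (\<lambda>j. \<chi> i. \<sigma> x0 u0 i j))"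
proof (cases "CARD('d) = 1")
  case True
  have uni: "UNIV = {undefined :: 'd}"
  proof -
    obtain z :: 'd where "UNIV = {z}" using True by (auto simp: card_1_singleton_iff)
    then show ?thesis by (metis UNIV_I singletonD)
  qed
  have "formS 1 (\<lambda>j. axis undefined 1) v v = norm v ^ 2" for v :: "real^'d"
    unfolding power2_norm_eq_inner by (simp add: formS_def inner_axis' inner_vec_def uni)
  moreover have "1 / C0 * norm v ^ 2 \<le> 1 * norm v ^ 2" "1 * norm v ^ 2 \<le> C0 * norm v ^ 2" for v :: "real^'d"
    using pars by (intro mult_right_mono; simp)+
  ultimately show ?thesis using True by (simp add: gram_def)
next
  case False
  then show ?thesis using gram_columns(1)[OF assms] by simp
qed

end

section \<open>One policy step and its iteration in rescaled variables\<close>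

text \<open>Names the conclusion of \<open>perturbed_morrey_bound\<close> for the ellipticity
  constants of the control problem, so that \<open>R\<close>, \<open>C\<close> and
  \<open>\<kappa>0\<close> can be fixed from d and \<open>C0\<close> before any data appear. The
  range of \<open>\<alpha>\<close> covers both forms of the equation: twice the reciprocal of the
  averaged coefficient in dimension one, and the constant 2 otherwise.\<close>

definition elliptic_bound :: "'d::finite itself \<Rightarrow> real \<Rightarrow> real \<Rightarrow> real \<Rightarrow> real \<Rightarrow> bool" where
  "elliptic_bound _ C0 R C \<kappa>0 \<longleftrightarrow> (\<forall>w p (H :: real^'d \<Rightarrow> real^'d^'d) f F \<beta> \<kappa> B.
    C2 w p H \<and> (\<forall>x. \<bar>w x\<bar> \<le> B \<and> norm (p x) \<le> B \<and> norm (H x) \<le> B) \<and> 0 < F \<and> continuous_on UNIV f \<and> morrey f F \<and>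
    0 \<le> \<beta> \<and> \<beta> \<le> \<kappa>0 \<and> 0 \<le> \<kappa> \<and> \<kappa> \<le> \<kappa>0 \<and>
    (\<forall>x0. \<exists>m \<sigma> \<alpha>. gram (1 / C0) (real CARD('d) * C0) m \<sigma> \<and> (\<forall>x. norm (x - x0) \<le> R \<longrightarrow>
        2 / (real CARD('d) * C0) \<le> \<alpha> x \<and> \<alpha> x \<le> 2 * C0 \<and> \<bar>trS m \<sigma> (H x) - \<alpha> x * w x\<bar> \<le> \<beta> * norm (p x) + \<kappa> * norm (H x) + f x)) \<longrightarrow>
    (\<forall>x. \<bar>w x\<bar> \<le> C * F) \<and> (\<forall>x. norm (p x) \<le> C * F) \<and> morrey (\<lambda>x. norm (H x)) (C * F))"

lemma elliptic_bound_exists: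
  assumes "1 \<le> C0"
  shows "\<exists>R>0. \<exists>C\<ge>1. \<exists>\<kappa>0>0. elliptic_bound TYPE('d::finite) C0 R C \<kappa>0"
  unfolding elliptic_bound_def by (rule perturbed_morrey_bound) (use assms in auto)

lemma grad_hess_bound:
  assumes "\<And>is x. length is = 1 \<Longrightarrow> \<bar>D_list is w x\<bar> \<le> B" "\<And>is x. length is = 2 \<Longrightarrow> \<bar>D_list is w x\<bar> \<le> B"
  shows "norm (grad w (x :: real^'d)) \<le> real CARD('d) * B" "norm (hess w x) \<le> real CARD('d) * B"
proof -
  have "\<bar>grad w x \<bullet> e\<bar> \<le> B" if e: "e \<in> Basis" for e
  proof -
    obtain i where "e = axis i 1" using e by (auto simp: Basis_vec_def)
    then show ?thesis using assms(1)[of "[i]" x] by (simp add: inner_axis grad_def)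
  qed
  then have "infnorm (grad w x) \<le> B" unfolding infnorm_Max by (intro Max.boundedI) auto
  then show "norm (grad w x) \<le> real CARD('d) * B"
    by (intro order_trans[OF norm_le_card_infnorm(1) mult_left_mono]) auto
  have "infnorm (hess w x) \<le> B" using assms(2) by (intro infnorm_matrix_le) (simp add: hess_def)
  then show "norm (hess w x) \<le> real CARD('d) * B"
    by (intro order_trans[OF norm_le_card_infnorm(2) mult_left_mono]) auto
qed

lemma derivs_bounded:
  assumes "deriv_seminorm 1 w < \<infinity>" "deriv_seminorm 2 w < \<infinity>"
  obtains B where "0 \<le> B" "\<And>x. norm (grad w x) \<le> B" "\<And>x. norm (hess w x) \<le> B"
proof -
  obtain A1 where A1: "0 \<le> A1" "\<And>is x. length is = 1 \<Longrightarrow> \<bar>D_list is w x\<bar> \<le> A1" using deriv_seminorm_finite[OF assms(1)] by blast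
  obtain A2 where A2: "0 \<le> A2" "\<And>is x. length is = 2 \<Longrightarrow> \<bar>D_list is w x\<bar> \<le> A2" using deriv_seminorm_finite[OF assms(2)] by blast
  have "length is = 1 \<Longrightarrow> \<bar>D_list is w x\<bar> \<le> A1 + A2" "length is = 2 \<Longrightarrow> \<bar>D_list is w x\<bar> \<le> A1 + A2" for "is" x
    using A1(1) A1(2)[of "is" x] A2(1) A2(2)[of "is" x] by auto
  from grad_hess_bound[of w, OF this] show ?thesis
    using A1 A2 by (intro that[of "real CARD('a) * (A1 + A2)"]) auto
qed

context control_problem
begin

text \<open>In the variable y = x/\<tau> with \<tau> = \<rho>^(-1/2) the zeroth-order coefficient is
  of order one and the drift carries a factor \<tau>. A ball of radius R in y has radius \<tau> R in
  x, so the matrix frozen at its centre errs by at most \<open>\<kappa>\<close> there. Regularity of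
  \<open>v\<close> and the finite seminorms of \<open>vs\<close> supply the qualitative bound that
  \<open>elliptic_bound\<close> asks for.\<close>

lemma policy_step_estimate:
  assumes EB: "elliptic_bound TYPE('d) C0 R C \<kappa>0" and R: "0 < R"
    and v: "bounded_solution \<rho> (\<lambda>x p X. F_pi N lam r b S (gibbs_policy N lam r b S w x) x p X) v"
    and vs: "bounded_solution \<rho> (F_sup N lam r b S) vs" "deriv_seminorm 1 vs < \<infinity>" "deriv_seminorm 2 vs < \<infinity>"
    and reg: "regular \<alpha> v" "regular \<alpha> w"
    and e: "\<And>u x. u \<in> space N \<Longrightarrow> infnorm (S x u - S0 x) \<le> e" "0 \<le> e"
    and \<tau>: "0 < \<tau>" "\<tau>\<^sup>2 * \<rho> = 1" "\<tau> * R \<le> 1" "2 * real CARD('d)^2 * C0^2 * \<tau> \<le> \<kappa>0"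
    and \<kappa>: "0 \<le> \<kappa>" "\<kappa> \<le> \<kappa>0" "CARD('d) = 1 \<or> real CARD('d) * (2 * e + C0 * (\<tau> * R) powr \<alpha>) \<le> \<kappa>"
    and F: "0 < F" "morrey (\<lambda>y. 4 * real CARD('d) * C0^2 * \<tau> * norm (\<tau> *\<^sub>R (grad w (\<tau> *\<^sub>R y) - grad vs (\<tau> *\<^sub>R y)))
        + 2 * real CARD('d) * C0 * e * norm (\<tau>\<^sup>2 *\<^sub>R (hess w (\<tau> *\<^sub>R y) - hess vs (\<tau> *\<^sub>R y)))) F"
  shows "\<bar>v (\<tau> *\<^sub>R y) - vs (\<tau> *\<^sub>R y)\<bar> \<le> C * F"
    "norm (\<tau> *\<^sub>R (grad v (\<tau> *\<^sub>R y) - grad vs (\<tau> *\<^sub>R y))) \<le> C * F"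
    "morrey (\<lambda>y. norm (\<tau>\<^sup>2 *\<^sub>R (hess v (\<tau> *\<^sub>R y) - hess vs (\<tau> *\<^sub>R y)))) (C * F)"
proof -
  let ?d = "real CARD('d)"
  have C2s: "C2 v (grad v) (hess v)" "C2 w (grad w) (hess w)" "C2 vs (grad vs) (hess vs)"
    using reg vs(1) by (auto simp: regular_def bounded_solution_def intro: C_class_2_C2)
  have C: "C2 (\<lambda>y. v (\<tau> *\<^sub>R y) - vs (\<tau> *\<^sub>R y)) (\<lambda>y. \<tau> *\<^sub>R (grad v (\<tau> *\<^sub>R y) - grad vs (\<tau> *\<^sub>R y)))
      (\<lambda>y. \<tau>\<^sup>2 *\<^sub>R (hess v (\<tau> *\<^sub>R y) - hess vs (\<tau> *\<^sub>R y)))"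
    using C2_rescale[OF C2_minus[OF C2s(1,3)], of 0 \<tau>] by simp
  define f where "f y = 4 * ?d * C0^2 * \<tau> * norm (\<tau> *\<^sub>R (grad w (\<tau> *\<^sub>R y) - grad vs (\<tau> *\<^sub>R y)))
        + 2 * ?d * C0 * e * norm (\<tau>\<^sup>2 *\<^sub>R (hess w (\<tau> *\<^sub>R y) - hess vs (\<tau> *\<^sub>R y)))" for y
  have Cw: "C2 (\<lambda>y. w (\<tau> *\<^sub>R y) - vs (\<tau> *\<^sub>R y)) (\<lambda>y. \<tau> *\<^sub>R (grad w (\<tau> *\<^sub>R y) - grad vs (\<tau> *\<^sub>R y)))
      (\<lambda>y. \<tau>\<^sup>2 *\<^sub>R (hess w (\<tau> *\<^sub>R y) - hess vs (\<tau> *\<^sub>R y)))"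
    using C2_rescale[OF C2_minus[OF C2s(2,3)], of 0 \<tau>] by simp
  have fc: "continuous_on UNIV f" unfolding f_def
    by (rule continuous_on_add[OF continuous_on_mult_left[OF continuous_on_norm[OF C2D(4)[OF Cw]]]
        continuous_on_mult_left[OF continuous_on_norm[OF C2D(3)[OF Cw]]]])
  have S0n: "norm (S x u - S0 x) \<le> ?d * e" if "u \<in> space N" for x u
    by (intro order_trans[OF norm_le_card_infnorm(2) mult_left_mono] e that) auto
  obtain Bv where Bv: "\<And>x. norm (grad v x) \<le> Bv" "\<And>x. norm (hess v x) \<le> Bv"
    using derivs_bounded[of v] reg(1) unfolding regular_def by metis
  obtain Bs where Bs: "\<And>x. norm (grad vs x) \<le> Bs" "\<And>x. norm (hess vs x) \<le> Bs"
    using derivs_bounded[OF vs(2,3)] by metis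
  obtain B1 where B1: "\<And>x. \<bar>v x\<bar> \<le> B1" using v by (auto simp: bounded_solution_def bounded_iff)
  obtain B2 where B2: "\<And>x. \<bar>vs x\<bar> \<le> B2" using vs(1) by (auto simp: bounded_solution_def bounded_iff)
  define B where "B = max (B1 + B2) (max (\<tau> * (Bv + Bs)) (\<tau>\<^sup>2 * (Bv + Bs)))"
  have Bb: "\<bar>v (\<tau> *\<^sub>R y) - vs (\<tau> *\<^sub>R y)\<bar> \<le> B \<and> norm (\<tau> *\<^sub>R (grad v (\<tau> *\<^sub>R y) - grad vs (\<tau> *\<^sub>R y))) \<le> B
      \<and> norm (\<tau>\<^sup>2 *\<^sub>R (hess v (\<tau> *\<^sub>R y) - hess vs (\<tau> *\<^sub>R y))) \<le> B" for y
  proof -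
    have "\<bar>v (\<tau> *\<^sub>R y) - vs (\<tau> *\<^sub>R y)\<bar> \<le> B1 + B2" using B1[of "\<tau> *\<^sub>R y"] B2[of "\<tau> *\<^sub>R y"] by linarith
    moreover have "norm (\<tau> *\<^sub>R (grad v (\<tau> *\<^sub>R y) - grad vs (\<tau> *\<^sub>R y))) \<le> \<tau> * (Bv + Bs)"
      using \<tau>(1) order_trans[OF norm_triangle_ineq4 add_mono[OF Bv(1) Bs(1)]] by (simp add: mult_left_mono)
    moreover have "norm (\<tau>\<^sup>2 *\<^sub>R (hess v (\<tau> *\<^sub>R y) - hess vs (\<tau> *\<^sub>R y))) \<le> \<tau>\<^sup>2 * (Bv + Bs)"
      using order_trans[OF norm_triangle_ineq4 add_mono[OF Bv(2) Bs(2)]] by (simp add: mult_left_mono)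
    ultimately show ?thesis unfolding B_def by linarith
  qed
  obtain u0 where u0: "u0 \<in> space N" using space_nonempty by blast
  define \<beta> where "\<beta> = 2 * ?d^2 * C0^2 * \<tau>"
  have loc: "\<exists>m \<sigma> \<alpha>. gram (1 / C0) (?d * C0) m \<sigma> \<and> (\<forall>y. norm (y - y0) \<le> R \<longrightarrow>
        2 / (?d * C0) \<le> \<alpha> y \<and> \<alpha> y \<le> 2 * C0 \<and>
        \<bar>trS m \<sigma> (\<tau>\<^sup>2 *\<^sub>R (hess v (\<tau> *\<^sub>R y) - hess vs (\<tau> *\<^sub>R y))) - \<alpha> y * (v (\<tau> *\<^sub>R y) - vs (\<tau> *\<^sub>R y))\<bar>
          \<le> \<beta> * norm (\<tau> *\<^sub>R (grad v (\<tau> *\<^sub>R y) - grad vs (\<tau> *\<^sub>R y))) + \<kappa> * norm (\<tau>\<^sup>2 *\<^sub>R (hess v (\<tau> *\<^sub>R y) - hess vs (\<tau> *\<^sub>R y))) + f y)" for y0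
  proof -
    define al where "al y = (if CARD('d) = 1 then 2 / (avg_S w (\<tau> *\<^sub>R y) $ undefined $ undefined) else 2)" for y
    have "2 / (?d * C0) \<le> al y \<and> al y \<le> 2 * C0 \<and>
        \<bar>trS (if CARD('d) = 1 then 1 else m) (if CARD('d) = 1 then (\<lambda>j. axis undefined 1) else (\<lambda>j. \<chi> i. \<sigma> (\<tau> *\<^sub>R y0) u0 i j))
           (\<tau>\<^sup>2 *\<^sub>R (hess v (\<tau> *\<^sub>R y) - hess vs (\<tau> *\<^sub>R y))) - al y * (v (\<tau> *\<^sub>R y) - vs (\<tau> *\<^sub>R y))\<bar>
          \<le> \<beta> * norm (\<tau> *\<^sub>R (grad v (\<tau> *\<^sub>R y) - grad vs (\<tau> *\<^sub>R y))) + \<kappa> * norm (\<tau>\<^sup>2 *\<^sub>R (hess v (\<tau> *\<^sub>R y) - hess vs (\<tau> *\<^sub>R y))) + f y"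
      if y: "norm (y - y0) \<le> R" for y
    proof -
      let ?x = "\<tau> *\<^sub>R y" and ?z = "\<tau> *\<^sub>R y0"
      define D where "D = ?d * C0 * norm (grad w ?x - grad vs ?x) + 1/2 * (?d * e) * norm (hess w ?x - hess vs ?x)"
      have dx: "dist ?x ?z \<le> \<tau> * R"
      proof -
        have "\<tau> *\<^sub>R y - \<tau> *\<^sub>R y0 = \<tau> *\<^sub>R (y - y0)" by (simp add: scaleR_diff_right)
        then have "dist ?x ?z = norm (\<tau> *\<^sub>R (y - y0))" by (simp only: dist_norm)
        also have "\<dots> = \<tau> * norm (y - y0)" using \<tau>(1) unfolding norm_scaleR by simp
        also have "\<dots> \<le> \<tau> * R" using y \<tau>(1) by (intro mult_left_mono) auto
        finally show ?thesis .
      qed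
      have eq: "\<bar>\<rho> * (v ?x - vs ?x) - avg_b w ?x \<bullet> (grad v ?x - grad vs ?x) - 1/2 * trace (avg_S w ?x ** (hess v ?x - hess vs ?x))\<bar> \<le> 2 * D"
        unfolding D_def by (rule difference_equation[OF v vs(1) S0n])
      have "C0 * dist ?x ?z powr \<alpha> \<le> C0 * (\<tau> * R) powr \<alpha>"
        using dx pars by (intro mult_left_mono powr_mono2) auto
      then have "?d * (2 * e + C0 * dist ?x ?z powr \<alpha>) \<le> ?d * (2 * e + C0 * (\<tau> * R) powr \<alpha>)"
        by - (rule mult_left_mono[OF add_left_mono], assumption, simp)
      then have osc: "CARD('d) = 1 \<or> ?d * (2 * e + C0 * dist ?x ?z powr \<alpha>) \<le> \<kappa>" using \<kappa>(3) by linarith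
      have dx1: "dist ?x ?z \<le> 1" using dx \<tau>(3) by linarith
      \<comment> \<open>Each derivative absorbs one factor \<tau>. The gradient term keeps a further
        \<tau> as coefficient, while the Hessian term keeps none and is small only through
        e.\<close>
      have fD: "4 * C0 * \<tau>\<^sup>2 * D = f y"
      proof -
        have alg: "4 * C0 * \<tau>\<^sup>2 * (?d * C0 * a + 1/2 * (?d * e) * h) = 4 * ?d * C0^2 * \<tau> * (\<tau> * a) + 2 * ?d * C0 * e * (\<tau>\<^sup>2 * h)" for a h
          by (simp add: power2_eq_square algebra_simps)
        have n: "norm (\<tau> *\<^sub>R (grad w ?x - grad vs ?x)) = \<tau> * norm (grad w ?x - grad vs ?x)"
            "norm (\<tau>\<^sup>2 *\<^sub>R (hess w ?x - hess vs ?x)) = \<tau>\<^sup>2 * norm (hess w ?x - hess vs ?x)"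
          using \<tau>(1) unfolding norm_scaleR by simp_all
        show ?thesis unfolding D_def f_def n by (rule alg)
      qed
      note fr = frozen_equation[OF eq \<tau>(1,2) u0 e(1) dx1 osc \<kappa>(1)]
      show ?thesis unfolding al_def \<beta>_def fD[symmetric] using fr by blast
    qed
    then show ?thesis using gram_frozen[OF u0, of "\<tau> *\<^sub>R y0"] by blast
  qed
  have mf: "morrey f F" using F(2) unfolding f_def .
  have b: "0 \<le> \<beta>" "\<beta> \<le> \<kappa>0" using \<tau>(1,4) by (auto simp: \<beta>_def)
  have all: "\<forall>y. \<bar>v (\<tau> *\<^sub>R y) - vs (\<tau> *\<^sub>R y)\<bar> \<le> B \<and> norm (\<tau> *\<^sub>R (grad v (\<tau> *\<^sub>R y) - grad vs (\<tau> *\<^sub>R y))) \<le> B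
      \<and> norm (\<tau>\<^sup>2 *\<^sub>R (hess v (\<tau> *\<^sub>R y) - hess vs (\<tau> *\<^sub>R y))) \<le> B" using Bb by blast
  note res = EB[unfolded elliptic_bound_def, rule_format, OF conjI[OF C conjI[OF all conjI[OF F(1) conjI[OF fc conjI[OF mf
      conjI[OF b(1) conjI[OF b(2) conjI[OF \<kappa>(1) conjI[OF \<kappa>(2) allI[OF loc]]]]]]]]]]]
  show "\<bar>v (\<tau> *\<^sub>R y) - vs (\<tau> *\<^sub>R y)\<bar> \<le> C * F"
    "norm (\<tau> *\<^sub>R (grad v (\<tau> *\<^sub>R y) - grad vs (\<tau> *\<^sub>R y))) \<le> C * F"
    "morrey (\<lambda>y. norm (\<tau>\<^sup>2 *\<^sub>R (hess v (\<tau> *\<^sub>R y) - hess vs (\<tau> *\<^sub>R y)))) (C * F)"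
    using res by blast+
qed

end

context control_problem
begin

text \<open>The first step starts from sup bounds on the derivatives of v0 - vs. In rescaled
  variables these carry \<tau> and \<tau>^2, and the coefficient of the gradient term supplies
  another \<tau>, so the total gain is \<tau>^2. Each later step feeds the sup bound of the gradient
  and the Morrey bound of the Hessian back into \<open>policy_step_estimate\<close>, and
  \<open>half\<close> makes it a contraction by 1/2.\<close>

lemma policy_iteration_estimate:
  fixes K :: real
  defines "d \<equiv> real CARD('d)" and "V \<equiv> measure lborel (cball (0::real^'d) 1) + 1"
  assumes EB: "elliptic_bound TYPE('d) C0 R C \<kappa>0" and R: "0 < R" and C: "1 \<le> C"
    and PI: "policy_iteration N lam \<rho> r b S v0 v"
    and vs: "bounded_solution \<rho> (F_sup N lam r b S) vs" "deriv_seminorm 1 vs < \<infinity>" "deriv_seminorm 2 vs < \<infinity>"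
    and reg: "regular \<alpha> v0" and sch: "schauder_bound TYPE('d) \<alpha> C0 \<eta>" and \<rho>: "1 \<le> \<rho>"
    and e: "\<And>u x. u \<in> space N \<Longrightarrow> infnorm (S x u - S0 x) \<le> e" "0 \<le> e" "e \<le> 1"
    and \<tau>: "0 < \<tau>" "\<tau>\<^sup>2 * \<rho> = 1" "\<tau> * R \<le> 1" "2 * d^2 * C0^2 * \<tau> \<le> \<kappa>0"
    and \<kappa>: "0 \<le> \<kappa>" "\<kappa> \<le> \<kappa>0" "CARD('d) = 1 \<or> d * (2 * e + C0 * (\<tau> * R) powr \<alpha>) \<le> \<kappa>"
    and half: "2 * C * (V * (4 * d * C0^2 * \<tau>) + 2 * d * C0 * e) \<le> 1 / 2"
    and K: "0 \<le> K" "\<And>x. norm (grad v0 x - grad vs x) \<le> d * K" "\<And>x. norm (hess v0 x - hess vs x) \<le> d * K"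
    and n: "1 \<le> n"
  shows "\<bar>v n x - vs x\<bar> \<le> 2 * (C * (V * ((4 * d * C0^2 + 2 * d * C0) * d * \<tau>\<^sup>2 * (K + 1)))) * (1/2) ^ n"
    "\<tau> * norm (grad (v n) x - grad vs x) \<le> 2 * (C * (V * ((4 * d * C0^2 + 2 * d * C0) * d * \<tau>\<^sup>2 * (K + 1)))) * (1/2) ^ n"
    "C_class 2 (v n)"
proof -
  have d1: "1 \<le> d" by (simp add: d_def)
  have V1: "1 \<le> V" by (simp add: V_def)
  have C01: "1 \<le> C0" by (rule pars)
  have v0: "v 0 = v0" and vn: "\<And>n. bounded_solution \<rho> (\<lambda>x p X. F_pi N lam r b S (gibbs_policy N lam r b S (v n) x) x p X) (v (Suc n))"
    using PI unfolding policy_iteration_def by (auto dest: spec[of _ "Suc _"])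
  have regn: "regular \<alpha> (v n)" for n
    by (induction n) (use v0 reg regular_policy_step[OF _ vn sch \<rho>] in auto)
  define q where "q n y = \<tau> *\<^sub>R (grad (v n) (\<tau> *\<^sub>R y) - grad vs (\<tau> *\<^sub>R y))" for n y
  define G where "G n y = \<tau>\<^sup>2 *\<^sub>R (hess (v n) (\<tau> *\<^sub>R y) - hess vs (\<tau> *\<^sub>R y))" for n y
  have Cc: "C2 (\<lambda>y. v n (\<tau> *\<^sub>R y) - vs (\<tau> *\<^sub>R y)) (q n) (G n)" for n
  proof -
    have "C2 (v n) (grad (v n)) (hess (v n))" "C2 vs (grad vs) (hess vs)"
      using regn[of n] vs(1) by (auto simp: regular_def bounded_solution_def intro: C_class_2_C2)
    from C2_rescale[OF C2_minus[OF this], of 0 \<tau>] show ?thesis by (simp add: q_def[abs_def] G_def[abs_def])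
  qed
  define a0 where "a0 = 4 * d * C0^2 * \<tau>"
  define b0 where "b0 = 2 * d * C0 * e"
  have ab0: "0 \<le> a0" "0 \<le> b0" using \<tau>(1) e(2) d1 C01 by (simp_all add: a0_def b0_def)
  \<comment> \<open>\<open>K + 1\<close> in place of \<open>K\<close> keeps the right-hand side
    positive, as \<open>elliptic_bound\<close> requires. The summand without the square of C0 bounds
    the Hessian coefficient through e \<le> 1.\<close>
  define M where "M = (4 * d * C0^2 + 2 * d * C0) * d * \<tau>\<^sup>2 * (K + 1)"
  have M0: "0 < M"
  proof -
    have "0 < 4 * d * C0^2" "0 \<le> 2 * d * C0" using d1 C01 by (auto intro!: mult_pos_pos)
    then have "0 < 4 * d * C0^2 + 2 * d * C0" by linarith
    moreover have "0 < K + 1" using K(1) by linarith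
    ultimately show ?thesis unfolding M_def using d1 \<tau>(1) by (auto intro!: mult_pos_pos)
  qed
  define Z1 where "Z1 = C * (V * M)"
  have Z1: "0 < Z1" using M0 V1 C by (simp add: Z1_def)
  have step: "(\<forall>y. \<bar>v (Suc n) (\<tau> *\<^sub>R y) - vs (\<tau> *\<^sub>R y)\<bar> \<le> C * F) \<and> (\<forall>y. norm (q (Suc n) y) \<le> C * F) \<and> morrey (\<lambda>y. norm (G (Suc n) y)) (C * F)"
    if F: "0 < F" "morrey (\<lambda>y. a0 * norm (q n y) + b0 * norm (G n y)) F" for n F
    using policy_step_estimate[OF EB R vn vs regn[of "Suc n"] regn[of n] e(1,2) \<tau>(1-3) \<tau>(4)[unfolded d_def] \<kappa>(1,2) \<kappa>(3)[unfolded d_def] F(1)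
        F(2)[unfolded a0_def b0_def q_def G_def d_def]] unfolding q_def G_def by blast
  have main: "(\<forall>y. \<bar>v (Suc n) (\<tau> *\<^sub>R y) - vs (\<tau> *\<^sub>R y)\<bar> \<le> Z1 / 2 ^ n) \<and> (\<forall>y. norm (q (Suc n) y) \<le> Z1 / 2 ^ n)
      \<and> morrey (\<lambda>y. norm (G (Suc n) y)) (Z1 / 2 ^ n)" for n
  proof (induction n)
    case 0
    have "morrey (\<lambda>y. a0 * norm (q 0 y) + b0 * norm (G 0 y)) (V * M)"
      unfolding V_def
    proof (rule morrey_bounded)
      show "continuous_on UNIV (\<lambda>y. a0 * norm (q 0 y) + b0 * norm (G 0 y))"
        by (rule continuous_on_add[OF continuous_on_mult_left[OF continuous_on_norm[OF C2D(4)[OF Cc]]]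
            continuous_on_mult_left[OF continuous_on_norm[OF C2D(3)[OF Cc]]]])
      fix y
      have "norm (q 0 y) \<le> \<tau> * (d * K)" using K(2)[of "\<tau> *\<^sub>R y"] \<tau>(1) by (simp add: q_def v0)
      then have 1: "a0 * norm (q 0 y) \<le> a0 * (\<tau> * (d * K))" using ab0(1) by (rule mult_left_mono)
      have "norm (G 0 y) \<le> \<tau>\<^sup>2 * (d * K)" using K(3)[of "\<tau> *\<^sub>R y"] \<tau>(1) by (simp add: G_def v0)
      then have 2: "b0 * norm (G 0 y) \<le> b0 * (\<tau>\<^sup>2 * (d * K))" using ab0 by (intro mult_left_mono)
      have 3: "b0 * (\<tau>\<^sup>2 * (d * K)) \<le> (2 * d * C0) * (\<tau>\<^sup>2 * (d * K))"
      proof (intro mult_right_mono)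
        show "b0 \<le> 2 * d * C0" using mult_left_mono[OF e(3), of "2 * d * C0"] d1 C01 by (simp add: b0_def)
      qed (use d1 K(1) in auto)
      have "a0 * (\<tau> * (d * K)) + (2 * d * C0) * (\<tau>\<^sup>2 * (d * K)) = (4 * d * C0^2 + 2 * d * C0) * d * \<tau>\<^sup>2 * K"
        by (simp add: a0_def power2_eq_square algebra_simps)
      also have "\<dots> \<le> M" unfolding M_def using d1 C01 by (intro mult_left_mono) auto
      finally have "a0 * norm (q 0 y) + b0 * norm (G 0 y) \<le> M" using 1 2 3 by linarith
      moreover have "0 \<le> a0 * norm (q 0 y) + b0 * norm (G 0 y)" using ab0 by simp
      ultimately show "\<bar>a0 * norm (q 0 y) + b0 * norm (G 0 y)\<bar> \<le> M" by linarith
    qed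
    from step[OF _ this] show ?case using V1 M0 by (simp add: Z1_def)
  next
    case (Suc n)
    define Z where "Z = Z1 / 2 ^ n"
    have Z: "0 < Z" using Z1 by (simp add: Z_def)
    have q: "\<And>y. norm (q (Suc n) y) \<le> Z" and G: "morrey (\<lambda>y. norm (G (Suc n) y)) Z" using Suc by (auto simp: Z_def)
    define F where "F = 2 * (V * (a0 * Z) + b0 * Z + 0)"
    have mF: "morrey (\<lambda>y. a0 * norm (q (Suc n) y) + b0 * norm (G (Suc n) y) + 0) F"
      unfolding F_def V_def
    proof (rule morrey_add3)
      show c1: "continuous_on UNIV (\<lambda>y. a0 * norm (q (Suc n) y))"
        by (rule continuous_on_mult_left[OF continuous_on_norm[OF C2D(4)[OF Cc]]])
      show "continuous_on UNIV (\<lambda>y. b0 * norm (G (Suc n) y))"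
        by (rule continuous_on_mult_left[OF continuous_on_norm[OF C2D(3)[OF Cc]]])
      show "morrey (\<lambda>y. a0 * norm (q (Suc n) y)) ((measure lborel (cball (0::real^'d) 1) + 1) * (a0 * Z))"
      proof (rule morrey_bounded[OF c1])
        show "\<bar>a0 * norm (q (Suc n) y)\<bar> \<le> a0 * Z" for y using ab0 q[of y] by (simp add: abs_mult mult_left_mono)
      qed
      show "morrey (\<lambda>y. b0 * norm (G (Suc n) y)) (b0 * Z)" by (rule morrey_scale[OF G])
      show "morrey (\<lambda>x::real^'d. 0) 0" by (simp add: morrey_def)
    qed (use ab0 Z in auto)
    have a0p: "0 < a0" unfolding a0_def using d1 C01 \<tau>(1) by (intro mult_pos_pos) auto
    have F0: "0 < F" unfolding F_def using a0p V1 Z ab0 by (intro mult_pos_pos add_pos_nonneg) auto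
    have CF: "C * F \<le> Z / 2"
    proof -
      have "C * F = 2 * C * (V * a0 + b0) * Z" by (simp add: F_def algebra_simps)
      also have "\<dots> \<le> 1 / 2 * Z" using half Z unfolding a0_def[symmetric] b0_def[symmetric] by (intro mult_right_mono) auto
      finally show ?thesis by simp
    qed
    have CF0: "0 \<le> C * F" using C F0 by simp
    have mF': "morrey (\<lambda>y. a0 * norm (q (Suc n) y) + b0 * norm (G (Suc n) y)) F" using mF by simp
    note st = step[OF F0 mF']
    have "\<bar>v (Suc (Suc n)) (\<tau> *\<^sub>R y) - vs (\<tau> *\<^sub>R y)\<bar> \<le> Z / 2" for y
      using conjunct1[OF st, THEN spec, of y] CF by linarith
    moreover have "norm (q (Suc (Suc n)) y) \<le> Z / 2" for y
      using conjunct1[OF conjunct2[OF st], THEN spec, of y] CF by linarith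
    moreover have "morrey (\<lambda>y. norm (G (Suc (Suc n)) y)) (Z / 2)"
      by (rule morrey_weaken[OF conjunct2[OF conjunct2[OF st]] CF0 CF])
    ultimately have "(\<forall>y. \<bar>v (Suc (Suc n)) (\<tau> *\<^sub>R y) - vs (\<tau> *\<^sub>R y)\<bar> \<le> Z / 2) \<and> (\<forall>y. norm (q (Suc (Suc n)) y) \<le> Z / 2)
      \<and> morrey (\<lambda>y. norm (G (Suc (Suc n)) y)) (Z / 2)" by blast
    then show ?case by (simp add: Z_def mult.commute)
  qed
  obtain k where k: "n = Suc k" using n by (cases n) auto
  \<comment> \<open>\<open>Z1 / 2 ^ k\<close> belongs to the iterate \<open>Suc k\<close>, whence
    the factor 2 in front of (1/2)^n.\<close>
  have Zk: "Z1 / 2 ^ k = 2 * Z1 * (1/2) ^ n" by (simp add: k power_one_over)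
  have "\<bar>v n x - vs x\<bar> \<le> Z1 / 2 ^ k" using conjunct1[OF main[of k], THEN spec, of "(1 / \<tau>) *\<^sub>R x"] \<tau>(1) by (simp add: k)
  then show "\<bar>v n x - vs x\<bar> \<le> 2 * (C * (V * ((4 * d * C0^2 + 2 * d * C0) * d * \<tau>\<^sup>2 * (K + 1)))) * (1/2) ^ n"
    unfolding Zk unfolding Z1_def M_def .
  have "norm (q (Suc k) ((1 / \<tau>) *\<^sub>R x)) \<le> Z1 / 2 ^ k" using main[of k] by blast
  then have "\<tau> * norm (grad (v n) x - grad vs x) \<le> Z1 / 2 ^ k" using \<tau>(1) by (simp add: q_def k)
  then show "\<tau> * norm (grad (v n) x - grad vs x) \<le> 2 * (C * (V * ((4 * d * C0^2 + 2 * d * C0) * d * \<tau>\<^sup>2 * (K + 1)))) * (1/2) ^ n"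
    unfolding Zk unfolding Z1_def M_def .
  show "C_class 2 (v n)" using regn[of n] by (simp add: regular_def)
qed

end

section \<open>From the sup bounds to the stated estimates\<close>

lemma ball_integral_le:
  fixes f :: "real^'d \<Rightarrow> real"
  assumes "\<And>x. 0 \<le> f x" "\<And>x. f x \<le> c" "0 \<le> c"
  shows "(LINT x:ball x0 1|lborel. f x) \<le> c * measure lborel (cball (0::real^'d) 1)"
proof -
  \<comment> \<open>A non-integrable left-hand side has integral 0 by convention, and then the bound
    holds because the majorant is nonnegative.\<close>
  have "(LINT x|lborel. indicator (ball x0 1) x *\<^sub>R f x) \<le> (LINT x|lborel. indicator (cball x0 1) x *\<^sub>R c)"
  proof (rule integral_mono')
    show "integrable lborel (\<lambda>x. indicator (cball x0 1) x *\<^sub>R c)" by (rule borel_integrable_compact) auto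
  qed (use assms in \<open>auto simp: indicator_def\<close>)
  also have "\<dots> = c * measure lborel (cball x0 1)" by simp
  also have "measure lborel (cball x0 1) = measure lborel (cball (0::real^'d) 1)" by (simp add: content_cball)
  finally show ?thesis by (simp add: set_lebesgue_integral_def)
qed

text \<open>The factor 1/(2 V) pays for the volume of the unit ball and for the presence of two
  integrals: their sum is at most 2 V s^2 with s = (K + 1) h/(2 V). The factor \<tau> in the bound
  of \<open>w\<close> cancels \<rho> in the first conclusion; in the last one it is at most
  \<rho>^(-1/(d+2)), since \<rho> \<ge> 1 and 1/(d+2) \<le> 1/2.\<close>

lemma error_terms:
  fixes w g :: "real^'d \<Rightarrow> real"
  assumes K: "0 \<le> K" and V: "V = measure lborel (cball (0::real^'d) 1) + 1" and \<rho>: "1 \<le> \<rho>" and \<tau>: "0 < \<tau>" "\<tau>\<^sup>2 * \<rho> = 1"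
    and h: "0 < h" "h \<le> (1::real)"
    and w: "\<And>x. \<bar>w x\<bar> \<le> \<tau> * (1 / (2 * V) * ((K + 1) * h))" and g: "\<And>x. 0 \<le> g x" "\<And>x. g x \<le> 1 / (2 * V) * ((K + 1) * h)"
    and T: "(K + 1) ^ (CARD('d) + 2) * h \<le> T"
  shows "\<rho> * (LINT x:ball x0 1|lborel. (w x)^2) + (LINT x:ball x0 1|lborel. (g x)^2) \<le> T"
    "g x \<le> T powr (1 / (real CARD('d) + 2))"
    "\<bar>w x\<bar> \<le> \<rho> powr (- 1 / (real CARD('d) + 2)) * T powr (1 / (real CARD('d) + 2) + real CARD('d) / (real CARD('d) + 2)^2)"
proof -
  define s where "s = 1 / (2 * V) * ((K + 1) * h)"
  let ?D = "CARD('d) + 2"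
  have V1: "1 \<le> V" using V by simp
  have k1: "1 \<le> K + 1" using K by simp
  have s0: "0 \<le> s" using V1 K h by (simp add: s_def)
  have sk: "s \<le> (K + 1) * h"
  proof -
    have "s \<le> 1 * ((K + 1) * h)" unfolding s_def using V1 K h by (intro mult_right_mono) auto
    then show ?thesis by simp
  qed
  have VV: "V - 1 \<le> V" by simp
  have b1: "(LINT x:ball x0 1|lborel. (w x)^2) \<le> (\<tau> * s)^2 * (V - 1)"
  proof -
    have "(w x)^2 \<le> (\<tau> * s)^2" for x using power_mono[OF w[of x] abs_ge_zero, of 2] by (simp add: s_def)
    from ball_integral_le[of "\<lambda>x. (w x)^2", OF _ this] show ?thesis by (simp add: V)
  qed
  have b2: "(LINT x:ball x0 1|lborel. (g x)^2) \<le> s^2 * (V - 1)"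
  proof -
    have "(g x)^2 \<le> s^2" for x using power_mono[OF g(2)[of x] g(1), of 2] by (simp add: s_def)
    from ball_integral_le[of "\<lambda>x. (g x)^2", OF _ this] show ?thesis by (simp add: V)
  qed
  have "\<rho> * (LINT x:ball x0 1|lborel. (w x)^2) \<le> \<rho> * ((\<tau> * s)^2 * (V - 1))" using b1 \<rho> by (intro mult_left_mono) auto
  also have "\<dots> = (\<tau>\<^sup>2 * \<rho>) * (s^2 * (V - 1))" by (simp add: power_mult_distrib)
  finally have "\<rho> * (LINT x:ball x0 1|lborel. (w x)^2) + (LINT x:ball x0 1|lborel. (g x)^2) \<le> 2 * (s^2 * (V - 1))"
    using b2 \<tau>(2) by simp
  also have "\<dots> \<le> 2 * (s^2 * V)" by (intro mult_left_mono) auto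
  also have "\<dots> = (1 / (2 * V)) * ((K + 1) * h)^2" using V1 by (simp add: s_def power2_eq_square field_simps)
  also have "\<dots> \<le> 1 * ((K + 1) * h)^2" using V1 by (intro mult_right_mono) auto
  also have "\<dots> = (K + 1)^2 * (h * h)" by (simp add: power2_eq_square)
  also have "\<dots> \<le> (K + 1) ^ ?D * (h * 1)" using k1 h by (intro mult_mono power_increasing) auto
  also have "\<dots> \<le> T" using T by simp
  finally show "\<rho> * (LINT x:ball x0 1|lborel. (w x)^2) + (LINT x:ball x0 1|lborel. (g x)^2) \<le> T" .
  have D: "real ?D = real CARD('d) + 2" "2 \<le> real ?D" "1 \<le> real ?D" "0 < real ?D" by simp_all
  have "1 / real ?D \<le> 1" using D by simp
  then have "(K + 1) * h \<le> T powr (1 / real ?D)"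
    by (intro powr_le_aux[OF k1 h _ _ _ T]) auto
  then show "g x \<le> T powr (1 / (real CARD('d) + 2))" using g(2)[of x] sk unfolding s_def D(1) by linarith
  define \<theta> where "\<theta> = 1 / real ?D + real CARD('d) / (real ?D)^2"
  have \<theta>: "1 / real ?D \<le> \<theta>" "\<theta> \<le> 1"
  proof -
    show "1 / real ?D \<le> \<theta>" by (simp add: \<theta>_def)
    have "\<theta> \<le> 1 / real ?D + real ?D / (real ?D)^2" unfolding \<theta>_def by (intro add_left_mono divide_right_mono) auto
    also have "\<dots> = 2 / real ?D" using D(4) by (simp only: power2_eq_square divide_divide_eq_left[symmetric] divide_self)
    also have "\<dots> \<le> 1" using D(2) by simp
    finally show "\<theta> \<le> 1" .
  qed
  have 1: "(K + 1) * h \<le> T powr \<theta>" by (rule powr_le_aux[OF k1 h \<theta> _ T]) simp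
  have "\<tau> = \<rho> powr (- (1/2))"
  proof -
    have "(\<rho> powr (- (1/2)))^2 * \<rho> = 1" using \<rho> by (simp add: powr_minus powr_half_sqrt power_inverse)
    then have "(\<rho> powr (- (1/2)))^2 = \<tau>\<^sup>2" using \<tau>(2) \<rho> by (metis mult_right_cancel not_one_le_zero)
    then show ?thesis using \<tau>(1) by (simp add: power2_eq_iff_nonneg)
  qed
  also have "\<rho> powr (- (1/2)) \<le> \<rho> powr (- 1 / real ?D)"
    using \<rho> D(2) by (intro powr_mono) (auto simp: field_simps)
  finally have 2: "\<tau> \<le> \<rho> powr (- 1 / real ?D)" .
  have "\<bar>w x\<bar> \<le> \<tau> * s" using w[of x] by (simp add: s_def)
  also have "\<dots> \<le> \<rho> powr (- 1 / real ?D) * T powr \<theta>" using 1 2 sk s0 \<tau>(1) by (intro mult_mono) auto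
  finally show "\<bar>w x\<bar> \<le> \<rho> powr (- 1 / (real CARD('d) + 2)) * T powr (1 / (real CARD('d) + 2) + real CARD('d) / (real CARD('d) + 2)^2)"
    unfolding \<theta>_def D(1) .
qed

lemma norm_k_D_list:
  assumes "norm_k 2 w = ennreal k" "0 \<le> k" "length is \<le> 2"
  shows "\<bar>D_list is w x\<bar> \<le> k"
proof -
  have "sup_norm (D_list is w) \<le> deriv_seminorm (length is) w"
    unfolding deriv_seminorm_def by (rule SUP_upper) simp
  also have "\<dots> \<le> norm_k 2 w"
    unfolding norm_k_def using assms(3) by (intro member_le_sum) auto
  finally have "infnorm (D_list is w x) \<le> k" using assms sup_norm_le_iff[of k "D_list is w"] by simp
  then show ?thesis by simp
qed

text \<open>With \<tau> = \<rho>^(-1/2) the first condition says that \<tau> is at most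
  A^(-1/(1-\<alpha>)). Since 1/(1-\<alpha>) \<ge> 1 and \<alpha>/(1-\<alpha>) \<ge> \<alpha> \<ge>
  \<alpha>0, both \<tau> A and \<tau>^\<alpha> A^\<alpha>0 are at most 1. The condition on
  \<epsilon> loses its power of \<rho> because \<rho> \<ge> 1.\<close>

lemma large_rho:
  fixes A \<rho> \<alpha> \<epsilon> :: real
  assumes A: "1 \<le> A" and \<alpha>: "0 < \<alpha>" "\<alpha> < 1" and \<epsilon>: "0 < \<epsilon>" "\<epsilon> * A * \<rho> powr (\<alpha> / 2) \<le> 1"
    and \<rho>: "0 < \<rho>" "A powr (2 / (1 - \<alpha>)) \<le> \<rho>"
  obtains \<tau> where "0 < \<tau>" "\<tau>\<^sup>2 * \<rho> = 1" "1 \<le> \<rho>" "\<tau> * A \<le> 1" "\<epsilon> * A \<le> 1"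
    "\<And>\<alpha>0. \<alpha>0 \<le> \<alpha> \<Longrightarrow> \<tau> powr \<alpha> * A powr \<alpha>0 \<le> 1"
proof (rule that[of "\<rho> powr (- (1/2))"])
  have a: "2 \<le> 2 / (1 - \<alpha>)" "\<alpha> \<le> \<alpha> / (1 - \<alpha>)" using \<alpha> by (auto simp: field_simps)
  have "1 \<le> A powr (2 / (1 - \<alpha>))" using A a \<alpha> by (intro ge_one_powr_ge_zero) auto
  then show \<rho>1: "1 \<le> \<rho>" using \<rho> by linarith
  show "0 < \<rho> powr (- (1/2))" using \<rho> by simp
  show "(\<rho> powr (- (1/2)))\<^sup>2 * \<rho> = 1" using \<rho>(1) by (simp add: powr_minus powr_half_sqrt power_inverse)
  have pw: "\<rho> powr (- (\<beta>/2)) * A powr \<gamma> \<le> 1" if "0 \<le> \<beta>" "\<gamma> \<le> \<beta> / (1 - \<alpha>)" for \<beta> \<gamma>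
  proof -
    have "A powr \<gamma> \<le> A powr (\<beta> / (1 - \<alpha>))" using A that by (intro powr_mono) auto
    also have "\<dots> = A powr (2 / (1 - \<alpha>) * (\<beta>/2))" using \<alpha> by (simp add: field_simps)
    also have "\<dots> = (A powr (2 / (1 - \<alpha>))) powr (\<beta>/2)" by (rule powr_powr[symmetric])
    also have "\<dots> \<le> \<rho> powr (\<beta>/2)" using \<rho> that by (intro powr_mono2) auto
    finally have "\<rho> powr (- (\<beta>/2)) * A powr \<gamma> \<le> \<rho> powr (- (\<beta>/2)) * \<rho> powr (\<beta>/2)"
      by (intro mult_left_mono) auto
    also have "\<dots> = 1" using \<rho>(1) by (simp add: powr_add[symmetric])
    finally show ?thesis .
  qed
  show "\<rho> powr (- (1/2)) * A \<le> 1" using pw[of 1 1] A \<alpha> by (simp add: field_simps)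
  show "(\<rho> powr (- (1/2))) powr \<alpha> * A powr \<alpha>0 \<le> 1" if "\<alpha>0 \<le> \<alpha>" for \<alpha>0
    using pw[of \<alpha> \<alpha>0] \<alpha> a that by (simp add: powr_powr)
  have "1 \<le> \<rho> powr (\<alpha>/2)" using \<rho>1 \<alpha> by (intro ge_one_powr_ge_zero) auto
  then have "\<epsilon> * A * 1 \<le> \<epsilon> * A * \<rho> powr (\<alpha>/2)" using \<epsilon> A by (intro mult_left_mono) auto
  then show "\<epsilon> * A \<le> 1" using \<epsilon>(2) by linarith
qed

lemma lebesgue_U_prob:
  assumes "emeasure (lebesgue_Rl l) U = 1"
  shows "space (lebesgue_U l U) = U" "finite_measure (lebesgue_U l U)" "measure (lebesgue_U l U) U = 1"
proof -
  have U: "U \<in> sets (lebesgue_Rl l)" using assms emeasure_notin_sets by fastforce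
  show sp: "space (lebesgue_U l U) = U"
    using sets.sets_into_space[OF U] by (auto simp: lebesgue_U_def space_restrict_space)
  have em: "emeasure (lebesgue_U l U) U = 1"
    using U assms by (simp add: lebesgue_U_def emeasure_restrict_space)
  then show "finite_measure (lebesgue_U l U)" using sp by (intro finite_measureI) simp
  show "measure (lebesgue_U l U) U = 1" using em by (simp add: measure_def)
qed

lemma mult_le_one_if_le:
  fixes x :: real
  assumes "x * A \<le> 1" "0 \<le> x" "s \<le> A"
  shows "x * s \<le> 1"
  using mult_left_mono[OF assms(3,2)] assms(1) by linarith

theorem theorem3p2:
  fixes K :: real
  assumes "0 \<le> K"
  shows
   "\<exists>C>0. \<forall>lam>0. \<forall>C0\<ge>1. \<forall>\<eta>. \<exists>A1\<ge>1. \<exists>C'>0.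
    \<forall>(l::nat) (m::nat) (U :: control set)
      (r :: real^'d \<Rightarrow> control \<Rightarrow> real) (b :: real^'d \<Rightarrow> control \<Rightarrow> real^'d)
      (\<sigma> :: real^'d \<Rightarrow> control \<Rightarrow> 'd \<Rightarrow> nat \<Rightarrow> real) (S0 :: real^'d \<Rightarrow> real^'d^'d)
      (v0 :: real^'d \<Rightarrow> real) (vs :: real^'d \<Rightarrow> real) (v :: nat \<Rightarrow> real^'d \<Rightarrow> real)
      (\<alpha>::real) (\<epsilon>0::real) (\<epsilon>1::real) (\<rho>::real) N S.
      1 \<le> l \<and> 1 \<le> m \<and> bounded_domain l U \<and> emeasure (lebesgue_Rl l) U = 1 \<and>
      N = lebesgue_U l U \<and> S = diffusion m \<sigma> \<and> measurable_coeffs N m r b \<sigma> \<and>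
      0 < \<alpha> \<and> \<alpha> < 1 \<and> 0 < \<epsilon>0 \<and> \<epsilon>0 < 1 \<and> 0 < \<epsilon>1 \<and> \<epsilon>1 < 1 \<and> 0 < \<rho> \<and>
      schauder_bound TYPE('d) \<alpha> C0 \<eta> \<and>
      (\<forall>u\<in>U. (\<forall>x. loewner_le (mat (1 / C0)) (S x u)) \<and>
             norm_0a \<alpha> (\<lambda>x. r x u) \<le> ennreal C0 \<and>
             norm_0a \<alpha> (\<lambda>x. b x u) \<le> ennreal C0 \<and>
             norm_0a \<alpha> (\<lambda>x. S x u) \<le> ennreal C0) \<and>
      (\<forall>x. transpose (S0 x) = S0 x) \<and> (\<exists>L. L-lipschitz_on UNIV S0) \<and>
      (SUP u\<in>U. sup_norm (\<lambda>x. S x u - S0 x)) \<le> ennreal \<epsilon>0 \<and>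
      (SUP u\<in>U. hoelder_seminorm \<alpha> (\<lambda>x. S x u - S0 x)) \<le> ennreal \<epsilon>1 \<and>
      v0 \<in> hoelder_space 2 \<alpha> \<and>
      bounded_solution \<rho> (F_sup N lam r b S) vs \<and>
      policy_iteration N lam \<rho> r b S v0 v \<and>
      norm_k 2 v0 + norm_k 2 vs = ennreal K \<and>
      A1 powr (2 / (1 - \<alpha>)) \<le> \<rho> \<and> \<epsilon>0 * A1 * \<rho> powr (\<alpha> / 2) \<le> 1 \<and> \<epsilon>1 * A1 \<le> 1
      \<longrightarrow>
      (\<forall>n\<ge>1. \<forall>x0.
         \<rho> * (LINT x:ball x0 1|lborel. (v n x - vs x)^2) +
         (LINT x:ball x0 1|lborel. (infnorm (grad (\<lambda>y. v n y - vs y) x))^2)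
         \<le> C * (1/2)^n + C' * \<epsilon>0^2 / \<rho>) \<and>
      (\<forall>n\<ge>1.
         sup_norm (grad (\<lambda>y. v n y - vs y))
         \<le> ennreal ((C * (1/2)^n + C' * \<epsilon>0^2 / \<rho>) powr (1 / (real CARD('d) + 2)))) \<and>
      (\<forall>n\<ge>1.
         sup_norm (\<lambda>y. v n y - vs y)
         \<le> ennreal (\<rho> powr (- 1 / (real CARD('d) + 2)) *
              (C * (1/2)^n + C' * \<epsilon>0^2 / \<rho>) powr
                (1 / (real CARD('d) + 2) + real CARD('d) / (real CARD('d) + 2)^2)))"
proof (rule exI[of _ "(K + 1) ^ (CARD('d) + 2)"], intro conjI allI impI)
  \<comment> \<open>Pattern matching names the body of the nested quantifiers, so that the inner
    witnesses can be given in a separate \<open>show\<close>. The exponent d + 2 in the witness for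
    C is the reciprocal of the smaller exponent in the two sup bounds, as \<open>powr_le_aux\<close>
    requires.\<close>
  let "\<exists>C>0. \<forall>lam>0. \<forall>C0\<ge>1. \<forall>\<eta>. \<exists>A1\<ge>1. \<exists>C'>0. ?P C lam C0 \<eta> A1 C'" = ?thesis
  show "0 < (K + 1) ^ (CARD('d) + 2)" using assms by simp
  fix lam C0 :: real and \<eta> :: "real \<Rightarrow> real"
  assume lam: "0 < lam" and C0: "1 \<le> C0"
  define d where "d = real CARD('d)"
  define V where "V = measure lborel (cball (0::real^'d) 1) + 1"
  have d1: "1 \<le> d" by (simp add: d_def)
  have V1: "1 \<le> V" by (simp add: V_def)
  obtain R Q \<kappa>0 where R: "0 < R" and Q: "1 \<le> Q" and \<kappa>0: "0 < \<kappa>0" and EB: "elliptic_bound TYPE('d) C0 R Q \<kappa>0"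
    using elliptic_bound_exists[OF C0, where 'd = 'd] by blast
  \<comment> \<open>In dimension one no matrix is frozen, and \<open>\<alpha>0\<close> = 1 is a
    placeholder that only makes \<open>s5\<close> well formed. In higher dimensions the positive
    lower bound on \<alpha> keeps the constant \<open>A\<close> independent of \<alpha>.\<close>
  obtain \<alpha>0 where \<alpha>0: "0 < \<alpha>0"
    "CARD('d) = 1 \<or> (\<forall>\<alpha>. 0 < \<alpha> \<and> schauder_bound TYPE('d) \<alpha> C0 \<eta> \<longrightarrow> \<alpha>0 \<le> \<alpha>)"
  proof (cases "CARD('d) = 1")
    case False
    moreover have "CARD('d) \<noteq> 0" by simp
    ultimately have "2 \<le> CARD('d)" by linarith
    from schauder_exponent_bound[OF this C0, of \<eta>] show ?thesis using that by blast
  qed (use that[of 1] in simp)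
  \<comment> \<open>Each summand of \<open>A\<close> secures one smallness condition after
    multiplication by \<tau> or \<epsilon>0. \<open>s1\<close> gives the contraction factor 1/2,
    \<open>s2\<close> absorbs the constants of the first step, \<open>s3\<close> brings the drift
    coefficient below \<open>\<kappa>0\<close>, and \<open>s4\<close> and \<open>s5\<close> leave
    \<kappa>0/2 for each of the two parts of the oscillation of the leading matrix. The power
    1/\<alpha>0 in \<open>s5\<close> is undone by the bound on \<tau>^\<alpha> A^\<alpha>0.\<close>
  define s1 where "s1 = 4 * Q * (V * (4 * d * C0^2) + 2 * d * C0)"
  define s2 where "s2 = 4 * V * (Q * (V * ((4 * d * C0^2 + 2 * d * C0) * d)))"
  define s3 where "s3 = 2 * d^2 * C0^2 / \<kappa>0"
  define s4 where "s4 = 4 * d / \<kappa>0"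
  define s5 where "s5 = (2 * d * C0 * (R + 1) / \<kappa>0) powr (1 / \<alpha>0)"
  define A where "A = 1 + R + s1 + s2 + s3 + s4 + s5"
  have s0: "0 \<le> s1" "0 \<le> s2" "0 \<le> s3" "0 \<le> s4" "0 \<le> s5"
    using d1 C0 V1 Q \<kappa>0 by (auto simp: s1_def s2_def s3_def s4_def s5_def)
  then have A: "1 \<le> A" "R \<le> A" "s1 \<le> A" "s2 \<le> A" "s3 \<le> A" "s4 \<le> A" "s5 \<le> A" using R by (auto simp: A_def)
  show "\<exists>A1\<ge>1. \<exists>C'>0. ?P ((K + 1) ^ (CARD('d) + 2)) lam C0 \<eta> A1 C'"
  proof (rule exI[of _ A], rule conjI[OF A(1)], rule exI[of _ 1], rule conjI[OF zero_less_one], intro allI impI, elim conjE)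
    fix l m :: nat and U :: "control set"
      and r :: "real^'d \<Rightarrow> control \<Rightarrow> real" and b :: "real^'d \<Rightarrow> control \<Rightarrow> real^'d"
      and \<sigma> :: "real^'d \<Rightarrow> control \<Rightarrow> 'd \<Rightarrow> nat \<Rightarrow> real" and S0 :: "real^'d \<Rightarrow> real^'d^'d"
      and v0 vs :: "real^'d \<Rightarrow> real" and v :: "nat \<Rightarrow> real^'d \<Rightarrow> real" and \<alpha> \<epsilon>0 \<epsilon>1 \<rho> :: real and N S
    assume U: "emeasure (lebesgue_Rl l) U = 1" and N: "N = lebesgue_U l U" and S: "S = diffusion m \<sigma>"
      and meas: "measurable_coeffs N m r b \<sigma>" and \<alpha>: "0 < \<alpha>" "\<alpha> < 1" and \<epsilon>0: "0 < \<epsilon>0" "\<epsilon>0 < 1" and \<rho>: "0 < \<rho>"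
      and sch: "schauder_bound TYPE('d) \<alpha> C0 \<eta>"
      and co: "\<forall>u\<in>U. (\<forall>x. loewner_le (mat (1 / C0)) (S x u)) \<and>
             norm_0a \<alpha> (\<lambda>x. r x u) \<le> ennreal C0 \<and>
             norm_0a \<alpha> (\<lambda>x. b x u) \<le> ennreal C0 \<and>
             norm_0a \<alpha> (\<lambda>x. S x u) \<le> ennreal C0"
      and sup: "(SUP u\<in>U. sup_norm (\<lambda>x. S x u - S0 x)) \<le> ennreal \<epsilon>0"
      and v0: "v0 \<in> hoelder_space 2 \<alpha>" and vs: "bounded_solution \<rho> (F_sup N lam r b S) vs"
      and PI: "policy_iteration N lam \<rho> r b S v0 v" and KK: "norm_k 2 v0 + norm_k 2 vs = ennreal K"
      and A\<rho>: "A powr (2 / (1 - \<alpha>)) \<le> \<rho>" "\<epsilon>0 * A * \<rho> powr (\<alpha> / 2) \<le> 1"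
    have spN: "space N = U" "finite_measure N" "measure N (space N) = 1"
      using lebesgue_U_prob[OF U] by (simp_all add: N)
    interpret control_problem N m r b \<sigma> S lam C0 \<alpha>
      by (rule control_problem.intro[OF spN(2,3) meas S lam C0 \<alpha>]) (use co in \<open>unfold spN(1), simp_all\<close>)
    obtain \<tau> where \<tau>: "0 < \<tau>" "\<tau>\<^sup>2 * \<rho> = 1" and \<rho>1: "1 \<le> \<rho>" and \<tau>A: "\<tau> * A \<le> 1" and eA: "\<epsilon>0 * A \<le> 1"
      and \<tau>\<alpha>: "\<And>\<alpha>0. \<alpha>0 \<le> \<alpha> \<Longrightarrow> \<tau> powr \<alpha> * A powr \<alpha>0 \<le> 1"
      by (rule large_rho[OF A(1) \<alpha> \<epsilon>0(1) A\<rho>(2) \<rho> A\<rho>(1)]) blast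
    have \<tau>s: "\<tau> * s \<le> 1" if "s \<le> A" for s by (rule mult_le_one_if_le[OF \<tau>A _ that]) (use \<tau> in simp)
    have es: "\<epsilon>0 * s \<le> 1" if "s \<le> A" for s by (rule mult_le_one_if_le[OF eA _ that]) (use \<epsilon>0 in simp)
    have e: "infnorm (S x u - S0 x) \<le> \<epsilon>0" if "u \<in> space N" for u x
    proof -
      have "sup_norm (\<lambda>x. S x u - S0 x) \<le> ennreal \<epsilon>0" using sup that spN by (auto simp: SUP_le_iff)
      then show ?thesis using sup_norm_le_iff[of \<epsilon>0 "\<lambda>x. S x u - S0 x"] \<epsilon>0 by simp
    qed
    have c3: "2 * d^2 * C0^2 * \<tau> \<le> \<kappa>0" using \<tau>s[OF A(5)] \<kappa>0 by (simp add: s3_def field_simps)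
    \<comment> \<open>Zero in dimension one, where the leading coefficient is divided out; otherwise
      the bound of \<open>avg_S_oscillation\<close> on a ball of radius \<tau> R.\<close>
    define \<kappa> where "\<kappa> = (if CARD('d) = 1 then 0 else d * (2 * \<epsilon>0 + C0 * (\<tau> * R) powr \<alpha>))"
    have \<kappa>1: "0 \<le> \<kappa>" "CARD('d) = 1 \<or> d * (2 * \<epsilon>0 + C0 * (\<tau> * R) powr \<alpha>) \<le> \<kappa>"
      using d1 C0 \<epsilon>0 by (auto simp: \<kappa>_def)
    have \<kappa>2: "\<kappa> \<le> \<kappa>0"
    proof (cases "CARD('d) = 1")
      case False
      then have a: "\<alpha>0 \<le> \<alpha>" using \<alpha>0(2) \<alpha> sch by blast
      have p: "0 < 2 * d * C0 * (R + 1) / \<kappa>0" using d1 C0 R \<kappa>0 by simp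
      have "X = (X powr (1 / \<alpha>0)) powr \<alpha>0" if "0 < X" for X using that \<alpha>0(1) by (simp add: powr_powr)
      from this[OF p] have "2 * d * C0 * (R + 1) / \<kappa>0 = s5 powr \<alpha>0" unfolding s5_def .
      also have "\<dots> \<le> A powr \<alpha>0" using A(7) s0 \<alpha>0(1) by (intro powr_mono2) auto
      finally have "\<tau> powr \<alpha> * (2 * d * C0 * (R + 1) / \<kappa>0) \<le> \<tau> powr \<alpha> * A powr \<alpha>0" by (intro mult_left_mono) auto
      also have "\<dots> \<le> 1" by (rule \<tau>\<alpha>[OF a])
      finally have 1: "2 * (d * C0 * (\<tau> powr \<alpha> * (R + 1))) \<le> \<kappa>0" using \<kappa>0 by (simp add: field_simps)
      have "R powr \<alpha> \<le> (R + 1) powr \<alpha>" using R \<alpha> by (intro powr_mono2) auto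
      also have "\<dots> \<le> (R + 1) powr 1" using R \<alpha> by (intro powr_mono) auto
      finally have "R powr \<alpha> \<le> R + 1" using R by simp
      then have "(\<tau> * R) powr \<alpha> \<le> \<tau> powr \<alpha> * (R + 1)" using \<tau> R by (simp add: powr_mult mult_left_mono)
      then have "d * C0 * (\<tau> * R) powr \<alpha> \<le> d * C0 * (\<tau> powr \<alpha> * (R + 1))" using d1 C0 by (intro mult_left_mono) auto
      moreover have "4 * (d * \<epsilon>0) \<le> \<kappa>0" using es[OF A(6)] \<kappa>0 by (simp add: s4_def field_simps)
      ultimately have "2 * (d * \<epsilon>0) + d * C0 * (\<tau> * R) powr \<alpha> \<le> \<kappa>0" using 1 by linarith
      then show ?thesis using False by (simp add: \<kappa>_def algebra_simps)
    qed (use \<kappa>0 in \<open>simp add: \<kappa>_def\<close>)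
    have half: "2 * Q * (V * (4 * d * C0^2 * \<tau>) + 2 * d * C0 * \<epsilon>0) \<le> 1 / 2"
    proof -
      define t where "t = max \<tau> \<epsilon>0"
      have "t * s1 \<le> 1" using \<tau>s[OF A(3)] es[OF A(3)] by (auto simp: t_def max_def)
      then have "2 * Q * (V * (4 * d * C0^2 * t) + 2 * d * C0 * t) \<le> 1 / 2" by (simp add: s1_def algebra_simps)
      moreover have "2 * Q * (V * (4 * d * C0^2 * \<tau>) + 2 * d * C0 * \<epsilon>0) \<le> 2 * Q * (V * (4 * d * C0^2 * t) + 2 * d * C0 * t)"
        using Q V1 d1 C0 by (intro mult_left_mono add_mono) (auto simp: t_def)
      ultimately show ?thesis by linarith
    qed
    have fin: "norm_k 2 v0 < \<infinity>" "norm_k 2 vs < \<infinity>"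
    proof -
      have "norm_k 2 v0 \<le> ennreal K" "norm_k 2 vs \<le> ennreal K" using KK[symmetric] by auto
      then show "norm_k 2 v0 < \<infinity>" "norm_k 2 vs < \<infinity>" by (auto simp: less_top[symmetric] top_unique)
    qed
    obtain k1 k2 where k: "norm_k 2 v0 = ennreal k1" "0 \<le> k1" "norm_k 2 vs = ennreal k2" "0 \<le> k2"
      using fin by (cases "norm_k 2 v0"; cases "norm_k 2 vs") auto
    have kK: "k1 + k2 = K" using KK assms k by (simp add: ennreal_plus[symmetric] del: ennreal_plus)
    have g0: "norm (grad v0 x) \<le> d * k1" "norm (hess v0 x) \<le> d * k1" for x
      unfolding d_def using norm_k_D_list[OF k(1,2)] by (intro grad_hess_bound; simp)+
    have gs: "norm (grad vs x) \<le> d * k2" "norm (hess vs x) \<le> d * k2" for x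
      unfolding d_def using norm_k_D_list[OF k(3,4)] by (intro grad_hess_bound; simp)+
    have Kg: "norm (grad v0 x - grad vs x) \<le> d * K" "norm (hess v0 x - hess vs x) \<le> d * K" for x
      using norm_triangle_ineq4[of "grad v0 x" "grad vs x"] norm_triangle_ineq4[of "hess v0 x" "hess vs x"] g0[of x] gs[of x]
      by (auto simp: kK[symmetric] distrib_left)
    define M where "M = (4 * d * C0^2 + 2 * d * C0) * d"
    \<comment> \<open>The first step provides \<tau>^2. One factor \<tau> absorbs, through
      \<open>s2\<close>, the constants \<open>Q\<close>, \<open>M\<close> and the powers of
      \<open>V\<close>, so that only K + 1 and the volume factor 1/(2 V) remain; the other \<tau> is
      kept and matches the weight \<rho> in the first conclusion. This keeps C independent of
      \<open>C0\<close>, lam and \<open>\<eta>\<close>.\<close>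
    have small: "2 * (Q * (V * (M * \<tau>\<^sup>2 * (K + 1)))) * h \<le> \<tau> * (1 / (2 * V) * ((K + 1) * h))" if "0 \<le> h" for h
    proof -
      have "\<tau> * (4 * V * (Q * (V * M))) \<le> 1" using \<tau>s[OF A(4)] by (simp add: s2_def M_def)
      then have "\<tau> * (1 / (2 * V)) * ((K + 1) * h) * (\<tau> * (4 * V * (Q * (V * M)))) \<le> \<tau> * (1 / (2 * V)) * ((K + 1) * h) * 1"
        using \<tau> V1 assms that by (intro mult_left_mono) auto
      moreover have "\<tau> * (1 / (2 * V)) * ((K + 1) * h) * (\<tau> * (4 * V * (Q * (V * M)))) = 2 * (Q * (V * (M * \<tau>\<^sup>2 * (K + 1)))) * h"
        using V1 by (simp add: power2_eq_square field_simps)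
      ultimately show ?thesis by (simp add: mult.assoc)
    qed
    let ?T = "\<lambda>n. (K + 1) ^ (CARD('d) + 2) * (1/2)^n + 1 * \<epsilon>0^2 / \<rho>"
    have concl: "\<rho> * (LINT x:ball x0 1|lborel. (v n x - vs x)^2) +
         (LINT x:ball x0 1|lborel. (infnorm (grad (\<lambda>y. v n y - vs y) x))^2) \<le> ?T n"
      "infnorm (grad (\<lambda>y. v n y - vs y) x) \<le> ?T n powr (1 / (real CARD('d) + 2))"
      "\<bar>v n x - vs x\<bar> \<le> \<rho> powr (- 1 / (real CARD('d) + 2)) *
              ?T n powr
                (1 / (real CARD('d) + 2) + real CARD('d) / (real CARD('d) + 2)^2)"
      if n: "1 \<le> n" for n x x0
    proof -
      note est = policy_iteration_estimate[OF EB R Q PI vs norm_2_finite[OF fin(2)] hoelder_space_regular[OF v0] sch \<rho>1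
          e less_imp_le[OF \<epsilon>0(1)] less_imp_le[OF \<epsilon>0(2)] \<tau> \<tau>s[OF A(2)] c3[unfolded d_def] \<kappa>1(1) \<kappa>2 \<kappa>1(2)[unfolded d_def]
          half[unfolded d_def V_def] assms Kg[unfolded d_def] n, folded d_def V_def, folded M_def]
      have gr: "grad (\<lambda>y. v n y - vs y) = (\<lambda>y. grad (v n) y - grad vs y)"
        by (rule grad_eq[OF C2_minus[OF C_class_2_C2[OF est(3)] C_class_2_C2[OF conjunct1[OF vs[unfolded bounded_solution_def]]]]])
      have h: "0 < (1/2::real) ^ n" "(1/2::real) ^ n \<le> 1" by (auto intro: power_le_one)
      have w: "\<bar>v n x - vs x\<bar> \<le> \<tau> * (1 / (2 * V) * ((K + 1) * (1/2) ^ n))" for x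
        using est(1)[of x] small[OF less_imp_le[OF h(1)]] by linarith
      have "\<tau> * norm (grad (v n) x - grad vs x) \<le> \<tau> * (1 / (2 * V) * ((K + 1) * (1/2) ^ n))" for x
        using est(2)[of x] small[OF less_imp_le[OF h(1)]] by linarith
      then have "norm (grad (v n) x - grad vs x) \<le> 1 / (2 * V) * ((K + 1) * (1/2) ^ n)" for x
        by (rule mult_left_le_imp_le[OF _ \<tau>(1)])
      then have g: "infnorm (grad (\<lambda>y. v n y - vs y) x) \<le> 1 / (2 * V) * ((K + 1) * (1/2) ^ n)" for x
        unfolding gr by (rule order_trans[OF infnorm_le_norm])
      have T: "(K + 1) ^ (CARD('d) + 2) * (1/2)^n \<le> ?T n" using \<rho> by simp
      note et = error_terms[of K V \<rho> \<tau> "(1/2)^n" "\<lambda>x. v n x - vs x" "\<lambda>x. infnorm (grad (\<lambda>y. v n y - vs y) x)",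
          OF assms V_def \<rho>1 \<tau> h w infnorm_pos_le g T]
      show "\<rho> * (LINT x:ball x0 1|lborel. (v n x - vs x)^2) +
         (LINT x:ball x0 1|lborel. (infnorm (grad (\<lambda>y. v n y - vs y) x))^2) \<le> ?T n"
        by (rule et(1))
      show "infnorm (grad (\<lambda>y. v n y - vs y) x) \<le> ?T n powr (1 / (real CARD('d) + 2))"
        by (rule et(2))
      show "\<bar>v n x - vs x\<bar> \<le> \<rho> powr (- 1 / (real CARD('d) + 2)) *
              ?T n powr
                (1 / (real CARD('d) + 2) + real CARD('d) / (real CARD('d) + 2)^2)"
        by (rule et(3))
    qed
    have sup1: "sup_norm (grad (\<lambda>y. v n y - vs y)) \<le> ennreal (?T n powr (1 / (real CARD('d) + 2)))" if "1 \<le> n" for n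
      using concl(2)[OF that] by (subst sup_norm_le_iff) auto
    have sup2: "sup_norm (\<lambda>y. v n y - vs y) \<le> ennreal (\<rho> powr (- 1 / (real CARD('d) + 2)) *
              ?T n powr (1 / (real CARD('d) + 2) + real CARD('d) / (real CARD('d) + 2)^2))" if "1 \<le> n" for n
      using concl(3)[OF that] by (subst sup_norm_le_iff) auto
    show "(\<forall>n\<ge>1. \<forall>x0.
         \<rho> * (LINT x:ball x0 1|lborel. (v n x - vs x)^2) +
         (LINT x:ball x0 1|lborel. (infnorm (grad (\<lambda>y. v n y - vs y) x))^2) \<le> ?T n) \<and>
      (\<forall>n\<ge>1. sup_norm (grad (\<lambda>y. v n y - vs y)) \<le> ennreal (?T n powr (1 / (real CARD('d) + 2)))) \<and>
      (\<forall>n\<ge>1. sup_norm (\<lambda>y. v n y - vs y)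
         \<le> ennreal (\<rho> powr (- 1 / (real CARD('d) + 2)) *
              ?T n powr (1 / (real CARD('d) + 2) + real CARD('d) / (real CARD('d) + 2)^2)))"
      by (intro conjI allI impI; rule concl(1) sup1 sup2)
  qed
qed

end
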